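(* Let $A$ and $B$ be finite dimensional algebras over a field $k$. If $A$ and $B$ are singularly equivalent of Morita type with level, then $$\mathrm{IT.dist}(A)=\mathrm{IT.dist}(B).$$
   Context: For a finite dimensional algebra $A$, $A\text{-mod}$ denotes the category of finitely generated left $A$-modules. For $M\in A\text{-mod}$, $\Omega(M)=\Omega_A(M)$ is the kernel of a projective cover $P\to M$, $\Omega^0(M)=M$, and $\Omega^n(M)=\Omega(\Omega^{n-1}(M))$. For $U\in A\text{-mod}$, $\mathrm{add}(U)$ is the full subcategory of all direct summands of finite direct sums of copies of $U$. The stable category $A\text{-}\underline{\mathrm{mod}}$ is $A\text{-mod}$ modulo the morphisms factoring through projective modules. For nonnegative integers $m,n$, $A$ is an $(m,n)$-Igusa-Todorov algebra if there is $U\in A\text{-mod}$ such that for every $X\in A\text{-mod}$ there is an exact sequence $0\to U_m\to U_{m-1}\to\cdots\to U_1\to U_0\to\Omega^n(X)\to 0$ with $U_i\in\mathrm{add}(U)$ for $0\le i\le m$. The Igusa-Todorov distance of $A$ is $$\mathrm{IT.dist}(A):=\inf\{m\mid A\text{ is an }(m,n)\text{-Igusa-Todorov algebra for some } n\}.$$ Let $A^e=A\otimes_k A^{\mathrm{op}}$; $A$-$A$-bimodules are identified with left $A^e$-modules. Given an $A$-$B$-bimodule ${}_AM_B$, a $B$-$A$-bimodule ${}_BN_A$ and an integer $l\ge0$, the pair $(M,N)$ defines a singular equivalence of Morita type with level $l$ if: (1) the one-sided modules ${}_AM$, $M_B$, ${}_BN$, $N_A$ are all finitely generated projective; (2) $M\otimes_BN\simeq\Omega^l_{A^e}(A)$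 in $A^e\text{-}\underline{\mathrm{mod}}$ and $N\otimes_AM\simeq\Omega^l_{B^e}(B)$ in $B^e\text{-}\underline{\mathrm{mod}}$. $A$ and $B$ are singularly equivalent of Morita type with level if such a pair exists for some $l\ge 0$. *)

theory Defs
  imports
    "HOL-Algebra.Module"
    "HOL-Algebra.AbelCoset"
    "HOL-Algebra.Free_Abelian_Groups"
    "HOL-Library.Extended_Nat"
begin

section \<open>Modules over a not necessarily commutative ring\<close>

text \<open>The locale \<^locale>\<open>Module.module\<close> of HOL-Algebra requires commutative scalars. The axioms below are the
  same with a ring in place of a commutative ring. As there, the fields \<open>mult\<close> and \<open>one\<close> of the
  record of a module carry no information; the constructions below copy them or leave them
  \<open>undefined\<close>.\<close>

locale left_module = R?: Ring.ring R + M?: abelian_group M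
  for R (structure) and M :: "('r, 'm, 'x) module_scheme" (structure) +
  assumes smult_closed:
      "\<lbrakk>a \<in> carrier R; x \<in> carrier M\<rbrakk> \<Longrightarrow> a \<odot>\<^bsub>M\<^esub> x \<in> carrier M"
    and smult_l_distr:
      "\<lbrakk>a \<in> carrier R; b \<in> carrier R; x \<in> carrier M\<rbrakk> \<Longrightarrow>
       (a \<oplus> b) \<odot>\<^bsub>M\<^esub> x = a \<odot>\<^bsub>M\<^esub> x \<oplus>\<^bsub>M\<^esub> b \<odot>\<^bsub>M\<^esub> x"
    and smult_r_distr:
      "\<lbrakk>a \<in> carrier R; x \<in> carrier M; y \<in> carrier M\<rbrakk> \<Longrightarrow>
       a \<odot>\<^bsub>M\<^esub> (x \<oplus>\<^bsub>M\<^esub> y) = a \<odot>\<^bsub>M\<^esub> x \<oplus>\<^bsub>M\<^esub> a \<odot>\<^bsub>M\<^esub> y"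
    and smult_assoc:
      "\<lbrakk>a \<in> carrier R; b \<in> carrier R; x \<in> carrier M\<rbrakk> \<Longrightarrow>
       (a \<otimes> b) \<odot>\<^bsub>M\<^esub> x = a \<odot>\<^bsub>M\<^esub> (b \<odot>\<^bsub>M\<^esub> x)"
    and smult_one: "x \<in> carrier M \<Longrightarrow> \<one> \<odot>\<^bsub>M\<^esub> x = x"

definition finitely_generated ::
  "('r, 'x) ring_scheme \<Rightarrow> ('r, 'm, 'y) module_scheme \<Rightarrow> bool" where
  "finitely_generated R M \<longleftrightarrow>
     (\<exists>S. finite S \<and> S \<subseteq> carrier M \<and>
        (\<forall>N. submodule N R M \<and> S \<subseteq> N \<longrightarrow> N = carrier M))"

definition fg_module :: "('r, 'x) ring_scheme \<Rightarrow> ('r, 'm, 'y) module_scheme \<Rightarrow> bool" where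
  "fg_module R M \<longleftrightarrow> left_module R M \<and> finitely_generated R M"

definition mod_hom ::
  "('r, 'x) ring_scheme \<Rightarrow> ('r, 'm, 'y) module_scheme \<Rightarrow> ('r, 'n, 'z) module_scheme
    \<Rightarrow> ('m \<Rightarrow> 'n) set" where
  "mod_hom R M N =
     {f \<in> hom (add_monoid M) (add_monoid N).
        \<forall>a\<in>carrier R. \<forall>x\<in>carrier M. f (a \<odot>\<^bsub>M\<^esub> x) = a \<odot>\<^bsub>N\<^esub> f x}"

definition mod_iso ::
  "('r, 'x) ring_scheme \<Rightarrow> ('r, 'm, 'y) module_scheme \<Rightarrow> ('r, 'n, 'z) module_scheme \<Rightarrow> bool" where
  "mod_iso R M N \<longleftrightarrow> left_module R M \<and> left_module R N \<and>
     (\<exists>f \<in> mod_hom R M N. bij_betw f (carrier M) (carrier N))"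

definition regular_module :: "('r, 'x) ring_scheme \<Rightarrow> ('r, 'r) module" where
  "regular_module R =
     \<lparr>carrier = carrier R, mult = mult R, one = \<one>\<^bsub>R\<^esub>, ring.zero = \<zero>\<^bsub>R\<^esub>, add = add R, smult = mult R\<rparr>"

definition direct_sum ::
  "('r, 'm, 'x) module_scheme \<Rightarrow> ('r, 'n, 'y) module_scheme \<Rightarrow> ('r, 'm \<times> 'n) module" where
  "direct_sum M N =
     \<lparr>carrier = carrier M \<times> carrier N, mult = undefined, one = undefined,
      ring.zero = (\<zero>\<^bsub>M\<^esub>, \<zero>\<^bsub>N\<^esub>),
      add = (\<lambda>(x, y) (x', y'). (x \<oplus>\<^bsub>M\<^esub> x', y \<oplus>\<^bsub>N\<^esub> y')),
      smult = (\<lambda>a (x, y). (a \<odot>\<^bsub>M\<^esub> x, a \<odot>\<^bsub>N\<^esub> y))\<rparr>"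

definition direct_power :: "nat \<Rightarrow> ('r, 'm, 'x) module_scheme \<Rightarrow> ('r, nat \<Rightarrow> 'm) module" where
  "direct_power n M =
     \<lparr>carrier = {..<n} \<rightarrow>\<^sub>E carrier M, mult = undefined, one = undefined,
      ring.zero = (\<lambda>i\<in>{..<n}. \<zero>\<^bsub>M\<^esub>),
      add = (\<lambda>x y. \<lambda>i\<in>{..<n}. x i \<oplus>\<^bsub>M\<^esub> y i),
      smult = (\<lambda>a x. \<lambda>i\<in>{..<n}. a \<odot>\<^bsub>M\<^esub> x i)\<rparr>"

text \<open>Every finitely generated \<open>R\<close>-module is a quotient of some \<open>R\<^sup>n\<close>, so its elements can be
  represented (by a choice of representatives) by sequences over \<open>R\<close>. Hence every finitely
  generated \<open>R\<close>-module is isomorphic to one whose carrier is a set of such sequences, and this type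
  serves as the domain of quantification over \<open>R\<close>-mod. The complements and projective modules
  occurring in the definitions below are finitely generated as well.\<close>

type_synonym 'r std_module = "('r, nat \<Rightarrow> 'r) module"

definition in_add ::
  "('r, 'x) ring_scheme \<Rightarrow> ('r, 'u, 'y) module_scheme \<Rightarrow> ('r, 'm, 'z) module_scheme \<Rightarrow> bool" where
  "in_add R U X \<longleftrightarrow> left_module R X \<and>
     (\<exists>n (V :: 'r std_module). left_module R V \<and> mod_iso R (direct_sum X V) (direct_power n U))"

text \<open>Finitely generated projective: a direct summand of a free module of finite rank.\<close>

definition fg_projective :: "('r, 'x) ring_scheme \<Rightarrow> ('r, 'm, 'y) module_scheme \<Rightarrow> bool" where
  "fg_projective R P \<longleftrightarrow> in_add R (regular_module R) P"

text \<open>A projective cover is an epimorphism from a projective module with superfluous kernel.\<close>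

definition projective_cover ::
  "('r, 'x) ring_scheme \<Rightarrow> ('r, 'p, 'y) module_scheme \<Rightarrow> ('p \<Rightarrow> 'm) \<Rightarrow> ('r, 'm, 'z) module_scheme
    \<Rightarrow> bool" where
  "projective_cover R P f X \<longleftrightarrow>
     fg_projective R P \<and> left_module R X \<and> f \<in> mod_hom R P X \<and> f ` carrier P = carrier X \<and>
     (\<forall>N. submodule N R P \<and> N <+>\<^bsub>P\<^esub> a_kernel P X f = carrier P \<longrightarrow> N = carrier P)"

text \<open>\<open>syzygy R n X Y\<close> says that \<open>Y\<close> is (isomorphic to) the \<open>n\<close>-th syzygy of \<open>X\<close>; syzygies are
  defined only up to isomorphism.\<close>

primrec syzygy ::
  "('r, 'x) ring_scheme \<Rightarrow> nat \<Rightarrow> ('r, 'm) module \<Rightarrow> 'r std_module \<Rightarrow> bool" where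
  "syzygy R 0 X Y \<longleftrightarrow> mod_iso R X Y"
| "syzygy R (Suc n) X Y \<longleftrightarrow>
     (\<exists>Z. syzygy R n X Z \<and>
        (\<exists>(P :: 'r std_module) f. projective_cover R P f Z \<and>
           mod_iso R (P\<lparr>carrier := a_kernel P Z f\<rparr>) Y))"

definition factors_through_projective ::
  "('r, 'x) ring_scheme \<Rightarrow> ('r, 'm, 'y) module_scheme \<Rightarrow> ('r, 'n, 'z) module_scheme
    \<Rightarrow> ('m \<Rightarrow> 'n) \<Rightarrow> bool" where
  "factors_through_projective R X Y h \<longleftrightarrow>
     (\<exists>(P :: 'r std_module) u v. fg_projective R P \<and> u \<in> mod_hom R X P \<and> v \<in> mod_hom R P Y \<and>
        (\<forall>x\<in>carrier X. h x = v (u x)))"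

text \<open>Isomorphism in the stable category: homomorphisms that are mutually inverse modulo the
  homomorphisms factoring through projective modules.\<close>

definition stably_isomorphic ::
  "('r, 'x) ring_scheme \<Rightarrow> ('r, 'm, 'y) module_scheme \<Rightarrow> ('r, 'n, 'z) module_scheme \<Rightarrow> bool" where
  "stably_isomorphic R X Y \<longleftrightarrow>
     (\<exists>f \<in> mod_hom R X Y. \<exists>g \<in> mod_hom R Y X.
        factors_through_projective R X X (\<lambda>x. g (f x) \<ominus>\<^bsub>X\<^esub> x) \<and>
        factors_through_projective R Y Y (\<lambda>y. f (g y) \<ominus>\<^bsub>Y\<^esub> y))"

section \<open>Igusa-Todorov algebras and the Igusa-Todorov distance\<close>

text \<open>The exact sequence \<open>0 \<rightarrow> U\<^sub>m \<rightarrow> \<dots> \<rightarrow> U\<^sub>0 \<rightarrow> Y \<rightarrow> 0\<close> is given by a chain \<open>C\<close> with \<open>C 0 = Y\<close> and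
  \<open>C (Suc i) = U\<^sub>i\<close>, and by maps \<open>d i\<close> from \<open>C (Suc i)\<close> to \<open>C i\<close>.\<close>

definition exact_resolution ::
  "('r, 'x) ring_scheme \<Rightarrow> nat \<Rightarrow> (nat \<Rightarrow> ('r, 'm) module) \<Rightarrow> (nat \<Rightarrow> 'm \<Rightarrow> 'm) \<Rightarrow> bool" where
  "exact_resolution R m C d \<longleftrightarrow>
     (\<forall>i\<le>m. d i \<in> mod_hom R (C (Suc i)) (C i)) \<and>
     d 0 ` carrier (C (Suc 0)) = carrier (C 0) \<and>
     (\<forall>i<m. d (Suc i) ` carrier (C (Suc (Suc i))) = a_kernel (C (Suc i)) (C i) (d i)) \<and>
     inj_on (d m) (carrier (C (Suc m)))"

definition igusa_todorov_algebra :: "nat \<Rightarrow> nat \<Rightarrow> ('r, 'x) ring_scheme \<Rightarrow> bool" where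
  "igusa_todorov_algebra m n R \<longleftrightarrow>
     (\<exists>U :: 'r std_module. fg_module R U \<and>
        (\<forall>X :: 'r std_module. fg_module R X \<longrightarrow>
           (\<exists>C d. syzygy R n X (C 0) \<and> (\<forall>i\<le>m. in_add R U (C (Suc i))) \<and>
              exact_resolution R m C d)))"

definition IT_dist :: "('r, 'x) ring_scheme \<Rightarrow> enat" where
  "IT_dist R = Inf {enat m | m. \<exists>n. igusa_todorov_algebra m n R}"

section \<open>Algebras, bimodules and tensor products\<close>

text \<open>\<^locale>\<open>Module.algebra\<close> of HOL-Algebra requires a commutative algebra. The zero algebra is allowed
  here.\<close>

locale fd_algebra = Ring.field K + Ring.ring A + Module.module K A
  for K (structure) and A :: "('k, 'a, 'x) module_scheme" (structure) +
  assumes smult_mult_left: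
      "\<lbrakk>c \<in> carrier K; a \<in> carrier A; b \<in> carrier A\<rbrakk> \<Longrightarrow>
       (c \<odot>\<^bsub>A\<^esub> a) \<otimes>\<^bsub>A\<^esub> b = c \<odot>\<^bsub>A\<^esub> (a \<otimes>\<^bsub>A\<^esub> b)"
    and smult_mult_right:
      "\<lbrakk>c \<in> carrier K; a \<in> carrier A; b \<in> carrier A\<rbrakk> \<Longrightarrow>
       a \<otimes>\<^bsub>A\<^esub> (c \<odot>\<^bsub>A\<^esub> b) = c \<odot>\<^bsub>A\<^esub> (a \<otimes>\<^bsub>A\<^esub> b)"
    and finite_dimensional: "finitely_generated K A"

definition opposite :: "('a, 'x) ring_scheme \<Rightarrow> ('a, 'x) ring_scheme" where
  "opposite A = A\<lparr>mult := (\<lambda>a b. b \<otimes>\<^bsub>A\<^esub> a)\<rparr>"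

record ('a, 'b, 'm) bimodule = "('a, 'm) module" +
  rsmult :: "'m \<Rightarrow> 'b \<Rightarrow> 'm"

text \<open>The underlying right \<open>B\<close>-module, as a left module over the opposite of \<open>B\<close>.\<close>

definition right_part :: "('a, 'b, 'm, 'x) bimodule_scheme \<Rightarrow> ('b, 'm) module" where
  "right_part M =
     \<lparr>carrier = carrier M, mult = mult M, one = \<one>\<^bsub>M\<^esub>, ring.zero = \<zero>\<^bsub>M\<^esub>, add = add M,
      smult = (\<lambda>b x. rsmult M x b)\<rparr>"

text \<open>The last condition says that \<open>K\<close> acts centrally; it is part of the identification of
  bimodules with modules over the enveloping algebra.\<close>

definition is_bimodule ::
  "('k, 'w) ring_scheme \<Rightarrow> ('k, 'a, 'x) module_scheme \<Rightarrow> ('k, 'b, 'y) module_scheme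
    \<Rightarrow> ('a, 'b, 'm, 'z) bimodule_scheme \<Rightarrow> bool" where
  "is_bimodule K A B M \<longleftrightarrow>
     left_module A M \<and> left_module (opposite B) (right_part M) \<and>
     (\<forall>a\<in>carrier A. \<forall>x\<in>carrier M. \<forall>b\<in>carrier B.
        rsmult M (a \<odot>\<^bsub>M\<^esub> x) b = a \<odot>\<^bsub>M\<^esub> rsmult M x b) \<and>
     (\<forall>c\<in>carrier K. \<forall>x\<in>carrier M.
        (c \<odot>\<^bsub>A\<^esub> \<one>\<^bsub>A\<^esub>) \<odot>\<^bsub>M\<^esub> x = rsmult M x (c \<odot>\<^bsub>B\<^esub> \<one>\<^bsub>B\<^esub>))"

definition regular_bimodule :: "('a, 'x) ring_scheme \<Rightarrow> ('a, 'a, 'a) bimodule" where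
  "regular_bimodule A =
     \<lparr>carrier = carrier A, mult = mult A, one = \<one>\<^bsub>A\<^esub>, ring.zero = \<zero>\<^bsub>A\<^esub>, add = add A,
      smult = mult A, rsmult = mult A\<rparr>"

text \<open>The tensor product of \<open>M\<close> and \<open>N\<close> over \<open>B\<close> is the free abelian group on
  \<open>carrier M \<times> carrier N\<close> modulo the usual relations. Its elements are cosets, that is, sets of
  formal \<open>\<int>\<close>-linear combinations of pairs.\<close>

definition tensor_relations ::
  "('b, 'w) ring_scheme \<Rightarrow> ('a, 'b, 'm, 'x) bimodule_scheme \<Rightarrow> ('b, 'n, 'y) module_scheme
    \<Rightarrow> ('m \<times> 'n \<Rightarrow>\<^sub>0 int) set" where
  "tensor_relations B M N =
     {frag_of (x \<oplus>\<^bsub>M\<^esub> x', y) - frag_of (x, y) - frag_of (x', y) | x x' y.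
        x \<in> carrier M \<and> x' \<in> carrier M \<and> y \<in> carrier N} \<union>
     {frag_of (x, y \<oplus>\<^bsub>N\<^esub> y') - frag_of (x, y) - frag_of (x, y') | x y y'.
        x \<in> carrier M \<and> y \<in> carrier N \<and> y' \<in> carrier N} \<union>
     {frag_of (rsmult M x b, y) - frag_of (x, b \<odot>\<^bsub>N\<^esub> y) | x b y.
        x \<in> carrier M \<and> b \<in> carrier B \<and> y \<in> carrier N}"

definition tensor_kernel ::
  "('b, 'w) ring_scheme \<Rightarrow> ('a, 'b, 'm, 'x) bimodule_scheme \<Rightarrow> ('b, 'n, 'y) module_scheme
    \<Rightarrow> ('m \<times> 'n \<Rightarrow>\<^sub>0 int) set" where
  "tensor_kernel B M N =
     generate (free_Abelian_group (carrier M \<times> carrier N)) (tensor_relations B M N)"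

definition tensor_group ::
  "('b, 'w) ring_scheme \<Rightarrow> ('a, 'b, 'm, 'x) bimodule_scheme \<Rightarrow> ('b, 'n, 'y) module_scheme
    \<Rightarrow> ('m \<times> 'n \<Rightarrow>\<^sub>0 int) set monoid" where
  "tensor_group B M N = free_Abelian_group (carrier M \<times> carrier N) Mod tensor_kernel B M N"

definition tensor_class ::
  "('b, 'w) ring_scheme \<Rightarrow> ('a, 'b, 'm, 'x) bimodule_scheme \<Rightarrow> ('b, 'n, 'y) module_scheme
    \<Rightarrow> ('m \<times> 'n \<Rightarrow>\<^sub>0 int) \<Rightarrow> ('m \<times> 'n \<Rightarrow>\<^sub>0 int) set" where
  "tensor_class B M N p =
     tensor_kernel B M N #>\<^bsub>free_Abelian_group (carrier M \<times> carrier N)\<^esub> p"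

text \<open>Operations on cosets are given as unions of the classes of the results on representatives,
  as for the multiplication of a quotient ring in HOL-Algebra. The actions are
  \<open>a(x \<otimes> y) = ax \<otimes> y\<close> and \<open>(x \<otimes> y)c = x \<otimes> yc\<close>.\<close>

definition tensor_bimodule ::
  "('b, 'w) ring_scheme \<Rightarrow> ('a, 'b, 'm, 'x) bimodule_scheme \<Rightarrow> ('b, 'c, 'n, 'y) bimodule_scheme
    \<Rightarrow> ('a, 'c, ('m \<times> 'n \<Rightarrow>\<^sub>0 int) set) bimodule" where
  "tensor_bimodule B M N =
     \<lparr>carrier = carrier (tensor_group B M N), mult = undefined, one = undefined,
      ring.zero = \<one>\<^bsub>tensor_group B M N\<^esub>, add = mult (tensor_group B M N),
      smult = (\<lambda>a X. \<Union>p\<in>X. tensor_class B M N (frag_extend (\<lambda>(x, y). frag_of (a \<odot>\<^bsub>M\<^esub> x, y)) p)),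
      rsmult = (\<lambda>X c. \<Union>p\<in>X. tensor_class B M N (frag_extend (\<lambda>(x, y). frag_of (x, rsmult N y c)) p))\<rparr>"

text \<open>A \<open>K\<close>-algebra as a \<open>K\<close>-\<open>K\<close>-bimodule.\<close>

definition scalar_bimodule :: "('k, 'a, 'x) module_scheme \<Rightarrow> ('k, 'k, 'a) bimodule" where
  "scalar_bimodule A =
     \<lparr>carrier = carrier A, mult = mult A, one = \<one>\<^bsub>A\<^esub>, ring.zero = \<zero>\<^bsub>A\<^esub>, add = add A,
      smult = smult A, rsmult = (\<lambda>a c. c \<odot>\<^bsub>A\<^esub> a)\<rparr>"

text \<open>The multiplication is the biadditive extension of
  \<open>(a \<otimes> b)(a' \<otimes> b') = aa' \<otimes> bb'\<close>.\<close>

definition tensor_algebra ::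
  "('k, 'w) ring_scheme \<Rightarrow> ('k, 'a, 'x) module_scheme \<Rightarrow> ('k, 'b, 'y) module_scheme
    \<Rightarrow> ('k, ('a \<times> 'b \<Rightarrow>\<^sub>0 int) set) module" where
  "tensor_algebra K A B =
     (let G = tensor_group K (scalar_bimodule A) B; cl = tensor_class K (scalar_bimodule A) B in
      \<lparr>carrier = carrier G,
       mult = (\<lambda>X Y. \<Union>p\<in>X. \<Union>q\<in>Y.
          cl (frag_extend (\<lambda>(a, b).
                frag_extend (\<lambda>(a', b'). frag_of (a \<otimes>\<^bsub>A\<^esub> a', b \<otimes>\<^bsub>B\<^esub> b')) q) p)),
       one = cl (frag_of (\<one>\<^bsub>A\<^esub>, \<one>\<^bsub>B\<^esub>)),
       ring.zero = \<one>\<^bsub>G\<^esub>, add = mult G,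
       smult = (\<lambda>c X. \<Union>p\<in>X. cl (frag_extend (\<lambda>(a, b). frag_of (c \<odot>\<^bsub>A\<^esub> a, b)) p))\<rparr>)"

definition enveloping_algebra ::
  "('k, 'w) ring_scheme \<Rightarrow> ('k, 'a, 'x) module_scheme
    \<Rightarrow> ('k, ('a \<times> 'a \<Rightarrow>\<^sub>0 int) set) module" where
  "enveloping_algebra K A = tensor_algebra K A (opposite A)"

text \<open>An \<open>A\<close>-\<open>A\<close>-bimodule as a left module over the enveloping algebra: the class of
  \<open>\<Sum> n\<^sub>i (a\<^sub>i, b\<^sub>i)\<close> sends \<open>x\<close> to \<open>\<Sum> n\<^sub>i a\<^sub>i x b\<^sub>i\<close>. For a bimodule this does not depend on the
  chosen representative.\<close>

definition enveloping_module ::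
  "('a, 'a, 'm, 'x) bimodule_scheme \<Rightarrow> (('a \<times> 'a \<Rightarrow>\<^sub>0 int) set, 'm) module" where
  "enveloping_module M =
     \<lparr>carrier = carrier M, mult = mult M, one = \<one>\<^bsub>M\<^esub>, ring.zero = \<zero>\<^bsub>M\<^esub>, add = add M,
      smult = (\<lambda>X x. let p = (SOME p. p \<in> X) in
        \<Oplus>\<^bsub>M\<^esub>ab\<in>Poly_Mapping.keys p.
          [Poly_Mapping.lookup p ab] \<cdot>\<^bsub>M\<^esub> rsmult M (fst ab \<odot>\<^bsub>M\<^esub> x) (snd ab))\<rparr>"

section \<open>Singular equivalences of Morita type with level\<close>

definition singular_equivalence_pair ::
  "('k, 'w) ring_scheme \<Rightarrow> ('k, 'a, 'x) module_scheme \<Rightarrow> ('k, 'b, 'y) module_scheme \<Rightarrow> nat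
    \<Rightarrow> ('a, 'b, 'm, 'u) bimodule_scheme \<Rightarrow> ('b, 'a, 'n, 'v) bimodule_scheme \<Rightarrow> bool" where
  "singular_equivalence_pair K A B l M N \<longleftrightarrow>
     is_bimodule K A B M \<and> is_bimodule K B A N \<and>
     fg_projective A M \<and> fg_projective (opposite B) (right_part M) \<and>
     fg_projective B N \<and> fg_projective (opposite A) (right_part N) \<and>
     (\<exists>W. syzygy (enveloping_algebra K A) l (enveloping_module (regular_bimodule A)) W \<and>
        stably_isomorphic (enveloping_algebra K A) (enveloping_module (tensor_bimodule B M N)) W) \<and>
     (\<exists>W. syzygy (enveloping_algebra K B) l (enveloping_module (regular_bimodule B)) W \<and>
        stably_isomorphic (enveloping_algebra K B) (enveloping_module (tensor_bimodule A N M)) W)"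

text \<open>\<open>M\<close> and \<open>N\<close> are finitely generated left modules over \<open>A\<close> and \<open>B\<close>, so sequences over these
  algebras again suffice as carrier types.\<close>

definition singularly_equivalent_with_level ::
  "('k, 'w) ring_scheme \<Rightarrow> ('k, 'a, 'x) module_scheme \<Rightarrow> ('k, 'b, 'y) module_scheme
    \<Rightarrow> bool" where
  "singularly_equivalent_with_level K A B \<longleftrightarrow>
     (\<exists>l (M :: ('a, 'b, nat \<Rightarrow> 'a) bimodule) (N :: ('b, 'a, nat \<Rightarrow> 'b) bimodule).
        singular_equivalence_pair K A B l M N)"

end

(* Let (M, N) be a singular equivalence of level l. Tensoring with N is exact and preserves projectives,
   so it turns a resolution of Omega^n(M (x) Y) over A into one of N (x) Omega^n(M (x) Y) over B, and this
   module is stably isomorphic to Omega^n(N (x) M (x) Y), hence to Omega^(n+l)(Y): bimodule syzygies of B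
   are projective on the right, so -(x) Y turns Omega^l of the bimodule B into Omega^l(Y) up to projectives.
   Replacing the first term by a pullback, a resolution can be transported along a stable isomorphism.
   Stable isomorphisms, projectivity and add(U) are all expressed by homomorphisms that are finite sums
   of homomorphisms through a given module, so that no decompositions have to be chosen. *)

theory Submission
  imports Defs
begin

section \<open>Modules and homomorphisms\<close>

text \<open>Two obstacles shape the development. The definitions quantify over modules whose
  elements are sequences over the ring, whereas pullbacks consist of pairs and tensor products of
  cosets; modules built on the way are therefore transported along injections into sequences,
  obtained from finite generation, from membership in add, or from a surjection. And tensoring
  resolves only a module stably equivalent to the wanted syzygy; the pullback that repairs this
  brings in a free module, so the generator over B has to be N \<otimes> U together with B itself.
  The length m never changes while n grows by l, which suffices because the distance looks at m
  alone and the pair (M, N) is symmetric at the same level. The field acts through dimension: it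
  gives ranks of submodules, hence projective covers and finitely generated syzygies, and K-bases,
  which show that a projective bimodule is projective on the right and stays projective over B after
  tensoring with a finitely generated Y. Syzygies are compared through short exact sequences with
  projective middle term, a form that survives tensoring although projective covers need
  not.\<close>

lemma mod_homI:
  assumes "\<And>x. x \<in> carrier M \<Longrightarrow> f x \<in> carrier N"
    and "\<And>x y. x \<in> carrier M \<Longrightarrow> y \<in> carrier M \<Longrightarrow> f (x \<oplus>\<^bsub>M\<^esub> y) = f x \<oplus>\<^bsub>N\<^esub> f y"
    and "\<And>a x. a \<in> carrier R \<Longrightarrow> x \<in> carrier M \<Longrightarrow> f (a \<odot>\<^bsub>M\<^esub> x) = a \<odot>\<^bsub>N\<^esub> f x"
  shows "f \<in> mod_hom R M N"
  using assms by (auto simp: mod_hom_def hom_def)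

lemma mod_hom_closed: "f \<in> mod_hom R M N \<Longrightarrow> x \<in> carrier M \<Longrightarrow> f x \<in> carrier N"
  and mod_hom_add: "f \<in> mod_hom R M N \<Longrightarrow> x \<in> carrier M \<Longrightarrow> y \<in> carrier M \<Longrightarrow>
    f (x \<oplus>\<^bsub>M\<^esub> y) = f x \<oplus>\<^bsub>N\<^esub> f y"
  and mod_hom_smult: "f \<in> mod_hom R M N \<Longrightarrow> a \<in> carrier R \<Longrightarrow> x \<in> carrier M \<Longrightarrow>
    f (a \<odot>\<^bsub>M\<^esub> x) = a \<odot>\<^bsub>N\<^esub> f x"
  by (auto simp: mod_hom_def hom_def)

lemmas mod_hom_simps = mod_hom_closed mod_hom_add mod_hom_smult

lemma abelian_group_eq_zero:
  assumes "abelian_group G" "x \<in> carrier G" "x \<oplus>\<^bsub>G\<^esub> x = x"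
  shows "x = \<zero>\<^bsub>G\<^esub>"
proof -
  interpret abelian_group G by fact
  show ?thesis using assms(2,3) by (metis add.l_cancel_one')
qed

text \<open>Stated for additive maps between abelian groups, because it is applied to scalar
  multiplication in either argument and to maps on tensor products that are not linear.\<close>

lemma additive_zero:
  assumes "abelian_group M" "abelian_group N" "\<And>x. x \<in> carrier M \<Longrightarrow> f x \<in> carrier N"
    and "\<And>x y. x \<in> carrier M \<Longrightarrow> y \<in> carrier M \<Longrightarrow> f (x \<oplus>\<^bsub>M\<^esub> y) = f x \<oplus>\<^bsub>N\<^esub> f y"
  shows "f \<zero>\<^bsub>M\<^esub> = \<zero>\<^bsub>N\<^esub>"
proof -
  interpret M: abelian_group M by fact
  show ?thesis
    using assms(3)[of "\<zero>\<^bsub>M\<^esub>"] assms(4)[of "\<zero>\<^bsub>M\<^esub>" "\<zero>\<^bsub>M\<^esub>"] abelian_group_eq_zero[OF assms(2)] by simp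
qed

lemma additive_minus:
  assumes "abelian_group M" "abelian_group N" "\<And>x. x \<in> carrier M \<Longrightarrow> f x \<in> carrier N"
    and "\<And>x y. x \<in> carrier M \<Longrightarrow> y \<in> carrier M \<Longrightarrow> f (x \<oplus>\<^bsub>M\<^esub> y) = f x \<oplus>\<^bsub>N\<^esub> f y"
    and "x \<in> carrier M"
  shows "f (\<ominus>\<^bsub>M\<^esub> x) = \<ominus>\<^bsub>N\<^esub> f x"
proof -
  interpret M: abelian_group M by fact
  interpret N: abelian_group N by fact
  have "f (\<ominus>\<^bsub>M\<^esub> x) \<oplus>\<^bsub>N\<^esub> f x = \<zero>\<^bsub>N\<^esub>"
    using assms(4)[of "\<ominus>\<^bsub>M\<^esub> x" x] assms(5) additive_zero[OF assms(1-4)] by (simp add: M.l_neg)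
  then show ?thesis using assms(3,5) by (simp add: N.minus_equality)
qed

context left_module
begin

lemma smult_closed' [simp, intro]: "a \<in> carrier R \<Longrightarrow> x \<in> carrier M \<Longrightarrow> a \<odot>\<^bsub>M\<^esub> x \<in> carrier M"
  by (rule smult_closed)

lemma smult_l_null [simp]: "x \<in> carrier M \<Longrightarrow> \<zero> \<odot>\<^bsub>M\<^esub> x = \<zero>\<^bsub>M\<^esub>"
  by (rule additive_zero[where M = R and f = "\<lambda>a. a \<odot>\<^bsub>M\<^esub> x"])
     (auto simp: smult_l_distr R.is_abelian_group M.abelian_group_axioms)

lemma smult_r_null [simp]: "a \<in> carrier R \<Longrightarrow> a \<odot>\<^bsub>M\<^esub> \<zero>\<^bsub>M\<^esub> = \<zero>\<^bsub>M\<^esub>"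
  by (rule additive_zero[where M = M and f = "\<lambda>x. a \<odot>\<^bsub>M\<^esub> x"])
     (auto simp: smult_r_distr M.abelian_group_axioms)

lemma smult_l_minus: "a \<in> carrier R \<Longrightarrow> x \<in> carrier M \<Longrightarrow> (\<ominus> a) \<odot>\<^bsub>M\<^esub> x = \<ominus>\<^bsub>M\<^esub> (a \<odot>\<^bsub>M\<^esub> x)"
  by (rule additive_minus[where M = R and f = "\<lambda>a. a \<odot>\<^bsub>M\<^esub> x"])
     (auto simp: smult_l_distr R.is_abelian_group M.abelian_group_axioms)

lemma smult_r_minus: "a \<in> carrier R \<Longrightarrow> x \<in> carrier M \<Longrightarrow> a \<odot>\<^bsub>M\<^esub> (\<ominus>\<^bsub>M\<^esub> x) = \<ominus>\<^bsub>M\<^esub> (a \<odot>\<^bsub>M\<^esub> x)"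
  by (rule additive_minus[where M = M and f = "\<lambda>x. a \<odot>\<^bsub>M\<^esub> x"])
     (auto simp: smult_r_distr M.abelian_group_axioms)

text \<open>The subgroup that \<open>submodule\<close> demands gets its inverses from multiplication
  by -1.\<close>

lemma submoduleI:
  assumes "H \<subseteq> carrier M" "\<zero>\<^bsub>M\<^esub> \<in> H"
    and "\<And>x y. x \<in> H \<Longrightarrow> y \<in> H \<Longrightarrow> x \<oplus>\<^bsub>M\<^esub> y \<in> H"
    and "\<And>a x. a \<in> carrier R \<Longrightarrow> x \<in> H \<Longrightarrow> a \<odot>\<^bsub>M\<^esub> x \<in> H"
  shows "submodule H R M"
proof -
  have "\<ominus>\<^bsub>M\<^esub> x \<in> H" if "x \<in> H" for x
  proof -
    have "(\<ominus> \<one>) \<odot>\<^bsub>M\<^esub> x = \<ominus>\<^bsub>M\<^esub> x" using that assms(1) by (subst smult_l_minus) (auto simp: smult_one)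
    then show ?thesis using assms(4)[of "\<ominus> \<one>" x] that by simp
  qed
  then show ?thesis
    using assms by (auto intro!: submodule.intro subgroup.intro simp: submodule_axioms_def a_inv_def)
qed

lemma submoduleD:
  assumes "submodule H R M"
  shows "H \<subseteq> carrier M" "\<zero>\<^bsub>M\<^esub> \<in> H"
    and "\<And>x y. x \<in> H \<Longrightarrow> y \<in> H \<Longrightarrow> x \<oplus>\<^bsub>M\<^esub> y \<in> H"
    and "\<And>a x. a \<in> carrier R \<Longrightarrow> x \<in> H \<Longrightarrow> a \<odot>\<^bsub>M\<^esub> x \<in> H"
    and "\<And>x. x \<in> H \<Longrightarrow> \<ominus>\<^bsub>M\<^esub> x \<in> H"
    and "\<And>x y. x \<in> H \<Longrightarrow> y \<in> H \<Longrightarrow> x \<ominus>\<^bsub>M\<^esub> y \<in> H"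
proof -
  interpret submodule H R M by fact
  show "H \<subseteq> carrier M" "\<zero>\<^bsub>M\<^esub> \<in> H" using subset one_closed by auto
  show "\<And>x y. x \<in> H \<Longrightarrow> y \<in> H \<Longrightarrow> x \<oplus>\<^bsub>M\<^esub> y \<in> H"
    and "\<And>a x. a \<in> carrier R \<Longrightarrow> x \<in> H \<Longrightarrow> a \<odot>\<^bsub>M\<^esub> x \<in> H" using m_closed smult_closed by auto
  show *: "\<And>x. x \<in> H \<Longrightarrow> \<ominus>\<^bsub>M\<^esub> x \<in> H" using m_inv_closed by (simp add: a_inv_def)
  show "\<And>x y. x \<in> H \<Longrightarrow> y \<in> H \<Longrightarrow> x \<ominus>\<^bsub>M\<^esub> y \<in> H" using m_closed * by (simp add: a_minus_def)
qed

lemma carrier_submodule: "submodule (carrier M) R M"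
  by (rule submoduleI) auto

end

lemma left_moduleI:
  assumes "ring R"
    and "\<And>x y. \<lbrakk> x \<in> carrier M; y \<in> carrier M \<rbrakk> \<Longrightarrow> x \<oplus>\<^bsub>M\<^esub> y \<in> carrier M"
    and "\<zero>\<^bsub>M\<^esub> \<in> carrier M"
    and "\<And>x y z. \<lbrakk> x \<in> carrier M; y \<in> carrier M; z \<in> carrier M \<rbrakk> \<Longrightarrow>
      (x \<oplus>\<^bsub>M\<^esub> y) \<oplus>\<^bsub>M\<^esub> z = x \<oplus>\<^bsub>M\<^esub> (y \<oplus>\<^bsub>M\<^esub> z)"
    and "\<And>x y. \<lbrakk> x \<in> carrier M; y \<in> carrier M \<rbrakk> \<Longrightarrow> x \<oplus>\<^bsub>M\<^esub> y = y \<oplus>\<^bsub>M\<^esub> x"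
    and "\<And>x. x \<in> carrier M \<Longrightarrow> \<zero>\<^bsub>M\<^esub> \<oplus>\<^bsub>M\<^esub> x = x"
    and "\<And>x. x \<in> carrier M \<Longrightarrow> \<exists>y\<in>carrier M. y \<oplus>\<^bsub>M\<^esub> x = \<zero>\<^bsub>M\<^esub>"
    and "\<And>a x. \<lbrakk>a \<in> carrier R; x \<in> carrier M\<rbrakk> \<Longrightarrow> a \<odot>\<^bsub>M\<^esub> x \<in> carrier M"
    and "\<And>a b x. \<lbrakk>a \<in> carrier R; b \<in> carrier R; x \<in> carrier M\<rbrakk> \<Longrightarrow>
       (a \<oplus>\<^bsub>R\<^esub> b) \<odot>\<^bsub>M\<^esub> x = a \<odot>\<^bsub>M\<^esub> x \<oplus>\<^bsub>M\<^esub> b \<odot>\<^bsub>M\<^esub> x"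
    and "\<And>a x y. \<lbrakk>a \<in> carrier R; x \<in> carrier M; y \<in> carrier M\<rbrakk> \<Longrightarrow>
       a \<odot>\<^bsub>M\<^esub> (x \<oplus>\<^bsub>M\<^esub> y) = a \<odot>\<^bsub>M\<^esub> x \<oplus>\<^bsub>M\<^esub> a \<odot>\<^bsub>M\<^esub> y"
    and "\<And>a b x. \<lbrakk>a \<in> carrier R; b \<in> carrier R; x \<in> carrier M\<rbrakk> \<Longrightarrow>
       (a \<otimes>\<^bsub>R\<^esub> b) \<odot>\<^bsub>M\<^esub> x = a \<odot>\<^bsub>M\<^esub> (b \<odot>\<^bsub>M\<^esub> x)"
    and "\<And>x. x \<in> carrier M \<Longrightarrow> \<one>\<^bsub>R\<^esub> \<odot>\<^bsub>M\<^esub> x = x"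
  shows "left_module R M"
proof -
  interpret ring R by fact
  have "abelian_group M" using assms by (intro abelian_groupI) auto
  then show ?thesis using assms
    by (intro left_module.intro left_module_axioms.intro) (auto simp: ring_axioms)
qed

lemma left_module_restrict:
  assumes "left_module R M" "submodule Q R M"
  shows "left_module R (M\<lparr>carrier := Q\<rparr>)"
proof -
  interpret left_module R M by fact
  note Q = submoduleD[OF assms(2)]
  have Qc: "x \<in> carrier M" if "x \<in> Q" for x using that Q(1) by auto
  show ?thesis
  proof (rule left_moduleI)
    show "\<exists>y\<in>carrier (M\<lparr>carrier := Q\<rparr>). y \<oplus>\<^bsub>M\<lparr>carrier := Q\<rparr>\<^esub> x = \<zero>\<^bsub>M\<lparr>carrier := Q\<rparr>\<^esub>"
      if "x \<in> carrier (M\<lparr>carrier := Q\<rparr>)" for x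
      using that Q(5) Qc by (intro bexI[of _ "\<ominus>\<^bsub>M\<^esub> x"]) (auto simp: M.l_neg)
  qed (auto simp: Q Qc a_ac smult_l_distr smult_r_distr smult_assoc smult_one ring_axioms)
qed

lemma mod_hom_zero:
  assumes "left_module R M" "left_module R N" "f \<in> mod_hom R M N"
  shows "f \<zero>\<^bsub>M\<^esub> = \<zero>\<^bsub>N\<^esub>"
  by (rule additive_zero) (use assms in \<open>auto simp: mod_hom_simps left_module_def\<close>)

lemma mod_hom_minus:
  assumes "left_module R M" "left_module R N" "f \<in> mod_hom R M N" "x \<in> carrier M"
  shows "f (\<ominus>\<^bsub>M\<^esub> x) = \<ominus>\<^bsub>N\<^esub> f x"
  by (rule additive_minus) (use assms in \<open>auto simp: mod_hom_simps left_module_def\<close>)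

lemma mod_hom_diff:
  assumes "left_module R M" "left_module R N" "f \<in> mod_hom R M N" "x \<in> carrier M" "y \<in> carrier M"
  shows "f (x \<ominus>\<^bsub>M\<^esub> y) = f x \<ominus>\<^bsub>N\<^esub> f y"
proof -
  interpret M: left_module R M by fact
  show ?thesis using assms by (simp add: a_minus_def mod_hom_simps mod_hom_minus)
qed

lemma mod_hom_comp:
  assumes "f \<in> mod_hom R M N" "g \<in> mod_hom R N P"
  shows "(\<lambda>x. g (f x)) \<in> mod_hom R M P"
  using assms by (intro mod_homI) (auto simp: mod_hom_simps)

lemma mod_hom_cong:
  assumes "f \<in> mod_hom R M N" "\<And>x. x \<in> carrier M \<Longrightarrow> f' x = f x" "left_module R M"
  shows "f' \<in> mod_hom R M N"
proof -
  interpret left_module R M by fact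
  show ?thesis using assms by (intro mod_homI) (auto simp: mod_hom_simps)
qed

lemma mod_hom_id: "(\<lambda>x. x) \<in> mod_hom R M M"
  by (intro mod_homI) auto

lemma mod_hom_null: "left_module R N \<Longrightarrow> (\<lambda>x. \<zero>\<^bsub>N\<^esub>) \<in> mod_hom R M N"
proof -
  assume "left_module R N"
  then interpret left_module R N .
  show ?thesis by (intro mod_homI) auto
qed

lemma mod_hom_plus:
  assumes "f \<in> mod_hom R M N" "g \<in> mod_hom R M N" "left_module R N"
  shows "(\<lambda>x. f x \<oplus>\<^bsub>N\<^esub> g x) \<in> mod_hom R M N"
proof -
  interpret left_module R N by fact
  show ?thesis using assms
    by (intro mod_homI) (auto simp: mod_hom_simps smult_r_distr a_ac)
qed

lemma mod_hom_uminus: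
  assumes "f \<in> mod_hom R M N" "left_module R N"
  shows "(\<lambda>x. \<ominus>\<^bsub>N\<^esub> f x) \<in> mod_hom R M N"
proof -
  interpret left_module R N by fact
  show ?thesis using assms
    by (intro mod_homI) (auto simp: mod_hom_simps smult_r_minus minus_add a_ac)
qed

lemma mod_hom_sub:
  assumes "f \<in> mod_hom R M N" "g \<in> mod_hom R M N" "left_module R N"
  shows "(\<lambda>x. f x \<ominus>\<^bsub>N\<^esub> g x) \<in> mod_hom R M N"
  unfolding a_minus_def by (intro mod_hom_plus mod_hom_uminus assms)

lemma mod_hom_restrict: "f \<in> mod_hom R M N \<Longrightarrow> Q \<subseteq> carrier M \<Longrightarrow> f \<in> mod_hom R (M\<lparr>carrier := Q\<rparr>) N"
  by (intro mod_homI) (auto simp: mod_hom_simps subset_iff)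

lemma mod_hom_corestrict:
  "f \<in> mod_hom R M N \<Longrightarrow> f ` carrier M \<subseteq> Q \<Longrightarrow> f \<in> mod_hom R M (N\<lparr>carrier := Q\<rparr>)"
  by (intro mod_homI) (auto simp: mod_hom_simps image_subset_iff)

section \<open>Isomorphisms and transport of structure\<close>

lemma mod_hom_inv:
  assumes "f \<in> mod_hom R M N" "bij_betw f (carrier M) (carrier N)" "left_module R M"
  shows "the_inv_into (carrier M) f \<in> mod_hom R N M"
proof -
  interpret left_module R M by fact
  let ?g = "the_inv_into (carrier M) f"
  have inj: "inj_on f (carrier M)" and im: "f ` carrier M = carrier N"
    using assms(2) by (auto simp: bij_betw_def)
  have g: "?g (f x) = x" if "x \<in> carrier M" for x using inj that by (rule the_inv_into_f_f)
  have gc: "?g y \<in> carrier M" "f (?g y) = y" if "y \<in> carrier N" for y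
    using the_inv_into_into[OF inj, of y "carrier M"] f_the_inv_into_f[OF inj, of y] that im by auto
  show ?thesis
  proof (rule mod_homI)
    fix x y assume "x \<in> carrier N" "y \<in> carrier N"
    then have "?g (f (?g x \<oplus>\<^bsub>M\<^esub> ?g y)) = ?g x \<oplus>\<^bsub>M\<^esub> ?g y" by (intro g) (auto simp: gc)
    then show "?g (x \<oplus>\<^bsub>N\<^esub> y) = ?g x \<oplus>\<^bsub>M\<^esub> ?g y"
      using \<open>x \<in> carrier N\<close> \<open>y \<in> carrier N\<close> assms(1) by (simp add: mod_hom_simps gc)
  next
    fix a y assume "a \<in> carrier R" "y \<in> carrier N"
    then have "?g (f (a \<odot>\<^bsub>M\<^esub> ?g y)) = a \<odot>\<^bsub>M\<^esub> ?g y" by (intro g) (auto simp: gc)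
    then show "?g (a \<odot>\<^bsub>N\<^esub> y) = a \<odot>\<^bsub>M\<^esub> ?g y"
      using \<open>a \<in> carrier R\<close> \<open>y \<in> carrier N\<close> assms(1) by (simp add: mod_hom_simps gc)
  qed (rule gc)
qed

lemma mod_isoE:
  assumes "mod_iso R M N"
  obtains f g where "left_module R M" "left_module R N" "f \<in> mod_hom R M N" "g \<in> mod_hom R N M"
    "\<And>x. x \<in> carrier M \<Longrightarrow> g (f x) = x" "\<And>y. y \<in> carrier N \<Longrightarrow> f (g y) = y"
proof -
  obtain f where f: "left_module R M" "left_module R N" "f \<in> mod_hom R M N" "bij_betw f (carrier M) (carrier N)"
    using assms by (auto simp: mod_iso_def)
  show ?thesis
    using f mod_hom_inv[OF f(3,4,1)]
    by (intro that[of f "the_inv_into (carrier M) f"])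
       (auto simp: bij_betw_def the_inv_into_f_f f_the_inv_into_f)
qed

lemma mod_isoI:
  assumes "left_module R M" "left_module R N" "f \<in> mod_hom R M N" "g \<in> mod_hom R N M"
    "\<And>x. x \<in> carrier M \<Longrightarrow> g (f x) = x" "\<And>y. y \<in> carrier N \<Longrightarrow> f (g y) = y"
  shows "mod_iso R M N"
  unfolding mod_iso_def using assms
  by (auto intro!: bexI[of _ f] bij_betw_byWitness[where f' = g] simp: mod_hom_closed)

lemma mod_iso_refl: "left_module R M \<Longrightarrow> mod_iso R M M"
  by (rule mod_isoI[where f = "\<lambda>x. x" and g = "\<lambda>x. x"]) (auto simp: mod_hom_id)

lemma mod_iso_sym: "mod_iso R M N \<Longrightarrow> mod_iso R N M"
  by (elim mod_isoE) (rule mod_isoI)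

lemma mod_iso_trans:
  assumes "mod_iso R M N" "mod_iso R N P"
  shows "mod_iso R M P"
proof -
  obtain f g where 1: "left_module R M" "left_module R N" "f \<in> mod_hom R M N" "g \<in> mod_hom R N M"
    "\<And>x. x \<in> carrier M \<Longrightarrow> g (f x) = x" "\<And>y. y \<in> carrier N \<Longrightarrow> f (g y) = y"
    using mod_isoE[OF assms(1)] by metis
  obtain f' g' where 2: "left_module R P" "f' \<in> mod_hom R N P" "g' \<in> mod_hom R P N"
    "\<And>x. x \<in> carrier N \<Longrightarrow> g' (f' x) = x" "\<And>y. y \<in> carrier P \<Longrightarrow> f' (g' y) = y"
    using mod_isoE[OF assms(2)] by metis
  show ?thesis
    by (rule mod_isoI[OF 1(1) 2(1) mod_hom_comp[OF 1(3) 2(2)] mod_hom_comp[OF 2(3) 1(4)]])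
       (use 1 2 in \<open>simp_all add: mod_hom_closed\<close>)
qed

text \<open>This brings a module of pairs, cosets or functions back to the type
  \<open>nat \<Rightarrow> 'r\<close> over which the definitions quantify; all that has to be
  supplied is an injection of the carrier, linear or not.\<close>

lemma mod_iso_transport:
  fixes X :: "('r, 'm, 'y) module_scheme" and e :: "'m \<Rightarrow> 'n"
  assumes "left_module R X" "inj_on e (carrier X)"
  obtains Y :: "('r, 'n) module" where "mod_iso R X Y"
proof -
  interpret X: left_module R X by fact
  let ?i = "the_inv_into (carrier X) e"
  define Y :: "('r, 'n) module" where "Y = \<lparr>carrier = e ` carrier X, mult = undefined, one = undefined,
    ring.zero = e \<zero>\<^bsub>X\<^esub>, add = (\<lambda>x y. e (?i x \<oplus>\<^bsub>X\<^esub> ?i y)), smult = (\<lambda>a x. e (a \<odot>\<^bsub>X\<^esub> ?i x))\<rparr>"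
  have [simp]: "?i (e x) = x" if "x \<in> carrier X" for x
    using assms(2) that by (rule the_inv_into_f_f)
  have Y [simp]: "carrier Y = e ` carrier X" "\<zero>\<^bsub>Y\<^esub> = e \<zero>\<^bsub>X\<^esub>"
    "x \<in> carrier X \<Longrightarrow> y \<in> carrier X \<Longrightarrow> e x \<oplus>\<^bsub>Y\<^esub> e y = e (x \<oplus>\<^bsub>X\<^esub> y)"
    "x \<in> carrier X \<Longrightarrow> a \<odot>\<^bsub>Y\<^esub> e x = e (a \<odot>\<^bsub>X\<^esub> x)" for x y a
    by (auto simp: Y_def)
  have "left_module R Y"
  proof (rule left_moduleI)
    show "\<exists>y\<in>carrier Y. y \<oplus>\<^bsub>Y\<^esub> x = \<zero>\<^bsub>Y\<^esub>" if "x \<in> carrier Y" for x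
    proof -
      from that obtain z where z: "z \<in> carrier X" "x = e z" by auto
      then show ?thesis by (intro bexI[of _ "e (\<ominus>\<^bsub>X\<^esub> z)"]) (auto simp: X.M.l_neg)
    qed
  qed (auto simp: X.M.a_ac X.smult_l_distr X.smult_r_distr X.smult_assoc X.smult_one X.ring_axioms)
  then have "mod_iso R X Y"
    using assms by (intro mod_isoI[where f = e and g = ?i] mod_homI) auto
  then show ?thesis by (rule that)
qed

lemma left_module_regular:
  assumes "ring R"
  shows "left_module R (regular_module R)"
proof -
  interpret ring R by fact
  show ?thesis
  proof (rule left_moduleI)
    show "\<exists>y\<in>carrier (regular_module R). y \<oplus>\<^bsub>regular_module R\<^esub> x = \<zero>\<^bsub>regular_module R\<^esub>"
      if "x \<in> carrier (regular_module R)" for x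
      using that by (intro bexI[of _ "\<ominus>\<^bsub>R\<^esub> x"]) (auto simp: l_neg regular_module_def)
  qed (auto simp: regular_module_def a_ac l_distr r_distr m_assoc ring_axioms)
qed

lemma regular_module_simps [simp]:
  "carrier (regular_module R) = carrier R" "add (regular_module R) = add R"
  "\<zero>\<^bsub>regular_module R\<^esub> = \<zero>\<^bsub>R\<^esub>" "smult (regular_module R) = mult R"
  by (auto simp: regular_module_def)

lemma mod_hom_regular:
  assumes "left_module R X" "x \<in> carrier X"
  shows "(\<lambda>a. a \<odot>\<^bsub>X\<^esub> x) \<in> mod_hom R (regular_module R) X"
proof -
  interpret left_module R X by fact
  show ?thesis using assms(2)
    by (intro mod_homI) (auto simp: smult_l_distr smult_assoc)
qed

lemma mod_hom_regular_eq:
  assumes "ring R" "f \<in> mod_hom R (regular_module R) X" "a \<in> carrier R"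
  shows "f a = a \<odot>\<^bsub>X\<^esub> f \<one>\<^bsub>R\<^esub>"
proof -
  interpret ring R by fact
  show ?thesis using mod_hom_smult[OF assms(2), of a "\<one>\<^bsub>R\<^esub>"] assms(3) by simp
qed

section \<open>Homomorphisms factoring through direct powers\<close>

text \<open>The maps from X to Y that are finite sums of composites through U, an ideal in the
  category of modules. For the identity of X it says that X lies in add(U); for U the regular module
  it is the ideal of maps through finitely generated projectives. Values are compared on the carrier
  only, so \<open>h\<close> may be any function outside it.\<close>

inductive fac ::
  "('r, 'x) ring_scheme \<Rightarrow> ('r, 'u, 'y) module_scheme \<Rightarrow> ('r, 'm, 'z) module_scheme
    \<Rightarrow> ('r, 'n, 'w) module_scheme \<Rightarrow> ('m \<Rightarrow> 'n) \<Rightarrow> bool"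
  for R U X Y where
  fac_null: "(\<And>x. x \<in> carrier X \<Longrightarrow> h x = \<zero>\<^bsub>Y\<^esub>) \<Longrightarrow> fac R U X Y h"
| fac_step: "\<alpha> \<in> mod_hom R X U \<Longrightarrow> \<beta> \<in> mod_hom R U Y \<Longrightarrow> fac R U X Y h' \<Longrightarrow>
    (\<And>x. x \<in> carrier X \<Longrightarrow> h x = \<beta> (\<alpha> x) \<oplus>\<^bsub>Y\<^esub> h' x) \<Longrightarrow> fac R U X Y h"

lemma fac_cong:
  assumes "fac R U X Y h" "\<And>x. x \<in> carrier X \<Longrightarrow> h2 x = h x"
  shows "fac R U X Y h2"
  using assms(1)
proof cases
  case fac_null
  then show ?thesis using assms(2) by (auto intro: fac.fac_null)
next
  case (fac_step \<alpha> \<beta> h')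
  then show ?thesis using assms(2) by (auto intro!: fac.fac_step[OF fac_step(1-3)])
qed

lemma fac_mod_hom:
  assumes "fac R U X Y h" "left_module R X" "left_module R Y"
  shows "h \<in> mod_hom R X Y"
  using assms(1)
proof induction
  case (fac_null h)
  then show ?case using mod_hom_cong[OF mod_hom_null] assms by blast
next
  case (fac_step \<alpha> \<beta> h' h)
  show ?case
    by (rule mod_hom_cong[OF mod_hom_plus[OF mod_hom_comp[OF fac_step(1,2)] fac_step(5) assms(3)]])
       (use fac_step assms in auto)
qed

lemma fac_single:
  assumes "\<alpha> \<in> mod_hom R X U" "\<beta> \<in> mod_hom R U Y" "left_module R Y"
  shows "fac R U X Y (\<lambda>x. \<beta> (\<alpha> x))"
proof -
  interpret left_module R Y by fact
  show ?thesis
    by (rule fac_step[OF assms(1,2) fac_null[where h = "\<lambda>x. \<zero>\<^bsub>Y\<^esub>"]])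
       (use assms in \<open>auto simp: mod_hom_simps\<close>)
qed

lemma fac_add:
  assumes "fac R U X Y h" "fac R U X Y h'" "left_module R X" "left_module R U" "left_module R Y"
  shows "fac R U X Y (\<lambda>x. h x \<oplus>\<^bsub>Y\<^esub> h' x)"
proof -
  interpret left_module R Y by fact
  have h': "h' \<in> mod_hom R X Y" using assms fac_mod_hom by blast
  show ?thesis using assms(1)
  proof induction
    case (fac_null h)
    show ?case by (rule fac_cong[OF assms(2)]) (use fac_null h' in \<open>simp add: mod_hom_simps\<close>)
  next
    case (fac_step \<alpha> \<beta> h1 h)
    have "h1 \<in> mod_hom R X Y" using fac_step assms fac_mod_hom by blast
    then show ?case
      by (intro fac.fac_step[OF fac_step(1,2,5)]) (use fac_step h' in \<open>simp add: mod_hom_simps a_assoc\<close>)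
  qed
qed

lemma fac_comp_left:
  assumes "fac R U X Y h" "g \<in> mod_hom R Y Z" "left_module R X" "left_module R Y" "left_module R Z"
  shows "fac R U X Z (\<lambda>x. g (h x))"
  using assms(1)
proof induction
  case (fac_null h)
  then show ?case using mod_hom_zero[OF assms(4,5,2)] by (intro fac.fac_null) auto
next
  case (fac_step \<alpha> \<beta> h1 h)
  have "h1 \<in> mod_hom R X Y" using fac_step assms fac_mod_hom by blast
  then show ?case
    by (intro fac.fac_step[OF fac_step(1) mod_hom_comp[OF fac_step(2) assms(2)] fac_step(5)])
       (use fac_step assms in \<open>simp add: mod_hom_simps\<close>)
qed

lemma fac_comp_right:
  assumes "fac R U Y Z h" "g \<in> mod_hom R X Y"
  shows "fac R U X Z (\<lambda>x. h (g x))"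
  using assms(1)
proof induction
  case (fac_null h)
  then show ?case using assms(2) by (intro fac.fac_null) (auto simp: mod_hom_closed)
next
  case (fac_step \<alpha> \<beta> h1 h)
  then show ?case using assms(2)
    by (intro fac.fac_step[OF mod_hom_comp[OF assms(2) fac_step(1)] fac_step(2,5)])
       (auto simp: mod_hom_closed)
qed

lemma fac_uminus:
  assumes "fac R U X Y h" "left_module R X" "left_module R Y"
  shows "fac R U X Y (\<lambda>x. \<ominus>\<^bsub>Y\<^esub> h x)"
  using fac_comp_left[OF assms(1) mod_hom_uminus[OF mod_hom_id assms(3)] assms(2,3,3)] .

text \<open>Each summand is written as \<beta> id \<alpha>, and the identity of U is replaced by its
  sum through V. This is transitivity of add; it also replaces the regular module by any module
  whose add contains it.\<close>

lemma fac_trans: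
  assumes "fac R U X Y h" "fac R V U U (\<lambda>x. x)" "left_module R X" "left_module R Y" "left_module R U"
    "left_module R V"
  shows "fac R V X Y h"
  using assms(1)
proof induction
  case (fac_null h)
  then show ?case by (rule fac.fac_null)
next
  case (fac_step \<alpha> \<beta> h1 h)
  have "fac R V X Y (\<lambda>x. \<beta> (\<alpha> x))"
    using fac_comp_left[OF fac_comp_right[OF assms(2) fac_step(1)] fac_step(2)] assms by auto
  then show ?case
    by (rule fac_cong[OF fac_add[OF _ fac_step(5)]]) (use assms fac_step in auto)
qed

text \<open>Finitely generated projective modules enter only through dual bases, that is through
  \<open>fac\<close> for the regular module.\<close>

abbreviation pfac where "pfac R \<equiv> fac R (regular_module R)"

abbreviation dual_basis where "dual_basis R P \<equiv> pfac R P P (\<lambda>x. x)"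

text \<open>A map out of the regular module is fixed by the image of 1, and that element has a
  preimage under \<pi>. Lifting summand by summand works for X projective or not, and the lift is
  again a sum through the regular module.\<close>

lemma pfac_lift:
  assumes "pfac R X Y h" "\<pi> \<in> mod_hom R E Y" "\<pi> ` carrier E = carrier Y"
    "left_module R X" "left_module R Y" "left_module R E"
  obtains h' where "pfac R X E h'" "\<And>x. x \<in> carrier X \<Longrightarrow> \<pi> (h' x) = h x"
proof -
  interpret Y: left_module R Y by fact
  interpret E: left_module R E by fact
  have "\<exists>h'. pfac R X E h' \<and> (\<forall>x\<in>carrier X. \<pi> (h' x) = h x)" using assms(1)
  proof induction
    case (fac_null h)
    then show ?case using mod_hom_zero[OF assms(6,5,2)]
      by (intro exI[of _ "\<lambda>x. \<zero>\<^bsub>E\<^esub>"]) (auto intro: fac.fac_null)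
  next
    case (fac_step \<alpha> \<beta> h1 h)
    then obtain h1' where h1': "pfac R X E h1'" "\<And>x. x \<in> carrier X \<Longrightarrow> \<pi> (h1' x) = h1 x" by blast
    have "\<beta> \<one>\<^bsub>R\<^esub> \<in> carrier Y" using fac_step(2) by (auto simp: mod_hom_closed)
    then obtain e where e: "e \<in> carrier E" "\<pi> e = \<beta> \<one>\<^bsub>R\<^esub>" using assms(3) by (metis imageE)
    have "h1' \<in> mod_hom R X E" using h1' assms fac_mod_hom by blast
    moreover have "\<alpha> x \<in> carrier R" if "x \<in> carrier X" for x
      using mod_hom_closed[OF fac_step(1) that] by simp
    moreover from this have "\<beta> (\<alpha> x) = \<alpha> x \<odot>\<^bsub>Y\<^esub> \<beta> \<one>\<^bsub>R\<^esub>" if "x \<in> carrier X" for x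
      using mod_hom_regular_eq[OF Y.ring_axioms fac_step(2)] that by blast
    ultimately show ?case
      using fac_step assms(2) e h1'
      by (intro exI[of _ "\<lambda>x. \<alpha> x \<odot>\<^bsub>E\<^esub> e \<oplus>\<^bsub>E\<^esub> h1' x"] conjI ballI
            fac.fac_step[OF fac_step(1) mod_hom_regular[OF assms(6) e(1)] h1'(1)])
         (auto simp: mod_hom_simps)
  qed
  then show ?thesis using that by blast
qed

lemma dual_basis_lift:
  assumes "dual_basis R P" "f \<in> mod_hom R P Y" "\<pi> \<in> mod_hom R E Y" "\<pi> ` carrier E = carrier Y"
    "left_module R P" "left_module R Y" "left_module R E"
  obtains f' where "f' \<in> mod_hom R P E" "\<And>x. x \<in> carrier P \<Longrightarrow> \<pi> (f' x) = f x"
proof -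
  have "pfac R P Y f" using fac_comp_left[OF assms(1,2)] assms by auto
  then show ?thesis using pfac_lift[OF _ assms(3,4)] assms fac_mod_hom that by metis
qed

text \<open>The identity of Y is p id i: closure of add under direct summands.\<close>

lemma fac_retract:
  assumes "fac R U X X (\<lambda>x. x)" "i \<in> mod_hom R Y X" "p \<in> mod_hom R X Y"
    "\<And>y. y \<in> carrier Y \<Longrightarrow> p (i y) = y" "left_module R X" "left_module R Y"
  shows "fac R U Y Y (\<lambda>y. y)"
  by (rule fac_cong[OF fac_comp_left[OF fac_comp_right[OF assms(1,2)] assms(3)]]) (use assms in auto)

lemma fac_iso:
  assumes "mod_iso R X Y" "fac R U X X (\<lambda>x. x)"
  shows "fac R U Y Y (\<lambda>y. y)"
  using assms(1) by (elim mod_isoE) (rule fac_retract[OF assms(2)])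

lemma fac_change:
  assumes "mod_iso R U V" "fac R U X Y h" "left_module R X" "left_module R Y"
  shows "fac R V X Y h"
proof -
  obtain f g where fg: "left_module R U" "left_module R V" "f \<in> mod_hom R U V" "g \<in> mod_hom R V U"
    "\<And>x. x \<in> carrier U \<Longrightarrow> g (f x) = x"
    using mod_isoE[OF assms(1)] by metis
  have "fac R V U U (\<lambda>x. x)"
    by (rule fac_cong[OF fac_single[OF fg(3,4)]]) (use fg in auto)
  then show ?thesis using fac_trans[OF assms(2)] assms fg by blast
qed

lemma dual_basis_regular: "ring R \<Longrightarrow> dual_basis R (regular_module R)"
  using fac_single[OF mod_hom_id mod_hom_id left_module_regular] .

section \<open>Direct powers and finite generation\<close>

lemma direct_power_simps [simp]:
  "carrier (direct_power n M) = {..<n} \<rightarrow>\<^sub>E carrier M"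
  "\<zero>\<^bsub>direct_power n M\<^esub> = (\<lambda>i\<in>{..<n}. \<zero>\<^bsub>M\<^esub>)"
  "x \<oplus>\<^bsub>direct_power n M\<^esub> y = (\<lambda>i\<in>{..<n}. x i \<oplus>\<^bsub>M\<^esub> y i)"
  "a \<odot>\<^bsub>direct_power n M\<^esub> x = (\<lambda>i\<in>{..<n}. a \<odot>\<^bsub>M\<^esub> x i)"
  by (auto simp: direct_power_def)

lemma left_module_direct_power:
  assumes "left_module R M"
  shows "left_module R (direct_power n M)"
proof -
  interpret left_module R M by fact
  show ?thesis
  proof (rule left_moduleI)
    show "\<exists>y\<in>carrier (direct_power n M). y \<oplus>\<^bsub>direct_power n M\<^esub> x = \<zero>\<^bsub>direct_power n M\<^esub>"
      if "x \<in> carrier (direct_power n M)" for x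
      using that by (intro bexI[of _ "\<lambda>i\<in>{..<n}. \<ominus>\<^bsub>M\<^esub> x i"]) (auto simp: M.l_neg PiE_iff fun_eq_iff)
  qed (auto simp: M.a_ac smult_l_distr smult_r_distr smult_assoc smult_one ring_axioms
        PiE_iff extensional_def fun_eq_iff)
qed

lemma direct_power_upd:
  "w \<in> carrier (direct_power n M) \<Longrightarrow> u \<in> carrier M \<Longrightarrow> w(n := u) \<in> carrier (direct_power (Suc n) M)"
  by (auto simp: PiE_def Pi_def extensional_def less_Suc_eq)

lemma mod_hom_direct_power_Suc:
  assumes "b \<in> mod_hom R (direct_power n U) Y" "\<beta> \<in> mod_hom R U Y" "left_module R U" "left_module R Y"
  shows "(\<lambda>w. \<beta> (w n) \<oplus>\<^bsub>Y\<^esub> b (restrict w {..<n})) \<in> mod_hom R (direct_power (Suc n) U) Y"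
proof (rule mod_hom_plus[OF mod_hom_comp[OF _ assms(2)] mod_hom_comp[OF _ assms(1)] assms(4)])
  show "(\<lambda>w. w n) \<in> mod_hom R (direct_power (Suc n) U) U"
    by (rule mod_homI) (auto simp: PiE_def Pi_def)
  show "(\<lambda>w. restrict w {..<n}) \<in> mod_hom R (direct_power (Suc n) U) (direct_power n U)"
    by (rule mod_homI) (auto simp: PiE_iff extensional_def fun_eq_iff)
qed

lemma mod_hom_direct_power_upd:
  assumes "a \<in> mod_hom R X (direct_power n U)" "\<alpha> \<in> mod_hom R X U"
  shows "(\<lambda>x. (a x)(n := \<alpha> x)) \<in> mod_hom R X (direct_power (Suc n) U)"
proof (rule mod_homI)
  show "(a x)(n := \<alpha> x) \<in> carrier (direct_power (Suc n) U)" if "x \<in> carrier X" for x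
    using direct_power_upd[OF mod_hom_closed[OF assms(1) that] mod_hom_closed[OF assms(2) that]] .
qed (auto simp: mod_hom_simps(2,3)[OF assms(1)] mod_hom_simps(2,3)[OF assms(2)] fun_eq_iff less_Suc_eq)

lemma restrict_upd_direct_power:
  "w \<in> carrier (direct_power n M) \<Longrightarrow> restrict (w(n := u)) {..<n} = w"
  by (auto simp: PiE_def extensional_def fun_eq_iff)

text \<open>The summands become coordinates: a collects the \<alpha>, and b adds up the \<beta>. A
  new summand takes index n in a sequence of length \<open>Suc n\<close>; the older part is
  recovered by restriction to \<open>{..<n}\<close>, as elements of direct powers are extensional
  functions.\<close>

lemma fac_direct_power:
  assumes "fac R U X Y h" "left_module R U" "left_module R X" "left_module R Y"
  obtains n a b where "a \<in> mod_hom R X (direct_power n U)" "b \<in> mod_hom R (direct_power n U) Y"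
    "\<And>x. x \<in> carrier X \<Longrightarrow> h x = b (a x)"
proof -
  interpret U: left_module R U by fact
  interpret Y: left_module R Y by fact
  have "\<exists>n a b. a \<in> mod_hom R X (direct_power n U) \<and> b \<in> mod_hom R (direct_power n U) Y \<and>
    (\<forall>x\<in>carrier X. h x = b (a x))" using assms(1)
  proof induction
    case (fac_null h)
    have "(\<lambda>x. \<zero>\<^bsub>direct_power 0 U\<^esub>) \<in> mod_hom R X (direct_power 0 U)"
      "(\<lambda>x. \<zero>\<^bsub>Y\<^esub>) \<in> mod_hom R (direct_power 0 U) Y"
      by (rule mod_hom_null[OF left_module_direct_power[OF assms(2)]], rule mod_hom_null[OF assms(4)])
    then show ?case using fac_null by blast
  next
    case (fac_step \<alpha> \<beta> h1 h)
    then obtain n a b where *: "a \<in> mod_hom R X (direct_power n U)" "b \<in> mod_hom R (direct_power n U) Y"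
      "\<forall>x\<in>carrier X. h1 x = b (a x)" by blast
    have "h x = \<beta> (((a x)(n := \<alpha> x)) n) \<oplus>\<^bsub>Y\<^esub> b (restrict ((a x)(n := \<alpha> x)) {..<n})" if "x \<in> carrier X" for x
      using that fac_step(4) *(3) restrict_upd_direct_power[OF mod_hom_closed[OF *(1) that]] by simp
    then show ?case
      using mod_hom_direct_power_upd[OF *(1) fac_step(1)]
        mod_hom_direct_power_Suc[OF *(2) fac_step(2) assms(2,4)] by blast
  qed
  then show ?thesis using that by blast
qed

text \<open>The identity is the sum of the coordinate idempotents; \<open>?t k\<close> is the
  partial sum over the coordinates below k, so \<open>?t n\<close> is the identity on extensional
  functions.\<close>

lemma fac_direct_power_id:
  assumes "left_module R U"
  shows "fac R U (direct_power n U) (direct_power n U) (\<lambda>x. x)"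
proof -
  interpret U: left_module R U by fact
  let ?t = "\<lambda>k x. \<lambda>i\<in>{..<n}. if i < k then x i else \<zero>\<^bsub>U\<^esub>"
  have "k \<le> n \<Longrightarrow> fac R U (direct_power n U) (direct_power n U) (?t k)" for k
  proof (induction k)
    case 0
    show ?case by (rule fac_null) (simp add: fun_eq_iff)
  next
    case (Suc k)
    show ?case
    proof (rule fac_step[OF _ _ Suc.IH])
      show "(\<lambda>x. x k) \<in> mod_hom R (direct_power n U) U"
        using Suc.prems by (intro mod_homI) (auto simp: PiE_def Pi_def)
      show "(\<lambda>u. \<lambda>i\<in>{..<n}. if i = k then u else \<zero>\<^bsub>U\<^esub>) \<in> mod_hom R U (direct_power n U)"
        by (intro mod_homI) (auto simp: fun_eq_iff)
      show "k \<le> n" using Suc.prems by simp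
      fix x assume x: "x \<in> carrier (direct_power n U)"
      then have xU: "x i \<in> carrier U" if "i < n" for i using that by (auto simp: PiE_iff)
      show "?t (Suc k) x = (\<lambda>i\<in>{..<n}. if i = k then x k else \<zero>\<^bsub>U\<^esub>) \<oplus>\<^bsub>direct_power n U\<^esub> ?t k x"
        by (rule ext) (auto simp: xU less_Suc_eq)
    qed
  qed
  from this[of n] show ?thesis
    by (rule fac_cong) (auto simp: PiE_def extensional_def fun_eq_iff)
qed

lemma left_module_direct_sum:
  assumes "left_module R M" "left_module R N"
  shows "left_module R (direct_sum M N)"
proof -
  interpret M: left_module R M by fact
  interpret N: left_module R N by fact
  show ?thesis
  proof (rule left_moduleI)
    show "\<exists>y\<in>carrier (direct_sum M N). y \<oplus>\<^bsub>direct_sum M N\<^esub> x = \<zero>\<^bsub>direct_sum M N\<^esub>"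
      if "x \<in> carrier (direct_sum M N)" for x
      using that by (intro bexI[of _ "(\<ominus>\<^bsub>M\<^esub> fst x, \<ominus>\<^bsub>N\<^esub> snd x)"])
        (auto simp: direct_sum_def M.M.l_neg N.M.l_neg)
  qed (auto simp: direct_sum_def M.M.a_ac M.smult_l_distr M.smult_r_distr M.smult_assoc M.smult_one
        N.M.a_ac N.smult_l_distr N.smult_r_distr N.smult_assoc N.smult_one M.ring_axioms)
qed

lemma direct_sum_simps [simp]:
  "carrier (direct_sum M N) = carrier M \<times> carrier N"
  "\<zero>\<^bsub>direct_sum M N\<^esub> = (\<zero>\<^bsub>M\<^esub>, \<zero>\<^bsub>N\<^esub>)"
  "(x, y) \<oplus>\<^bsub>direct_sum M N\<^esub> (x', y') = (x \<oplus>\<^bsub>M\<^esub> x', y \<oplus>\<^bsub>N\<^esub> y')"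
  "a \<odot>\<^bsub>direct_sum M N\<^esub> (x, y) = (a \<odot>\<^bsub>M\<^esub> x, a \<odot>\<^bsub>N\<^esub> y)"
  by (auto simp: direct_sum_def)

lemma direct_sum_homs:
  assumes "left_module R M" "left_module R N"
  shows "fst \<in> mod_hom R (direct_sum M N) M" "snd \<in> mod_hom R (direct_sum M N) N"
    "(\<lambda>x. (x, \<zero>\<^bsub>N\<^esub>)) \<in> mod_hom R M (direct_sum M N)"
    "(\<lambda>y. (\<zero>\<^bsub>M\<^esub>, y)) \<in> mod_hom R N (direct_sum M N)"
proof -
  interpret M: left_module R M by fact
  interpret N: left_module R N by fact
  show "fst \<in> mod_hom R (direct_sum M N) M" "snd \<in> mod_hom R (direct_sum M N) N"
    "(\<lambda>x. (x, \<zero>\<^bsub>N\<^esub>)) \<in> mod_hom R M (direct_sum M N)"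
    "(\<lambda>y. (\<zero>\<^bsub>M\<^esub>, y)) \<in> mod_hom R N (direct_sum M N)"
    by (auto intro!: mod_homI)
qed

lemma mod_hom_pair:
  "f \<in> mod_hom R X M \<Longrightarrow> g \<in> mod_hom R X N \<Longrightarrow> (\<lambda>x. (f x, g x)) \<in> mod_hom R X (direct_sum M N)"
  by (rule mod_homI) (simp_all add: mod_hom_simps[of f] mod_hom_simps[of g])

lemma kernel_submodule:
  assumes "left_module R X" "left_module R Y" "f \<in> mod_hom R X Y"
  shows "submodule {x \<in> carrier X. f x = \<zero>\<^bsub>Y\<^esub>} R X"
proof -
  interpret X: left_module R X by fact
  interpret Y: left_module R Y by fact
  show ?thesis using assms
    by (intro X.submoduleI) (auto simp: mod_hom_simps mod_hom_zero[OF assms])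
qed

lemma image_submodule:
  assumes "left_module R X" "left_module R Y" "f \<in> mod_hom R X Y"
  shows "submodule (f ` carrier X) R Y"
proof -
  interpret X: left_module R X by fact
  interpret Y: left_module R Y by fact
  show ?thesis
  proof (rule Y.submoduleI)
    show "\<zero>\<^bsub>Y\<^esub> \<in> f ` carrier X" using mod_hom_zero[OF assms] by (metis X.M.zero_closed image_eqI)
  qed (use assms(3) in \<open>auto simp: mod_hom_simps simp flip: mod_hom_add mod_hom_smult\<close>)
qed

section \<open>Membership in add and projectivity in terms of \<open>fac\<close>\<close>

lemma in_add_imp_fac:
  assumes "in_add R U X" "left_module R U"
  shows "left_module R X" "fac R U X X (\<lambda>x. x)"
proof -
  show X: "left_module R X" using assms(1) by (simp add: in_add_def)
  obtain n and V :: "'a std_module" where V: "left_module R V" "mod_iso R (direct_sum X V) (direct_power n U)"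
    using assms(1) by (auto simp: in_add_def)
  have "fac R U (direct_sum X V) (direct_sum X V) (\<lambda>x. x)"
    using fac_iso[OF mod_iso_sym[OF V(2)] fac_direct_power_id[OF assms(2)]] .
  then show "fac R U X X (\<lambda>x. x)"
    by (rule fac_retract[OF _ direct_sum_homs(3)[OF X V(1)] direct_sum_homs(1)[OF X V(1)]])
       (use X V left_module_direct_sum in auto)
qed

text \<open>Writing the identity of X as b a, with a into the direct power P, exhibits X as a
  summand of P: the complement is the kernel of b, with projection w - a (b w). As
  \<open>in_add\<close> wants the complement as a module of sequences over R, the kernel is
  transported along e.\<close>

lemma fac_imp_in_add:
  fixes R :: "('r, 'x) ring_scheme" and U :: "('r, 'u, 'y) module_scheme"
    and e :: "(nat \<Rightarrow> 'u) \<Rightarrow> (nat \<Rightarrow> 'r)"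
  assumes X: "left_module R X" and U: "left_module R U" and id: "fac R U X X (\<lambda>x. x)" and e: "inj e"
  shows "in_add R U X"
proof -
  obtain n a b where ab: "a \<in> mod_hom R X (direct_power n U)" "b \<in> mod_hom R (direct_power n U) X"
    "\<And>x. x \<in> carrier X \<Longrightarrow> x = b (a x)" 
    by (rule fac_direct_power[OF id U X X]) (rule that)
  let ?P = "direct_power n U"
  have P: "left_module R ?P" by (rule left_module_direct_power[OF U])
  interpret X: left_module R X by fact
  interpret P: left_module R ?P by fact
  define Q where "Q = ?P\<lparr>carrier := {w \<in> carrier ?P. b w = \<zero>\<^bsub>X\<^esub>}\<rparr>"
  have Q: "left_module R Q" unfolding Q_def by (rule left_module_restrict[OF P kernel_submodule[OF P X ab(2)]])
  have Qs: "carrier Q = {w \<in> carrier ?P. b w = \<zero>\<^bsub>X\<^esub>}" "add Q = add ?P" "smult Q = smult ?P" "\<zero>\<^bsub>Q\<^esub> = \<zero>\<^bsub>?P\<^esub>"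
    by (auto simp: Q_def)
  have "inj_on e (carrier Q)" using e by (rule inj_on_subset) auto
  then obtain V :: "'r std_module" where V: "mod_iso R Q V" using mod_iso_transport[OF Q] by metis
  obtain f g where fg: "left_module R V" "f \<in> mod_hom R Q V" "g \<in> mod_hom R V Q"
    "\<And>x. x \<in> carrier Q \<Longrightarrow> g (f x) = x" "\<And>y. y \<in> carrier V \<Longrightarrow> f (g y) = y"
    using mod_isoE[OF V] by metis
  have S: "left_module R (direct_sum X V)" by (rule left_module_direct_sum[OF X fg(1)])
  have g: "g \<in> mod_hom R V ?P" "\<And>v. v \<in> carrier V \<Longrightarrow> b (g v) = \<zero>\<^bsub>X\<^esub>"
    using fg(3) mod_hom_closed[OF fg(3)] by (auto intro!: mod_homI simp: mod_hom_simps Qs simp del: direct_power_simps)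
  have pr: "(\<lambda>w. w \<ominus>\<^bsub>?P\<^esub> a (b w)) \<in> mod_hom R ?P ?P"
    by (rule mod_hom_sub[OF mod_hom_id mod_hom_comp[OF ab(2,1)] P])
  have pr0: "b (w \<ominus>\<^bsub>?P\<^esub> a (b w)) = \<zero>\<^bsub>X\<^esub>" if "w \<in> carrier ?P" for w
    using that ab(3)[symmetric, OF mod_hom_closed[OF ab(2) that]]
    by (subst mod_hom_diff[OF P X ab(2)]) (auto simp: mod_hom_simps[OF ab(1)] mod_hom_simps[OF ab(2)] X.M.r_neg a_minus_def simp del: direct_power_simps)
  have prQ: "(\<lambda>w. w \<ominus>\<^bsub>?P\<^esub> a (b w)) \<in> mod_hom R ?P Q"
    unfolding Q_def by (rule mod_hom_corestrict[OF pr]) (use pr0 mod_hom_closed[OF pr] in auto)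
  have "mod_iso R (direct_sum X V) ?P"
  proof (rule mod_isoI[OF S P])
    show "(\<lambda>z. a (fst z) \<oplus>\<^bsub>?P\<^esub> g (snd z)) \<in> mod_hom R (direct_sum X V) ?P"
      using direct_sum_homs[OF X fg(1)] ab g by (intro mod_hom_plus[OF _ _ P] mod_hom_comp[OF _ ab(1)] mod_hom_comp[OF _ g(1)])
    show "(\<lambda>w. (b w, f (w \<ominus>\<^bsub>?P\<^esub> a (b w)))) \<in> mod_hom R ?P (direct_sum X V)"
      by (rule mod_hom_pair[OF ab(2) mod_hom_comp[OF prQ fg(2)]])
    show "a (fst (b w, f (w \<ominus>\<^bsub>?P\<^esub> a (b w)))) \<oplus>\<^bsub>?P\<^esub> g (snd (b w, f (w \<ominus>\<^bsub>?P\<^esub> a (b w)))) = w" if "w \<in> carrier ?P" for w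
      using fg(4)[OF mod_hom_closed[OF prQ that]] that mod_hom_closed[OF mod_hom_comp[OF ab(2,1)] that]
      by (simp add: a_minus_def P.M.add.m_lcomm P.M.r_neg del: direct_power_simps)
    show "(b (a (fst z) \<oplus>\<^bsub>?P\<^esub> g (snd z)), f ((a (fst z) \<oplus>\<^bsub>?P\<^esub> g (snd z)) \<ominus>\<^bsub>?P\<^esub> a (b (a (fst z) \<oplus>\<^bsub>?P\<^esub> g (snd z))))) = z"
      if zc: "z \<in> carrier (direct_sum X V)" for z
    proof -
      obtain x v where z: "z = (x, v)" "x \<in> carrier X" "v \<in> carrier V" using zc by (cases z) auto
      have c: "a x \<in> carrier ?P" "g v \<in> carrier ?P"
        using z mod_hom_closed[OF ab(1)] mod_hom_closed[OF g(1)] by auto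
      have 1: "b (a x \<oplus>\<^bsub>?P\<^esub> g v) = x" using z c ab(2) ab(3)[of x] g(2)[of v]
        by (simp add: mod_hom_simps del: direct_power_simps)
      have "(a x \<oplus>\<^bsub>?P\<^esub> g v) \<ominus>\<^bsub>?P\<^esub> a x = g v"
        using c by (simp add: a_minus_def P.M.add.m_comm[of "a x"] P.M.a_assoc P.M.r_neg del: direct_power_simps)
      then show ?thesis using 1 z fg(5)[of v] by (simp del: direct_power_simps)
    qed
  qed
  then show ?thesis using X fg(1) by (auto simp: in_add_def)
qed

text \<open>The injection for the case that U is itself a module of sequences: an element of a power
  of U is a sequence of sequences, flattened by the pairing function.\<close>

lemma inj_uncurry: "inj (\<lambda>w k. w (fst (prod_decode k)) (snd (prod_decode k)))"
proof (rule injI, rule ext, rule ext)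
  fix v w :: "nat \<Rightarrow> nat \<Rightarrow> 'a" and i j
  assume "(\<lambda>k. v (fst (prod_decode k)) (snd (prod_decode k))) = (\<lambda>k. w (fst (prod_decode k)) (snd (prod_decode k)))"
  from fun_cong[OF this, of "prod_encode (i, j)"] show "v i j = w i j" by simp
qed

lemma in_add_std_iff:
  fixes U :: "'r std_module"
  assumes "left_module R U"
  shows "in_add R U X \<longleftrightarrow> left_module R X \<and> fac R U X X (\<lambda>x. x)"
  using in_add_imp_fac[OF _ assms] fac_imp_in_add[OF _ assms _ inj_uncurry] by blast

lemma fg_projective_imp:
  assumes "fg_projective R P"
  shows "left_module R P" "dual_basis R P"
proof -
  have "left_module R P" using assms by (simp add: fg_projective_def in_add_def)
  then have "ring R" by (simp add: left_module_def)
  then show "left_module R P" "dual_basis R P"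
    using assms in_add_imp_fac[OF _ left_module_regular] unfolding fg_projective_def by blast+
qed

text \<open>Elements of a power of the regular module are already sequences over R, so the identity
  serves as the injection.\<close>

lemma fg_projectiveI: "left_module R P \<Longrightarrow> dual_basis R P \<Longrightarrow> fg_projective R P"
  unfolding fg_projective_def
  by (rule fac_imp_in_add[OF _ left_module_regular, where e = "\<lambda>w. w"]) (auto dest: left_module.axioms(1))

text \<open>From x = b (a x) it follows that a is injective; so X embeds into a power of U and,
  after flattening, into sequences over R.\<close>

lemma std_copy:
  fixes R :: "('r, 'x) ring_scheme" and U :: "'r std_module"
  assumes "left_module R X" "left_module R U" "fac R U X X (\<lambda>x. x)"
  obtains Y :: "'r std_module" where "mod_iso R X Y"
proof -
  let ?e = "\<lambda>w k. w (fst (prod_decode k)) (snd (prod_decode k)) :: 'r"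
  obtain n a b where ab: "a \<in> mod_hom R X (direct_power n U)"
    "\<And>x. x \<in> carrier X \<Longrightarrow> x = b (a x)" 
    by (rule fac_direct_power[OF assms(3,2,1,1)]) (rule that)
  have "inj_on (\<lambda>x. ?e (a x)) (carrier X)"
    using ab(2) by (intro inj_onI) (metis injD[OF inj_uncurry])
  then show ?thesis using mod_iso_transport[OF assms(1)] that by metis
qed

section \<open>Finitely generated modules\<close>

lemma fg_surjection:
  assumes "left_module R X" "finitely_generated R X"
  obtains n \<pi> where "\<pi> \<in> mod_hom R (direct_power n (regular_module R)) X"
    "\<pi> ` carrier (direct_power n (regular_module R)) = carrier X"
proof -
  interpret X: left_module R X by fact
  let ?F = "\<lambda>n. direct_power n (regular_module R)"
  have F: "left_module R (?F n)" for n
    by (intro left_module_direct_power left_module_regular X.ring_axioms)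
  obtain S where S: "finite S" "S \<subseteq> carrier X" "\<And>N. submodule N R X \<Longrightarrow> S \<subseteq> N \<Longrightarrow> N = carrier X"
    using assms(2) by (auto simp: finitely_generated_def)
  have "\<exists>n b. b \<in> mod_hom R (?F n) X \<and> S \<subseteq> b ` carrier (?F n)" using S(1,2)
  proof (induction S)
    case empty
    then show ?case using mod_hom_null[OF assms(1)] by blast
  next
    case (insert x S)
    then obtain n b where b: "b \<in> mod_hom R (?F n) X" "S \<subseteq> b ` carrier (?F n)" by auto
    let ?b = "\<lambda>w. w n \<odot>\<^bsub>X\<^esub> x \<oplus>\<^bsub>X\<^esub> b (restrict w {..<n})"
    have "?b \<in> mod_hom R (?F (Suc n)) X"
      using mod_hom_direct_power_Suc[OF b(1) mod_hom_regular left_module_regular] insert.prems X.ring_axioms assms(1)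
      by blast
    \<comment> \<open>The last coordinate carries the new generator: the unit vector at index n is
      sent to x, and the old preimages are extended by 0 there.\<close>
    moreover have "x \<in> ?b ` carrier (?F (Suc n))"
    proof (rule image_eqI)
      have z: "\<zero>\<^bsub>?F n\<^esub> \<in> carrier (?F n)" by (auto simp: X.R.zero_closed)
      from direct_power_upd[OF z] show "\<zero>\<^bsub>?F n\<^esub>(n := \<one>\<^bsub>R\<^esub>) \<in> carrier (?F (Suc n))" by simp
      show "x = ?b (\<zero>\<^bsub>?F n\<^esub>(n := \<one>\<^bsub>R\<^esub>))"
        using insert.prems mod_hom_zero[OF F assms(1) b(1)] restrict_upd_direct_power[OF z, of "\<one>\<^bsub>R\<^esub>"]
        by (simp add: X.smult_one del: direct_power_simps)
    qed
    moreover have "S \<subseteq> ?b ` carrier (?F (Suc n))"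
    proof
      fix s assume "s \<in> S"
      then obtain w where w: "w \<in> carrier (?F n)" "s = b w" using b(2) by blast
      have "s = ?b (w(n := \<zero>\<^bsub>R\<^esub>))"
        using w insert.prems restrict_upd_direct_power[OF w(1), of "\<zero>\<^bsub>R\<^esub>"] mod_hom_closed[OF b(1) w(1)]
        by (simp del: direct_power_simps)
      moreover have "w(n := \<zero>\<^bsub>R\<^esub>) \<in> carrier (?F (Suc n))"
        by (rule direct_power_upd[OF w(1)]) simp
      ultimately show "s \<in> ?b ` carrier (?F (Suc n))" by (rule image_eqI)
    qed
    ultimately show ?case by blast
  qed
  then obtain n b where b: "b \<in> mod_hom R (?F n) X" "S \<subseteq> b ` carrier (?F n)" by blast
  have "b ` carrier (?F n) = carrier X" using S(3)[OF image_submodule[OF F assms(1) b(1)] b(2)] .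
  with b(1) show ?thesis by (rule that)
qed

lemma vimage_submodule:
  assumes "left_module R X" "left_module R Y" "f \<in> mod_hom R X Y" "submodule Q R Y"
  shows "submodule {x \<in> carrier X. f x \<in> Q} R X"
proof -
  interpret X: left_module R X by fact
  interpret Y: left_module R Y by fact
  show ?thesis using assms Y.submoduleD[OF assms(4)]
    by (intro X.submoduleI) (auto simp: mod_hom_simps mod_hom_zero[OF assms(1-3)])
qed

lemma fg_image:
  assumes "left_module R X" "left_module R Y" "f \<in> mod_hom R X Y" "f ` carrier X = carrier Y"
    "finitely_generated R X"
  shows "finitely_generated R Y"
proof -
  interpret Y: left_module R Y by fact
  obtain S where S: "finite S" "S \<subseteq> carrier X" "\<And>N. submodule N R X \<Longrightarrow> S \<subseteq> N \<Longrightarrow> N = carrier X"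
    using assms(5) by (auto simp: finitely_generated_def)
  show ?thesis unfolding finitely_generated_def
  proof (intro exI[of _ "f ` S"] conjI allI impI)
    fix N assume N: "submodule N R Y \<and> f ` S \<subseteq> N"
    have "{x \<in> carrier X. f x \<in> N} = carrier X"
      using S(2) N vimage_submodule[OF assms(1-3)] by (intro S(3)) auto
    then have "carrier Y \<subseteq> N" unfolding assms(4)[symmetric] by blast
    then show "N = carrier Y" using N Y.submoduleD(1)[of N] by auto
  qed (use S assms(4) in auto)
qed

text \<open>The elements \<beta> 1 of the summands generate, since every x is the sum of the
  multiples of \<beta> 1 by \<alpha> x. For the induction the claim is made about the image of each
  partial sum h; it is then applied to the identity.\<close>

lemma fg_dual_basis:
  assumes "left_module R P" "dual_basis R P"
  shows "finitely_generated R P"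
proof -
  interpret P: left_module R P by fact
  have "\<exists>S. finite S \<and> S \<subseteq> carrier P \<and> (\<forall>N. submodule N R P \<and> S \<subseteq> N \<longrightarrow> h ` carrier P \<subseteq> N)"
    if "pfac R P P h" for h
    using that
  proof induction
    case (fac_null h)
    then show ?case using P.submoduleD(2) by (intro exI[of _ "{}"]) auto
  next
    case (fac_step \<alpha> \<beta> h1 h)
    from fac_step(5) obtain S where S: "finite S" "S \<subseteq> carrier P"
      "\<And>N. submodule N R P \<Longrightarrow> S \<subseteq> N \<Longrightarrow> h1 ` carrier P \<subseteq> N"
      by auto
    have \<beta>: "\<beta> \<one>\<^bsub>R\<^esub> \<in> carrier P" by (rule mod_hom_closed[OF fac_step(2)]) simp
    show ?case
    proof (intro exI[of _ "insert (\<beta> \<one>\<^bsub>R\<^esub>) S"] conjI allI impI)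
      fix N assume N: "submodule N R P \<and> insert (\<beta> \<one>\<^bsub>R\<^esub>) S \<subseteq> N"
      show "h ` carrier P \<subseteq> N"
      proof
        fix y assume "y \<in> h ` carrier P"
        then obtain x where x: "x \<in> carrier P" "y = h x" by blast
        have \<alpha>: "\<alpha> x \<in> carrier R" using mod_hom_closed[OF fac_step(1) x(1)] by simp
        have "\<alpha> x \<odot>\<^bsub>P\<^esub> \<beta> \<one>\<^bsub>R\<^esub> \<in> N" "h1 x \<in> N"
          using N \<alpha> P.submoduleD(4)[of N] S(3)[of N] x(1) by auto
        then show "y \<in> N"
          using fac_step(4)[OF x(1)] mod_hom_regular_eq[OF P.ring_axioms fac_step(2) \<alpha>] x(2) N P.submoduleD(3)[of N]
          by auto
      qed
    qed (use S \<beta> in auto)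
  qed
  from this[OF assms(2)] have "\<exists>S. finite S \<and> S \<subseteq> carrier P \<and> (\<forall>N. submodule N R P \<and> S \<subseteq> N \<longrightarrow> carrier P \<subseteq> N)"
    unfolding image_ident .
  then show ?thesis unfolding finitely_generated_def
    by (elim ex_forward) (use P.submoduleD(1) in blast)
qed

text \<open>A choice of preimages under a surjection from a free module embeds the carrier into
  sequences over R; the structure is then transported along this set-theoretic section.\<close>

lemma std_copy_fg:
  fixes R :: "('r, 'x) ring_scheme"
  assumes "left_module R X" "finitely_generated R X"
  obtains Y :: "'r std_module" where "mod_iso R X Y"
proof -
  let ?F = "\<lambda>n. direct_power n (regular_module R)"
  obtain n \<pi> where p: "\<pi> ` carrier (?F n) = carrier X"
    by (rule fg_surjection[OF assms]) (rule that)
  have "inj_on (inv_into (carrier (?F n)) \<pi>) (carrier X)" using p by (metis inj_on_inv_into subset_refl)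
  then show ?thesis using mod_iso_transport[OF assms(1)] that by metis
qed

lemma fg_iso: "mod_iso R X Y \<Longrightarrow> finitely_generated R X \<Longrightarrow> finitely_generated R Y"
  by (auto simp: mod_iso_def bij_betw_def intro: fg_image)

lemma fg_direct_sum:
  assumes "left_module R X" "left_module R Y" "finitely_generated R X" "finitely_generated R Y"
  shows "finitely_generated R (direct_sum X Y)"
proof -
  note h = direct_sum_homs[OF assms(1,2)] and S = left_module_direct_sum[OF assms(1,2)]
  interpret S: left_module R "direct_sum X Y" by fact
  interpret X: left_module R X by fact
  interpret Y: left_module R Y by fact
  obtain A where A: "finite A" "A \<subseteq> carrier X" "\<And>N. submodule N R X \<Longrightarrow> A \<subseteq> N \<Longrightarrow> N = carrier X"
    using assms(3) by (auto simp: finitely_generated_def)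
  obtain B where B: "finite B" "B \<subseteq> carrier Y" "\<And>N. submodule N R Y \<Longrightarrow> B \<subseteq> N \<Longrightarrow> N = carrier Y"
    using assms(4) by (auto simp: finitely_generated_def)
  show ?thesis unfolding finitely_generated_def
  proof (intro exI[of _ "(\<lambda>x. (x, \<zero>\<^bsub>Y\<^esub>)) ` A \<union> (\<lambda>y. (\<zero>\<^bsub>X\<^esub>, y)) ` B"] conjI allI impI)
    fix N assume N: "submodule N R (direct_sum X Y) \<and> (\<lambda>x. (x, \<zero>\<^bsub>Y\<^esub>)) ` A \<union> (\<lambda>y. (\<zero>\<^bsub>X\<^esub>, y)) ` B \<subseteq> N"
    have x: "{x \<in> carrier X. (x, \<zero>\<^bsub>Y\<^esub>) \<in> N} = carrier X"
      using A(2) N vimage_submodule[OF assms(1) S h(3)] by (intro A(3)) auto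
    have y: "{y \<in> carrier Y. (\<zero>\<^bsub>X\<^esub>, y) \<in> N} = carrier Y"
      using B(2) N vimage_submodule[OF assms(2) S h(4)] by (intro B(3)) auto
    have "(x, y) \<in> N" if "x \<in> carrier X" "y \<in> carrier Y" for x y
      using S.submoduleD(3)[of N "(x, \<zero>\<^bsub>Y\<^esub>)" "(\<zero>\<^bsub>X\<^esub>, y)"] N x y that by auto
    then show "N = carrier (direct_sum X Y)" using S.submoduleD(1)[of N] N by auto
  qed (use A B in auto)
qed

section \<open>Stable equivalence of modules\<close>

text \<open>Mutually inverse morphisms of the stable category, with the defects named: this form avoids
  differences and is composed by substitution.\<close>

definition stab ::
  "('r, 'x) ring_scheme \<Rightarrow> ('r, 'm, 'y) module_scheme \<Rightarrow> ('r, 'n, 'z) module_scheme \<Rightarrow> bool" where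
  "stab R X Y \<longleftrightarrow> left_module R X \<and> left_module R Y \<and>
     (\<exists>f g h k. f \<in> mod_hom R X Y \<and> g \<in> mod_hom R Y X \<and> pfac R X X h \<and> pfac R Y Y k \<and>
       (\<forall>x\<in>carrier X. g (f x) \<oplus>\<^bsub>X\<^esub> h x = x) \<and> (\<forall>y\<in>carrier Y. f (g y) \<oplus>\<^bsub>Y\<^esub> k y = y))"

lemma stabE:
  assumes "stab R X Y"
  obtains f g h k where "left_module R X" "left_module R Y" "f \<in> mod_hom R X Y" "g \<in> mod_hom R Y X"
    "pfac R X X h" "pfac R Y Y k"
    "\<And>x. x \<in> carrier X \<Longrightarrow> g (f x) \<oplus>\<^bsub>X\<^esub> h x = x" "\<And>y. y \<in> carrier Y \<Longrightarrow> f (g y) \<oplus>\<^bsub>Y\<^esub> k y = y"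
  using assms unfolding stab_def by blast

lemma stabI:
  assumes "left_module R X" "left_module R Y" "f \<in> mod_hom R X Y" "g \<in> mod_hom R Y X"
    "pfac R X X h" "pfac R Y Y k"
    "\<And>x. x \<in> carrier X \<Longrightarrow> g (f x) \<oplus>\<^bsub>X\<^esub> h x = x" "\<And>y. y \<in> carrier Y \<Longrightarrow> f (g y) \<oplus>\<^bsub>Y\<^esub> k y = y"
  shows "stab R X Y"
  unfolding stab_def using assms by blast

lemma stab_iso:
  assumes "mod_iso R X Y"
  shows "stab R X Y"
proof -
  obtain f g where fg: "left_module R X" "left_module R Y" "f \<in> mod_hom R X Y" "g \<in> mod_hom R Y X"
    "\<And>x. x \<in> carrier X \<Longrightarrow> g (f x) = x" "\<And>y. y \<in> carrier Y \<Longrightarrow> f (g y) = y"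
    by (rule mod_isoE[OF assms]) (rule that)
  interpret X: left_module R X by fact
  interpret Y: left_module R Y by fact
  have "pfac R X X (\<lambda>x. \<zero>\<^bsub>X\<^esub>)" "pfac R Y Y (\<lambda>y. \<zero>\<^bsub>Y\<^esub>)" by (rule fac_null; simp)+
  from stabI[OF fg(1-4) this] show ?thesis using fg(5,6) by simp
qed

lemma stab_sym: "stab R X Y \<Longrightarrow> stab R Y X"
  by (elim stabE) (rule stabI)

lemma stab_trans:
  assumes "stab R X Y" "stab R Y Z"
  shows "stab R X Z"
proof -
  obtain f g h k where 1: "left_module R X" "left_module R Y" "f \<in> mod_hom R X Y" "g \<in> mod_hom R Y X"
    "pfac R X X h" "pfac R Y Y k"
    "\<And>x. x \<in> carrier X \<Longrightarrow> g (f x) \<oplus>\<^bsub>X\<^esub> h x = x" "\<And>y. y \<in> carrier Y \<Longrightarrow> f (g y) \<oplus>\<^bsub>Y\<^esub> k y = y"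
    by (rule stabE[OF assms(1)]) (rule that)
  obtain f' g' h' k' where 2: "left_module R Y" "left_module R Z" "f' \<in> mod_hom R Y Z" "g' \<in> mod_hom R Z Y"
    "pfac R Y Y h'" "pfac R Z Z k'"
    "\<And>x. x \<in> carrier Y \<Longrightarrow> g' (f' x) \<oplus>\<^bsub>Y\<^esub> h' x = x" "\<And>y. y \<in> carrier Z \<Longrightarrow> f' (g' y) \<oplus>\<^bsub>Z\<^esub> k' y = y"
    by (rule stabE[OF assms(2)]) (rule that)
  interpret X: left_module R X by fact
  interpret Y: left_module R Y by fact
  interpret Z: left_module R Z by fact
  have reg: "left_module R (regular_module R)" by (rule left_module_regular[OF X.ring_axioms])
  have homs: "h \<in> mod_hom R X X" "k \<in> mod_hom R Y Y" "h' \<in> mod_hom R Y Y" "k' \<in> mod_hom R Z Z"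
    by (intro fac_mod_hom[OF 1(5)] fac_mod_hom[OF 1(6)] fac_mod_hom[OF 2(5)] fac_mod_hom[OF 2(6)] 1 2)+
  note s = mod_hom_simps(1,2)[OF 1(3)] mod_hom_simps(1,2)[OF 1(4)] mod_hom_simps(1,2)[OF 2(3)]
    mod_hom_simps(1,2)[OF 2(4)] mod_hom_closed[OF homs(1)] mod_hom_closed[OF homs(2)]
    mod_hom_closed[OF homs(3)] mod_hom_closed[OF homs(4)]
  show ?thesis
  proof (rule stabI[OF 1(1) 2(2) mod_hom_comp[OF 1(3) 2(3)] mod_hom_comp[OF 2(4) 1(4)]])
    \<comment> \<open>Putting id = g' f' + h' on Y between f and g turns id = g f + h into id = g g'
      f' f + (g h' f + h). The bracket is the defect of the composite; the other side is
      symmetric.\<close>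
    show "pfac R X X (\<lambda>x. g (h' (f x)) \<oplus>\<^bsub>X\<^esub> h x)"
      by (rule fac_add[OF fac_comp_left[OF fac_comp_right[OF 2(5) 1(3)] 1(4,1,2,1)] 1(5) 1(1) reg 1(1)])
    show "pfac R Z Z (\<lambda>x. f' (k (g' x)) \<oplus>\<^bsub>Z\<^esub> k' x)"
      by (rule fac_add[OF fac_comp_left[OF fac_comp_right[OF 1(6) 2(4)] 2(3) 2(2) 2(1) 2(2)] 2(6) 2(2) reg 2(2)])
    show "g (g' (f' (f x))) \<oplus>\<^bsub>X\<^esub> (g (h' (f x)) \<oplus>\<^bsub>X\<^esub> h x) = x" if "x \<in> carrier X" for x
    proof -
      have "g (g' (f' (f x)) \<oplus>\<^bsub>Y\<^esub> h' (f x)) = g (f x)" using 2(7)[of "f x"] that s by simp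
      then have "g (g' (f' (f x))) \<oplus>\<^bsub>X\<^esub> g (h' (f x)) = g (f x)" using that by (simp add: s)
      then have "(g (g' (f' (f x))) \<oplus>\<^bsub>X\<^esub> g (h' (f x))) \<oplus>\<^bsub>X\<^esub> h x = x" using 1(7) that by simp
      then show ?thesis using that by (simp add: s X.M.a_assoc)
    qed
    show "f' (f (g (g' y))) \<oplus>\<^bsub>Z\<^esub> (f' (k (g' y)) \<oplus>\<^bsub>Z\<^esub> k' y) = y" if "y \<in> carrier Z" for y
    proof -
      have "f' (f (g (g' y)) \<oplus>\<^bsub>Y\<^esub> k (g' y)) = f' (g' y)" using 1(8)[of "g' y"] that s by simp
      then have "f' (f (g (g' y))) \<oplus>\<^bsub>Z\<^esub> f' (k (g' y)) = f' (g' y)" using that by (simp add: s)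
      then have "(f' (f (g (g' y))) \<oplus>\<^bsub>Z\<^esub> f' (k (g' y))) \<oplus>\<^bsub>Z\<^esub> k' y = y" using 2(8) that by simp
      then show ?thesis using that by (simp add: s Z.M.a_assoc)
    qed
  qed
qed

section \<open>Short exact sequences and the syzygies of stably equivalent modules\<close>

definition short_exact ::
  "('r, 'x) ring_scheme \<Rightarrow> ('r, 'k, 'u) module_scheme \<Rightarrow> ('k \<Rightarrow> 'm) \<Rightarrow> ('r, 'm, 'y) module_scheme
    \<Rightarrow> ('m \<Rightarrow> 'n) \<Rightarrow> ('r, 'n, 'z) module_scheme \<Rightarrow> bool" where
  "short_exact R L i P \<pi> X \<longleftrightarrow> left_module R L \<and> left_module R P \<and> left_module R X \<and>
     i \<in> mod_hom R L P \<and> \<pi> \<in> mod_hom R P X \<and> inj_on i (carrier L) \<and> \<pi> ` carrier P = carrier X \<and>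
     i ` carrier L = {p \<in> carrier P. \<pi> p = \<zero>\<^bsub>X\<^esub>}"

lemma abelian_group_add_cancel:
  assumes "abelian_group G" "x \<in> carrier G" "y \<in> carrier G"
  shows "x \<oplus>\<^bsub>G\<^esub> (y \<oplus>\<^bsub>G\<^esub> \<ominus>\<^bsub>G\<^esub> x) = y"
proof -
  interpret abelian_group G by fact
  show ?thesis using assms(2,3) by (simp add: a_lcomm[of x] r_neg)
qed

lemma short_exactD:
  assumes "short_exact R L i P \<pi> X"
  shows "left_module R L" "left_module R P" "left_module R X" "i \<in> mod_hom R L P" "\<pi> \<in> mod_hom R P X"
    "inj_on i (carrier L)" "\<pi> ` carrier P = carrier X" "i ` carrier L = {p \<in> carrier P. \<pi> p = \<zero>\<^bsub>X\<^esub>}"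
    "\<And>z. z \<in> carrier L \<Longrightarrow> \<pi> (i z) = \<zero>\<^bsub>X\<^esub>"
  using assms unfolding short_exact_def by blast+

text \<open>The universal property of the kernel, when i is the first map of a short exact sequence.
  It is stated for an abstract injection because syzygies are given only up to isomorphism.\<close>

lemma mod_hom_lift_inj:
  assumes "i \<in> mod_hom R L P" "inj_on i (carrier L)" "\<psi> \<in> mod_hom R Q P"
    "\<And>q. q \<in> carrier Q \<Longrightarrow> \<psi> q \<in> i ` carrier L" "left_module R L"
  obtains \<psi>' where "\<psi>' \<in> mod_hom R Q L" "\<And>q. q \<in> carrier Q \<Longrightarrow> i (\<psi>' q) = \<psi> q"
proof -
  interpret L: left_module R L by fact
  let ?t = "\<lambda>q. the_inv_into (carrier L) i (\<psi> q)"
  have t: "?t q \<in> carrier L" "i (?t q) = \<psi> q" if "q \<in> carrier Q" for q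
    using assms(4)[OF that] the_inv_into_into[OF assms(2) _ subset_refl] f_the_inv_into_f[OF assms(2)] by blast+
  have eq: "?t q = x" if "x \<in> carrier L" "\<psi> q = i x" for q x
    using that the_inv_into_f_f[OF assms(2)] by simp
  have "?t \<in> mod_hom R Q L"
  proof (rule mod_homI)
    show "?t (x \<oplus>\<^bsub>Q\<^esub> y) = ?t x \<oplus>\<^bsub>L\<^esub> ?t y" if "x \<in> carrier Q" "y \<in> carrier Q" for x y
      by (rule eq) (use that in \<open>simp_all add: t mod_hom_simps(2)[OF assms(3)] mod_hom_simps(2)[OF assms(1)]\<close>)
    show "?t (a \<odot>\<^bsub>Q\<^esub> x) = a \<odot>\<^bsub>L\<^esub> ?t x" if "a \<in> carrier R" "x \<in> carrier Q" for a x
      by (rule eq) (use that in \<open>simp_all add: t mod_hom_simps(3)[OF assms(3)] mod_hom_simps(3)[OF assms(1)]\<close>)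
  qed (rule t)
  then show ?thesis using t(2) by (rule that)
qed

text \<open>F and G lift f and g to the projectives. With \<eta> lifting h, the map p - (G F p +
  \<eta> (\<pi> p)) of P has its image in the kernel of \<pi>, hence comes from some \<psi> into L.
  On L the term with \<eta> vanishes, so \<psi> i is the defect of G' F'; it passes through P and
  thus through the regular module. The opposite composite is the same statement with the two
  sequences exchanged.\<close>

lemma stab_syzygy_defect:
  assumes E: "short_exact R L i P \<pi> X" and E': "short_exact R L' i' P' \<pi>' X'"
    and P: "dual_basis R P"
    and f: "f \<in> mod_hom R X X'" and g: "g \<in> mod_hom R X' X" and h: "pfac R X X h"
    and gf: "\<And>x. x \<in> carrier X \<Longrightarrow> g (f x) \<oplus>\<^bsub>X\<^esub> h x = x"
    and F: "F \<in> mod_hom R P P'" "\<And>p. p \<in> carrier P \<Longrightarrow> \<pi>' (F p) = f (\<pi> p)"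
    and G: "G \<in> mod_hom R P' P" "\<And>p. p \<in> carrier P' \<Longrightarrow> \<pi> (G p) = g (\<pi>' p)"
    and F': "F' \<in> mod_hom R L L'" "\<And>z. z \<in> carrier L \<Longrightarrow> i' (F' z) = F (i z)"
    and G': "G' \<in> mod_hom R L' L" "\<And>z. z \<in> carrier L' \<Longrightarrow> i (G' z) = G (i' z)"
  obtains h' where "pfac R L L h'" "\<And>z. z \<in> carrier L \<Longrightarrow> G' (F' z) \<oplus>\<^bsub>L\<^esub> h' z = z"
proof -
  note D = short_exactD[OF E] and D' = short_exactD[OF E']
  interpret L: left_module R L by fact
  interpret P: left_module R P by (rule D)
  interpret X: left_module R X by (rule D)
  obtain \<eta> where \<eta>: "pfac R X P \<eta>" "\<And>x. x \<in> carrier X \<Longrightarrow> \<pi> (\<eta> x) = h x"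
    by (rule pfac_lift[OF h D(5,7,3,3,2)]) (rule that)
  have \<eta>h: "\<eta> \<in> mod_hom R X P" by (rule fac_mod_hom[OF \<eta>(1) D(3,2)])
  note s = mod_hom_simps(1,2)[OF D(4)] mod_hom_simps(1,2)[OF D(5)] mod_hom_simps(1,2)[OF F(1)]
    mod_hom_simps(1,2)[OF G(1)] mod_hom_simps(1,2)[OF F'(1)] mod_hom_simps(1,2)[OF G'(1)]
    mod_hom_simps(1,2)[OF \<eta>h] mod_hom_closed[OF D'(4)] mod_hom_closed[OF D'(5)]
  let ?\<psi> = "\<lambda>p. p \<ominus>\<^bsub>P\<^esub> (G (F p) \<oplus>\<^bsub>P\<^esub> \<eta> (\<pi> p))"
  have hom: "?\<psi> \<in> mod_hom R P P"
    by (rule mod_hom_sub[OF mod_hom_id mod_hom_plus[OF mod_hom_comp[OF F(1) G(1)] mod_hom_comp[OF D(5) \<eta>h] D(2)] D(2)])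
  have "?\<psi> p \<in> i ` carrier L" if p: "p \<in> carrier P" for p
  proof -
    have "\<pi> (G (F p) \<oplus>\<^bsub>P\<^esub> \<eta> (\<pi> p)) = \<pi> p" using p gf[of "\<pi> p"] by (simp add: s F(2) G(2) \<eta>(2))
    then have "\<pi> (?\<psi> p) = \<zero>\<^bsub>X\<^esub>"
      using p by (subst mod_hom_diff[OF D(2,3,5)]) (simp_all add: s a_minus_def X.M.r_neg)
    then show ?thesis using mod_hom_closed[OF hom p] by (simp add: D(8))
  qed
  then obtain \<psi> where \<psi>: "\<psi> \<in> mod_hom R P L" "\<And>p. p \<in> carrier P \<Longrightarrow> i (\<psi> p) = ?\<psi> p"
    using mod_hom_lift_inj[OF D(4,6) hom _ D(1)] by metis
  have "pfac R L L (\<lambda>z. \<psi> (i z))"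
    by (rule fac_comp_right[OF fac_comp_left[OF P \<psi>(1) D(2,2,1)] D(4)])
  moreover have "G' (F' z) \<oplus>\<^bsub>L\<^esub> \<psi> (i z) = z" if z: "z \<in> carrier L" for z
  proof (rule inj_onD[OF D(6)])
    have "\<eta> \<zero>\<^bsub>X\<^esub> = \<zero>\<^bsub>P\<^esub>" by (rule mod_hom_zero[OF D(3,2) \<eta>h])
    then have "i (\<psi> (i z)) = i z \<ominus>\<^bsub>P\<^esub> G (F (i z))" using z by (simp add: s \<psi>(2) D(9))
    then show "i (G' (F' z) \<oplus>\<^bsub>L\<^esub> \<psi> (i z)) = i z"
      using z mod_hom_closed[OF \<psi>(1)]
      by (simp add: s F'(2) G'(2) a_minus_def P.M.a_lcomm[of "G (F (i z))"] P.M.r_neg)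
  qed (use z mod_hom_closed[OF \<psi>(1)] s in auto)
  ultimately show ?thesis by (rule that)
qed

text \<open>The comparison theorem for arbitrary projective presentations. This generality is what
  lets tensored sequences, whose middle term is projective but need not be a projective cover, be
  compared with syzygy sequences.\<close>

lemma stab_syzygy:
  assumes E: "short_exact R L i P \<pi> X" and E': "short_exact R L' i' P' \<pi>' X'"
    and P: "dual_basis R P" and P': "dual_basis R P'" and "stab R X X'"
  shows "stab R L L'"
proof -
  note D = short_exactD[OF E] and D' = short_exactD[OF E']
  obtain f g h k where fg: "left_module R X" "left_module R X'" "f \<in> mod_hom R X X'" "g \<in> mod_hom R X' X"
    "pfac R X X h" "pfac R X' X' k"
    "\<And>x. x \<in> carrier X \<Longrightarrow> g (f x) \<oplus>\<^bsub>X\<^esub> h x = x" "\<And>y. y \<in> carrier X' \<Longrightarrow> f (g y) \<oplus>\<^bsub>X'\<^esub> k y = y"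
    by (rule stabE[OF assms(5)]) (rule that)
  obtain F where F: "F \<in> mod_hom R P P'" "\<And>p. p \<in> carrier P \<Longrightarrow> \<pi>' (F p) = f (\<pi> p)"
    by (rule dual_basis_lift[OF P mod_hom_comp[OF D(5) fg(3)] D'(5,7) D(2) D'(3,2)]) (rule that)
  obtain G where G: "G \<in> mod_hom R P' P" "\<And>p. p \<in> carrier P' \<Longrightarrow> \<pi> (G p) = g (\<pi>' p)"
    by (rule dual_basis_lift[OF P' mod_hom_comp[OF D'(5) fg(4)] D(5,7) D'(2) D(3,2)]) (rule that)
  have "F (i z) \<in> i' ` carrier L'" if "z \<in> carrier L" for z
    using that F(2)[of "i z"] mod_hom_zero[OF fg(1-3)] mod_hom_closed[OF D(4) that] mod_hom_closed[OF F(1)]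
    by (simp add: D' D(9))
  then obtain F' where F': "F' \<in> mod_hom R L L'" "\<And>z. z \<in> carrier L \<Longrightarrow> i' (F' z) = F (i z)"
    using mod_hom_lift_inj[OF D'(4,6) mod_hom_comp[OF D(4) F(1)] _ D'(1)] by metis
  have "G (i' z) \<in> i ` carrier L" if "z \<in> carrier L'" for z
    using that G(2)[of "i' z"] mod_hom_zero[OF fg(2,1,4)] mod_hom_closed[OF D'(4) that] mod_hom_closed[OF G(1)]
    by (simp add: D D'(9))
  then obtain G' where G': "G' \<in> mod_hom R L' L" "\<And>z. z \<in> carrier L' \<Longrightarrow> i (G' z) = G (i' z)"
    using mod_hom_lift_inj[OF D(4,6) mod_hom_comp[OF D'(4) G(1)] _ D(1)] by metis
  obtain h' where h': "pfac R L L h'" "\<And>z. z \<in> carrier L \<Longrightarrow> G' (F' z) \<oplus>\<^bsub>L\<^esub> h' z = z"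
    by (rule stab_syzygy_defect[OF E E' P fg(3,4,5,7) F G F' G']) (assumption+, rule that)
  obtain k' where k': "pfac R L' L' k'" "\<And>z. z \<in> carrier L' \<Longrightarrow> F' (G' z) \<oplus>\<^bsub>L'\<^esub> k' z = z"
    by (rule stab_syzygy_defect[OF E' E P' fg(4,3,6,8) G F G' F']) (assumption+, rule that)
  show ?thesis by (rule stabI[OF D(1) D'(1) F'(1) G'(1) h'(1) k'(1) h'(2) k'(2)])
qed

section \<open>Resolutions and stable equivalence\<close>

lemma fac_direct_sum_id:
  assumes "fac R U X X (\<lambda>x. x)" "fac R U Y Y (\<lambda>x. x)" "left_module R X" "left_module R Y" "left_module R U"
  shows "fac R U (direct_sum X Y) (direct_sum X Y) (\<lambda>x. x)"
proof -
  interpret X: left_module R X by fact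
  interpret Y: left_module R Y by fact
  note h = direct_sum_homs[OF assms(3,4)] and S = left_module_direct_sum[OF assms(3,4)]
  show ?thesis
    by (rule fac_cong[OF fac_add[OF fac_comp_left[OF fac_comp_right[OF assms(1) h(1)] h(3) S assms(3) S]
          fac_comp_left[OF fac_comp_right[OF assms(2) h(2)] h(4) S assms(4) S] S assms(5) S]]) auto
qed

text \<open>If \<open>Z\<close> is stably equivalent to \<open>W\<close>, then the first term of a resolution of \<open>W\<close> is replaced
  by its pullback along \<open>f : Z \<rightarrow> W\<close>, which has the same kernel over \<open>Z\<close>. It remains a summand of a
  direct power of \<open>V\<close>: with \<open>h = v \<circ> u\<close> for \<open>u : Z \<rightarrow> R\<^sup>n\<close>, the map \<open>(c, z) \<mapsto> (c, u z)\<close>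
  into \<open>V\<^sub>0 \<oplus> R\<^sup>n\<close> has the left inverse \<open>(c, r) \<mapsto> (c - k' (d c - f q) + m' (r - u q), q)\<close> with
  \<open>q = g (d c) + v r\<close>, where \<open>k'\<close> and \<open>m'\<close> lift \<open>k\<close> and \<open>f \<circ> v\<close> along \<open>d\<close>.\<close>

lemma stab_pullback:
  fixes Z :: "('r, 'z, 'w1) module_scheme" and V0 :: "('r, 'v, 'w2) module_scheme"
  assumes "stab R Z W" and d: "d \<in> mod_hom R V0 W" "d ` carrier V0 = carrier W"
    and V0: "left_module R V0" and V: "left_module R V"
    and fV0: "fac R V V0 V0 (\<lambda>x. x)" and fR: "fac R V (regular_module R) (regular_module R) (\<lambda>x. x)"
  obtains E :: "('r, 'v \<times> 'z) module" where "left_module R E" "fac R V E E (\<lambda>x. x)"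
    "snd \<in> mod_hom R E Z" "snd ` carrier E = carrier Z"
    "{e \<in> carrier E. snd e = \<zero>\<^bsub>Z\<^esub>} = (\<lambda>c. (c, \<zero>\<^bsub>Z\<^esub>)) ` {c \<in> carrier V0. d c = \<zero>\<^bsub>W\<^esub>}"
    "(\<lambda>c. (c, \<zero>\<^bsub>Z\<^esub>)) \<in> mod_hom R (V0\<lparr>carrier := {c \<in> carrier V0. d c = \<zero>\<^bsub>W\<^esub>}\<rparr>) E"
    "\<zero>\<^bsub>E\<^esub> = (\<zero>\<^bsub>V0\<^esub>, \<zero>\<^bsub>Z\<^esub>)"
proof -
  obtain f g h k where fg: "left_module R Z" "left_module R W" "f \<in> mod_hom R Z W" "g \<in> mod_hom R W Z"
    "pfac R Z Z h" "pfac R W W k"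
    "\<And>x. x \<in> carrier Z \<Longrightarrow> g (f x) \<oplus>\<^bsub>Z\<^esub> h x = x" "\<And>y. y \<in> carrier W \<Longrightarrow> f (g y) \<oplus>\<^bsub>W\<^esub> k y = y"
    by (rule stabE[OF assms(1)]) (rule that)
  interpret Z: left_module R Z by fact
  interpret W: left_module R W by fact
  interpret V0: left_module R V0 by fact
  have reg: "left_module R (regular_module R)" by (rule left_module_regular[OF Z.ring_axioms])
  obtain n u v where uv: "u \<in> mod_hom R Z (direct_power n (regular_module R))"
    "v \<in> mod_hom R (direct_power n (regular_module R)) Z" "\<And>z. z \<in> carrier Z \<Longrightarrow> h z = v (u z)"
    by (rule fac_direct_power[OF fg(5) reg fg(1,1)]) (rule that)
  define F where "F = direct_power n (regular_module R)"
  have F: "left_module R F" "dual_basis R F" unfolding F_def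
    by (rule left_module_direct_power[OF reg], rule fac_direct_power_id[OF reg])
  have FV: "fac R V F F (\<lambda>x. x)" by (rule fac_trans[OF F(2) fR F(1,1) reg V])
  have u: "u \<in> mod_hom R Z F" and v: "v \<in> mod_hom R F Z" using uv by (simp_all add: F_def)
  interpret F: left_module R F by fact
  obtain k' where k': "pfac R W V0 k'" "\<And>w. w \<in> carrier W \<Longrightarrow> d (k' w) = k w"
    by (rule pfac_lift[OF fg(6) d fg(2,2) V0]) (rule that)
  have k'h: "k' \<in> mod_hom R W V0" by (rule fac_mod_hom[OF k'(1) fg(2) V0])
  have kh: "k \<in> mod_hom R W W" by (rule fac_mod_hom[OF fg(6,2,2)])
  have hh: "h \<in> mod_hom R Z Z" by (rule fac_mod_hom[OF fg(5,1,1)])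
  obtain m' where m': "m' \<in> mod_hom R F V0" "\<And>r. r \<in> carrier F \<Longrightarrow> d (m' r) = f (v r)"
    by (rule dual_basis_lift[OF F(2) mod_hom_comp[OF v fg(3)] d F(1) fg(2) V0]) (rule that)
  note s = mod_hom_simps(1,2)[OF fg(3)] mod_hom_simps(1,2)[OF fg(4)] mod_hom_simps(1,2)[OF u]
    mod_hom_simps(1,2)[OF v] mod_hom_simps(1,2)[OF k'h] mod_hom_simps(1,2)[OF m'(1)] mod_hom_simps(1,2)[OF d(1)]
    mod_hom_simps(1,2)[OF kh] mod_hom_simps(1,2)[OF hh]
  let ?c = "{e. fst e \<in> carrier V0 \<and> snd e \<in> carrier Z \<and> d (fst e) = f (snd e)}"
  note S = left_module_direct_sum[OF V0 fg(1)] and Sh = direct_sum_homs[OF V0 fg(1)]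
  interpret S: left_module R "direct_sum V0 Z" by (rule S)
  define E where "E = (direct_sum V0 Z)\<lparr>carrier := ?c\<rparr>"
  have sub: "submodule ?c R (direct_sum V0 Z)"
    by (rule S.submoduleI)
       (auto simp: s mod_hom_simps(3)[OF fg(3)] mod_hom_simps(3)[OF d(1)] mod_hom_zero[OF V0 fg(2) d(1)] mod_hom_zero[OF fg(1-3)])
  have E: "left_module R E" unfolding E_def by (rule left_module_restrict[OF S sub])
  have cE: "carrier E = ?c" by (simp add: E_def)
  let ?D = "direct_sum V0 F"
  note D = left_module_direct_sum[OF V0 F(1)] and Dh = direct_sum_homs[OF V0 F(1)]
  define q where "q = (\<lambda>x. g (d (fst x)) \<oplus>\<^bsub>Z\<^esub> v (snd x))"
  have q: "q \<in> mod_hom R ?D Z" unfolding q_def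
    by (rule mod_hom_plus[OF mod_hom_comp[OF mod_hom_comp[OF Dh(1) d(1)] fg(4)] mod_hom_comp[OF Dh(2) v] fg(1)])
  define b where "b = (\<lambda>x. (fst x \<ominus>\<^bsub>V0\<^esub> k' (d (fst x) \<ominus>\<^bsub>W\<^esub> f (q x))) \<oplus>\<^bsub>V0\<^esub> m' (snd x \<ominus>\<^bsub>F\<^esub> u (q x)))"
  have b: "b \<in> mod_hom R ?D V0" unfolding b_def
    by (rule mod_hom_plus[OF mod_hom_sub[OF Dh(1) mod_hom_comp[OF mod_hom_sub[OF mod_hom_comp[OF Dh(1) d(1)]
          mod_hom_comp[OF q fg(3)] fg(2)] k'h] V0] mod_hom_comp[OF mod_hom_sub[OF Dh(2) mod_hom_comp[OF q u] F(1)] m'(1)] V0])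
  \<comment> \<open>This equation says that (b, q) takes its values in the pullback.\<close>
  have db: "d (b x) = f (q x)" if x: "x \<in> carrier ?D" for x
  proof -
    define c r where "c = fst x" and "r = snd x"
    have [simp]: "c \<in> carrier V0" "r \<in> carrier F" "q x \<in> carrier Z" using x mod_hom_closed[OF q x] by (auto simp: c_def r_def)
    \<comment> \<open>Both f g f + f h and f g f + k f equal f, so f intertwines the two defects;
      this cancels the two correction terms in b against each other.\<close>
    have kf: "k (f (q x)) = f (h (q x))"
    proof -
      have "f (g (f (q x)) \<oplus>\<^bsub>Z\<^esub> h (q x)) = f (q x)" using fg(7)[of "q x"] by simp
      then have "f (g (f (q x))) \<oplus>\<^bsub>W\<^esub> f (h (q x)) = f (g (f (q x))) \<oplus>\<^bsub>W\<^esub> k (f (q x))"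
        using fg(8)[of "f (q x)"] by (simp add: s)
      then show ?thesis by (simp add: s)
    qed
    have "d (b x) = (d c \<ominus>\<^bsub>W\<^esub> (k (d c) \<ominus>\<^bsub>W\<^esub> k (f (q x)))) \<oplus>\<^bsub>W\<^esub> (f (v r) \<ominus>\<^bsub>W\<^esub> f (h (q x)))"
      unfolding b_def c_def[symmetric] r_def[symmetric]
      by (simp add: s mod_hom_diff[OF V0 fg(2) d(1)] k'(2) m'(2) mod_hom_diff[OF fg(2,2) kh] mod_hom_diff[OF F(1) fg(1) v]
            mod_hom_diff[OF fg(1-3)] uv(3))
    also have "\<dots> = (d c \<ominus>\<^bsub>W\<^esub> k (d c)) \<oplus>\<^bsub>W\<^esub> f (v r)"
      unfolding kf a_minus_def
      by (simp add: s W.M.minus_add W.M.a_ac W.M.r_neg abelian_group_add_cancel[OF W.M.abelian_group_axioms])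
    also have "d c \<ominus>\<^bsub>W\<^esub> k (d c) = f (g (d c))"
      using fg(8)[of "d c"] s by (metis W.M.add.inv_solve_right a_minus_def \<open>c \<in> carrier V0\<close>)
    finally show ?thesis by (simp add: q_def s c_def[symmetric] r_def[symmetric])
  qed
  have bq: "(\<lambda>x. (b x, q x)) \<in> mod_hom R ?D E"
    unfolding E_def by (rule mod_hom_corestrict[OF mod_hom_pair[OF b q]])
      (use db mod_hom_closed[OF b] mod_hom_closed[OF q] in auto)
  have sE: "fst \<in> mod_hom R E V0" "snd \<in> mod_hom R E Z"
    unfolding E_def by (rule mod_hom_restrict[OF Sh(1)], force, rule mod_hom_restrict[OF Sh(2)], force)
  have j: "(\<lambda>e. (fst e, u (snd e))) \<in> mod_hom R E ?D"
    by (rule mod_hom_pair[OF sE(1) mod_hom_comp[OF sE(2) u]])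
  \<comment> \<open>On the image of E one has q = z because g (f z) + v (u z) = z; then d c = f z
    makes both correction terms vanish.\<close>
  have bj: "(b (fst e, u (snd e)), q (fst e, u (snd e))) = e" if eE: "e \<in> carrier E" for e
  proof -
    obtain c z where e: "e = (c, z)" "c \<in> carrier V0" "z \<in> carrier Z" "d c = f z" using eE by (cases e) (auto simp: cE)
    have "q (c, u z) = z" using e fg(7)[of z] uv(3)[of z] by (simp add: q_def)
    then show ?thesis using e mod_hom_zero[OF fg(2) V0 k'h] mod_hom_zero[OF F(1) V0 m'(1)]
      by (simp add: b_def s a_minus_def W.M.r_neg F.M.r_neg)
  qed
  have "fac R V E E (\<lambda>x. x)"
    by (rule fac_retract[OF fac_direct_sum_id[OF fV0 FV V0 F(1) V] j bq _ D E]) (rule bj)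
  moreover have "snd ` carrier E = carrier Z"
  proof
    show "carrier Z \<subseteq> snd ` carrier E"
    proof
      fix z assume z: "z \<in> carrier Z"
      then obtain c where "c \<in> carrier V0" "f z = d c" using d(2) s(1)[of z] by (metis imageE)
      then show "z \<in> snd ` carrier E" using z by (intro image_eqI[of _ _ "(c, z)"]) (auto simp: cE)
    qed
  qed (auto simp: cE)
  moreover have "{e \<in> carrier E. snd e = \<zero>\<^bsub>Z\<^esub>} = (\<lambda>c. (c, \<zero>\<^bsub>Z\<^esub>)) ` {c \<in> carrier V0. d c = \<zero>\<^bsub>W\<^esub>}"
    using mod_hom_zero[OF fg(1-3)] by (auto simp: cE image_iff)
  moreover have "(\<lambda>c. (c, \<zero>\<^bsub>Z\<^esub>)) \<in> mod_hom R (V0\<lparr>carrier := {c \<in> carrier V0. d c = \<zero>\<^bsub>W\<^esub>}\<rparr>) E"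
    unfolding E_def
    by (rule mod_hom_corestrict[OF mod_hom_restrict[OF Sh(3)]]) (auto simp: mod_hom_zero[OF fg(1-3)])
  moreover have "\<zero>\<^bsub>E\<^esub> = (\<zero>\<^bsub>V0\<^esub>, \<zero>\<^bsub>Z\<^esub>)" by (simp add: E_def)
  ultimately show ?thesis using E sE(2) by (intro that)
qed

lemma a_kernel_eq: "a_kernel G H h = {x \<in> carrier G. h x = \<zero>\<^bsub>H\<^esub>}"
  by (simp add: a_kernel_def kernel_def)

lemma inj_on_kernel:
  assumes "left_module R M" "left_module R N" "f \<in> mod_hom R M N"
    "\<And>x. x \<in> carrier M \<Longrightarrow> f x = \<zero>\<^bsub>N\<^esub> \<Longrightarrow> x = \<zero>\<^bsub>M\<^esub>"
  shows "inj_on f (carrier M)"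
proof (rule inj_onI)
  interpret M: left_module R M by fact
  interpret N: left_module R N by fact
  fix x y assume xy: "x \<in> carrier M" "y \<in> carrier M" "f x = f y"
  then have "f (x \<ominus>\<^bsub>M\<^esub> y) = \<zero>\<^bsub>N\<^esub>"
    using mod_hom_closed[OF assms(3)] by (subst mod_hom_diff[OF assms(1-3)]) (simp_all add: a_minus_def N.M.r_neg)
  then have "x \<ominus>\<^bsub>M\<^esub> y = \<zero>\<^bsub>M\<^esub>" using assms(4) xy by simp
  then show "x = y" using xy by (metis M.M.a_inv_closed M.M.minus_equality M.M.minus_minus a_minus_def)
qed

text \<open>Only the terms at 0 and 1 and the maps \<open>d 0\<close> and \<open>d 1\<close> change:
  Z replaces the resolved module, and a copy E' of the pullback replaces the first term. Since the
  kernel of the pullback over Z is the kernel of \<open>d 0\<close>, embedded by c \<mapsto> (c, 0),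
  everything from index 2 on is kept.\<close>

lemma exact_resolution_stab:
  fixes C :: "nat \<Rightarrow> 'r std_module" and Z V :: "'r std_module"
  assumes ex: "exact_resolution R m C d" and V: "left_module R V"
    and fR: "fac R V (regular_module R) (regular_module R) (\<lambda>x. x)"
    and add: "\<And>i. i \<le> m \<Longrightarrow> in_add R V (C (Suc i))" and "stab R Z (C 0)"
  obtains C' d' where "C' 0 = Z" "\<And>i. i \<le> m \<Longrightarrow> in_add R V (C' (Suc i))" "exact_resolution R m C' d'"
proof -
  have LC: "left_module R (C (Suc i))" "fac R V (C (Suc i)) (C (Suc i)) (\<lambda>x. x)" if "i \<le> m" for i
    using add[OF that] in_add_std_iff[OF V] by auto
  have dh: "\<And>i. i \<le> m \<Longrightarrow> d i \<in> mod_hom R (C (Suc i)) (C i)"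
    and d0: "d 0 ` carrier (C 1) = carrier (C 0)"
    and dS: "\<And>i. i < m \<Longrightarrow> d (Suc i) ` carrier (C (Suc (Suc i))) = {x \<in> carrier (C (Suc i)). d i x = \<zero>\<^bsub>C i\<^esub>}"
    and dm: "inj_on (d m) (carrier (C (Suc m)))"
    using ex by (auto simp: exact_resolution_def a_kernel_eq)
  have LZ: "left_module R Z" "left_module R (C 0)" using assms(5) by (auto simp: stab_def)
  obtain E :: "('r, (nat \<Rightarrow> 'r) \<times> (nat \<Rightarrow> 'r)) module" where E: "left_module R E" "fac R V E E (\<lambda>x. x)"
    "snd \<in> mod_hom R E Z" "snd ` carrier E = carrier Z"
    "{e \<in> carrier E. snd e = \<zero>\<^bsub>Z\<^esub>} = (\<lambda>c. (c, \<zero>\<^bsub>Z\<^esub>)) ` {c \<in> carrier (C 1). d 0 c = \<zero>\<^bsub>C 0\<^esub>}"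
    "(\<lambda>c. (c, \<zero>\<^bsub>Z\<^esub>)) \<in> mod_hom R ((C 1)\<lparr>carrier := {c \<in> carrier (C 1). d 0 c = \<zero>\<^bsub>C 0\<^esub>}\<rparr>) E"
    "\<zero>\<^bsub>E\<^esub> = (\<zero>\<^bsub>C 1\<^esub>, \<zero>\<^bsub>Z\<^esub>)"
    using stab_pullback[OF assms(5), of "d 0" "C 1" V] dh[of 0] d0 LC[of 0] V fR by auto
  obtain E' :: "'r std_module" where "mod_iso R E E'" by (rule std_copy[OF E(1) V E(2)])
  then obtain \<phi> \<psi> where p: "left_module R E'" "\<phi> \<in> mod_hom R E E'" "\<psi> \<in> mod_hom R E' E"
    "\<And>x. x \<in> carrier E \<Longrightarrow> \<psi> (\<phi> x) = x" "\<And>y. y \<in> carrier E' \<Longrightarrow> \<phi> (\<psi> y) = y"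
    using mod_isoE by metis
  have addE': "in_add R V E'" using in_add_std_iff[OF V] p(1) fac_iso[OF \<open>mod_iso R E E'\<close> E(2)] by auto
  let ?K = "{c \<in> carrier (C 1). d 0 c = \<zero>\<^bsub>C 0\<^esub>}"
  have \<psi>s: "\<psi> ` carrier E' = carrier E"
  proof (intro equalityI subsetI)
    fix x assume "x \<in> carrier E"
    then show "x \<in> \<psi> ` carrier E'" using mod_hom_closed[OF p(2)] by (intro image_eqI[of _ _ "\<phi> x"]) (auto simp: p(4))
  qed (use mod_hom_closed[OF p(3)] in auto)
  define C' where "C' = (\<lambda>i. if i = 0 then Z else if i = 1 then E' else C i)"
  define d' where "d' = (\<lambda>i. if i = 0 then (\<lambda>x. snd (\<psi> x)) else if i = 1 then (\<lambda>x. \<phi> (d 1 x, \<zero>\<^bsub>Z\<^esub>)) else d i)"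
  have C' [simp]: "C' 0 = Z" "C' (Suc 0) = E'" "C' (Suc (Suc i)) = C (Suc (Suc i))" for i by (auto simp: C'_def)
  have d' [simp]: "d' 0 = (\<lambda>x. snd (\<psi> x))" "d' (Suc 0) = (\<lambda>x. \<phi> (d 1 x, \<zero>\<^bsub>Z\<^esub>))" "d' (Suc (Suc i)) = d (Suc (Suc i))" for i
    by (auto simp: d'_def)
  have h0: "d' 0 \<in> mod_hom R (C' 1) (C' 0)" using mod_hom_comp[OF p(3) E(3)] by simp
  have \<phi>0: "\<phi> e = \<zero>\<^bsub>E'\<^esub> \<longleftrightarrow> e = \<zero>\<^bsub>E\<^esub>" if "e \<in> carrier E" for e
    using mod_hom_zero[OF E(1) p(1,2)] mod_hom_zero[OF p(1) E(1) p(3)] p(4)[OF that] by metis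
  have h1: "d' 1 \<in> mod_hom R (C' 2) (C' 1)" and d1K: "d 1 ` carrier (C 2) = ?K" if "1 \<le> m"
  proof -
    show K: "d 1 ` carrier (C 2) = ?K" using dS[of 0] that by (simp add: numeral_2_eq_2)
    have "d 1 \<in> mod_hom R (C 2) ((C 1)\<lparr>carrier := ?K\<rparr>)"
      using dh[of 1] that K by (intro mod_hom_corestrict) (auto simp: numeral_2_eq_2)
    from mod_hom_comp[OF mod_hom_comp[OF this E(6)] p(2)] show "d' 1 \<in> mod_hom R (C' 2) (C' 1)"
      by (simp add: numeral_2_eq_2)
  qed
  have dE: "(d 1 x, \<zero>\<^bsub>Z\<^esub>) \<in> carrier E" if "1 \<le> m" "x \<in> carrier (C 2)" for x
    using d1K[OF that(1)] that(2) mod_hom_closed[OF E(6), of "d 1 x"] by auto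
  have "exact_resolution R m C' d'" unfolding exact_resolution_def a_kernel_eq
  proof (intro conjI allI impI)
    fix i assume "i \<le> m"
    then show "d' i \<in> mod_hom R (C' (Suc i)) (C' i)"
      using h0 h1 dh[of i] by (cases i rule: nat.exhaust; cases "i - 1") (auto simp: numeral_2_eq_2)
  next
    show "d' 0 ` carrier (C' (Suc 0)) = carrier (C' 0)"
      using E(4) \<psi>s by (simp add: image_image[symmetric, of snd \<psi>])
  next
    fix i assume i: "i < m"
    \<comment> \<open>At index 0 the kernel of the pullback enters; at index 1 the maps
      \<open>d 1\<close> and \<open>d' 1\<close> have the same kernel, because c \<mapsto> \<phi>
      (c, 0) is injective on the image of \<open>d 1\<close>; beyond that nothing has
      changed.\<close>
    consider "i = 0" | "i = 1" | j where "i = Suc (Suc j)" by (metis One_nat_def not0_implies_Suc)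
    then show "d' (Suc i) ` carrier (C' (Suc (Suc i))) = {x \<in> carrier (C' (Suc i)). d' i x = \<zero>\<^bsub>C' i\<^esub>}"
    proof cases
      case 1
      have "d' (Suc i) ` carrier (C' (Suc (Suc i))) = \<phi> ` (\<lambda>c. (c, \<zero>\<^bsub>Z\<^esub>)) ` (d 1 ` carrier (C 2))"
        using 1 by (simp add: image_image numeral_2_eq_2)
      also have "\<dots> = \<phi> ` {e \<in> carrier E. snd e = \<zero>\<^bsub>Z\<^esub>}" using d1K i 1 E(5) by simp
      also have "\<dots> = {x \<in> carrier E'. snd (\<psi> x) = \<zero>\<^bsub>Z\<^esub>}"
      proof (intro equalityI subsetI)
        fix x assume "x \<in> {x \<in> carrier E'. snd (\<psi> x) = \<zero>\<^bsub>Z\<^esub>}"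
        then show "x \<in> \<phi> ` {e \<in> carrier E. snd e = \<zero>\<^bsub>Z\<^esub>}"
          using mod_hom_closed[OF p(3)] by (intro image_eqI[of _ _ "\<psi> x"]) (auto simp: p(5))
      qed (use mod_hom_closed[OF p(2)] p(4) in auto)
      finally show ?thesis using 1 by simp
    next
      case 2
      then have m: "1 \<le> m" "1 < m" using i by auto
      have "{x \<in> carrier (C 2). d 1 x = \<zero>\<^bsub>C 1\<^esub>} = {x \<in> carrier (C 2). \<phi> (d 1 x, \<zero>\<^bsub>Z\<^esub>) = \<zero>\<^bsub>E'\<^esub>}"
        using dE[OF m(1)] \<phi>0 E(7) by auto
      then show ?thesis using 2 dS[OF m(2)] by (simp add: numeral_2_eq_2)
    next
      case 3
      then show ?thesis using dS[OF i] by simp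
    qed
  next
    consider "m = 0" | "m = 1" | j where "m = Suc (Suc j)" by (metis One_nat_def not0_implies_Suc)
    then show "inj_on (d' m) (carrier (C' (Suc m)))"
    proof cases
      \<comment> \<open>A resolution of length 0: \<open>d 0\<close> is injective, so the only
        element of the pullback over 0 is 0.\<close>
      case 1
      show ?thesis unfolding 1
      proof (rule inj_on_kernel[of R "C' (Suc 0)" "C' 0"])
        fix x assume x: "x \<in> carrier (C' (Suc 0))" "d' 0 x = \<zero>\<^bsub>C' 0\<^esub>"
        then have "\<psi> x \<in> {e \<in> carrier E. snd e = \<zero>\<^bsub>Z\<^esub>}" using mod_hom_closed[OF p(3)] by simp
        then obtain c where c: "\<psi> x = (c, \<zero>\<^bsub>Z\<^esub>)" "c \<in> carrier (C 1)" "d 0 c = \<zero>\<^bsub>C 0\<^esub>" unfolding E(5) by blast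
        have "d 0 \<zero>\<^bsub>C 1\<^esub> = \<zero>\<^bsub>C 0\<^esub>" using mod_hom_zero[OF LC(1)[of 0] LZ(2)] dh[of 0] by simp
        moreover have "\<zero>\<^bsub>C 1\<^esub> \<in> carrier (C 1)"
          using LC(1)[of 0] by (simp add: left_module_def abelian_group_def abelian_monoid.zero_closed)
        ultimately have "c = \<zero>\<^bsub>C 1\<^esub>" using dm c inj_onD[of "d 0" "carrier (C 1)"] by (simp add: 1)
        then have "\<psi> x = \<zero>\<^bsub>E\<^esub>" using c E(7) by simp
        moreover have "x \<in> carrier E'" using x(1) by simp
        ultimately show "x = \<zero>\<^bsub>C' (Suc 0)\<^esub>"
          using p(5)[of x] mod_hom_zero[OF E(1) p(1,2)] by simp
      qed (use p LZ h0 in auto)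
    next
      case 2
      have "inj_on (\<lambda>x. \<phi> (d 1 x, \<zero>\<^bsub>Z\<^esub>)) (carrier (C 2))"
      proof (rule inj_onI)
        fix x y assume xy: "x \<in> carrier (C 2)" "y \<in> carrier (C 2)" "\<phi> (d 1 x, \<zero>\<^bsub>Z\<^esub>) = \<phi> (d 1 y, \<zero>\<^bsub>Z\<^esub>)"
        have "1 \<le> m" using 2 by simp
        from xy(3) have "\<psi> (\<phi> (d 1 x, \<zero>\<^bsub>Z\<^esub>)) = \<psi> (\<phi> (d 1 y, \<zero>\<^bsub>Z\<^esub>))" by (rule arg_cong)
        then have "d 1 x = d 1 y"
          unfolding p(4)[OF dE[OF \<open>1 \<le> m\<close> xy(1)]] p(4)[OF dE[OF \<open>1 \<le> m\<close> xy(2)]] by (rule Pair_inject)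
        then show "x = y" using dm xy 2 by (auto simp: inj_on_def numeral_2_eq_2)
      qed
      then show ?thesis using 2 by (simp add: numeral_2_eq_2)
    next
      case 3
      then show ?thesis using dm by simp
    qed
  qed
  moreover have "in_add R V (C' (Suc i))" if "i \<le> m" for i
    using add[OF that] addE' by (cases i) auto
  ultimately show ?thesis by (intro that[of C' d']) auto
qed

text \<open>The terms may change their type here: this brings a tensored resolution, whose terms
  consist of cosets, back to modules of sequences.\<close>

lemma exact_resolution_iso:
  assumes ex: "exact_resolution R m D \<delta>" and iso: "\<And>i. i \<le> Suc m \<Longrightarrow> mod_iso R (D i) (C i)"
  obtains d where "exact_resolution R m C d"
proof -
  have "\<forall>i. \<exists>f g. i \<le> Suc m \<longrightarrow> left_module R (D i) \<and> left_module R (C i) \<and> f \<in> mod_hom R (D i) (C i) \<and> g \<in> mod_hom R (C i) (D i) \<and>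
    (\<forall>x\<in>carrier (D i). g (f x) = x) \<and> (\<forall>y\<in>carrier (C i). f (g y) = y)"
    using mod_isoE[OF iso] by metis
  then obtain f g where fg: "\<And>i. i \<le> Suc m \<Longrightarrow> left_module R (D i) \<and> left_module R (C i) \<and> f i \<in> mod_hom R (D i) (C i) \<and> g i \<in> mod_hom R (C i) (D i) \<and>
    (\<forall>x\<in>carrier (D i). g i (f i x) = x) \<and> (\<forall>y\<in>carrier (C i). f i (g i y) = y)"
    by metis
  have im: "f i ` carrier (D i) = carrier (C i)" "g i ` carrier (C i) = carrier (D i)" if "i \<le> Suc m" for i
  proof -
    note fi = fg[OF that]
    have c: "f i x \<in> carrier (C i)" if "x \<in> carrier (D i)" for x using fi mod_hom_closed that by metis
    have c': "g i x \<in> carrier (D i)" if "x \<in> carrier (C i)" for x using fi mod_hom_closed that by metis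
    have "x \<in> f i ` carrier (D i)" if "x \<in> carrier (C i)" for x
      by (rule image_eqI[of _ _ "g i x"]) (use fi c' that in auto)
    then show "f i ` carrier (D i) = carrier (C i)" using c by blast
    have "x \<in> g i ` carrier (C i)" if "x \<in> carrier (D i)" for x
      by (rule image_eqI[of _ _ "f i x"]) (use fi c that in auto)
    then show "g i ` carrier (C i) = carrier (D i)" using c' by blast
  qed
  define d where "d = (\<lambda>i x. f i (\<delta> i (g (Suc i) x)))"
  have dh: "\<And>i. i \<le> m \<Longrightarrow> \<delta> i \<in> mod_hom R (D (Suc i)) (D i)"
    and d0: "\<delta> 0 ` carrier (D 1) = carrier (D 0)"
    and dS: "\<And>i. i < m \<Longrightarrow> \<delta> (Suc i) ` carrier (D (Suc (Suc i))) = {x \<in> carrier (D (Suc i)). \<delta> i x = \<zero>\<^bsub>D i\<^esub>}"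
    and dm: "inj_on (\<delta> m) (carrier (D (Suc m)))"
    using ex by (auto simp: exact_resolution_def a_kernel_eq)
  have "exact_resolution R m C d" unfolding exact_resolution_def a_kernel_eq
  proof (intro conjI allI impI)
    fix i assume "i \<le> m"
    then have "g (Suc i) \<in> mod_hom R (C (Suc i)) (D (Suc i))" "f i \<in> mod_hom R (D i) (C i)"
      using fg[of i] fg[of "Suc i"] by auto
    from mod_hom_comp[OF mod_hom_comp[OF this(1) dh[OF \<open>i \<le> m\<close>]] this(2)]
    show "d i \<in> mod_hom R (C (Suc i)) (C i)" by (simp add: d_def)
  next
    have "d 0 ` carrier (C 1) = f 0 ` \<delta> 0 ` g 1 ` carrier (C 1)" by (simp add: d_def image_image)
    then show "d 0 ` carrier (C (Suc 0)) = carrier (C 0)" using im[of 1] im[of 0] d0 by simp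
  next
    fix i assume i: "i < m"
    have "d (Suc i) ` carrier (C (Suc (Suc i))) = f (Suc i) ` \<delta> (Suc i) ` g (Suc (Suc i)) ` carrier (C (Suc (Suc i)))"
      by (simp add: d_def image_image)
    also have "\<dots> = f (Suc i) ` {x \<in> carrier (D (Suc i)). \<delta> i x = \<zero>\<^bsub>D i\<^esub>}" using im[of "Suc (Suc i)"] i dS[OF i] by simp
    also have "\<dots> = {x \<in> carrier (C (Suc i)). d i x = \<zero>\<^bsub>C i\<^esub>}"
    proof -
      have fgi: "left_module R (D i)" "left_module R (C i)" "f i \<in> mod_hom R (D i) (C i)" "g i \<in> mod_hom R (C i) (D i)"
        "\<And>x. x \<in> carrier (D i) \<Longrightarrow> g i (f i x) = x" using fg[of i] i by auto
      have fgs: "f (Suc i) \<in> mod_hom R (D (Suc i)) (C (Suc i))" "g (Suc i) \<in> mod_hom R (C (Suc i)) (D (Suc i))"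
        "\<And>x. x \<in> carrier (D (Suc i)) \<Longrightarrow> g (Suc i) (f (Suc i) x) = x"
        "\<And>y. y \<in> carrier (C (Suc i)) \<Longrightarrow> f (Suc i) (g (Suc i) y) = y" using fg[of "Suc i"] i by auto
      have z: "f i x = \<zero>\<^bsub>C i\<^esub> \<longleftrightarrow> x = \<zero>\<^bsub>D i\<^esub>" if "x \<in> carrier (D i)" for x
        using mod_hom_zero[OF fgi(1-3)] mod_hom_zero[OF fgi(2,1,4)] fgi(5)[OF that] by metis
      have "\<delta> i x \<in> carrier (D i)" if "x \<in> carrier (D (Suc i))" for x
        using mod_hom_closed[OF dh[of i] that] i by simp
      then have eq: "d i y = \<zero>\<^bsub>C i\<^esub> \<longleftrightarrow> \<delta> i (g (Suc i) y) = \<zero>\<^bsub>D i\<^esub>" if "y \<in> carrier (C (Suc i))" for y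
        unfolding d_def by (intro z) (use that mod_hom_closed[OF fgs(2)] in auto)
      show ?thesis
      proof (intro equalityI subsetI)
        fix y assume "y \<in> {x \<in> carrier (C (Suc i)). d i x = \<zero>\<^bsub>C i\<^esub>}"
        then show "y \<in> f (Suc i) ` {x \<in> carrier (D (Suc i)). \<delta> i x = \<zero>\<^bsub>D i\<^esub>}"
          using fgs(4) eq mod_hom_closed[OF fgs(2)] by (intro image_eqI[of _ _ "g (Suc i) y"]) auto
      qed (use fgs(3) eq mod_hom_closed[OF fgs(1)] in auto)
    qed
    finally show "d (Suc i) ` carrier (C (Suc (Suc i))) = {x \<in> carrier (C (Suc i)). d i x = \<zero>\<^bsub>C i\<^esub>}" .
  next
    show "inj_on (d m) (carrier (C (Suc m)))" unfolding d_def
    proof (intro inj_onI)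
      fix x y assume xy: "x \<in> carrier (C (Suc m))" "y \<in> carrier (C (Suc m))" "f m (\<delta> m (g (Suc m) x)) = f m (\<delta> m (g (Suc m) y))"
      have c: "g (Suc m) x \<in> carrier (D (Suc m))" "g (Suc m) y \<in> carrier (D (Suc m))" using xy im[of "Suc m"] by auto
      then have "\<delta> m (g (Suc m) x) \<in> carrier (D m)" "\<delta> m (g (Suc m) y) \<in> carrier (D m)"
        using mod_hom_closed[OF dh[of m]] by auto
      then have "\<delta> m (g (Suc m) x) = \<delta> m (g (Suc m) y)" using xy(3) fg[of m] by (metis Suc_leD order_refl)
      then have "g (Suc m) x = g (Suc m) y" using inj_onD[OF dm] c by blast
      then show "x = y" using fg[of "Suc m"] xy by (metis order_refl)
    qed
  qed
  then show ?thesis by (rule that)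
qed

section \<open>Syzygies\<close>

text \<open>The given isomorphism with the kernel, inverted and followed by the inclusion, becomes
  the first map; syzygies enter all later arguments in this form.\<close>

lemma projective_cover_short_exact:
  assumes "projective_cover R P f Z" "mod_iso R (P\<lparr>carrier := a_kernel P Z f\<rparr>) Y"
  obtains i where "short_exact R Y i P f Z" "dual_basis R P"
proof -
  have P: "left_module R P" "dual_basis R P" using assms(1) fg_projective_imp by (auto simp: projective_cover_def)
  have Z: "left_module R Z" "f \<in> mod_hom R P Z" "f ` carrier P = carrier Z"
    using assms(1) by (auto simp: projective_cover_def)
  obtain g h where "left_module R Y"
    "g \<in> mod_hom R (P\<lparr>carrier := a_kernel P Z f\<rparr>) Y" "h \<in> mod_hom R Y (P\<lparr>carrier := a_kernel P Z f\<rparr>)"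
    "\<And>x. x \<in> carrier (P\<lparr>carrier := a_kernel P Z f\<rparr>) \<Longrightarrow> h (g x) = x" "\<And>y. y \<in> carrier Y \<Longrightarrow> g (h y) = y"
    by (rule mod_isoE[OF assms(2)]) (rule that)
  then have gh: "left_module R Y"
    "g \<in> mod_hom R (P\<lparr>carrier := a_kernel P Z f\<rparr>) Y" "h \<in> mod_hom R Y (P\<lparr>carrier := a_kernel P Z f\<rparr>)"
    "\<And>x. x \<in> a_kernel P Z f \<Longrightarrow> h (g x) = x" "\<And>y. y \<in> carrier Y \<Longrightarrow> g (h y) = y" by simp_all
  have hk: "h y \<in> a_kernel P Z f" if "y \<in> carrier Y" for y using mod_hom_closed[OF gh(3) that] by simp
  have gc: "g x \<in> carrier Y" if "x \<in> a_kernel P Z f" for x using mod_hom_closed[OF gh(2)] that by simp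
  have hom: "h \<in> mod_hom R Y P"
    using hk by (intro mod_homI) (auto simp: mod_hom_simps(2,3)[OF gh(3)] a_kernel_eq)
  have "inj_on h (carrier Y)" using gh(5) by (metis inj_onI)
  moreover have "h ` carrier Y = {p \<in> carrier P. f p = \<zero>\<^bsub>Z\<^esub>}"
    unfolding a_kernel_eq[symmetric] using hk gc gh(4) by (auto simp: image_iff) metis
  ultimately show ?thesis using P Z gh(1) hom by (intro that[of h]) (auto simp: short_exact_def)
qed

lemma syzygy_left_module: "syzygy R n X Y \<Longrightarrow> left_module R Y"
  by (cases n) (auto simp: mod_iso_def)

lemma syzygy_iso:
  assumes "syzygy R n X Y" "mod_iso R Y Y'"
  shows "syzygy R n X Y'"
  using assms by (cases n) (auto intro: mod_iso_trans)

text \<open>The base case absorbs the isomorphism that \<open>syzygy\<close> carries at 0.\<close>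

lemma syzygy_add:
  assumes "syzygy R l X Y"
  shows "syzygy R n Y Z \<Longrightarrow> syzygy R (n + l) X Z"
proof (induction n arbitrary: Z)
  case 0
  then show ?case using syzygy_iso[OF assms] by simp
next
  case (Suc n)
  then show ?case by auto
qed

section \<open>Modules of finite rank and projective covers\<close>

text \<open>A stand-in for finite length: a rank that grows strictly along inclusions of submodules.
  Extremal ranks yield minimal and maximal members of families of submodules; over a finite
  dimensional algebra the dimension over K is such a rank.\<close>

definition finite_rank :: "('r, 'x) ring_scheme \<Rightarrow> ('r, 'm, 'y) module_scheme \<Rightarrow> bool" where
  "finite_rank R M \<longleftrightarrow> (\<exists>r :: 'm set \<Rightarrow> nat.
     \<forall>Q Q'. submodule Q R M \<longrightarrow> submodule Q' R M \<longrightarrow> Q \<subset> Q' \<longrightarrow> r Q < r Q')"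

lemma submodule_unrestrict:
  assumes "left_module R M" "submodule Q R M" "submodule N R (M\<lparr>carrier := Q\<rparr>)"
  shows "submodule N R M" "N \<subseteq> Q"
proof -
  interpret M: left_module R M by fact
  interpret Q: left_module R "M\<lparr>carrier := Q\<rparr>" by (rule left_module_restrict[OF assms(1,2)])
  show "N \<subseteq> Q" using Q.submoduleD(1)[OF assms(3)] by simp
  then show "submodule N R M"
    using Q.submoduleD[OF assms(3)] M.submoduleD(1)[OF assms(2)] by (intro M.submoduleI) auto
qed

text \<open>Among the submodules of \<open>R\<^sup>n\<close> that are direct summands and map onto \<open>X\<close>, take a minimal one,
  \<open>Q\<close>. If \<open>N \<subseteq> Q\<close> still maps onto \<open>X\<close>, then projectivity gives endomorphisms \<open>h\<close> of \<open>Q\<close>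
  over \<open>X\<close> with image in \<open>N\<close>; when the image of \<open>h\<close> is minimal and its kernel maximal, both do not
  change on passing to \<open>h \<circ> h\<close>, so that the image is a direct summand, hence \<open>Q\<close>.\<close>

lemma projective_cover_exists:
  fixes R :: "('r, 'x) ring_scheme"
  assumes X: "left_module R X" and P: "left_module R P" and dP: "dual_basis R P" and fr: "finite_rank R P"
    and \<pi>: "\<pi> \<in> mod_hom R P X" "\<pi> ` carrier P = carrier X"
  obtains Q where "submodule Q R P" "projective_cover R (P\<lparr>carrier := Q\<rparr>) \<pi> X"
proof -
  obtain r :: "_ \<Rightarrow> nat" where r: "\<And>Q Q'. submodule Q R P \<Longrightarrow> submodule Q' R P \<Longrightarrow> Q \<subset> Q' \<Longrightarrow> r Q < r Q'"
    using fr by (auto simp: finite_rank_def)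
  have rle: "r Q \<le> r Q'" if "submodule Q R P" "submodule Q' R P" "Q \<subseteq> Q'" for Q Q'
    using r[OF that(1,2)] that(3) by (metis less_imp_le order_refl psubsetI)
  interpret P: left_module R P by fact
  interpret X: left_module R X by fact
  let ?F = "\<lambda>Q. submodule Q R P \<and> dual_basis R (P\<lparr>carrier := Q\<rparr>) \<and> \<pi> ` Q = carrier X"
  have "?F (carrier P)" using dP \<pi> P.carrier_submodule by simp
  then obtain Q where Q: "?F Q" "\<And>Q'. ?F Q' \<Longrightarrow> r Q \<le> r Q'"
    using ex_has_least_nat[of ?F "carrier P" r] by blast
  define PQ where "PQ = P\<lparr>carrier := Q\<rparr>"
  have sQ: "submodule Q R P" using Q by blast
  note Qs = P.submoduleD[OF sQ]
  have LQ: "left_module R PQ" unfolding PQ_def by (rule left_module_restrict[OF P sQ])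
  have PQs [simp]: "carrier PQ = Q" "\<zero>\<^bsub>PQ\<^esub> = \<zero>\<^bsub>P\<^esub>" "add PQ = add P" by (auto simp: PQ_def)
  interpret Q: left_module R PQ by fact
  have \<pi>Q: "\<pi> \<in> mod_hom R PQ X" unfolding PQ_def by (rule mod_hom_restrict[OF \<pi>(1) Qs(1)])
  have un: "submodule N R P" "N \<subseteq> Q" if "submodule N R PQ" for N
    using submodule_unrestrict[OF P sQ] that by (auto simp: PQ_def)
  have "N = Q" if N: "submodule N R PQ" "N <+>\<^bsub>PQ\<^esub> a_kernel PQ X \<pi> = Q" for N
  proof -
    note Ns = Q.submoduleD[OF N(1)]
    define PN where "PN = PQ\<lparr>carrier := N\<rparr>"
    have LN: "left_module R PN" unfolding PN_def by (rule left_module_restrict[OF LQ N(1)])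
    have \<pi>N: "\<pi> \<in> mod_hom R PN X" unfolding PN_def by (rule mod_hom_restrict[OF \<pi>Q Ns(1)])
    \<comment> \<open>N together with the kernel of \<pi> fills Q, so N alone maps onto X. By
      projectivity \<pi> then lifts to an endomorphism \<open>h0\<close> of Q over X with image in
      N.\<close>
    have "\<pi> ` carrier PN = carrier X"
    proof
      show "\<pi> ` carrier PN \<subseteq> carrier X" using mod_hom_closed[OF \<pi>N] by blast
      show "carrier X \<subseteq> \<pi> ` carrier PN"
      proof
        fix x assume "x \<in> carrier X"
        then obtain p where p: "p \<in> Q" "x = \<pi> p" using Q(1) by (metis imageE)
        from p(1) have "p \<in> N <+>\<^bsub>PQ\<^esub> a_kernel PQ X \<pi>" unfolding N(2) .
        then obtain y k where yk: "y \<in> N" "k \<in> Q" "\<pi> k = \<zero>\<^bsub>X\<^esub>" "p = y \<oplus>\<^bsub>P\<^esub> k"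
          by (auto simp: set_add_def set_mult_def a_kernel_eq)
        have "y \<in> Q" using yk(1) Ns(1) by auto
        then have "x = \<pi> y" using p yk mod_hom_simps(1,2)[OF \<pi>Q, of y] mod_hom_simps(2)[OF \<pi>Q, of y k] by simp
        then show "x \<in> \<pi> ` carrier PN" using yk by (auto simp: PN_def)
      qed
    qed
    moreover have "dual_basis R PQ" using Q by (simp add: PQ_def)
    ultimately obtain h0 where h0: "h0 \<in> mod_hom R PQ PN" "\<And>p. p \<in> carrier PQ \<Longrightarrow> \<pi> (h0 p) = \<pi> p"
      using dual_basis_lift[OF _ \<pi>Q \<pi>N _ LQ X LN] by blast
    let ?H = "\<lambda>h. h \<in> mod_hom R PQ PQ \<and> h ` Q \<subseteq> N \<and> (\<forall>p\<in>Q. \<pi> (h p) = \<pi> p)"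
    let ?ker = "\<lambda>h. {p \<in> Q. h p = \<zero>\<^bsub>P\<^esub>}"
    \<comment> \<open>Minimising this sum treats a small image and a large kernel at once: passing
      from h to h h increases neither summand, so both keep their value. The truncated difference is
      exact, since the kernel lies in Q and has rank at most \<open>r Q\<close>.\<close>
    let ?\<mu> = "\<lambda>h. r (h ` Q) + (r Q - r (?ker h))"
    have "?H h0"
      using h0(2) mod_hom_closed[OF h0(1)] mod_hom_comp[OF h0(1)[unfolded PN_def] mod_hom_restrict[OF mod_hom_id Ns(1)]]
      by (auto simp: PN_def)
    then obtain h where h: "?H h" "\<And>h'. ?H h' \<Longrightarrow> ?\<mu> h \<le> ?\<mu> h'"
      using ex_has_least_nat[of ?H h0 ?\<mu>] by blast
    have hh: "h \<in> mod_hom R PQ PQ" and hc: "\<And>p. p \<in> Q \<Longrightarrow> h p \<in> Q"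
      using h(1) mod_hom_closed[of h R PQ PQ] by auto
    have Hhh: "?H (\<lambda>p. h (h p))" using h(1) hc mod_hom_comp[OF hh hh] by auto
    have im: "submodule (g ` Q) R P" "g ` Q \<subseteq> Q" and ke: "submodule (?ker g) R P" if "g \<in> mod_hom R PQ PQ" for g
      using un[OF image_submodule[OF LQ LQ that, simplified]] un[OF kernel_submodule[OF LQ LQ that, simplified]] by auto
    note ihh = mod_hom_comp[OF hh hh]
    have imsub: "(\<lambda>p. h (h p)) ` Q \<subseteq> h ` Q" using hc by auto
    have kesub: "?ker h \<subseteq> ?ker (\<lambda>p. h (h p))" using mod_hom_zero[OF LQ LQ hh] by auto
    have "r ((\<lambda>p. h (h p)) ` Q) \<le> r (h ` Q)" "r (?ker h) \<le> r (?ker (\<lambda>p. h (h p)))" "r (?ker (\<lambda>p. h (h p))) \<le> r Q"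
      using rle[OF im(1)[OF ihh] im(1)[OF hh] imsub] rle[OF ke[OF hh] ke[OF ihh] kesub] rle[OF ke[OF ihh] sQ] by auto
    then have "r ((\<lambda>p. h (h p)) ` Q) = r (h ` Q)" "r (?ker h) = r (?ker (\<lambda>p. h (h p)))"
      using h(2)[OF Hhh] by linarith+
    then have imeq: "(\<lambda>p. h (h p)) ` Q = h ` Q" and keeq: "?ker h = ?ker (\<lambda>p. h (h p))"
      using r[OF im(1)[OF ihh] im(1)[OF hh]] imsub r[OF ke[OF hh] ke[OF ihh]] kesub by (auto simp: psubset_eq)
    define I where "I = PQ\<lparr>carrier := h ` Q\<rparr>"
    have sI: "submodule (h ` Q) R PQ" using image_submodule[OF LQ LQ hh] by simp
    have LI: "left_module R I" unfolding I_def by (rule left_module_restrict[OF LQ sI])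
    have cI: "carrier I = h ` Q" by (simp add: I_def)
    have incl: "(\<lambda>x. x) \<in> mod_hom R I PQ"
      unfolding I_def using im(2)[OF hh] by (intro mod_hom_restrict[OF mod_hom_id]) simp
    have hI: "h \<in> mod_hom R I PQ" using mod_hom_comp[OF incl hh] .
    \<comment> \<open>Equal kernels of h and h h make h injective on its image I, and equal images
      make it map I onto I. So h, followed by the inverse of its restriction to I, is a projection
      \<psi> of Q onto I.\<close>
    have inj: "inj_on h (carrier I)"
    proof (rule inj_on_kernel[OF LI LQ hI])
      fix x assume x: "x \<in> carrier I" "h x = \<zero>\<^bsub>PQ\<^esub>"
      then obtain y where y: "y \<in> Q" "x = h y" by (auto simp: cI)
      then have "y \<in> ?ker (\<lambda>p. h (h p))" using x by simp
      then have "y \<in> ?ker h" unfolding keeq .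
      then show "x = \<zero>\<^bsub>I\<^esub>" using y by (simp add: I_def)
    qed
    have "h q \<in> h ` carrier I" if "q \<in> carrier PQ" for q
    proof -
      have "h q \<in> (\<lambda>p. h (h p)) ` Q" using that imeq by auto
      then show ?thesis by (auto simp: cI)
    qed
    then obtain \<psi> where \<psi>: "\<psi> \<in> mod_hom R PQ I" "\<And>q. q \<in> carrier PQ \<Longrightarrow> h (\<psi> q) = h q"
      using mod_hom_lift_inj[OF hI inj hh _ LI] by metis
    have "\<psi> x = x" if "x \<in> carrier I" for x
      using that inj_onD[OF inj, of "\<psi> x" x] \<psi>(2)[of x] mod_hom_closed[OF \<psi>(1), of x] im(2)[OF hh] by (auto simp: cI)
    then have "dual_basis R I" using fac_retract[OF _ incl \<psi>(1) _ LQ LI] \<open>dual_basis R PQ\<close> by blast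
    moreover have "\<pi> ` h ` Q = carrier X"
    proof -
      have "\<pi> ` h ` Q = \<pi> ` Q" unfolding image_image using h(1) by (intro image_cong) auto
      then show ?thesis using Q by simp
    qed
    moreover have "I = P\<lparr>carrier := h ` Q\<rparr>" by (simp add: I_def PQ_def)
    \<comment> \<open>I is projective and still maps onto X, so minimality of Q leaves only I = Q,
      while I lies in N.\<close>
    ultimately have "r Q \<le> r (h ` Q)" using Q(2)[of "h ` Q"] im(1)[OF hh] by simp
    then have "h ` Q = Q" using r[OF im(1)[OF hh] sQ] im(2)[OF hh] by (metis linorder_not_less psubsetI)
    then show "N = Q" using h(1) Ns(1) by auto
  qed
  moreover have "fg_projective R PQ" using fg_projectiveI[OF LQ] Q by (simp add: PQ_def)
  ultimately have "projective_cover R PQ \<pi> X"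
    using X \<pi>Q Q(1) by (auto simp: projective_cover_def)
  then show ?thesis using sQ that by (simp add: PQ_def)
qed

text \<open>The submodule D + R x, presented as the image of D \<oplus> R. The presentation passes
  finite generation on to the sum, and over a field with x outside D it becomes an
  isomorphism.\<close>

lemma adjoin_submodule:
  assumes M: "left_module R M" and D: "submodule D R M" and x: "x \<in> carrier M"
  defines "S \<equiv> direct_sum (M\<lparr>carrier := D\<rparr>) (regular_module R)"
  defines "f \<equiv> \<lambda>p. fst p \<oplus>\<^bsub>M\<^esub> snd p \<odot>\<^bsub>M\<^esub> x"
  shows "left_module R S" "f \<in> mod_hom R S M" "submodule (f ` carrier S) R M"
    "carrier S = D \<times> carrier R" "D \<subseteq> f ` carrier S" "x \<in> f ` carrier S"
proof -
  interpret M: left_module R M by fact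
  note Ds = M.submoduleD[OF D]
  note reg = left_module_regular[OF M.ring_axioms] and LD = left_module_restrict[OF M D]
  note Sh = direct_sum_homs[OF LD reg]
  show S: "left_module R S" unfolding S_def by (rule left_module_direct_sum[OF LD reg])
  show f: "f \<in> mod_hom R S M" unfolding f_def S_def
    by (rule mod_hom_plus[OF mod_hom_comp[OF Sh(1) mod_hom_restrict[OF mod_hom_id Ds(1)]]
          mod_hom_comp[OF Sh(2) mod_hom_regular[OF M x]] M])
  show "submodule (f ` carrier S) R M" by (rule image_submodule[OF S M f])
  show cS: "carrier S = D \<times> carrier R" by (simp add: S_def)
  show "D \<subseteq> f ` carrier S"
  proof
    fix d assume d: "d \<in> D"
    then have "d = f (d, \<zero>\<^bsub>R\<^esub>)" using x Ds(1) by (auto simp: f_def)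
    then show "d \<in> f ` carrier S" by (rule image_eqI) (use d in \<open>simp add: cS\<close>)
  qed
  have "x = f (\<zero>\<^bsub>M\<^esub>, \<one>\<^bsub>R\<^esub>)" using x by (simp add: f_def M.smult_one)
  then show "x \<in> f ` carrier S" by (rule image_eqI) (use Ds in \<open>simp add: cS\<close>)
qed

text \<open>The noetherian property: among the finitely generated submodules inside Q, one of
  largest rank is all of Q, since adjoining an element outside it would raise the rank.\<close>

lemma fg_submodule:
  assumes M: "left_module R M" and fr: "finite_rank R M" and Q: "submodule Q R M"
  shows "finitely_generated R (M\<lparr>carrier := Q\<rparr>)"
proof -
  obtain r :: "_ \<Rightarrow> nat" where r: "\<And>Q Q'. submodule Q R M \<Longrightarrow> submodule Q' R M \<Longrightarrow> Q \<subset> Q' \<Longrightarrow> r Q < r Q'"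
    using fr by (auto simp: finite_rank_def)
  have rle: "r Q \<le> r Q'" if "submodule Q R M" "submodule Q' R M" "Q \<subseteq> Q'" for Q Q'
    using r[OF that(1,2)] that(3) by (metis less_imp_le order_refl psubsetI)
  interpret M: left_module R M by fact
  note Qs = M.submoduleD[OF Q]
  let ?F = "\<lambda>N. submodule N R M \<and> N \<subseteq> Q \<and> finitely_generated R (M\<lparr>carrier := N\<rparr>)"
  have z: "submodule {\<zero>\<^bsub>M\<^esub>} R M" by (rule M.submoduleI) auto
  have "finitely_generated R (M\<lparr>carrier := {\<zero>\<^bsub>M\<^esub>}\<rparr>)"
  proof -
    interpret Z: left_module R "M\<lparr>carrier := {\<zero>\<^bsub>M\<^esub>}\<rparr>" by (rule left_module_restrict[OF M z])
    show ?thesis unfolding finitely_generated_def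
      using Z.submoduleD(1,2) by (intro exI[of _ "{}"]) fastforce
  qed
  then have "?F {\<zero>\<^bsub>M\<^esub>}" using z Qs by auto
  then obtain N where N: "?F N" "\<And>N'. ?F N' \<Longrightarrow> r N' \<le> r N"
    using ex_has_greatest_nat[of ?F "{\<zero>\<^bsub>M\<^esub>}" r "Suc (r Q)"] rle[OF _ Q] by (metis less_Suc_eq_le)
  note Ns = M.submoduleD[of N]
  have sN: "submodule N R M" using N by blast
  note LN = left_module_restrict[OF M sN]
  have "N = Q"
  proof (rule ccontr)
    assume "N \<noteq> Q"
    then obtain x where x: "x \<in> Q" "x \<notin> N" using N by auto
    then have xM: "x \<in> carrier M" using Qs(1) by auto
    let ?S = "direct_sum (M\<lparr>carrier := N\<rparr>) (regular_module R)"
    let ?f = "\<lambda>p. fst p \<oplus>\<^bsub>M\<^esub> snd p \<odot>\<^bsub>M\<^esub> x"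
    let ?N = "?f ` carrier ?S"
    note A = adjoin_submodule[OF M sN xM]
    note reg = left_module_regular[OF M.ring_axioms] and sub = A(3)
    have fS: "finitely_generated R ?S"
      using fg_direct_sum[OF LN reg] fg_dual_basis[OF reg dual_basis_regular[OF M.ring_axioms]] N by blast
    have "finitely_generated R (M\<lparr>carrier := ?N\<rparr>)"
      by (rule fg_image[OF A(1) left_module_restrict[OF M sub] mod_hom_corestrict[OF A(2) subset_refl] _ fS]) simp
    moreover have "?N \<subseteq> Q" using N x Qs by auto
    ultimately have "r ?N \<le> r N" using N(2) sub by blast
    moreover have "N \<subset> ?N" using A(5,6) x by blast
    ultimately show False using r[OF sN sub] by simp
  qed
  then show ?thesis using N by simp
qed

text \<open>Finite generation is carried along to provide the next free cover. The projective cover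
  is found inside a power of the regular module, so cover and kernel are modules of sequences
  without any transport.\<close>

lemma syzygy_exists:
  fixes X :: "'r std_module"
  assumes fr: "\<And>n. finite_rank R (direct_power n (regular_module R))" and X: "fg_module R X"
  shows "\<exists>Y. syzygy R n X Y \<and> fg_module R Y"
proof (induction n)
  case 0
  show ?case using X mod_iso_refl by (auto simp: fg_module_def)
next
  case (Suc n)
  then obtain Z where Z: "syzygy R n X Z" "left_module R Z" "finitely_generated R Z" by (auto simp: fg_module_def)
  interpret Z: left_module R Z by fact
  obtain k \<pi> where k: "\<pi> \<in> mod_hom R (direct_power k (regular_module R)) Z"
    "\<pi> ` carrier (direct_power k (regular_module R)) = carrier Z" by (rule fg_surjection[OF Z(2,3)])
  define F where "F = direct_power k (regular_module R)"
  have F: "left_module R F" "dual_basis R F"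
    unfolding F_def by (intro left_module_direct_power left_module_regular Z.ring_axioms,
        intro fac_direct_power_id left_module_regular Z.ring_axioms)
  obtain Q where Q: "submodule Q R F" "projective_cover R (F\<lparr>carrier := Q\<rparr>) \<pi> Z"
    by (rule projective_cover_exists[OF Z(2) F fr[of k, folded F_def] k[folded F_def]])
  note LQ = left_module_restrict[OF F(1) Q(1)]
  have \<pi>: "\<pi> \<in> mod_hom R (F\<lparr>carrier := Q\<rparr>) Z" using Q(2) by (simp add: projective_cover_def)
  let ?Y = "F\<lparr>carrier := Q, carrier := a_kernel (F\<lparr>carrier := Q\<rparr>) Z \<pi>\<rparr>"
  have sk: "submodule (a_kernel (F\<lparr>carrier := Q\<rparr>) Z \<pi>) R (F\<lparr>carrier := Q\<rparr>)"
    unfolding a_kernel_eq by (rule kernel_submodule[OF LQ Z(2) \<pi>])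
  have L: "left_module R ?Y" by (rule left_module_restrict[OF LQ sk])
  have "finitely_generated R ?Y"
    using fg_submodule[OF F(1) fr[of k, folded F_def] submodule_unrestrict(1)[OF F(1) Q(1) sk]] by simp
  then have "fg_module R ?Y" using L by (simp add: fg_module_def)
  moreover have "syzygy R (Suc n) X ?Y" unfolding syzygy.simps
    by (intro exI[of _ Z] conjI exI[of _ "F\<lparr>carrier := Q\<rparr>"] exI[of _ \<pi>] Z(1) Q(2) mod_iso_refl[OF L])
  ultimately show ?case by blast
qed

section \<open>Modules over a finite dimensional algebra\<close>

text \<open>Otherwise c x would lie in D, and division by c would give x.\<close>

lemma field_solve:
  assumes K: "field K" and Y: "left_module K Y" and D: "submodule D K Y" and x: "x \<in> carrier Y" "x \<notin> D"
    and c: "c \<in> carrier K" "d \<in> D" "d \<oplus>\<^bsub>Y\<^esub> c \<odot>\<^bsub>Y\<^esub> x \<in> D"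
  shows "c = \<zero>\<^bsub>K\<^esub>"
proof (rule ccontr)
  assume nz: "c \<noteq> \<zero>\<^bsub>K\<^esub>"
  interpret K: field K by fact
  interpret Y: left_module K Y by fact
  note Ds = Y.submoduleD[OF D]
  have u: "c \<in> Units K" using nz c by (simp add: K.field_Units)
  have "(d \<oplus>\<^bsub>Y\<^esub> c \<odot>\<^bsub>Y\<^esub> x) \<ominus>\<^bsub>Y\<^esub> d \<in> D" by (rule Ds(6)) (use c in auto)
  moreover have "(d \<oplus>\<^bsub>Y\<^esub> c \<odot>\<^bsub>Y\<^esub> x) \<ominus>\<^bsub>Y\<^esub> d = c \<odot>\<^bsub>Y\<^esub> x"
    using c x Ds(1) by (auto simp: a_minus_def Y.M.add.m_comm[of d] Y.M.a_assoc Y.M.r_neg subset_iff)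
  ultimately have "inv\<^bsub>K\<^esub> c \<odot>\<^bsub>Y\<^esub> (c \<odot>\<^bsub>Y\<^esub> x) \<in> D" using Ds(4) u by simp
  then show False using x c u by (simp flip: Y.smult_assoc add: Y.smult_one)
qed

text \<open>Existence of bases, in the form of a dual basis: a generator x outside the subspace D
  reached so far splits off, D + K x being isomorphic to D \<oplus> K.\<close>

lemma field_dual_basis:
  assumes K: "field K" and Y: "left_module K Y" and fg: "finitely_generated K Y"
  shows "dual_basis K Y"
proof -
  interpret K: field K by fact
  interpret Y: left_module K Y by fact
  obtain S where S: "finite S" "S \<subseteq> carrier Y" "\<And>N. submodule N K Y \<Longrightarrow> S \<subseteq> N \<Longrightarrow> N = carrier Y"
    using fg by (auto simp: finitely_generated_def)
  have "\<exists>D. submodule D K Y \<and> S \<subseteq> D \<and> dual_basis K (Y\<lparr>carrier := D\<rparr>)" using S(1,2)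
  proof (induction S)
    case empty
    show ?case
      by (intro exI[of _ "{\<zero>\<^bsub>Y\<^esub>}"] conjI fac_null Y.submoduleI) auto
  next
    case (insert x S)
    then obtain D where D: "submodule D K Y" "S \<subseteq> D" "dual_basis K (Y\<lparr>carrier := D\<rparr>)" and x: "x \<in> carrier Y"
      by auto
    show ?case
    proof (cases "x \<in> D")
      case True
      then show ?thesis using D by auto
    next
      case False
      let ?S = "direct_sum (Y\<lparr>carrier := D\<rparr>) (regular_module K)"
      let ?f = "\<lambda>p. fst p \<oplus>\<^bsub>Y\<^esub> snd p \<odot>\<^bsub>Y\<^esub> x"
      note A = adjoin_submodule[OF Y D(1) x]
      note Ds = Y.submoduleD[OF D(1)]
      have inj: "inj_on ?f (carrier ?S)"
      proof (rule inj_on_kernel[OF A(1) Y A(2)])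
        fix p assume p: "p \<in> carrier ?S" "?f p = \<zero>\<^bsub>Y\<^esub>"
        then obtain d c where [simp]: "p = (d, c)" and dc: "d \<in> D" "c \<in> carrier K" by (cases p) auto
        have "c = \<zero>\<^bsub>K\<^esub>" by (rule field_solve[OF K Y D(1) x False dc(2,1)]) (use p Ds in simp)
        then show "p = \<zero>\<^bsub>?S\<^esub>" using p dc x Ds(1) by auto
      qed
      have "mod_iso K ?S (Y\<lparr>carrier := ?f ` carrier ?S\<rparr>)"
        unfolding mod_iso_def
        using A(1) left_module_restrict[OF Y A(3)] mod_hom_corestrict[OF A(2) subset_refl] inj
        by (auto simp: bij_betw_def)
      moreover have "dual_basis K ?S"
        by (rule fac_direct_sum_id[OF D(3) dual_basis_regular left_module_restrict[OF Y D(1)]])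
           (use left_module_regular K.ring_axioms in auto)
      ultimately have "dual_basis K (Y\<lparr>carrier := ?f ` carrier ?S\<rparr>)" by (rule fac_iso)
      then show ?thesis using A(3,5,6) D(2) by blast
    qed
  qed
  then obtain D where D: "submodule D K Y" "S \<subseteq> D" "dual_basis K (Y\<lparr>carrier := D\<rparr>)" by blast
  have "D = carrier Y" by (rule S(3)[OF D(1,2)])
  then show ?thesis using D(3) by simp
qed

text \<open>The dimension, built along a finite generating set: when D is enlarged by x, the rank on
  D is kept and 1 is added for every subspace not contained in D. During the induction the rank is
  controlled only on subspaces of D.\<close>

lemma field_finite_rank:
  assumes K: "field K" and Y: "left_module K Y" and fg: "finitely_generated K Y"
  shows "finite_rank K Y"
proof -
  interpret K: field K by fact
  interpret Y: left_module K Y by fact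
  obtain S where S: "finite S" "S \<subseteq> carrier Y" "\<And>N. submodule N K Y \<Longrightarrow> S \<subseteq> N \<Longrightarrow> N = carrier Y"
    using fg by (auto simp: finitely_generated_def)
  have "\<exists>D r. submodule D K Y \<and> S \<subseteq> D \<and> (\<forall>Q Q'. submodule Q K Y \<longrightarrow> submodule Q' K Y \<longrightarrow>
      Q' \<subseteq> D \<longrightarrow> Q \<subset> Q' \<longrightarrow> (r Q :: nat) < r Q')" using S(1,2)
  proof (induction S)
    case empty
    have "\<not> Q \<subset> Q'" if "submodule Q K Y" "Q' \<subseteq> {\<zero>\<^bsub>Y\<^esub>}" for Q Q'
      using that Y.submoduleD(2)[of Q] by auto
    moreover have "submodule {\<zero>\<^bsub>Y\<^esub>} K Y" by (rule Y.submoduleI) auto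
    ultimately show ?case by (intro exI[of _ "{\<zero>\<^bsub>Y\<^esub>}"]) auto
  next
    case (insert x S)
    then obtain D r where D: "submodule D K Y" "S \<subseteq> D" and x: "x \<in> carrier Y"
      and r': "\<forall>Q Q'. submodule Q K Y \<longrightarrow> submodule Q' K Y \<longrightarrow> Q' \<subseteq> D \<longrightarrow> Q \<subset> Q' \<longrightarrow> (r Q :: nat) < r Q'"
      by auto
    from r' have r: "r Q < r Q'" if "submodule Q K Y" "submodule Q' K Y" "Q' \<subseteq> D" "Q \<subset> Q'" for Q Q'
      using that by blast
    let ?S = "direct_sum (Y\<lparr>carrier := D\<rparr>) (regular_module K)"
    let ?f = "\<lambda>p. fst p \<oplus>\<^bsub>Y\<^esub> snd p \<odot>\<^bsub>Y\<^esub> x"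
    note A = adjoin_submodule[OF Y D(1) x]
    note Ds = Y.submoduleD[OF D(1)]
    define r' where "r' = (\<lambda>Q. r (Q \<inter> D) + (if Q \<subseteq> D then 0 else 1))"
    have int: "submodule (Q \<inter> D) K Y" if "submodule Q K Y" for Q
      using Y.submoduleD[OF that] Ds by (intro Y.submoduleI) auto
    have "r' Q < r' Q'" if Q: "submodule Q K Y" "submodule Q' K Y" "Q' \<subseteq> ?f ` carrier ?S" "Q \<subset> Q'" for Q Q'
    proof (cases "Q \<inter> D = Q' \<inter> D")
      case False
      then have "r (Q \<inter> D) < r (Q' \<inter> D)" using Q by (intro r int) auto
      then show ?thesis using Q(4) by (auto simp: r'_def)
    next
      case True
      note Qs = Y.submoduleD[OF Q(1)] and Qs' = Y.submoduleD[OF Q(2)]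
      have "\<not> Q' \<subseteq> D" using True Q(4) by auto
      \<comment> \<open>An element q of Q outside D could be used to clear the x-coordinate of any
        element of Q'; what remains lies in Q' \<inter> D = Q \<inter> D, so Q' would be contained
        in Q.\<close>
      moreover have "Q \<subseteq> D"
      proof (rule ccontr)
        assume "\<not> Q \<subseteq> D"
        then obtain q where q: "q \<in> Q" "q \<notin> D" by auto
        then have "q \<in> ?f ` carrier ?S" using Q by auto
        then obtain d c where dc: "d \<in> D" "c \<in> carrier K" "q = d \<oplus>\<^bsub>Y\<^esub> c \<odot>\<^bsub>Y\<^esub> x" by (auto simp: A(4))
        have dY: "d \<in> carrier Y" using dc Ds(1) by auto
        have "c \<noteq> \<zero>\<^bsub>K\<^esub>" using q(2) dc dY x by auto
        then have u: "c \<in> Units K" using dc by (simp add: K.field_Units)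
        have "Q' \<subseteq> Q"
        proof
          fix q' assume q': "q' \<in> Q'"
          then have "q' \<in> ?f ` carrier ?S" using Q by auto
          then obtain d' c' where dc': "d' \<in> D" "c' \<in> carrier K" "q' = d' \<oplus>\<^bsub>Y\<^esub> c' \<odot>\<^bsub>Y\<^esub> x" by (auto simp: A(4))
          have dY': "d' \<in> carrier Y" using dc' Ds(1) by auto
          \<comment> \<open>The ratio of the coefficients of x in q' and in q.\<close>
          define w where "w = c' \<otimes>\<^bsub>K\<^esub> inv\<^bsub>K\<^esub> c"
          have w: "w \<in> carrier K" "w \<otimes>\<^bsub>K\<^esub> c = c'" using u dc' dc(2) by (simp_all add: w_def K.m_assoc)
          have "w \<odot>\<^bsub>Y\<^esub> q = w \<odot>\<^bsub>Y\<^esub> d \<oplus>\<^bsub>Y\<^esub> c' \<odot>\<^bsub>Y\<^esub> x"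
            using w dY dc x by (simp add: Y.smult_r_distr flip: Y.smult_assoc)
          then have "q' \<ominus>\<^bsub>Y\<^esub> w \<odot>\<^bsub>Y\<^esub> q = d' \<ominus>\<^bsub>Y\<^esub> w \<odot>\<^bsub>Y\<^esub> d"
            using w dY dc' dY' x
            by (simp add: a_minus_def Y.M.minus_add Y.M.a_assoc abelian_group_add_cancel[OF Y.M.abelian_group_axioms])
          moreover have "d' \<ominus>\<^bsub>Y\<^esub> w \<odot>\<^bsub>Y\<^esub> d \<in> D" using Ds(4,6) w dc dc' by simp
          moreover have "q' \<ominus>\<^bsub>Y\<^esub> w \<odot>\<^bsub>Y\<^esub> q \<in> Q'" using Qs'(4,6) w q q' Q(4) by auto
          ultimately have "q' \<ominus>\<^bsub>Y\<^esub> w \<odot>\<^bsub>Y\<^esub> q \<in> Q" using True by auto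
          then have "(q' \<ominus>\<^bsub>Y\<^esub> w \<odot>\<^bsub>Y\<^esub> q) \<oplus>\<^bsub>Y\<^esub> w \<odot>\<^bsub>Y\<^esub> q \<in> Q" using Qs(3,4) w q by simp
          moreover have "(q' \<ominus>\<^bsub>Y\<^esub> w \<odot>\<^bsub>Y\<^esub> q) \<oplus>\<^bsub>Y\<^esub> w \<odot>\<^bsub>Y\<^esub> q = q'"
            using Qs'(1) q' Qs(1) q w by (auto simp: a_minus_def Y.M.a_assoc Y.M.l_neg subset_iff)
          ultimately show "q' \<in> Q" by simp
        qed
        then show False using Q(4) by auto
      qed
      ultimately show ?thesis using True by (simp add: r'_def)
    qed
    moreover have "insert x S \<subseteq> ?f ` carrier ?S" using A(5,6) D(2) by (meson insert_subsetI subset_trans)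
    ultimately show ?case using A(3) by blast
  qed
  then obtain D r where D: "submodule D K Y" "S \<subseteq> D"
    and r: "\<forall>Q Q'. submodule Q K Y \<longrightarrow> submodule Q' K Y \<longrightarrow> Q' \<subseteq> D \<longrightarrow> Q \<subset> Q' \<longrightarrow> (r Q :: nat) < r Q'" by blast
  have "D = carrier Y" by (rule S(3)[OF D])
  show ?thesis unfolding finite_rank_def
  proof (intro exI[of _ r] allI impI)
    fix Q Q' assume *: "submodule Q K Y" "submodule Q' K Y" "Q \<subset> Q'"
    then have "Q' \<subseteq> D" using Y.submoduleD(1) \<open>D = carrier Y\<close> by simp
    with * show "r Q < r Q'" using r by simp
  qed
qed

section \<open>Restriction of scalars from an algebra to its ground field\<close>

definition scalar_module ::
  "('k, 'a, 'x) module_scheme \<Rightarrow> ('a, 'm, 'y) module_scheme \<Rightarrow> ('k, 'm) module" where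
  "scalar_module A Y =
     \<lparr>carrier = carrier Y, mult = undefined, one = undefined, ring.zero = \<zero>\<^bsub>Y\<^esub>, add = add Y,
      smult = (\<lambda>c y. (c \<odot>\<^bsub>A\<^esub> \<one>\<^bsub>A\<^esub>) \<odot>\<^bsub>Y\<^esub> y)\<rparr>"

lemma scalar_module_simps [simp]:
  "carrier (scalar_module A Y) = carrier Y" "\<zero>\<^bsub>scalar_module A Y\<^esub> = \<zero>\<^bsub>Y\<^esub>" "add (scalar_module A Y) = add Y"
  "c \<odot>\<^bsub>scalar_module A Y\<^esub> y = (c \<odot>\<^bsub>A\<^esub> \<one>\<^bsub>A\<^esub>) \<odot>\<^bsub>Y\<^esub> y"
  by (auto simp: scalar_module_def)

lemma module_left_module:
  assumes "Module.module R M"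
  shows "left_module R M"
proof -
  interpret Module.module R M by fact
  show ?thesis
  proof (rule left_moduleI)
    show "\<exists>y\<in>carrier M. y \<oplus>\<^bsub>M\<^esub> x = \<zero>\<^bsub>M\<^esub>" if "x \<in> carrier M" for x
      using that by (intro bexI[of _ "\<ominus>\<^bsub>M\<^esub> x"]) (auto simp: M.l_neg)
  qed (auto simp: M.a_ac smult_l_distr smult_r_distr smult_assoc1 R.ring_axioms)
qed

context fd_algebra
begin

lemma field_K: "field K" and ring_A: "ring A" and module_A: "Module.module K A"
  by unfold_locales

lemma scalar_closed [simp]: "c \<in> carrier K \<Longrightarrow> a \<in> carrier A \<Longrightarrow> c \<odot>\<^bsub>A\<^esub> a \<in> carrier A"
  using Module.module.smult_closed[OF module_A] .

lemma scalar_one: "c \<in> carrier K \<Longrightarrow> a \<in> carrier A \<Longrightarrow> (c \<odot>\<^bsub>A\<^esub> \<one>\<^bsub>A\<^esub>) \<otimes>\<^bsub>A\<^esub> a = c \<odot>\<^bsub>A\<^esub> a"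
  and scalar_one': "c \<in> carrier K \<Longrightarrow> a \<in> carrier A \<Longrightarrow> a \<otimes>\<^bsub>A\<^esub> (c \<odot>\<^bsub>A\<^esub> \<one>\<^bsub>A\<^esub>) = c \<odot>\<^bsub>A\<^esub> a"
  using smult_mult_left[of c "\<one>\<^bsub>A\<^esub>" a] smult_mult_right[of c a "\<one>\<^bsub>A\<^esub>"] ring.ring_simprules(12)[OF ring_A]
    monoid.l_one[OF ring.is_monoid[OF ring_A]] monoid.r_one[OF ring.is_monoid[OF ring_A]]
    monoid.one_closed[OF ring.is_monoid[OF ring_A]] by auto

lemma left_module_A: "left_module K A"
  by (rule module_left_module[OF module_A])

lemma left_module_scalar:
  assumes "left_module A Y"
  shows "left_module K (scalar_module A Y)"
proof -
  interpret Y: left_module A Y by fact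
  interpret KA: left_module K A by (rule left_module_A)
  interpret AA: ring A by (rule ring_A)
  have one: "\<one>\<^bsub>A\<^esub> \<in> carrier A" by simp
  show ?thesis
  proof (rule left_moduleI)
    show "ring K" by (rule left_module.axioms(1)[OF left_module_A])
    show "\<exists>y\<in>carrier (scalar_module A Y). y \<oplus>\<^bsub>scalar_module A Y\<^esub> x = \<zero>\<^bsub>scalar_module A Y\<^esub>"
      if "x \<in> carrier (scalar_module A Y)" for x
      using that by (intro bexI[of _ "\<ominus>\<^bsub>Y\<^esub> x"]) (auto simp: Y.M.l_neg)
    show "(c \<otimes>\<^bsub>K\<^esub> c') \<odot>\<^bsub>scalar_module A Y\<^esub> x = c \<odot>\<^bsub>scalar_module A Y\<^esub> (c' \<odot>\<^bsub>scalar_module A Y\<^esub> x)"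
      if "c \<in> carrier K" "c' \<in> carrier K" "x \<in> carrier (scalar_module A Y)" for c c' x
      using that one by (simp add: scalar_one KA.smult_assoc flip: Y.smult_assoc)
  qed (use one in \<open>auto simp: Y.M.a_ac KA.smult_l_distr Y.smult_l_distr Y.smult_r_distr KA.smult_one Y.smult_one\<close>)
qed

lemma submodule_scalar:
  assumes "left_module A Y" "submodule Q A Y"
  shows "submodule Q K (scalar_module A Y)"
proof -
  interpret Y: left_module A Y by fact
  interpret S: left_module K "scalar_module A Y" by (rule left_module_scalar[OF assms(1)])
  interpret AA: ring A by (rule ring_A)
  show ?thesis using Y.submoduleD[OF assms(2)] by (intro S.submoduleI) auto
qed

text \<open>Products of K-generators of A with A-generators of Y generate over K.\<close>

lemma fg_scalar:
  assumes "left_module A Y" "finitely_generated A Y"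
  shows "finitely_generated K (scalar_module A Y)"
proof -
  interpret Y: left_module A Y by fact
  interpret S: left_module K "scalar_module A Y" by (rule left_module_scalar[OF assms(1)])
  interpret KA: left_module K A by (rule left_module_A)
  interpret AA: ring A by (rule ring_A)
  obtain X where X: "finite X" "X \<subseteq> carrier A" "\<And>N. submodule N K A \<Longrightarrow> X \<subseteq> N \<Longrightarrow> N = carrier A"
    using finite_dimensional by (auto simp: finitely_generated_def)
  obtain Z where Z: "finite Z" "Z \<subseteq> carrier Y" "\<And>N. submodule N A Y \<Longrightarrow> Z \<subseteq> N \<Longrightarrow> N = carrier Y"
    using assms(2) by (auto simp: finitely_generated_def)
  let ?G = "(\<lambda>(a, y). a \<odot>\<^bsub>Y\<^esub> y) ` (X \<times> Z)"
  show ?thesis unfolding finitely_generated_def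
  proof (intro exI[of _ ?G] conjI allI impI)
    show "?G \<subseteq> carrier (scalar_module A Y)" using X Z by auto
    fix N assume N: "submodule N K (scalar_module A Y) \<and> ?G \<subseteq> N"
    note Ns = S.submoduleD[of N]
    have 1: "{a \<in> carrier A. a \<odot>\<^bsub>Y\<^esub> z \<in> N} = carrier A" if z: "z \<in> Z" for z
    proof (rule X(3))
      have zY: "z \<in> carrier Y" using z Z by auto
      have "c \<odot>\<^bsub>A\<^esub> a \<odot>\<^bsub>Y\<^esub> z \<in> N" if "c \<in> carrier K" "a \<in> carrier A" "a \<odot>\<^bsub>Y\<^esub> z \<in> N" for c a
        using that Ns(4)[of c "a \<odot>\<^bsub>Y\<^esub> z"] N zY by (simp add: scalar_one flip: Y.smult_assoc)
      then show "submodule {a \<in> carrier A. a \<odot>\<^bsub>Y\<^esub> z \<in> N} K A"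
        using Ns N zY by (intro KA.submoduleI) (auto simp: Y.smult_l_distr)
      show "X \<subseteq> {a \<in> carrier A. a \<odot>\<^bsub>Y\<^esub> z \<in> N}" using X N z by auto
    qed
    \<comment> \<open>N is only a K-subspace, but the y with A y inside N form an A-submodule, so
      that generation over A applies.\<close>
    have 2: "{y \<in> carrier Y. \<forall>a\<in>carrier A. a \<odot>\<^bsub>Y\<^esub> y \<in> N} = carrier Y"
    proof (rule Z(3))
      show "submodule {y \<in> carrier Y. \<forall>a\<in>carrier A. a \<odot>\<^bsub>Y\<^esub> y \<in> N} A Y"
        using Ns N by (intro Y.submoduleI) (auto simp: Y.smult_r_distr simp flip: Y.smult_assoc)
      show "Z \<subseteq> {y \<in> carrier Y. \<forall>a\<in>carrier A. a \<odot>\<^bsub>Y\<^esub> y \<in> N}" using Z 1 by auto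
    qed
    have "y \<in> N" if "y \<in> carrier Y" for y
    proof -
      have "y \<in> {y \<in> carrier Y. \<forall>a\<in>carrier A. a \<odot>\<^bsub>Y\<^esub> y \<in> N}" using 2 that by simp
      then have "\<one>\<^bsub>A\<^esub> \<odot>\<^bsub>Y\<^esub> y \<in> N" by simp
      then show ?thesis using that by (simp add: Y.smult_one)
    qed
    then show "N = carrier (scalar_module A Y)" using Ns(1) N by auto
  qed (use X Z in auto)
qed

text \<open>Submodules over A are subspaces over K, so the dimension serves as the rank.\<close>

lemma finite_rank_fg:
  assumes "left_module A Y" "finitely_generated A Y"
  shows "finite_rank A Y"
proof -
  obtain r :: "_ \<Rightarrow> nat" where r: "\<forall>Q Q'. submodule Q K (scalar_module A Y) \<longrightarrow> submodule Q' K (scalar_module A Y) \<longrightarrow>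
      Q \<subset> Q' \<longrightarrow> r Q < r Q'"
    using field_finite_rank[OF field_K left_module_scalar[OF assms(1)] fg_scalar[OF assms]]
    unfolding finite_rank_def by (elim exE)
  show ?thesis unfolding finite_rank_def
    by (intro exI[of _ r] allI impI) (use r submodule_scalar[OF assms(1)] in simp)
qed

lemma finite_rank_free: "finite_rank A (direct_power n (regular_module A))"
proof (rule finite_rank_fg)
  show L: "left_module A (direct_power n (regular_module A))"
    by (intro left_module_direct_power left_module_regular ring_A)
  show "finitely_generated A (direct_power n (regular_module A))"
    by (intro fg_dual_basis[OF L] fac_direct_power_id left_module_regular ring_A)
qed

end

section \<open>Tensor products\<close>

lemma opposite_simps [simp]:
  "carrier (opposite B) = carrier B" "add (opposite B) = add B" "\<zero>\<^bsub>opposite B\<^esub> = \<zero>\<^bsub>B\<^esub>"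
  "\<one>\<^bsub>opposite B\<^esub> = \<one>\<^bsub>B\<^esub>" "a \<otimes>\<^bsub>opposite B\<^esub> b = b \<otimes>\<^bsub>B\<^esub> a"
  by (auto simp: opposite_def)

lemma right_part_simps [simp]:
  "carrier (right_part M) = carrier M" "add (right_part M) = add M" "\<zero>\<^bsub>right_part M\<^esub> = \<zero>\<^bsub>M\<^esub>"
  "b \<odot>\<^bsub>right_part M\<^esub> x = rsmult M x b"
  by (auto simp: right_part_def)

text \<open>The pure tensor x \<otimes> y.\<close>

definition tp where "tp B M N x y = tensor_class B M N (frag_of (x, y))"

definition balanced where
  "balanced B M N H \<beta> \<longleftrightarrow>
     (\<forall>x\<in>carrier M. \<forall>y\<in>carrier N. \<beta> x y \<in> carrier H) \<and>
     (\<forall>x\<in>carrier M. \<forall>x'\<in>carrier M. \<forall>y\<in>carrier N. \<beta> (x \<oplus>\<^bsub>M\<^esub> x') y = \<beta> x y \<oplus>\<^bsub>H\<^esub> \<beta> x' y) \<and>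
     (\<forall>x\<in>carrier M. \<forall>y\<in>carrier N. \<forall>y'\<in>carrier N. \<beta> x (y \<oplus>\<^bsub>N\<^esub> y') = \<beta> x y \<oplus>\<^bsub>H\<^esub> \<beta> x y') \<and>
     (\<forall>x\<in>carrier M. \<forall>b\<in>carrier B. \<forall>y\<in>carrier N. \<beta> (rsmult M x b) y = \<beta> x (b \<odot>\<^bsub>N\<^esub> y))"

lemma balancedI:
  assumes "\<And>x y. x \<in> carrier M \<Longrightarrow> y \<in> carrier N \<Longrightarrow> \<beta> x y \<in> carrier H"
    and "\<And>x x' y. x \<in> carrier M \<Longrightarrow> x' \<in> carrier M \<Longrightarrow> y \<in> carrier N \<Longrightarrow> \<beta> (x \<oplus>\<^bsub>M\<^esub> x') y = \<beta> x y \<oplus>\<^bsub>H\<^esub> \<beta> x' y"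
    and "\<And>x y y'. x \<in> carrier M \<Longrightarrow> y \<in> carrier N \<Longrightarrow> y' \<in> carrier N \<Longrightarrow> \<beta> x (y \<oplus>\<^bsub>N\<^esub> y') = \<beta> x y \<oplus>\<^bsub>H\<^esub> \<beta> x y'"
    and "\<And>x b y. x \<in> carrier M \<Longrightarrow> b \<in> carrier B \<Longrightarrow> y \<in> carrier N \<Longrightarrow> \<beta> (rsmult M x b) y = \<beta> x (b \<odot>\<^bsub>N\<^esub> y)"
  shows "balanced B M N H \<beta>"
  using assms by (auto simp: balanced_def)

text \<open>Coordinate forms, right actions and maps induced by right-linear maps respect only the
  addition of a tensor product; this notion covers them together with the linear maps.\<close>

definition additive_map where
  "additive_map M N f \<longleftrightarrow> (\<forall>x\<in>carrier M. f x \<in> carrier N) \<and>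
     (\<forall>x\<in>carrier M. \<forall>y\<in>carrier M. f (x \<oplus>\<^bsub>M\<^esub> y) = f x \<oplus>\<^bsub>N\<^esub> f y)"

lemma additive_mapD:
  "additive_map M N f \<Longrightarrow> x \<in> carrier M \<Longrightarrow> f x \<in> carrier N"
  "additive_map M N f \<Longrightarrow> x \<in> carrier M \<Longrightarrow> y \<in> carrier M \<Longrightarrow> f (x \<oplus>\<^bsub>M\<^esub> y) = f x \<oplus>\<^bsub>N\<^esub> f y"
  by (auto simp: additive_map_def)

text \<open>The assumptions keep the defining relations inside the free abelian group. Tensor
  products over A and B and the one over K behind the enveloping algebra are all instances.\<close>

locale tensor_pair =
  fixes B :: "('b, 'w) ring_scheme"
    and M :: "('a, 'b, 'm, 'x) bimodule_scheme"
    and N :: "('b, 'n, 'y) module_scheme"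
  assumes abelian_M: "abelian_group M"
    and abelian_N: "abelian_group N"
    and rsmult_closed [simp]: "x \<in> carrier M \<Longrightarrow> b \<in> carrier B \<Longrightarrow> rsmult M x b \<in> carrier M"
    and smult_closed [simp]: "y \<in> carrier N \<Longrightarrow> b \<in> carrier B \<Longrightarrow> b \<odot>\<^bsub>N\<^esub> y \<in> carrier N"
begin

abbreviation "FG \<equiv> free_Abelian_group (carrier M \<times> carrier N)"
abbreviation "TK \<equiv> tensor_kernel B M N"
abbreviation "cl \<equiv> tensor_class B M N"
abbreviation "TG \<equiv> tensor_group B M N"
abbreviation "pure \<equiv> tp B M N"

interpretation M: abelian_group M by (rule abelian_M)
interpretation N: abelian_group N by (rule abelian_N)
interpretation FG: comm_group FG by (rule abelian_free_Abelian_group)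

lemma relations_subset: "tensor_relations B M N \<subseteq> carrier FG"
proof -
  have "frag_of a - frag_of b - frag_of c \<in> carrier FG" "frag_of a - frag_of b \<in> carrier FG"
    if "a \<in> carrier M \<times> carrier N" "b \<in> carrier M \<times> carrier N" "c \<in> carrier M \<times> carrier N" for a b c
    using that keys_diff[of "frag_of a - frag_of b" "frag_of c"] keys_diff[of "frag_of a" "frag_of b"]
    by auto
  then show ?thesis unfolding tensor_relations_def by auto
qed

lemma TK_subgroup: "subgroup TK FG"
  unfolding tensor_kernel_def by (rule FG.generate_is_subgroup[OF relations_subset])

lemma TK_normal: "TK \<lhd> FG"
  by (rule FG.subgroup_imp_normal[OF TK_subgroup])

lemma TK_closed: "TK \<subseteq> carrier FG" "0 \<in> TK" "p \<in> TK \<Longrightarrow> q \<in> TK \<Longrightarrow> p + q \<in> TK" "p \<in> TK \<Longrightarrow> - p \<in> TK"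
  "p \<in> TK \<Longrightarrow> q \<in> TK \<Longrightarrow> p - q \<in> TK"
proof -
  show "TK \<subseteq> carrier FG" by (rule subgroup.subset[OF TK_subgroup])
  have keys: "Poly_Mapping.keys p \<subseteq> carrier M \<times> carrier N" if "p \<in> TK" for p
    using subsetD[OF subgroup.subset[OF TK_subgroup] that] by (simp only: carrier_free_Abelian_group_iff)
  show "0 \<in> TK" "p \<in> TK \<Longrightarrow> q \<in> TK \<Longrightarrow> p + q \<in> TK" for p q
    using subgroup.one_closed[OF TK_subgroup] subgroup.m_closed[OF TK_subgroup] by auto
  show neg: "p \<in> TK \<Longrightarrow> - p \<in> TK" for p
    using subgroup.m_inv_closed[OF TK_subgroup, of p] keys[of p] by simp
  show "p \<in> TK \<Longrightarrow> q \<in> TK \<Longrightarrow> p - q \<in> TK"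
    using subgroup.m_closed[OF TK_subgroup, of p "- q"] neg[of q] by simp
qed

lemma cl_iff: "q \<in> cl p \<longleftrightarrow> q - p \<in> TK"
  by (auto simp: tensor_class_def r_coset_def) (metis diff_add_cancel)

lemma cl_eq_iff: "cl p = cl q \<longleftrightarrow> p - q \<in> TK"
proof
  assume "cl p = cl q"
  then show "p - q \<in> TK" using cl_iff[of p p] cl_iff[of p q] TK_closed(2) by simp
next
  assume *: "p - q \<in> TK"
  have "r - q \<in> TK \<longleftrightarrow> r - p \<in> TK" for r
    using TK_closed(3)[OF _ *, of "r - p"] TK_closed(5)[OF _ *, of "r - q"] by auto
  then show "cl p = cl q" by (auto simp: cl_iff)
qed

text \<open>Operations on tensors are defined as unions over representatives; once the members of
  such a union agree, it equals their common value.\<close>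

lemma UN_cl:
  assumes "\<And>r. r \<in> cl p \<Longrightarrow> f r = f p"
  shows "(\<Union>r\<in>cl p. f r) = f p"
proof -
  have "p \<in> cl p" by (simp add: cl_iff TK_closed(2))
  then show ?thesis using assms by blast
qed

lemma TK_induct:
  assumes "p \<in> TK" "P 0" "\<And>p q. P p \<Longrightarrow> P q \<Longrightarrow> P (p + q)" "\<And>p. P p \<Longrightarrow> P (- p)"
    and "\<And>x x' y. x \<in> carrier M \<Longrightarrow> x' \<in> carrier M \<Longrightarrow> y \<in> carrier N \<Longrightarrow>
      P (frag_of (x \<oplus>\<^bsub>M\<^esub> x', y) - frag_of (x, y) - frag_of (x', y))"
    and "\<And>x y y'. x \<in> carrier M \<Longrightarrow> y \<in> carrier N \<Longrightarrow> y' \<in> carrier N \<Longrightarrow>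
      P (frag_of (x, y \<oplus>\<^bsub>N\<^esub> y') - frag_of (x, y) - frag_of (x, y'))"
    and "\<And>x b y. x \<in> carrier M \<Longrightarrow> b \<in> carrier B \<Longrightarrow> y \<in> carrier N \<Longrightarrow>
      P (frag_of (rsmult M x b, y) - frag_of (x, b \<odot>\<^bsub>N\<^esub> y))"
  shows "P p"
proof -
  have rel: "P r" if "r \<in> tensor_relations B M N" for r
    using that assms(5-7) unfolding tensor_relations_def by auto
  show ?thesis using assms(1) unfolding tensor_kernel_def
  proof induction
    case (inv h)
    have "Poly_Mapping.keys h \<subseteq> carrier M \<times> carrier N"
      using subsetD[OF relations_subset inv] by (simp only: carrier_free_Abelian_group_iff)
    then show ?case using assms(4)[OF rel[OF inv]] by simp
  qed (use assms(2,3) rel in auto)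
qed

lemma TK_relations:
  shows "x \<in> carrier M \<Longrightarrow> x' \<in> carrier M \<Longrightarrow> y \<in> carrier N \<Longrightarrow>
      frag_of (x \<oplus>\<^bsub>M\<^esub> x', y) - frag_of (x, y) - frag_of (x', y) \<in> TK"
    and "x \<in> carrier M \<Longrightarrow> y \<in> carrier N \<Longrightarrow> y' \<in> carrier N \<Longrightarrow>
      frag_of (x, y \<oplus>\<^bsub>N\<^esub> y') - frag_of (x, y) - frag_of (x, y') \<in> TK"
    and "x \<in> carrier M \<Longrightarrow> b \<in> carrier B \<Longrightarrow> y \<in> carrier N \<Longrightarrow>
      frag_of (rsmult M x b, y) - frag_of (x, b \<odot>\<^bsub>N\<^esub> y) \<in> TK"
  unfolding tensor_kernel_def tensor_relations_def by (rule generate.incl; blast)+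

lemma carrier_TG: "carrier TG = cl ` carrier FG"
  by (auto simp: tensor_group_def tensor_class_def carrier_FactGroup)

lemma comm_group_TG: "comm_group TG"
  unfolding tensor_group_def by (rule FG.abelian_FactGroup[OF TK_subgroup])

lemma cl_add: "p \<in> carrier FG \<Longrightarrow> q \<in> carrier FG \<Longrightarrow> cl p \<otimes>\<^bsub>TG\<^esub> cl q = cl (p + q)"
  using normal.rcos_sum[OF TK_normal, of p q] by (simp add: tensor_group_def tensor_class_def)

lemma one_TG: "\<one>\<^bsub>TG\<^esub> = cl 0"
  using FG.coset_join2[of 0 TK] TK_subgroup TK_closed(2) by (simp add: tensor_group_def tensor_class_def)

lemma pure_closed [simp]: "x \<in> carrier M \<Longrightarrow> y \<in> carrier N \<Longrightarrow> pure x y \<in> carrier TG"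
  by (auto simp: carrier_TG tp_def)

lemma frag_closed: "p \<in> carrier FG \<Longrightarrow> q \<in> carrier FG \<Longrightarrow> p + q \<in> carrier FG"
  using FG.m_closed[of p q] by simp

lemma pure_add_left: "x \<in> carrier M \<Longrightarrow> x' \<in> carrier M \<Longrightarrow> y \<in> carrier N \<Longrightarrow>
    pure (x \<oplus>\<^bsub>M\<^esub> x') y = pure x y \<otimes>\<^bsub>TG\<^esub> pure x' y"
  using TK_relations(1)[of x x' y] unfolding tp_def
  by (subst cl_add) (auto simp: cl_eq_iff diff_diff_eq)

lemma pure_add_right: "x \<in> carrier M \<Longrightarrow> y \<in> carrier N \<Longrightarrow> y' \<in> carrier N \<Longrightarrow>
    pure x (y \<oplus>\<^bsub>N\<^esub> y') = pure x y \<otimes>\<^bsub>TG\<^esub> pure x y'"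
  using TK_relations(2)[of x y y'] unfolding tp_def
  by (subst cl_add) (auto simp: cl_eq_iff diff_diff_eq)

lemma pure_balanced: "x \<in> carrier M \<Longrightarrow> b \<in> carrier B \<Longrightarrow> y \<in> carrier N \<Longrightarrow>
    pure (rsmult M x b) y = pure x (b \<odot>\<^bsub>N\<^esub> y)"
  using TK_relations(3)[of x b y] unfolding tp_def by (simp add: cl_eq_iff)

text \<open>Every tensor is a sum of pure tensors without signs, since -(x \<otimes> y) = (-x)
  \<otimes> y. As the induction over the free group proceeds by differences, the property is proved
  for a class together with its inverse.\<close>

lemma TG_induct:
  assumes "t \<in> carrier TG"
    and pure: "\<And>x y. x \<in> carrier M \<Longrightarrow> y \<in> carrier N \<Longrightarrow> P (pure x y)"
    and add: "\<And>s t. s \<in> carrier TG \<Longrightarrow> t \<in> carrier TG \<Longrightarrow> P s \<Longrightarrow> P t \<Longrightarrow> P (s \<otimes>\<^bsub>TG\<^esub> t)"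
  shows "P t"
proof -
  interpret TG: comm_group TG by (rule comm_group_TG)
  have z: "pure \<zero>\<^bsub>M\<^esub> y = \<one>\<^bsub>TG\<^esub>" if "y \<in> carrier N" for y
    using pure_add_left[of "\<zero>\<^bsub>M\<^esub>" "\<zero>\<^bsub>M\<^esub>" y] that by simp
  have neg: "inv\<^bsub>TG\<^esub> pure x y = pure (\<ominus>\<^bsub>M\<^esub> x) y" if "x \<in> carrier M" "y \<in> carrier N" for x y
    using pure_add_left[of "\<ominus>\<^bsub>M\<^esub> x" x y] that z[of y] by (intro TG.inv_equality) (simp_all add: M.l_neg)
  obtain p where p: "p \<in> carrier FG" "t = cl p" using assms(1) by (auto simp: carrier_TG)
  have "P (cl p) \<and> P (inv\<^bsub>TG\<^esub> (cl p))"
  proof (rule free_Abelian_group_induct[OF p(1)[unfolded carrier_free_Abelian_group_iff]])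
    show "P (cl 0) \<and> P (inv\<^bsub>TG\<^esub> (cl 0))"
      using pure[of "\<zero>\<^bsub>M\<^esub>" "\<zero>\<^bsub>N\<^esub>"] z[of "\<zero>\<^bsub>N\<^esub>"] by (simp flip: one_TG)
    show "P (cl (frag_of a)) \<and> P (inv\<^bsub>TG\<^esub> (cl (frag_of a)))" if "a \<in> carrier M \<times> carrier N" for a
      using pure neg that by (cases a) (auto simp flip: tp_def)
    fix p q assume pq: "Poly_Mapping.keys p \<subseteq> carrier M \<times> carrier N" "Poly_Mapping.keys q \<subseteq> carrier M \<times> carrier N"
      "P (cl p) \<and> P (inv\<^bsub>TG\<^esub> (cl p))" "P (cl q) \<and> P (inv\<^bsub>TG\<^esub> (cl q))"
    have c: "cl p \<in> carrier TG" "cl q \<in> carrier TG" using pq by (auto simp: carrier_TG)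
    have inv: "inv\<^bsub>TG\<^esub> cl q = cl (- q)"
      using pq cl_add[of "- q" q] c by (intro TG.inv_equality) (auto simp: one_TG carrier_TG)
    have "cl (p - q) = cl p \<otimes>\<^bsub>TG\<^esub> inv\<^bsub>TG\<^esub> cl q"
      using pq unfolding inv by (subst cl_add) auto
    then show "P (cl (p - q)) \<and> P (inv\<^bsub>TG\<^esub> (cl (p - q)))" using pq c add by (simp add: TG.inv_mult)
  qed
  then show ?thesis using p by simp
qed

lemma tensor_universal:
  assumes "abelian_group H" "balanced B M N H \<beta>"
  obtains h where "\<And>t. t \<in> carrier TG \<Longrightarrow> h t \<in> carrier H"
    "\<And>s t. s \<in> carrier TG \<Longrightarrow> t \<in> carrier TG \<Longrightarrow> h (s \<otimes>\<^bsub>TG\<^esub> t) = h s \<oplus>\<^bsub>H\<^esub> h t"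
    "\<And>x y. x \<in> carrier M \<Longrightarrow> y \<in> carrier N \<Longrightarrow> h (pure x y) = \<beta> x y"
proof -
  interpret H: abelian_group H by fact
  have \<beta>: "\<And>x y. x \<in> carrier M \<Longrightarrow> y \<in> carrier N \<Longrightarrow> \<beta> x y \<in> carrier H"
    "\<And>x x' y. x \<in> carrier M \<Longrightarrow> x' \<in> carrier M \<Longrightarrow> y \<in> carrier N \<Longrightarrow> \<beta> (x \<oplus>\<^bsub>M\<^esub> x') y = \<beta> x y \<oplus>\<^bsub>H\<^esub> \<beta> x' y"
    "\<And>x y y'. x \<in> carrier M \<Longrightarrow> y \<in> carrier N \<Longrightarrow> y' \<in> carrier N \<Longrightarrow> \<beta> x (y \<oplus>\<^bsub>N\<^esub> y') = \<beta> x y \<oplus>\<^bsub>H\<^esub> \<beta> x y'"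
    "\<And>x b y. x \<in> carrier M \<Longrightarrow> b \<in> carrier B \<Longrightarrow> y \<in> carrier N \<Longrightarrow> \<beta> (rsmult M x b) y = \<beta> x (b \<odot>\<^bsub>N\<^esub> y)"
    using assms(2) unfolding balanced_def by auto
  obtain g where g: "g \<in> hom FG (add_monoid H)" "\<And>z. z \<in> carrier M \<times> carrier N \<Longrightarrow> g (frag_of z) = case_prod \<beta> z"
    using comm_group.free_Abelian_group_universal[OF H.a_comm_group, of "case_prod \<beta>" "carrier M \<times> carrier N"] \<beta>(1)
    by (auto simp: image_subset_iff)
  interpret g: group_hom FG "add_monoid H" g
    by (intro group_hom.intro group_hom_axioms.intro g(1)) (simp_all add: H.a_group)
  have gadd: "g (p + q) = g p \<oplus>\<^bsub>H\<^esub> g q" if "p \<in> carrier FG" "q \<in> carrier FG" for p q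
    using g.hom_mult[OF that] by simp
  have gc: "g p \<in> carrier H" if "p \<in> carrier FG" for p using g.hom_closed[OF that] by simp
  have gneg: "g (- p) = \<ominus>\<^bsub>H\<^esub> g p" if "p \<in> carrier FG" for p
    using g.hom_inv[OF that] that by (simp add: a_inv_def)
  have diff_closed: "p - q \<in> carrier FG" "- p \<in> carrier FG" if "p \<in> carrier FG" "q \<in> carrier FG" for p q
    using that keys_diff[of p q] unfolding carrier_free_Abelian_group_iff keys_minus by blast+
  have gdiff: "g (p - q) = g p \<ominus>\<^bsub>H\<^esub> g q" if "p \<in> carrier FG" "q \<in> carrier FG" for p q
    using gadd[of p "- q"] gneg[OF that(2)] that by (simp add: a_minus_def)
  have of: "frag_of (x, y) \<in> carrier FG" if "x \<in> carrier M" "y \<in> carrier N" for x y using that by simp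
  \<comment> \<open>Membership is carried through the induction because g is known to be additive on
    the free group only.\<close>
  have "p \<in> carrier FG \<and> g p = \<zero>\<^bsub>H\<^esub>" if "p \<in> TK" for p
    using that
  proof (rule TK_induct)
    show "0 \<in> carrier FG \<and> g 0 = \<zero>\<^bsub>H\<^esub>" using g.hom_one by simp
    show "p + q \<in> carrier FG \<and> g (p + q) = \<zero>\<^bsub>H\<^esub>" if "p \<in> carrier FG \<and> g p = \<zero>\<^bsub>H\<^esub>" "q \<in> carrier FG \<and> g q = \<zero>\<^bsub>H\<^esub>" for p q
      using that frag_closed[of p q] gadd[of p q] by simp
    show "- p \<in> carrier FG \<and> g (- p) = \<zero>\<^bsub>H\<^esub>" if "p \<in> carrier FG \<and> g p = \<zero>\<^bsub>H\<^esub>" for p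
      using that gneg[of p] by simp
    fix x x' y assume *: "x \<in> carrier M" "x' \<in> carrier M" "y \<in> carrier N"
    show "frag_of (x \<oplus>\<^bsub>M\<^esub> x', y) - frag_of (x, y) - frag_of (x', y) \<in> carrier FG \<and>
      g (frag_of (x \<oplus>\<^bsub>M\<^esub> x', y) - frag_of (x, y) - frag_of (x', y)) = \<zero>\<^bsub>H\<^esub>"
      using * by (simp add: gdiff diff_closed of g(2) \<beta> a_minus_def H.a_ac H.r_neg abelian_group_add_cancel[OF assms(1)] del: carrier_free_Abelian_group_iff)
  next
    fix x y y' assume *: "x \<in> carrier M" "y \<in> carrier N" "y' \<in> carrier N"
    show "frag_of (x, y \<oplus>\<^bsub>N\<^esub> y') - frag_of (x, y) - frag_of (x, y') \<in> carrier FG \<and>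
      g (frag_of (x, y \<oplus>\<^bsub>N\<^esub> y') - frag_of (x, y) - frag_of (x, y')) = \<zero>\<^bsub>H\<^esub>"
      using * by (simp add: gdiff diff_closed of g(2) \<beta> a_minus_def H.a_ac H.r_neg abelian_group_add_cancel[OF assms(1)] del: carrier_free_Abelian_group_iff)
  next
    fix x b y assume *: "x \<in> carrier M" "b \<in> carrier B" "y \<in> carrier N"
    show "frag_of (rsmult M x b, y) - frag_of (x, b \<odot>\<^bsub>N\<^esub> y) \<in> carrier FG \<and>
      g (frag_of (rsmult M x b, y) - frag_of (x, b \<odot>\<^bsub>N\<^esub> y)) = \<zero>\<^bsub>H\<^esub>"
      using * by (simp add: gdiff diff_closed of g(2) \<beta> a_minus_def H.r_neg del: carrier_free_Abelian_group_iff)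
  qed
  then have "TK \<subseteq> kernel FG (add_monoid H) g" by (auto simp: kernel_def)
  then obtain h where h: "h \<in> hom TG (add_monoid H)" "\<And>p. p \<in> carrier FG \<Longrightarrow> h (cl p) = g p"
    using g.FactGroup_universal_kernel[OF TK_normal] unfolding tensor_group_def tensor_class_def by metis
  show ?thesis
  proof (rule that[of h])
    show "h t \<in> carrier H" if "t \<in> carrier TG" for t using h(1) that by (auto simp: hom_def)
    show "h (s \<otimes>\<^bsub>TG\<^esub> t) = h s \<oplus>\<^bsub>H\<^esub> h t" if "s \<in> carrier TG" "t \<in> carrier TG" for s t
      using h(1) that by (auto simp: hom_def)
    show "h (pure x y) = \<beta> x y" if "x \<in> carrier M" "y \<in> carrier N" for x y
      using h(2)[of "frag_of (x, y)"] g(2)[of "(x, y)"] that by (simp add: tp_def)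
  qed
qed

text \<open>Independence of the representative for a map F of formal sums that respects differences
  and sends relations to relations; \<open>cl'\<close> and \<open>K'\<close> are the classes and the
  relations of the target.\<close>

lemma UN_cl_action:
  assumes p: "p \<in> carrier FG"
    and F: "\<And>p q. F (p - q) = F p - (F q :: _ \<Rightarrow>\<^sub>0 int)" "\<And>p. p \<in> TK \<Longrightarrow> F p \<in> K'"
    and eq: "\<And>p q. cl' p = cl' q \<longleftrightarrow> p - q \<in> K'"
  shows "(\<Union>r\<in>cl p. cl' (F r)) = cl' (F p)"
  by (rule UN_cl) (use F in \<open>simp add: eq cl_iff flip: F(1)\<close>)

text \<open>Well-definedness of f \<otimes> g. With f and g taken as the identity or as
  multiplication by an algebra element, this covers both actions on a tensor product and the
  multiplication of the enveloping algebra.\<close>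

lemma frag_map_TK:
  assumes "\<And>x x'. x \<in> carrier M \<Longrightarrow> x' \<in> carrier M \<Longrightarrow> f (x \<oplus>\<^bsub>M\<^esub> x') = f x \<oplus>\<^bsub>M'\<^esub> f x'"
    and "\<And>x. x \<in> carrier M \<Longrightarrow> f x \<in> carrier M'"
    and "\<And>y y'. y \<in> carrier N \<Longrightarrow> y' \<in> carrier N \<Longrightarrow> g (y \<oplus>\<^bsub>N\<^esub> y') = g y \<oplus>\<^bsub>N'\<^esub> g y'"
    and "\<And>y. y \<in> carrier N \<Longrightarrow> g y \<in> carrier N'"
    and "\<And>x b. x \<in> carrier M \<Longrightarrow> b \<in> carrier B \<Longrightarrow> f (rsmult M x b) = rsmult M' (f x) b"
    and "\<And>y b. y \<in> carrier N \<Longrightarrow> b \<in> carrier B \<Longrightarrow> g (b \<odot>\<^bsub>N\<^esub> y) = b \<odot>\<^bsub>N'\<^esub> g y"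
    and "tensor_pair B M' N'"
    and "p \<in> TK"
  shows "frag_extend (\<lambda>(x, y). frag_of (f x, g y)) p \<in> tensor_kernel B M' N'"
proof -
  interpret T': tensor_pair B M' N' by fact
  show ?thesis using assms(8)
    by (rule TK_induct)
       (use T'.TK_relations T'.TK_closed assms(1-6) in \<open>auto simp: frag_extend_add frag_extend_diff frag_extend_minus\<close>)
qed

end

text \<open>The left-module part of \<open>tensor_bimodule\<close>, so that the second factor may be
  a mere left module.\<close>

definition tens ::
  "('b, 'w) ring_scheme \<Rightarrow> ('a, 'b, 'm, 'x) bimodule_scheme \<Rightarrow> ('b, 'n, 'y) module_scheme
    \<Rightarrow> ('a, ('m \<times> 'n \<Rightarrow>\<^sub>0 int) set) module" where
  "tens B M N =
     \<lparr>carrier = carrier (tensor_group B M N), mult = undefined, one = undefined,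
      ring.zero = \<one>\<^bsub>tensor_group B M N\<^esub>, add = mult (tensor_group B M N),
      smult = (\<lambda>a X. \<Union>p\<in>X. tensor_class B M N (frag_extend (\<lambda>(x, y). frag_of (a \<odot>\<^bsub>M\<^esub> x, y)) p))\<rparr>"

text \<open>The part of \<open>is_bimodule\<close> that makes sense over arbitrary rings. Centrality
  of K is called on where bimodules are turned into modules over the enveloping algebra.\<close>

definition bimod ::
  "('a, 'u) ring_scheme \<Rightarrow> ('b, 'v) ring_scheme \<Rightarrow> ('a, 'b, 'm, 'x) bimodule_scheme \<Rightarrow> bool" where
  "bimod A B M \<longleftrightarrow> left_module A M \<and> left_module (opposite B) (right_part M) \<and>
     (\<forall>a\<in>carrier A. \<forall>x\<in>carrier M. \<forall>b\<in>carrier B. rsmult M (a \<odot>\<^bsub>M\<^esub> x) b = a \<odot>\<^bsub>M\<^esub> rsmult M x b)"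

lemma bimodD:
  assumes "bimod A B M"
  shows "left_module A M" "left_module (opposite B) (right_part M)"
    "\<And>a x b. a \<in> carrier A \<Longrightarrow> x \<in> carrier M \<Longrightarrow> b \<in> carrier B \<Longrightarrow> rsmult M (a \<odot>\<^bsub>M\<^esub> x) b = a \<odot>\<^bsub>M\<^esub> rsmult M x b"
    "\<And>x b. x \<in> carrier M \<Longrightarrow> b \<in> carrier B \<Longrightarrow> rsmult M x b \<in> carrier M"
    "\<And>x y b. x \<in> carrier M \<Longrightarrow> y \<in> carrier M \<Longrightarrow> b \<in> carrier B \<Longrightarrow>
      rsmult M (x \<oplus>\<^bsub>M\<^esub> y) b = rsmult M x b \<oplus>\<^bsub>M\<^esub> rsmult M y b"
    "\<And>x b c. x \<in> carrier M \<Longrightarrow> b \<in> carrier B \<Longrightarrow> c \<in> carrier B \<Longrightarrow>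
      rsmult M x (b \<oplus>\<^bsub>B\<^esub> c) = rsmult M x b \<oplus>\<^bsub>M\<^esub> rsmult M x c"
    "\<And>x b c. x \<in> carrier M \<Longrightarrow> b \<in> carrier B \<Longrightarrow> c \<in> carrier B \<Longrightarrow>
      rsmult M x (b \<otimes>\<^bsub>B\<^esub> c) = rsmult M (rsmult M x b) c"
    "\<And>x. x \<in> carrier M \<Longrightarrow> rsmult M x \<one>\<^bsub>B\<^esub> = x"
    "abelian_group M"
proof -
  show 1: "left_module A M" and 2: "left_module (opposite B) (right_part M)"
    and "\<And>a x b. a \<in> carrier A \<Longrightarrow> x \<in> carrier M \<Longrightarrow> b \<in> carrier B \<Longrightarrow> rsmult M (a \<odot>\<^bsub>M\<^esub> x) b = a \<odot>\<^bsub>M\<^esub> rsmult M x b"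
    using assms by (auto simp: bimod_def)
  interpret R: left_module "opposite B" "right_part M" by fact
  show "\<And>x b. x \<in> carrier M \<Longrightarrow> b \<in> carrier B \<Longrightarrow> rsmult M x b \<in> carrier M"
    "\<And>x y b. x \<in> carrier M \<Longrightarrow> y \<in> carrier M \<Longrightarrow> b \<in> carrier B \<Longrightarrow>
      rsmult M (x \<oplus>\<^bsub>M\<^esub> y) b = rsmult M x b \<oplus>\<^bsub>M\<^esub> rsmult M y b"
    "\<And>x b c. x \<in> carrier M \<Longrightarrow> b \<in> carrier B \<Longrightarrow> c \<in> carrier B \<Longrightarrow>
      rsmult M x (b \<oplus>\<^bsub>B\<^esub> c) = rsmult M x b \<oplus>\<^bsub>M\<^esub> rsmult M x c"
    "\<And>x b c. x \<in> carrier M \<Longrightarrow> b \<in> carrier B \<Longrightarrow> c \<in> carrier B \<Longrightarrow>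
      rsmult M x (b \<otimes>\<^bsub>B\<^esub> c) = rsmult M (rsmult M x b) c"
    "\<And>x. x \<in> carrier M \<Longrightarrow> rsmult M x \<one>\<^bsub>B\<^esub> = x"
    using R.smult_closed R.smult_r_distr R.smult_l_distr R.smult_assoc R.smult_one by simp_all
  show "abelian_group M" using 1 by (simp add: left_module_def)
qed

lemma tensor_pairI:
  assumes "bimod A B M" "left_module B Y"
  shows "tensor_pair B M Y"
  using bimodD(4,9)[OF assms(1)] left_module.axioms(2)[OF assms(2)] left_module.smult_closed[OF assms(2)]
  by (intro tensor_pair.intro) auto

lemma tens_simps:
  "carrier (tens B M Y) = carrier (tensor_group B M Y)" "add (tens B M Y) = mult (tensor_group B M Y)"
  "\<zero>\<^bsub>tens B M Y\<^esub> = \<one>\<^bsub>tensor_group B M Y\<^esub>"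
  by (auto simp: tens_def)

lemma (in tensor_pair) tens_abelian: "abelian_group (tens B M N)"
proof -
  interpret TG: comm_group TG by (rule comm_group_TG)
  show ?thesis
    by (rule abelian_groupI) (auto simp: tens_simps TG.m_ac intro: TG.l_inv_ex)
qed

context
  fixes A :: "('a, 'u) ring_scheme" and B :: "('b, 'v) ring_scheme"
    and M :: "('a, 'b, 'm, 'x) bimodule_scheme" and Y :: "('b, 'n, 'y) module_scheme"
  assumes M: "bimod A B M" and Y: "left_module B Y"
begin

interpretation T: tensor_pair B M Y by (rule tensor_pairI[OF M Y])
interpretation M: left_module A M by (rule bimodD(1)[OF M])
interpretation Y: left_module B Y by (rule Y)

lemma tp_closed: "x \<in> carrier M \<Longrightarrow> y \<in> carrier Y \<Longrightarrow> tp B M Y x y \<in> carrier (tens B M Y)"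
  and tp_add_left: "x \<in> carrier M \<Longrightarrow> x' \<in> carrier M \<Longrightarrow> y \<in> carrier Y \<Longrightarrow>
    tp B M Y (x \<oplus>\<^bsub>M\<^esub> x') y = tp B M Y x y \<oplus>\<^bsub>tens B M Y\<^esub> tp B M Y x' y"
  and tp_add_right: "x \<in> carrier M \<Longrightarrow> y \<in> carrier Y \<Longrightarrow> y' \<in> carrier Y \<Longrightarrow>
    tp B M Y x (y \<oplus>\<^bsub>Y\<^esub> y') = tp B M Y x y \<oplus>\<^bsub>tens B M Y\<^esub> tp B M Y x y'"
  and tp_balanced: "x \<in> carrier M \<Longrightarrow> b \<in> carrier B \<Longrightarrow> y \<in> carrier Y \<Longrightarrow>
    tp B M Y (rsmult M x b) y = tp B M Y x (b \<odot>\<^bsub>Y\<^esub> y)"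
  using T.pure_add_left T.pure_add_right T.pure_balanced by (simp_all add: tens_simps)

lemma tens_induct [consumes 1]:
  assumes "t \<in> carrier (tens B M Y)"
    and "\<And>x y. x \<in> carrier M \<Longrightarrow> y \<in> carrier Y \<Longrightarrow> P (tp B M Y x y)"
    and "\<And>s t. s \<in> carrier (tens B M Y) \<Longrightarrow> t \<in> carrier (tens B M Y) \<Longrightarrow> P s \<Longrightarrow> P t \<Longrightarrow> P (s \<oplus>\<^bsub>tens B M Y\<^esub> t)"
  shows "P t"
  using assms T.TG_induct[of t P] by (simp add: tens_simps)

lemma tens_smult_cl:
  assumes "p \<in> carrier T.FG" "a \<in> carrier A"
  shows "a \<odot>\<^bsub>tens B M Y\<^esub> T.cl p = T.cl (frag_extend (\<lambda>(x, y). frag_of (a \<odot>\<^bsub>M\<^esub> x, y)) p)"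
proof -
  have "frag_extend (\<lambda>(x, y). frag_of (a \<odot>\<^bsub>M\<^esub> x, y)) p \<in> T.TK" if "p \<in> T.TK" for p
    by (rule T.frag_map_TK[where g = "\<lambda>y. y", OF _ _ _ _ _ _ T.tensor_pair_axioms that])
       (use assms(2) bimodD(3)[OF M] M.smult_r_distr in auto)
  then show ?thesis
    using T.UN_cl_action[OF assms(1), of "frag_extend (\<lambda>(x, y). frag_of (a \<odot>\<^bsub>M\<^esub> x, y))" T.TK T.cl]
    by (simp add: tens_def frag_extend_diff T.cl_eq_iff)
qed

lemma tens_smult_tp:
  "a \<in> carrier A \<Longrightarrow> x \<in> carrier M \<Longrightarrow> y \<in> carrier Y \<Longrightarrow> a \<odot>\<^bsub>tens B M Y\<^esub> tp B M Y x y = tp B M Y (a \<odot>\<^bsub>M\<^esub> x) y"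
  unfolding tp_def by (subst tens_smult_cl) auto

lemma tens_smult_add:
  assumes "a \<in> carrier A" "s \<in> carrier (tens B M Y)" "t \<in> carrier (tens B M Y)"
  shows "a \<odot>\<^bsub>tens B M Y\<^esub> (s \<oplus>\<^bsub>tens B M Y\<^esub> t) = a \<odot>\<^bsub>tens B M Y\<^esub> s \<oplus>\<^bsub>tens B M Y\<^esub> a \<odot>\<^bsub>tens B M Y\<^esub> t"
proof -
  obtain p q where pq: "p \<in> carrier T.FG" "s = T.cl p" "q \<in> carrier T.FG" "t = T.cl q"
    using assms by (auto simp: tens_simps T.carrier_TG)
  let ?F = "frag_extend (\<lambda>(x, y). frag_of (a \<odot>\<^bsub>M\<^esub> x, y))"
  have F: "?F p \<in> carrier T.FG" if p: "p \<in> carrier T.FG" for p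
  proof -
    have "Poly_Mapping.keys (?F p) \<subseteq> (\<Union>z\<in>Poly_Mapping.keys p. Poly_Mapping.keys (case z of (x, y) \<Rightarrow> frag_of (a \<odot>\<^bsub>M\<^esub> x, y)))"
      by (rule keys_frag_extend)
    also have "\<dots> \<subseteq> carrier M \<times> carrier Y"
    proof (rule UN_least)
      fix z assume "z \<in> Poly_Mapping.keys p"
      then have "z \<in> carrier M \<times> carrier Y" using p[unfolded carrier_free_Abelian_group_iff] by blast
      then show "Poly_Mapping.keys (case z of (x, y) \<Rightarrow> frag_of (a \<odot>\<^bsub>M\<^esub> x, y)) \<subseteq> carrier M \<times> carrier Y"
        using assms(1) by (cases z) auto
    qed
    finally show ?thesis by simp
  qed
  have "s \<oplus>\<^bsub>tens B M Y\<^esub> t = T.cl (p + q)" using pq T.cl_add by (simp add: tens_simps)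
  then have "a \<odot>\<^bsub>tens B M Y\<^esub> (s \<oplus>\<^bsub>tens B M Y\<^esub> t) = T.cl (?F p + ?F q)"
    using tens_smult_cl[OF T.frag_closed[OF pq(1,3)] assms(1)] by (simp add: frag_extend_add)
  also have "\<dots> = T.cl (?F p) \<oplus>\<^bsub>tens B M Y\<^esub> T.cl (?F q)" using T.cl_add[OF F[OF pq(1)] F[OF pq(3)]] by (simp add: tens_simps)
  finally show ?thesis using pq tens_smult_cl[OF _ assms(1)] by simp
qed

lemma left_module_tens: "left_module A (tens B M Y)"
proof -
  interpret G: abelian_group "tens B M Y" by (rule T.tens_abelian)
  have cl: "a \<odot>\<^bsub>tens B M Y\<^esub> t \<in> carrier (tens B M Y)" if "a \<in> carrier A" "t \<in> carrier (tens B M Y)" for a t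
    using that(2) by (induction rule: tens_induct) (use that(1) in \<open>auto simp: tens_smult_tp tens_smult_add tp_closed\<close>)
  show ?thesis
  proof (intro left_module.intro left_module_axioms.intro M.ring_axioms G.abelian_group_axioms cl tens_smult_add)
    fix a b t assume ab: "a \<in> carrier A" "b \<in> carrier A" and t: "t \<in> carrier (tens B M Y)"
    show "(a \<oplus>\<^bsub>A\<^esub> b) \<odot>\<^bsub>tens B M Y\<^esub> t = a \<odot>\<^bsub>tens B M Y\<^esub> t \<oplus>\<^bsub>tens B M Y\<^esub> b \<odot>\<^bsub>tens B M Y\<^esub> t"
      using t by (induction rule: tens_induct)
        (use ab cl in \<open>simp_all add: tens_smult_tp tens_smult_add tp_closed M.smult_l_distr tp_add_left G.a_ac\<close>)
    show "(a \<otimes>\<^bsub>A\<^esub> b) \<odot>\<^bsub>tens B M Y\<^esub> t = a \<odot>\<^bsub>tens B M Y\<^esub> (b \<odot>\<^bsub>tens B M Y\<^esub> t)"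
      using t by (induction rule: tens_induct)
        (use ab cl in \<open>simp_all add: tens_smult_tp tens_smult_add tp_closed M.smult_assoc\<close>)
  next
    fix t assume t: "t \<in> carrier (tens B M Y)"
    show "\<one>\<^bsub>A\<^esub> \<odot>\<^bsub>tens B M Y\<^esub> t = t"
      using t by (induction rule: tens_induct) (simp_all add: tens_smult_tp tens_smult_add M.smult_one)
  qed
qed

lemma tens_ext:
  assumes "additive_map (tens B M Y) H f" "additive_map (tens B M Y) H g"
    and "\<And>x y. x \<in> carrier M \<Longrightarrow> y \<in> carrier Y \<Longrightarrow> f (tp B M Y x y) = g (tp B M Y x y)"
    and "t \<in> carrier (tens B M Y)"
  shows "f t = g t"
  using assms(4)
  by (induction rule: tens_induct) (use assms(1-3) in \<open>simp_all add: additive_mapD(2)[of _ H]\<close>)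

lemma tens_additive:
  assumes "abelian_group H" "balanced B M Y H \<beta>"
  obtains h where "additive_map (tens B M Y) H h"
    "\<And>x y. x \<in> carrier M \<Longrightarrow> y \<in> carrier Y \<Longrightarrow> h (tp B M Y x y) = \<beta> x y"
proof (rule T.tensor_universal[OF assms])
  fix h
  assume "\<And>t. t \<in> carrier T.TG \<Longrightarrow> h t \<in> carrier H"
    "\<And>s t. s \<in> carrier T.TG \<Longrightarrow> t \<in> carrier T.TG \<Longrightarrow> h (s \<otimes>\<^bsub>T.TG\<^esub> t) = h s \<oplus>\<^bsub>H\<^esub> h t"
    and *: "\<And>x y. x \<in> carrier M \<Longrightarrow> y \<in> carrier Y \<Longrightarrow> h (tp B M Y x y) = \<beta> x y"
  then have "additive_map (tens B M Y) H h" by (simp add: additive_map_def tens_simps)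
  then show thesis using * by (rule that)
qed

lemma tens_hom:
  assumes "left_module A H" "balanced B M Y H \<beta>"
    and "\<And>a x y. a \<in> carrier A \<Longrightarrow> x \<in> carrier M \<Longrightarrow> y \<in> carrier Y \<Longrightarrow> \<beta> (a \<odot>\<^bsub>M\<^esub> x) y = a \<odot>\<^bsub>H\<^esub> \<beta> x y"
  obtains h where "h \<in> mod_hom A (tens B M Y) H"
    "\<And>x y. x \<in> carrier M \<Longrightarrow> y \<in> carrier Y \<Longrightarrow> h (tp B M Y x y) = \<beta> x y"
proof -
  interpret H: left_module A H by fact
  interpret TT: left_module A "tens B M Y" by (rule left_module_tens)
  obtain h where h: "additive_map (tens B M Y) H h"
    "\<And>x y. x \<in> carrier M \<Longrightarrow> y \<in> carrier Y \<Longrightarrow> h (tp B M Y x y) = \<beta> x y"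
    by (rule tens_additive[OF left_module.axioms(2)[OF assms(1)] assms(2)]) (rule that)
  have "h (a \<odot>\<^bsub>tens B M Y\<^esub> t) = a \<odot>\<^bsub>H\<^esub> h t" if "a \<in> carrier A" "t \<in> carrier (tens B M Y)" for a t
    using that(2)
  proof (induction rule: tens_induct)
    case (1 x y)
    then show ?case using that(1) assms(3) by (simp add: tens_smult_tp h(2))
  next
    case (2 s t)
    then show ?case using that(1) additive_mapD[OF h(1)] by (simp add: tens_smult_add H.smult_r_distr)
  qed
  then have "h \<in> mod_hom A (tens B M Y) H" using additive_mapD[OF h(1)] by (intro mod_homI) auto
  then show ?thesis using h(2) by (rule that)
qed

end

section \<open>Functoriality and exactness of the tensor product\<close>

lemma mod_hom_additive: "f \<in> mod_hom R M N \<Longrightarrow> additive_map M N f"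
  by (auto simp: additive_map_def mod_hom_closed mod_hom_add)

lemma additive_map_id: "additive_map M M (\<lambda>x. x)"
  by (auto simp: additive_map_def)

lemma additive_map_comp: "additive_map M N f \<Longrightarrow> additive_map N P g \<Longrightarrow> additive_map M P (\<lambda>x. g (f x))"
  by (auto simp: additive_map_def)

lemma additive_map_plus:
  assumes "abelian_group N" "additive_map M N f" "additive_map M N g"
  shows "additive_map M N (\<lambda>x. f x \<oplus>\<^bsub>N\<^esub> g x)"
proof -
  interpret abelian_group N by fact
  show ?thesis using additive_mapD[OF assms(2)] additive_mapD[OF assms(3)]
    by (auto simp: additive_map_def a_ac)
qed

abbreviation right_hom where
  "right_hom B M M' \<equiv> mod_hom (opposite B) (right_part M) (right_part M')"

lemma right_homD:
  assumes "f \<in> right_hom B M M'"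
  shows "x \<in> carrier M \<Longrightarrow> f x \<in> carrier M'"
    "x \<in> carrier M \<Longrightarrow> y \<in> carrier M \<Longrightarrow> f (x \<oplus>\<^bsub>M\<^esub> y) = f x \<oplus>\<^bsub>M'\<^esub> f y"
    "x \<in> carrier M \<Longrightarrow> b \<in> carrier B \<Longrightarrow> f (rsmult M x b) = rsmult M' (f x) b"
  using mod_hom_simps[OF assms] by simp_all

lemma balanced_map:
  assumes M': "bimod A' B M'" and Y': "left_module B Y'"
    and f: "f \<in> right_hom B M M'" and g: "g \<in> mod_hom B Y Y'"
  shows "balanced B M Y (tens B M' Y') (\<lambda>x y. tp B M' Y' (f x) (g y))"
  by (rule balancedI)
     (simp_all add: right_homD[OF f] mod_hom_simps[OF g] tp_closed[OF M' Y'] tp_add_left[OF M' Y']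
        tp_add_right[OF M' Y'] tp_balanced[OF M' Y'])

lemma tens_map:
  assumes M: "bimod A B M" and Y: "left_module B Y" and M': "bimod A B M'" and Y': "left_module B Y'"
    and f: "f \<in> mod_hom A M M'" "f \<in> right_hom B M M'" and g: "g \<in> mod_hom B Y Y'"
  obtains h where "h \<in> mod_hom A (tens B M Y) (tens B M' Y')"
    "\<And>x y. x \<in> carrier M \<Longrightarrow> y \<in> carrier Y \<Longrightarrow> h (tp B M Y x y) = tp B M' Y' (f x) (g y)"
proof (rule tens_hom[OF M Y left_module_tens[OF M' Y'] balanced_map[OF M' Y' f(2) g]])
  show "tp B M' Y' (f (a \<odot>\<^bsub>M\<^esub> x)) (g y) = a \<odot>\<^bsub>tens B M' Y'\<^esub> tp B M' Y' (f x) (g y)"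
    if "a \<in> carrier A" "x \<in> carrier M" "y \<in> carrier Y" for a x y
    using that by (simp add: mod_hom_simps[OF f(1)] mod_hom_simps[OF g] tens_smult_tp[OF M' Y'])
qed (rule that)

lemma tens_map_additive:
  assumes M: "bimod A B M" and Y: "left_module B Y" and M': "bimod A' B M'" and f: "f \<in> right_hom B M M'"
  obtains h where "additive_map (tens B M Y) (tens B M' Y) h"
    "\<And>x y. x \<in> carrier M \<Longrightarrow> y \<in> carrier Y \<Longrightarrow> h (tp B M Y x y) = tp B M' Y (f x) y"
  by (rule tens_additive[OF M Y left_module.axioms(2)[OF left_module_tens[OF M' Y]]
        balanced_map[OF M' Y f mod_hom_id]]) (rule that)

lemma tens_map_right:
  assumes M: "bimod A B M" and Y: "left_module B Y" and Y': "left_module B Y'" and g: "g \<in> mod_hom B Y Y'"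
  obtains h where "h \<in> mod_hom A (tens B M Y) (tens B M Y')"
    "\<And>x y. x \<in> carrier M \<Longrightarrow> y \<in> carrier Y \<Longrightarrow> h (tp B M Y x y) = tp B M Y' x (g y)"
  by (rule tens_map[OF M Y M Y' mod_hom_id mod_hom_id g]) (rule that)

lemma tp_zero:
  assumes M: "bimod A B M" and Y: "left_module B Y" and x: "x \<in> carrier M"
  shows "tp B M Y x \<zero>\<^bsub>Y\<^esub> = \<zero>\<^bsub>tens B M Y\<^esub>"
  by (rule additive_zero[OF left_module.axioms(2)[OF Y] left_module.axioms(2)[OF left_module_tens[OF M Y]]])
     (use x in \<open>simp_all add: tp_closed[OF M Y] tp_add_right[OF M Y]\<close>)

lemma tp_zero_left:
  assumes M: "bimod A B M" and Y: "left_module B Y" and y: "y \<in> carrier Y"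
  shows "tp B M Y \<zero>\<^bsub>M\<^esub> y = \<zero>\<^bsub>tens B M Y\<^esub>"
  by (rule additive_zero[OF bimodD(9)[OF M] left_module.axioms(2)[OF left_module_tens[OF M Y]], where f = "\<lambda>x. tp B M Y x y"])
     (use y in \<open>simp_all add: tp_closed[OF M Y] tp_add_left[OF M Y]\<close>)

text \<open>M \<otimes> h is assembled along the summands of h. Its values on pure tensors determine
  it, which later allows the identity to be recognised.\<close>

lemma fac_tens_right:
  assumes M: "bimod A B M" and Y: "left_module B Y" and Y': "left_module B Y'" and U: "left_module B U"
    and "fac B U Y Y' h"
  shows "\<exists>H. fac A (tens B M U) (tens B M Y) (tens B M Y') H \<and>
    (\<forall>x\<in>carrier M. \<forall>y\<in>carrier Y. H (tp B M Y x y) = tp B M Y' x (h y))"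
  using assms(5)
proof induction
  case (fac_null h)
  show ?case
    by (intro exI[of _ "\<lambda>t. \<zero>\<^bsub>tens B M Y'\<^esub>"] conjI fac.fac_null)
       (simp_all add: fac_null tp_zero[OF M Y'])
next
  case (fac_step \<alpha> \<beta> h' h)
  obtain a where a: "a \<in> mod_hom A (tens B M Y) (tens B M U)"
    "\<And>x y. x \<in> carrier M \<Longrightarrow> y \<in> carrier Y \<Longrightarrow> a (tp B M Y x y) = tp B M U x (\<alpha> y)"
    by (rule tens_map_right[OF M Y U fac_step(1)]) (rule that)
  obtain b where b: "b \<in> mod_hom A (tens B M U) (tens B M Y')"
    "\<And>x y. x \<in> carrier M \<Longrightarrow> y \<in> carrier U \<Longrightarrow> b (tp B M U x y) = tp B M Y' x (\<beta> y)"
    by (rule tens_map_right[OF M U Y' fac_step(2)]) (rule that)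
  from fac_step(5) obtain H where H: "fac A (tens B M U) (tens B M Y) (tens B M Y') H"
    "\<forall>x\<in>carrier M. \<forall>y\<in>carrier Y. H (tp B M Y x y) = tp B M Y' x (h' y)" by (elim exE conjE)
  have h': "h' \<in> mod_hom B Y Y'" by (rule fac_mod_hom[OF fac_step(3) Y Y'])
  show ?case
  proof (intro exI conjI ballI)
    show "fac A (tens B M U) (tens B M Y) (tens B M Y') (\<lambda>t. b (a t) \<oplus>\<^bsub>tens B M Y'\<^esub> H t)"
      by (rule fac.fac_step[OF a(1) b(1) H(1)]) simp
    show "b (a (tp B M Y x y)) \<oplus>\<^bsub>tens B M Y'\<^esub> H (tp B M Y x y) = tp B M Y' x (h y)"
      if "x \<in> carrier M" "y \<in> carrier Y" for x y
      using that H(2) mod_hom_closed[OF fac_step(1)] mod_hom_closed[OF fac_step(2)] mod_hom_closed[OF h']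
      by (simp add: a(2) b(2) fac_step(4) tp_add_right[OF M Y'])
  qed
qed

text \<open>A single summand, now in the first variable; it serves the defects of stable
  isomorphisms of bimodules, with U a projective bimodule.\<close>

lemma fac_tens_left:
  assumes M: "bimod A B M" and M': "bimod A B M'" and U: "bimod A B U" and Y: "left_module B Y"
    and f: "f \<in> mod_hom A M U" "f \<in> right_hom B M U" and g: "g \<in> mod_hom A U M'" "g \<in> right_hom B U M'"
  shows "\<exists>H. fac A (tens B U Y) (tens B M Y) (tens B M' Y) H \<and>
    (\<forall>x\<in>carrier M. \<forall>y\<in>carrier Y. H (tp B M Y x y) = tp B M' Y (g (f x)) y)"
proof -
  obtain a where a: "a \<in> mod_hom A (tens B M Y) (tens B U Y)"
    "\<And>x y. x \<in> carrier M \<Longrightarrow> y \<in> carrier Y \<Longrightarrow> a (tp B M Y x y) = tp B U Y (f x) y"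
    by (rule tens_map[OF M Y U Y f mod_hom_id]) (rule that)
  obtain b where b: "b \<in> mod_hom A (tens B U Y) (tens B M' Y)"
    "\<And>x y. x \<in> carrier U \<Longrightarrow> y \<in> carrier Y \<Longrightarrow> b (tp B U Y x y) = tp B M' Y (g x) y"
    by (rule tens_map[OF U Y M' Y g mod_hom_id]) (rule that)
  show ?thesis
    using fac_single[OF a(1) b(1) left_module_tens[OF M' Y]]
    by (intro exI[of _ "\<lambda>t. b (a t)"]) (simp add: a(2) b(2) mod_hom_closed[OF f(1)])
qed

text \<open>The map x \<otimes> b \<mapsto> x b has the inverse x \<mapsto> x \<otimes> 1.\<close>

lemma tens_regular_iso:
  assumes M: "bimod A B M" and B: "ring B"
  shows "mod_iso A (tens B M (regular_module B)) M"
proof -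
  let ?R = "regular_module B"
  have R: "left_module B ?R" by (rule left_module_regular[OF B])
  note Md = bimodD[OF M]
  interpret B: ring B by fact
  obtain h where h: "h \<in> mod_hom A (tens B M ?R) M"
    "\<And>x y. x \<in> carrier M \<Longrightarrow> y \<in> carrier ?R \<Longrightarrow> h (tp B M ?R x y) = rsmult M x y"
  proof (rule tens_hom[OF M R Md(1)])
    show "balanced B M ?R M (rsmult M)" by (rule balancedI) (simp_all add: Md)
  qed (use Md(3) in auto)
  let ?g = "\<lambda>x. tp B M ?R x \<one>\<^bsub>B\<^esub>"
  have g: "?g \<in> mod_hom A M (tens B M ?R)"
    by (rule mod_homI) (simp_all add: tp_closed[OF M R] tp_add_left[OF M R] tens_smult_tp[OF M R])
  show ?thesis
  proof (rule mod_isoI[OF left_module_tens[OF M R] Md(1) h(1) g])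
    show "?g (h t) = t" if "t \<in> carrier (tens B M ?R)" for t
      by (rule tens_ext[OF M R additive_map_comp[OF mod_hom_additive[OF h(1)] mod_hom_additive[OF g]] additive_map_id _ that])
         (simp add: h(2) tp_balanced[OF M R])
  qed (simp add: h(2) Md)
qed

lemma dual_basis_tens_regular:
  assumes M: "bimod A B M" and B: "ring B" and "dual_basis A M"
  shows "dual_basis A (tens B M (regular_module B))"
  by (rule fac_iso[OF mod_iso_sym[OF tens_regular_iso[OF M B]] assms(3)])

text \<open>A sum through B becomes a sum through M \<otimes> B, which is isomorphic to M and hence
  projective over A.\<close>

lemma pfac_tens_right:
  assumes M: "bimod A B M" and Y: "left_module B Y" and Y': "left_module B Y'"
    and dM: "dual_basis A M" and h: "pfac B Y Y' h"
  shows "\<exists>H. pfac A (tens B M Y) (tens B M Y') H \<and>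
    (\<forall>x\<in>carrier M. \<forall>y\<in>carrier Y. H (tp B M Y x y) = tp B M Y' x (h y))"
proof -
  have B: "ring B" and A: "ring A" using left_module.axioms(1)[OF Y] left_module.axioms(1)[OF bimodD(1)[OF M]] by auto
  note R = left_module_regular[OF B]
  obtain H where "fac A (tens B M (regular_module B)) (tens B M Y) (tens B M Y') H"
    "\<forall>x\<in>carrier M. \<forall>y\<in>carrier Y. H (tp B M Y x y) = tp B M Y' x (h y)"
    using fac_tens_right[OF M Y Y' R h] by (elim exE conjE)
  then show ?thesis
    using fac_trans[OF _ dual_basis_tens_regular[OF M B dM] left_module_tens[OF M Y] left_module_tens[OF M Y']
        left_module_tens[OF M R] left_module_regular[OF A]] by (intro exI[of _ H]) simp
qed

text \<open>This puts the terms of a tensored resolution into add of the tensored generator.\<close>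

lemma fac_tens_id:
  assumes M: "bimod A B M" and Y: "left_module B Y" and U: "left_module B U" and "fac B U Y Y (\<lambda>y. y)"
  shows "fac A (tens B M U) (tens B M Y) (tens B M Y) (\<lambda>t. t)"
proof -
  obtain H where H: "fac A (tens B M U) (tens B M Y) (tens B M Y) H"
    "\<forall>x\<in>carrier M. \<forall>y\<in>carrier Y. H (tp B M Y x y) = tp B M Y x y"
    using fac_tens_right[OF M Y Y U assms(4)] by (elim exE conjE)
  have "H t = t" if "t \<in> carrier (tens B M Y)" for t
    by (rule tens_ext[OF M Y mod_hom_additive[OF fac_mod_hom[OF H(1)]] additive_map_id _ that])
       (use left_module_tens[OF M Y] H(2) in auto)
  then show ?thesis using fac_cong[OF H(1), of "\<lambda>t. t"] by simp
qed

lemma dual_basis_tens: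
  assumes M: "bimod A B M" and Y: "left_module B Y" and dM: "dual_basis A M" and dY: "dual_basis B Y"
  shows "dual_basis A (tens B M Y)"
proof -
  have B: "ring B" and A: "ring A" using left_module.axioms(1)[OF Y] left_module.axioms(1)[OF bimodD(1)[OF M]] by auto
  note R = left_module_regular[OF B]
  show ?thesis
    by (rule fac_trans[OF fac_tens_id[OF M Y R dY] dual_basis_tens_regular[OF M B dM] left_module_tens[OF M Y]
          left_module_tens[OF M Y] left_module_tens[OF M R] left_module_regular[OF A]])
qed

text \<open>The two defect equations are tensored with M; projectivity of M over A keeps the defects
  among the maps through projectives.\<close>

lemma stab_tens:
  assumes M: "bimod A B M" and dM: "dual_basis A M" and "stab B Y Y'"
  shows "stab A (tens B M Y) (tens B M Y')"
proof -
  obtain f g h k where fg: "left_module B Y" "left_module B Y'" "f \<in> mod_hom B Y Y'" "g \<in> mod_hom B Y' Y"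
    "pfac B Y Y h" "pfac B Y' Y' k"
    "\<And>x. x \<in> carrier Y \<Longrightarrow> g (f x) \<oplus>\<^bsub>Y\<^esub> h x = x" "\<And>y. y \<in> carrier Y' \<Longrightarrow> f (g y) \<oplus>\<^bsub>Y'\<^esub> k y = y"
    by (rule stabE[OF assms(3)]) (rule that)
  note Y = fg(1) and Y' = fg(2)
  note TY = left_module_tens[OF M Y] and TY' = left_module_tens[OF M Y']
  have hk: "h \<in> mod_hom B Y Y" "k \<in> mod_hom B Y' Y'" using fac_mod_hom[OF fg(5) Y Y] fac_mod_hom[OF fg(6) Y' Y'] by auto
  obtain F where F: "F \<in> mod_hom A (tens B M Y) (tens B M Y')"
    "\<And>x y. x \<in> carrier M \<Longrightarrow> y \<in> carrier Y \<Longrightarrow> F (tp B M Y x y) = tp B M Y' x (f y)"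
    by (rule tens_map_right[OF M Y Y' fg(3)]) (rule that)
  obtain G where G: "G \<in> mod_hom A (tens B M Y') (tens B M Y)"
    "\<And>x y. x \<in> carrier M \<Longrightarrow> y \<in> carrier Y' \<Longrightarrow> G (tp B M Y' x y) = tp B M Y x (g y)"
    by (rule tens_map_right[OF M Y' Y fg(4)]) (rule that)
  obtain H where H: "pfac A (tens B M Y) (tens B M Y) H"
    "\<forall>x\<in>carrier M. \<forall>y\<in>carrier Y. H (tp B M Y x y) = tp B M Y x (h y)"
    using pfac_tens_right[OF M Y Y dM fg(5)] by (elim exE conjE)
  obtain K where K: "pfac A (tens B M Y') (tens B M Y') K"
    "\<forall>x\<in>carrier M. \<forall>y\<in>carrier Y'. K (tp B M Y' x y) = tp B M Y' x (k y)"
    using pfac_tens_right[OF M Y' Y' dM fg(6)] by (elim exE conjE)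
  show ?thesis
  proof (rule stabI[OF TY TY' F(1) G(1) H(1) K(1)])
    show "G (F t) \<oplus>\<^bsub>tens B M Y\<^esub> H t = t" if "t \<in> carrier (tens B M Y)" for t
      by (rule tens_ext[OF M Y additive_map_plus[OF left_module.axioms(2)[OF TY] additive_map_comp[OF mod_hom_additive[OF F(1)]
            mod_hom_additive[OF G(1)]] mod_hom_additive[OF fac_mod_hom[OF H(1) TY TY]]] additive_map_id _ that])
         (simp add: F(2) G(2) H(2) mod_hom_closed[OF fg(3)] mod_hom_closed[OF fg(4)] mod_hom_closed[OF hk(1)] fg(7) flip: tp_add_right[OF M Y])
    show "F (G t) \<oplus>\<^bsub>tens B M Y'\<^esub> K t = t" if "t \<in> carrier (tens B M Y')" for t
      by (rule tens_ext[OF M Y' additive_map_plus[OF left_module.axioms(2)[OF TY'] additive_map_comp[OF mod_hom_additive[OF G(1)]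
            mod_hom_additive[OF F(1)]] mod_hom_additive[OF fac_mod_hom[OF K(1) TY' TY']]] additive_map_id _ that])
         (simp add: F(2) G(2) K(2) mod_hom_closed[OF fg(3)] mod_hom_closed[OF fg(4)] mod_hom_closed[OF hk(2)] fg(8) flip: tp_add_right[OF M Y'])
  qed
qed

text \<open>One term of a dual basis of the right module M, read off from its description over the
  opposite ring: a linear form \<alpha> into B and an element \<beta> 1.\<close>

lemma pfac_opposite_coordinates:
  assumes M: "bimod A B M" and B: "ring (opposite B)"
    and \<alpha>: "\<alpha> \<in> mod_hom (opposite B) (right_part M) (regular_module (opposite B))"
    and \<beta>: "\<beta> \<in> mod_hom (opposite B) (regular_module (opposite B)) (right_part M')"
  shows "x \<in> carrier M \<Longrightarrow> \<alpha> x \<in> carrier B"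
    "x \<in> carrier M \<Longrightarrow> y \<in> carrier M \<Longrightarrow> \<alpha> (x \<oplus>\<^bsub>M\<^esub> y) = \<alpha> x \<oplus>\<^bsub>B\<^esub> \<alpha> y"
    "x \<in> carrier M \<Longrightarrow> b \<in> carrier B \<Longrightarrow> \<alpha> (rsmult M x b) = \<alpha> x \<otimes>\<^bsub>B\<^esub> b"
    "c \<in> carrier B \<Longrightarrow> \<beta> c = rsmult M' (\<beta> \<one>\<^bsub>B\<^esub>) c" "\<beta> \<one>\<^bsub>B\<^esub> \<in> carrier M'"
proof -
  show "x \<in> carrier M \<Longrightarrow> \<alpha> x \<in> carrier B"
    "x \<in> carrier M \<Longrightarrow> y \<in> carrier M \<Longrightarrow> \<alpha> (x \<oplus>\<^bsub>M\<^esub> y) = \<alpha> x \<oplus>\<^bsub>B\<^esub> \<alpha> y"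
    "x \<in> carrier M \<Longrightarrow> b \<in> carrier B \<Longrightarrow> \<alpha> (rsmult M x b) = \<alpha> x \<otimes>\<^bsub>B\<^esub> b"
    using mod_hom_simps[OF \<alpha>] by simp_all
  show "\<beta> \<one>\<^bsub>B\<^esub> \<in> carrier M'"
    using mod_hom_closed[OF \<beta>, of "\<one>\<^bsub>B\<^esub>"] monoid.one_closed[OF ring.is_monoid[OF B]] by simp
  show "\<beta> c = rsmult M' (\<beta> \<one>\<^bsub>B\<^esub>) c" if "c \<in> carrier B"
    using mod_hom_regular_eq[OF B \<beta>, of c, unfolded opposite_simps right_part_simps, OF that] .
qed

text \<open>Exactness of \<open>M \<otimes> -\<close> is read off a dual basis of the right module \<open>M\<close>: writing
  \<open>x = \<Sum> n\<^sub>i \<alpha>\<^sub>i(x)\<close>, one has \<open>t = \<Sum> n\<^sub>i \<otimes> \<Phi>\<^sub>i(t)\<close> with \<open>\<Phi>\<^sub>i(x \<otimes> y) = \<alpha>\<^sub>i(x) y\<close>.\<close>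

lemma tens_exact:
  assumes M: "bimod A B M" and dM: "dual_basis (opposite B) (right_part M)"
    and Y': "left_module B Y'" and Y: "left_module B Y" and Y'': "left_module B Y''"
    and f: "f \<in> mod_hom B Y' Y" and g: "g \<in> mod_hom B Y Y''"
    and ex: "\<And>y. y \<in> carrier Y \<Longrightarrow> g y = \<zero>\<^bsub>Y''\<^esub> \<Longrightarrow> y \<in> f ` carrier Y'"
    and F: "F \<in> mod_hom A (tens B M Y') (tens B M Y)"
      "\<And>x y. x \<in> carrier M \<Longrightarrow> y \<in> carrier Y' \<Longrightarrow> F (tp B M Y' x y) = tp B M Y x (f y)"
    and G: "G \<in> mod_hom A (tens B M Y) (tens B M Y'')"
      "\<And>x y. x \<in> carrier M \<Longrightarrow> y \<in> carrier Y \<Longrightarrow> G (tp B M Y x y) = tp B M Y'' x (g y)"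
    and t: "t \<in> carrier (tens B M Y)" "G t = \<zero>\<^bsub>tens B M Y''\<^esub>"
  shows "t \<in> F ` carrier (tens B M Y')"
proof -
  note Md = bimodD[OF M]
  note TY' = left_module_tens[OF M Y'] and TY = left_module_tens[OF M Y] and TY'' = left_module_tens[OF M Y'']
  interpret TY': left_module A "tens B M Y'" by (rule TY')
  interpret TY: left_module A "tens B M Y" by (rule TY)
  interpret Y: left_module B Y by (rule Y)
  interpret Y'': left_module B Y'' by (rule Y'')
  have oB: "ring (opposite B)" using Md(2) by (rule left_module.axioms(1))
  \<comment> \<open>H is h \<otimes> id. For each partial sum h the element H t already lies in the
    image of F; the identity of M then yields t itself.\<close>
  have "\<exists>H. additive_map (tens B M Y) (tens B M Y) H \<and>
      (\<forall>x\<in>carrier M. \<forall>y\<in>carrier Y. H (tp B M Y x y) = tp B M Y (h x) y) \<and> H t \<in> F ` carrier (tens B M Y')"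
    if "pfac (opposite B) (right_part M) (right_part M) h" for h
    using that
  proof induction
    case (fac_null h)
    have "\<zero>\<^bsub>tens B M Y\<^esub> = F \<zero>\<^bsub>tens B M Y'\<^esub>" using mod_hom_zero[OF TY' TY F(1)] by simp
    then have "\<zero>\<^bsub>tens B M Y\<^esub> \<in> F ` carrier (tens B M Y')" by (rule image_eqI) simp
    then show ?case using fac_null
      by (intro exI[of _ "\<lambda>t. \<zero>\<^bsub>tens B M Y\<^esub>"]) (auto simp: additive_map_def tp_zero_left[OF M Y])
  next
    case (fac_step \<alpha> \<beta> h' h)
    note ab = pfac_opposite_coordinates[OF M oB fac_step(1,2)]
    let ?n = "\<beta> \<one>\<^bsub>B\<^esub>"
    have h': "h' \<in> right_hom B M M" by (rule fac_mod_hom[OF fac_step(3) Md(2,2)])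
    from fac_step(5) obtain H where H: "additive_map (tens B M Y) (tens B M Y) H"
      "\<forall>x\<in>carrier M. \<forall>y\<in>carrier Y. H (tp B M Y x y) = tp B M Y (h' x) y" "H t \<in> F ` carrier (tens B M Y')"
      by (elim exE conjE)
    obtain \<Phi> where \<Phi>: "additive_map (tens B M Y) Y \<Phi>"
      "\<And>x y. x \<in> carrier M \<Longrightarrow> y \<in> carrier Y \<Longrightarrow> \<Phi> (tp B M Y x y) = \<alpha> x \<odot>\<^bsub>Y\<^esub> y"
    proof (rule tens_additive[OF M Y left_module.axioms(2)[OF Y]])
      show "balanced B M Y Y (\<lambda>x y. \<alpha> x \<odot>\<^bsub>Y\<^esub> y)"
        by (rule balancedI) (simp_all add: ab(1-3) Y.smult_l_distr Y.smult_r_distr Y.smult_assoc)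
    qed (rule that)
    obtain \<Psi> where \<Psi>: "additive_map (tens B M Y'') Y'' \<Psi>"
      "\<And>x y. x \<in> carrier M \<Longrightarrow> y \<in> carrier Y'' \<Longrightarrow> \<Psi> (tp B M Y'' x y) = \<alpha> x \<odot>\<^bsub>Y''\<^esub> y"
    proof (rule tens_additive[OF M Y'' left_module.axioms(2)[OF Y'']])
      show "balanced B M Y'' Y'' (\<lambda>x y. \<alpha> x \<odot>\<^bsub>Y''\<^esub> y)"
        by (rule balancedI) (simp_all add: ab(1-3) Y''.smult_l_distr Y''.smult_r_distr Y''.smult_assoc)
    qed (rule that)
    \<comment> \<open>\<Phi> and \<Psi> are the same coordinate form on the two tensor products,
      hence natural. So G t = 0 puts \<Phi> t into the kernel of g, where exactness of the given
      sequence applies.\<close>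
    have "g (\<Phi> t) = \<Psi> (G t)"
      by (rule tens_ext[OF M Y additive_map_comp[OF \<Phi>(1) mod_hom_additive[OF g]] additive_map_comp[OF mod_hom_additive[OF G(1)] \<Psi>(1)] _ t(1)])
         (simp add: \<Phi>(2) \<Psi>(2) G(2) mod_hom_simps[OF g] ab(1))
    also have "\<dots> = \<zero>\<^bsub>Y''\<^esub>" unfolding t(2)
      by (rule additive_zero[OF left_module.axioms(2)[OF TY''] left_module.axioms(2)[OF Y'']])
         (simp_all add: additive_mapD[OF \<Psi>(1)])
    finally obtain y where y: "y \<in> carrier Y'" "\<Phi> t = f y" using ex[of "\<Phi> t"] additive_mapD(1)[OF \<Phi>(1) t(1)] by blast
    from H(3) obtain t' where t': "t' \<in> carrier (tens B M Y')" "H t = F t'" by blast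
    have "tp B M Y ?n (\<Phi> t) \<oplus>\<^bsub>tens B M Y\<^esub> H t = F (tp B M Y' ?n y \<oplus>\<^bsub>tens B M Y'\<^esub> t')"
      using y t' ab(5) by (simp add: mod_hom_simps[OF F(1)] F(2) tp_closed[OF M Y'])
    then have im: "tp B M Y ?n (\<Phi> t) \<oplus>\<^bsub>tens B M Y\<^esub> H t \<in> F ` carrier (tens B M Y')"
      by (rule image_eqI) (use y t' ab(5) in \<open>simp add: tp_closed[OF M Y']\<close>)
    have n: "additive_map Y (tens B M Y) (tp B M Y ?n)"
      using ab(5) by (auto simp: additive_map_def tp_closed[OF M Y] tp_add_right[OF M Y])
    show ?case
    proof (intro exI conjI ballI)
      show "additive_map (tens B M Y) (tens B M Y) (\<lambda>t. tp B M Y ?n (\<Phi> t) \<oplus>\<^bsub>tens B M Y\<^esub> H t)"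
        by (rule additive_map_plus[OF left_module.axioms(2)[OF TY] additive_map_comp[OF \<Phi>(1) n] H(1)])
      show "tp B M Y ?n (\<Phi> (tp B M Y x y)) \<oplus>\<^bsub>tens B M Y\<^esub> H (tp B M Y x y) = tp B M Y (h x) y"
        if "x \<in> carrier M" "y \<in> carrier Y" for x y
        using that ab(1,5) H(2) right_homD(1)[OF h'] fac_step(4)[of x] ab(4)[of "\<alpha> x"] Md(4)[of ?n "\<alpha> x"]
        by (simp add: \<Phi>(2) tp_add_left[OF M Y] tp_balanced[OF M Y])
    qed (rule im)
  qed
  from this[OF dM] obtain H where H: "additive_map (tens B M Y) (tens B M Y) H"
      "\<forall>x\<in>carrier M. \<forall>y\<in>carrier Y. H (tp B M Y x y) = tp B M Y x y" "H t \<in> F ` carrier (tens B M Y')"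
    by (elim exE conjE)
  have "H t = t" by (rule tens_ext[OF M Y H(1) additive_map_id _ t(1)]) (use H(2) in simp)
  then show ?thesis using H(3) by simp
qed

text \<open>Exactness at Y of the sequence 0 \<rightarrow> Y \<rightarrow> Y'', with the zero
  submodule of Y in the first place.\<close>

lemma tens_inj:
  assumes M: "bimod A B M" and dM: "dual_basis (opposite B) (right_part M)"
    and Y: "left_module B Y" and Y'': "left_module B Y''"
    and g: "g \<in> mod_hom B Y Y''" "inj_on g (carrier Y)"
    and G: "G \<in> mod_hom A (tens B M Y) (tens B M Y'')"
      "\<And>x y. x \<in> carrier M \<Longrightarrow> y \<in> carrier Y \<Longrightarrow> G (tp B M Y x y) = tp B M Y'' x (g y)"
  shows "inj_on G (carrier (tens B M Y))"
proof (rule inj_on_kernel[OF left_module_tens[OF M Y] left_module_tens[OF M Y''] G(1)])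
  fix t assume t: "t \<in> carrier (tens B M Y)" "G t = \<zero>\<^bsub>tens B M Y''\<^esub>"
  interpret Y: left_module B Y by (rule Y)
  let ?Z = "Y\<lparr>carrier := {\<zero>\<^bsub>Y\<^esub>}\<rparr>"
  have Z: "left_module B ?Z" by (rule left_module_restrict[OF Y Y.submoduleI]) auto
  have f: "(\<lambda>y. y) \<in> mod_hom B ?Z Y" by (rule mod_hom_restrict[OF mod_hom_id]) auto
  obtain F where F: "F \<in> mod_hom A (tens B M ?Z) (tens B M Y)"
    "\<And>x y. x \<in> carrier M \<Longrightarrow> y \<in> carrier ?Z \<Longrightarrow> F (tp B M ?Z x y) = tp B M Y x y"
    by (rule tens_map_right[OF M Z Y f]) (rule that)
  have "y \<in> (\<lambda>y. y) ` carrier ?Z" if "y \<in> carrier Y" "g y = \<zero>\<^bsub>Y''\<^esub>" for y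
    using inj_onD[OF g(2), of y "\<zero>\<^bsub>Y\<^esub>"] mod_hom_zero[OF Y Y'' g(1)] that by simp
  from tens_exact[OF M dM Z Y Y'' f g(1) this F G t]
  obtain s where s: "s \<in> carrier (tens B M ?Z)" "t = F s" by blast
  have "F s = \<zero>\<^bsub>tens B M Y\<^esub>"
  proof (rule tens_ext[OF M Z mod_hom_additive[OF F(1)] mod_hom_additive[OF mod_hom_null[OF left_module_tens[OF M Y]]] _ s(1)])
    show "F (tp B M ?Z x y) = \<zero>\<^bsub>tens B M Y\<^esub>" if "x \<in> carrier M" "y \<in> carrier ?Z" for x y
      using that by (simp add: F(2) tp_zero[OF M Y])
  qed
  then show "t = \<zero>\<^bsub>tens B M Y\<^esub>" using s by simp
qed

text \<open>A preimage of y under g gives one of x \<otimes> y, and pure tensors generate.\<close>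

lemma tens_surj:
  assumes M: "bimod A B M" and Y: "left_module B Y" and Y'': "left_module B Y''"
    and g: "g \<in> mod_hom B Y Y''" "g ` carrier Y = carrier Y''"
    and G: "G \<in> mod_hom A (tens B M Y) (tens B M Y'')"
      "\<And>x y. x \<in> carrier M \<Longrightarrow> y \<in> carrier Y \<Longrightarrow> G (tp B M Y x y) = tp B M Y'' x (g y)"
  shows "G ` carrier (tens B M Y) = carrier (tens B M Y'')"
proof
  show "G ` carrier (tens B M Y) \<subseteq> carrier (tens B M Y'')" using mod_hom_closed[OF G(1)] by blast
  interpret TY: left_module A "tens B M Y" by (rule left_module_tens[OF M Y])
  show "carrier (tens B M Y'') \<subseteq> G ` carrier (tens B M Y)"
  proof
    fix t assume "t \<in> carrier (tens B M Y'')"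
    then show "t \<in> G ` carrier (tens B M Y)"
    proof (induction rule: tens_induct[OF M Y'', consumes 1])
      case (1 x y)
      then obtain z where z: "z \<in> carrier Y" "y = g z" using g(2) by blast
      show ?case by (rule image_eqI[of _ _ "tp B M Y x z"]) (use 1 z in \<open>simp_all add: G(2) tp_closed[OF M Y]\<close>)
    next
      case (2 s t)
      then obtain u v where uv: "u \<in> carrier (tens B M Y)" "s = G u" "v \<in> carrier (tens B M Y)" "t = G v" by blast
      show ?case by (rule image_eqI[of _ _ "u \<oplus>\<^bsub>tens B M Y\<^esub> v"]) (use uv in \<open>simp_all add: mod_hom_simps[OF G(1)]\<close>)
    qed
  qed
qed

lemma tens_complex:
  assumes M: "bimod A B M" and Y': "left_module B Y'" and Y: "left_module B Y" and Y'': "left_module B Y''"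
    and f: "f \<in> mod_hom B Y' Y" and gf: "\<And>y. y \<in> carrier Y' \<Longrightarrow> g (f y) = \<zero>\<^bsub>Y''\<^esub>"
    and F: "F \<in> mod_hom A (tens B M Y') (tens B M Y)"
      "\<And>x y. x \<in> carrier M \<Longrightarrow> y \<in> carrier Y' \<Longrightarrow> F (tp B M Y' x y) = tp B M Y x (f y)"
    and G: "G \<in> mod_hom A (tens B M Y) (tens B M Y'')"
      "\<And>x y. x \<in> carrier M \<Longrightarrow> y \<in> carrier Y \<Longrightarrow> G (tp B M Y x y) = tp B M Y'' x (g y)"
    and t: "t \<in> carrier (tens B M Y')"
  shows "G (F t) = \<zero>\<^bsub>tens B M Y''\<^esub>"
  by (rule tens_ext[OF M Y' mod_hom_additive[OF mod_hom_comp[OF F(1) G(1)]]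
        mod_hom_additive[OF mod_hom_null[OF left_module_tens[OF M Y'']]] _ t])
     (simp add: F(2) G(2) mod_hom_closed[OF f] gf tp_zero[OF M Y''])

lemma tens_kernel:
  assumes M: "bimod A B M" and dM: "dual_basis (opposite B) (right_part M)"
    and Y': "left_module B Y'" and Y: "left_module B Y" and Y'': "left_module B Y''"
    and f: "f \<in> mod_hom B Y' Y" and g: "g \<in> mod_hom B Y Y''"
    and ex: "f ` carrier Y' = {y \<in> carrier Y. g y = \<zero>\<^bsub>Y''\<^esub>}"
    and F: "F \<in> mod_hom A (tens B M Y') (tens B M Y)"
      "\<And>x y. x \<in> carrier M \<Longrightarrow> y \<in> carrier Y' \<Longrightarrow> F (tp B M Y' x y) = tp B M Y x (f y)"
    and G: "G \<in> mod_hom A (tens B M Y) (tens B M Y'')"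
      "\<And>x y. x \<in> carrier M \<Longrightarrow> y \<in> carrier Y \<Longrightarrow> G (tp B M Y x y) = tp B M Y'' x (g y)"
  shows "F ` carrier (tens B M Y') = {t \<in> carrier (tens B M Y). G t = \<zero>\<^bsub>tens B M Y''\<^esub>}"
proof
  have gf: "g (f y) = \<zero>\<^bsub>Y''\<^esub>" if "y \<in> carrier Y'" for y using imageI[OF that, of f] unfolding ex by simp
  show "F ` carrier (tens B M Y') \<subseteq> {t \<in> carrier (tens B M Y). G t = \<zero>\<^bsub>tens B M Y''\<^esub>}"
    using tens_complex[OF M Y' Y Y'' f gf F G] mod_hom_closed[OF F(1)] by blast
  show "{t \<in> carrier (tens B M Y). G t = \<zero>\<^bsub>tens B M Y''\<^esub>} \<subseteq> F ` carrier (tens B M Y')"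
  proof
    fix t assume "t \<in> {t \<in> carrier (tens B M Y). G t = \<zero>\<^bsub>tens B M Y''\<^esub>}"
    then show "t \<in> F ` carrier (tens B M Y')"
      using tens_exact[OF M dM Y' Y Y'' f g _ F G, of t] ex by blast
  qed
qed

lemma tens_short_exact:
  assumes M: "bimod A B M" and dM: "dual_basis (opposite B) (right_part M)" and E: "short_exact B L i P \<pi> X"
  obtains i' \<pi>' where "short_exact A (tens B M L) i' (tens B M P) \<pi>' (tens B M X)"
proof -
  note D = short_exactD[OF E]
  obtain F where F: "F \<in> mod_hom A (tens B M L) (tens B M P)"
    "\<And>x y. x \<in> carrier M \<Longrightarrow> y \<in> carrier L \<Longrightarrow> F (tp B M L x y) = tp B M P x (i y)"
    by (rule tens_map_right[OF M D(1,2,4)]) (rule that)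
  obtain G where G: "G \<in> mod_hom A (tens B M P) (tens B M X)"
    "\<And>x y. x \<in> carrier M \<Longrightarrow> y \<in> carrier P \<Longrightarrow> G (tp B M P x y) = tp B M X x (\<pi> y)"
    by (rule tens_map_right[OF M D(2,3,5)]) (rule that)
  have "short_exact A (tens B M L) F (tens B M P) G (tens B M X)"
    unfolding short_exact_def
    by (intro conjI left_module_tens[OF M D(1)] left_module_tens[OF M D(2)] left_module_tens[OF M D(3)] F(1) G(1)
        tens_inj[OF M dM D(1,2,4,6) F] tens_surj[OF M D(2,3,5,7) G] tens_kernel[OF M dM D(1,2,3,4,5,8) F G])
  then show ?thesis by (rule that)
qed

lemma tens_exact_resolution:
  assumes M: "bimod A B M" and dM: "dual_basis (opposite B) (right_part M)"
    and ex: "exact_resolution B m C d" and L: "\<And>i. i \<le> Suc m \<Longrightarrow> left_module B (C i)"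
  obtains d' where "exact_resolution A m (\<lambda>i. tens B M (C i)) d'"
proof -
  have dh: "\<And>i. i \<le> m \<Longrightarrow> d i \<in> mod_hom B (C (Suc i)) (C i)"
    and d0: "d 0 ` carrier (C (Suc 0)) = carrier (C 0)"
    and dS: "\<And>i. i < m \<Longrightarrow> d (Suc i) ` carrier (C (Suc (Suc i))) = {x \<in> carrier (C (Suc i)). d i x = \<zero>\<^bsub>C i\<^esub>}"
    and dm: "inj_on (d m) (carrier (C (Suc m)))"
    using ex by (auto simp: exact_resolution_def a_kernel_eq)
  have "\<exists>F. F \<in> mod_hom A (tens B M (C (Suc i))) (tens B M (C i)) \<and>
      (\<forall>x\<in>carrier M. \<forall>y\<in>carrier (C (Suc i)). F (tp B M (C (Suc i)) x y) = tp B M (C i) x (d i y))" if i: "i \<le> m" for i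
  proof -
    obtain F where "F \<in> mod_hom A (tens B M (C (Suc i))) (tens B M (C i))"
      "\<And>x y. x \<in> carrier M \<Longrightarrow> y \<in> carrier (C (Suc i)) \<Longrightarrow> F (tp B M (C (Suc i)) x y) = tp B M (C i) x (d i y)"
      by (rule tens_map_right[OF M L L dh]) (use i in auto)
    then show ?thesis by auto
  qed
  then obtain d' where d': "\<And>i. i \<le> m \<Longrightarrow> d' i \<in> mod_hom A (tens B M (C (Suc i))) (tens B M (C i))"
    "\<And>i x y. i \<le> m \<Longrightarrow> x \<in> carrier M \<Longrightarrow> y \<in> carrier (C (Suc i)) \<Longrightarrow>
      d' i (tp B M (C (Suc i)) x y) = tp B M (C i) x (d i y)"
    by metis
  have "exact_resolution A m (\<lambda>i. tens B M (C i)) d'" unfolding exact_resolution_def a_kernel_eq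
  proof (intro conjI allI impI)
    show "d' 0 ` carrier (tens B M (C (Suc 0))) = carrier (tens B M (C 0))"
      by (rule tens_surj[OF M L L dh d0 d'(1,2)]) auto
    show "d' (Suc i) ` carrier (tens B M (C (Suc (Suc i)))) =
        {x \<in> carrier (tens B M (C (Suc i))). d' i x = \<zero>\<^bsub>tens B M (C i)\<^esub>}" if "i < m" for i
      by (rule tens_kernel[OF M dM L L L dh dh dS d'(1,2) d'(1,2)]) (use that in auto)
    show "inj_on (d' m) (carrier (tens B M (C (Suc m))))"
      by (rule tens_inj[OF M dM L L dh dm d'(1,2)]) auto
  qed (rule d'(1))
  then show ?thesis by (rule that)
qed

text \<open>Pure tensors of generators suffice, by the same two-stage closure argument as for
  restriction of scalars: first all elements of the left factor, then all of the right one.\<close>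

lemma tens_fg:
  assumes M: "bimod A B M" and Y: "left_module B Y" and fM: "finitely_generated A M" and fY: "finitely_generated B Y"
  shows "finitely_generated A (tens B M Y)"
proof -
  note Md = bimodD[OF M]
  interpret M: left_module A M by (rule Md(1))
  interpret Y: left_module B Y by (rule Y)
  interpret T: left_module A "tens B M Y" by (rule left_module_tens[OF M Y])
  obtain S where S: "finite S" "S \<subseteq> carrier M" "\<And>N. submodule N A M \<Longrightarrow> S \<subseteq> N \<Longrightarrow> N = carrier M"
    using fM by (auto simp: finitely_generated_def)
  obtain Z where Z: "finite Z" "Z \<subseteq> carrier Y" "\<And>N. submodule N B Y \<Longrightarrow> Z \<subseteq> N \<Longrightarrow> N = carrier Y"
    using fY by (auto simp: finitely_generated_def)
  let ?G = "(\<lambda>(x, y). tp B M Y x y) ` (S \<times> Z)"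
  show ?thesis unfolding finitely_generated_def
  proof (intro exI[of _ ?G] conjI allI impI)
    show "?G \<subseteq> carrier (tens B M Y)" using S Z by (auto intro!: tp_closed[OF M Y])
    fix N assume N: "submodule N A (tens B M Y) \<and> ?G \<subseteq> N"
    note Ns = T.submoduleD[of N]
    have 1: "{x \<in> carrier M. tp B M Y x z \<in> N} = carrier M" if z: "z \<in> Z" for z
    proof (rule S(3))
      have zY: "z \<in> carrier Y" using z Z by auto
      show "submodule {x \<in> carrier M. tp B M Y x z \<in> N} A M"
        using Ns N zY by (intro M.submoduleI) (auto simp: tp_zero_left[OF M Y] tp_add_left[OF M Y] simp flip: tens_smult_tp[OF M Y])
      show "S \<subseteq> {x \<in> carrier M. tp B M Y x z \<in> N}" using S N z by auto
    qed
    have 2: "{y \<in> carrier Y. \<forall>x\<in>carrier M. tp B M Y x y \<in> N} = carrier Y"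
    proof (rule Z(3))
      show "submodule {y \<in> carrier Y. \<forall>x\<in>carrier M. tp B M Y x y \<in> N} B Y"
        using Ns N Md(4) by (intro Y.submoduleI) (auto simp: tp_zero[OF M Y] tp_add_right[OF M Y] simp flip: tp_balanced[OF M Y])
      show "Z \<subseteq> {y \<in> carrier Y. \<forall>x\<in>carrier M. tp B M Y x y \<in> N}" using Z 1 by auto
    qed
    have "t \<in> N" if "t \<in> carrier (tens B M Y)" for t
      using that
    proof (induction rule: tens_induct[OF M Y, consumes 1])
      case (1 x y)
      then have "y \<in> {y \<in> carrier Y. \<forall>x\<in>carrier M. tp B M Y x y \<in> N}" unfolding 2 by simp
      then show ?case using 1 by simp
    qed (use Ns N in auto)
    then show "N = carrier (tens B M Y)" using Ns(1) N by auto
  qed (use S Z in auto)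
qed

text \<open>Here the first factor varies while Y is arbitrary, so exactness rests on a splitting. As
  k and s are linear on the right only, K and S are merely additive, but K I = id, Q S = id and I K
  + S Q = id still give exactness of the sequence of left modules.\<close>

lemma tens_split_exact:
  assumes L: "bimod A B L" and P: "bimod A B P" and Z: "bimod A B Z" and Y: "left_module B Y"
    and i: "i \<in> mod_hom A L P" "i \<in> right_hom B L P" and p: "p \<in> mod_hom A P Z" "p \<in> right_hom B P Z"
    and k: "k \<in> right_hom B P L" and s: "s \<in> right_hom B Z P"
    and eq: "\<And>x. x \<in> carrier L \<Longrightarrow> k (i x) = x" "\<And>z. z \<in> carrier Z \<Longrightarrow> p (s z) = z"
      "\<And>x. x \<in> carrier P \<Longrightarrow> i (k x) \<oplus>\<^bsub>P\<^esub> s (p x) = x" "\<And>x. x \<in> carrier L \<Longrightarrow> p (i x) = \<zero>\<^bsub>Z\<^esub>"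
  obtains i' p' where "short_exact A (tens B L Y) i' (tens B P Y) p' (tens B Z Y)"
proof -
  note TL = left_module_tens[OF L Y] and TP = left_module_tens[OF P Y] and TZ = left_module_tens[OF Z Y]
  interpret TP: left_module A "tens B P Y" by (rule TP)
  obtain I where I: "I \<in> mod_hom A (tens B L Y) (tens B P Y)"
    "\<And>x y. x \<in> carrier L \<Longrightarrow> y \<in> carrier Y \<Longrightarrow> I (tp B L Y x y) = tp B P Y (i x) y"
    by (rule tens_map[OF L Y P Y i mod_hom_id]) (rule that)
  obtain Q where Q: "Q \<in> mod_hom A (tens B P Y) (tens B Z Y)"
    "\<And>x y. x \<in> carrier P \<Longrightarrow> y \<in> carrier Y \<Longrightarrow> Q (tp B P Y x y) = tp B Z Y (p x) y"
    by (rule tens_map[OF P Y Z Y p mod_hom_id]) (rule that)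
  obtain K where K: "additive_map (tens B P Y) (tens B L Y) K"
    "\<And>x y. x \<in> carrier P \<Longrightarrow> y \<in> carrier Y \<Longrightarrow> K (tp B P Y x y) = tp B L Y (k x) y"
    by (rule tens_map_additive[OF P Y L k]) (rule that)
  obtain S where S: "additive_map (tens B Z Y) (tens B P Y) S"
    "\<And>x y. x \<in> carrier Z \<Longrightarrow> y \<in> carrier Y \<Longrightarrow> S (tp B Z Y x y) = tp B P Y (s x) y"
    by (rule tens_map_additive[OF Z Y P s]) (rule that)
  note Ia = mod_hom_additive[OF I(1)] and Qa = mod_hom_additive[OF Q(1)]
  note h = right_homD(1)[OF i(2)] right_homD(1)[OF p(2)] right_homD(1)[OF k] right_homD(1)[OF s]
  have KI: "K (I t) = t" if "t \<in> carrier (tens B L Y)" for t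
    by (rule tens_ext[OF L Y additive_map_comp[OF Ia K(1)] additive_map_id _ that]) (simp add: I(2) K(2) h eq)
  have QS: "Q (S t) = t" if "t \<in> carrier (tens B Z Y)" for t
    by (rule tens_ext[OF Z Y additive_map_comp[OF S(1) Qa] additive_map_id _ that]) (simp add: S(2) Q(2) h eq)
  have IKSQ: "I (K t) \<oplus>\<^bsub>tens B P Y\<^esub> S (Q t) = t" if "t \<in> carrier (tens B P Y)" for t
    by (rule tens_ext[OF P Y additive_map_plus[OF left_module.axioms(2)[OF TP] additive_map_comp[OF K(1) Ia]
          additive_map_comp[OF Qa S(1)]] additive_map_id _ that])
       (simp add: I(2) K(2) S(2) Q(2) h eq flip: tp_add_left[OF P Y])
  have QI: "Q (I t) = \<zero>\<^bsub>tens B Z Y\<^esub>" if "t \<in> carrier (tens B L Y)" for t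
    by (rule tens_ext[OF L Y additive_map_comp[OF Ia Qa] mod_hom_additive[OF mod_hom_null[OF TZ]] _ that])
       (simp add: I(2) Q(2) h eq tp_zero_left[OF Z Y])
  have S0: "S \<zero>\<^bsub>tens B Z Y\<^esub> = \<zero>\<^bsub>tens B P Y\<^esub>"
    by (rule additive_zero[OF left_module.axioms(2)[OF TZ] left_module.axioms(2)[OF TP]]) (simp_all add: additive_mapD[OF S(1)])
  have "short_exact A (tens B L Y) I (tens B P Y) Q (tens B Z Y)"
    unfolding short_exact_def
  proof (intro conjI TL TP TZ I(1) Q(1))
    show "inj_on I (carrier (tens B L Y))" using KI by (metis inj_onI)
    show "Q ` carrier (tens B P Y) = carrier (tens B Z Y)"
    proof
      show "carrier (tens B Z Y) \<subseteq> Q ` carrier (tens B P Y)"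
        using QS additive_mapD(1)[OF S(1)] by (metis image_eqI subsetI)
    qed (use mod_hom_closed[OF Q(1)] in blast)
    show "I ` carrier (tens B L Y) = {t \<in> carrier (tens B P Y). Q t = \<zero>\<^bsub>tens B Z Y\<^esub>}"
    proof
      show "I ` carrier (tens B L Y) \<subseteq> {t \<in> carrier (tens B P Y). Q t = \<zero>\<^bsub>tens B Z Y\<^esub>}"
        using QI mod_hom_closed[OF I(1)] by blast
      show "{t \<in> carrier (tens B P Y). Q t = \<zero>\<^bsub>tens B Z Y\<^esub>} \<subseteq> I ` carrier (tens B L Y)"
      proof
        fix t assume t: "t \<in> {t \<in> carrier (tens B P Y). Q t = \<zero>\<^bsub>tens B Z Y\<^esub>}"
        then have c: "K t \<in> carrier (tens B L Y)" using additive_mapD(1)[OF K(1)] by simp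
        then have "t = I (K t)" using IKSQ[of t] t S0 mod_hom_closed[OF I(1) c] by simp
        then show "t \<in> I ` carrier (tens B L Y)" using c by blast
      qed
    qed
  qed
  then show ?thesis by (rule that)
qed

section \<open>Associativity of the tensor product\<close>

lemma tensor_bimodule_simps:
  "carrier (tensor_bimodule A N M) = carrier (tens A N M)" "add (tensor_bimodule A N M) = add (tens A N M)"
  "\<zero>\<^bsub>tensor_bimodule A N M\<^esub> = \<zero>\<^bsub>tens A N M\<^esub>" "smult (tensor_bimodule A N M) = smult (tens A N M)"
  by (auto simp: tensor_bimodule_def tens_def)

context
  fixes C :: "('c, 'u) ring_scheme" and A :: "('a, 'v) ring_scheme" and B :: "('b, 'w) ring_scheme"
    and N :: "('c, 'a, 'n, 'x) bimodule_scheme" and M :: "('a, 'b, 'm, 'y) bimodule_scheme"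
  assumes N: "bimod C A N" and M: "bimod A B M"
begin

interpretation T: tensor_pair A N M by (rule tensor_pairI[OF N bimodD(1)[OF M]])

lemmas Nd = bimodD[OF N] and Md = bimodD[OF M]

lemma tensor_rsmult_cl:
  assumes "p \<in> carrier T.FG" "b \<in> carrier B"
  shows "rsmult (tensor_bimodule A N M) (T.cl p) b = T.cl (frag_extend (\<lambda>(x, y). frag_of (x, rsmult M y b)) p)"
proof -
  have "frag_extend (\<lambda>(x, y). frag_of (x, rsmult M y b)) p \<in> T.TK" if "p \<in> T.TK" for p
    by (rule T.frag_map_TK[where f = "\<lambda>x. x", OF _ _ _ _ _ _ T.tensor_pair_axioms that]) (use assms(2) Md in auto)
  then show ?thesis
    using T.UN_cl_action[OF assms(1), of "frag_extend (\<lambda>(x, y). frag_of (x, rsmult M y b))" T.TK T.cl]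
    by (simp add: tensor_bimodule_def frag_extend_diff T.cl_eq_iff)
qed

lemma tensor_rsmult_tp:
  "b \<in> carrier B \<Longrightarrow> x \<in> carrier N \<Longrightarrow> y \<in> carrier M \<Longrightarrow>
    rsmult (tensor_bimodule A N M) (tp A N M x y) b = tp A N M x (rsmult M y b)"
  unfolding tp_def by (subst tensor_rsmult_cl) auto

text \<open>The right action is given by representatives, so it is identified with the additive map
  h that the universal property provides for x \<otimes> y \<mapsto> x \<otimes> y b; the two agree
  on all classes by induction over the free group.\<close>

lemma tensor_rsmult_additive:
  assumes "b \<in> carrier B"
  shows "additive_map (tens A N M) (tens A N M) (\<lambda>t. rsmult (tensor_bimodule A N M) t b)"
proof -
  obtain h where h: "additive_map (tens A N M) (tens A N M) h"
    "\<And>x y. x \<in> carrier N \<Longrightarrow> y \<in> carrier M \<Longrightarrow> h (tp A N M x y) = tp A N M x (rsmult M y b)"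
  proof (rule tens_additive[OF N Md(1) left_module.axioms(2)[OF left_module_tens[OF N Md(1)]]])
    show "balanced A N M (tens A N M) (\<lambda>x y. tp A N M x (rsmult M y b))"
      by (rule balancedI) (use assms in \<open>simp_all add: Md tp_closed[OF N Md(1)] tp_add_left[OF N Md(1)]
        tp_add_right[OF N Md(1)] tp_balanced[OF N Md(1)]\<close>)
  qed (rule that)
  let ?F = "frag_extend (\<lambda>(x, y). frag_of (x, rsmult M y b))"
  \<comment> \<open>Membership of \<open>?F p\<close> in the free group is carried along, as classes
    can be added only there.\<close>
  have "h (T.cl p) = T.cl (?F p) \<and> ?F p \<in> carrier T.FG" if "Poly_Mapping.keys p \<subseteq> carrier N \<times> carrier M" for p
    using that
  proof (rule free_Abelian_group_induct)
    interpret G: abelian_group "tens A N M" by (rule T.tens_abelian)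
    have z: "h (T.cl 0) = T.cl 0"
      using additive_zero[OF G.abelian_group_axioms G.abelian_group_axioms additive_mapD[OF h(1)]]
      by (simp add: tens_simps T.one_TG)
    then show "h (T.cl 0) = T.cl (?F 0) \<and> ?F 0 \<in> carrier T.FG" by simp
    show "h (T.cl (frag_of a)) = T.cl (?F (frag_of a)) \<and> ?F (frag_of a) \<in> carrier T.FG" if "a \<in> carrier N \<times> carrier M" for a
      using that h(2) assms Md(4) by (cases a) (auto simp: tp_def)
    fix p q assume pq: "Poly_Mapping.keys p \<subseteq> carrier N \<times> carrier M" "Poly_Mapping.keys q \<subseteq> carrier N \<times> carrier M"
      "h (T.cl p) = T.cl (?F p) \<and> ?F p \<in> carrier T.FG" "h (T.cl q) = T.cl (?F q) \<and> ?F q \<in> carrier T.FG"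
    have cG: "T.cl u \<in> carrier (tens A N M)" if "u \<in> carrier T.FG" for u
      using that by (simp add: tens_simps T.carrier_TG)
    have neg: "T.cl (- u) = \<ominus>\<^bsub>tens A N M\<^esub> T.cl u" and negc: "- u \<in> carrier T.FG" if "u \<in> carrier T.FG" for u
    proof -
      show "- u \<in> carrier T.FG" using that by simp
      then have "T.cl (- u) \<oplus>\<^bsub>tens A N M\<^esub> T.cl u = \<zero>\<^bsub>tens A N M\<^esub>"
        using T.cl_add[of "- u" u] that by (simp add: tens_simps T.one_TG)
      then show "T.cl (- u) = \<ominus>\<^bsub>tens A N M\<^esub> T.cl u"
        using cG[OF that] cG[OF \<open>- u \<in> carrier T.FG\<close>] by (simp add: G.minus_equality)
    qed
    have sub: "T.cl (u - v) = T.cl u \<oplus>\<^bsub>tens A N M\<^esub> \<ominus>\<^bsub>tens A N M\<^esub> T.cl v" if "u \<in> carrier T.FG" "v \<in> carrier T.FG" for u v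
      using T.cl_add[OF that(1) negc[OF that(2)]] by (simp add: tens_simps flip: neg[OF that(2)])
    have c: "p \<in> carrier T.FG" "q \<in> carrier T.FG" using pq by simp_all
    have "h (\<ominus>\<^bsub>tens A N M\<^esub> T.cl q) = \<ominus>\<^bsub>tens A N M\<^esub> h (T.cl q)"
      by (rule additive_minus[OF G.abelian_group_axioms G.abelian_group_axioms additive_mapD[OF h(1)] cG[OF c(2)]])
    then have "h (T.cl (p - q)) = T.cl (?F (p - q))"
      using pq c cG by (simp add: sub additive_mapD[OF h(1)] frag_extend_diff del: carrier_free_Abelian_group_iff)
    moreover have "?F (p - q) \<in> carrier T.FG"
      using T.frag_closed[OF conjunct2[OF pq(3)] negc[OF conjunct2[OF pq(4)]]] by (simp add: frag_extend_diff)
    ultimately show "h (T.cl (p - q)) = T.cl (?F (p - q)) \<and> ?F (p - q) \<in> carrier T.FG" by blast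
  qed
  then have "rsmult (tensor_bimodule A N M) t b = h t" if "t \<in> carrier (tens A N M)" for t
    using that tensor_rsmult_cl[OF _ assms] by (auto simp: tens_simps T.carrier_TG)
  then show ?thesis using h(1) abelian_group.axioms(1)[OF T.tens_abelian]
    by (auto simp: additive_map_def abelian_monoid.a_closed)
qed

lemma bimod_tensor: "bimod C B (tensor_bimodule A N M)"
proof -
  let ?L = "tensor_bimodule A N M"
  have LT: "left_module C (tens A N M)" by (rule left_module_tens[OF N Md(1)])
  interpret LT: left_module C "tens A N M" by (rule LT)
  interpret R: left_module "opposite B" "right_part M" by (rule Md(2))
  note add = additive_mapD[OF tensor_rsmult_additive]
  note tpc = tp_closed[OF N Md(1)]
  have L: "left_module C ?L"
    by (rule left_moduleI)
       (auto simp: tensor_bimodule_simps LT.M.a_ac LT.smult_l_distr LT.smult_r_distr LT.smult_assoc LT.smult_one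
          LT.ring_axioms intro: LT.M.add.l_inv_ex)
  have R: "left_module (opposite B) (right_part ?L)"
  proof (rule left_moduleI)
    fix b c t assume b: "b \<in> carrier (opposite B)" "c \<in> carrier (opposite B)" and "t \<in> carrier (right_part ?L)"
    then have t: "t \<in> carrier (tens A N M)" by (simp add: tensor_bimodule_simps)
    have [simp]: "b \<in> carrier B" "c \<in> carrier B" using b by auto
    have bc: "b \<oplus>\<^bsub>B\<^esub> c \<in> carrier B" "c \<otimes>\<^bsub>B\<^esub> b \<in> carrier B" using R.R.a_closed[OF b] R.R.m_closed[OF b] by simp_all
    have "rsmult ?L t (b \<oplus>\<^bsub>B\<^esub> c) = rsmult ?L t b \<oplus>\<^bsub>tens A N M\<^esub> rsmult ?L t c"
      by (rule tens_ext[OF N Md(1) tensor_rsmult_additive additive_map_plus[OF left_module.axioms(2)[OF LT] tensor_rsmult_additive tensor_rsmult_additive] _ t])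
         (simp_all add: bc tensor_rsmult_tp Md tp_add_right[OF N Md(1)])
    then show "(b \<oplus>\<^bsub>opposite B\<^esub> c) \<odot>\<^bsub>right_part ?L\<^esub> t = b \<odot>\<^bsub>right_part ?L\<^esub> t \<oplus>\<^bsub>right_part ?L\<^esub> c \<odot>\<^bsub>right_part ?L\<^esub> t"
      by (simp add: tensor_bimodule_simps)
    have "rsmult ?L t (c \<otimes>\<^bsub>B\<^esub> b) = rsmult ?L (rsmult ?L t c) b"
      by (rule tens_ext[OF N Md(1) tensor_rsmult_additive additive_map_comp[OF tensor_rsmult_additive tensor_rsmult_additive] _ t])
         (simp_all add: bc tensor_rsmult_tp Md)
    then show "(b \<otimes>\<^bsub>opposite B\<^esub> c) \<odot>\<^bsub>right_part ?L\<^esub> t = b \<odot>\<^bsub>right_part ?L\<^esub> (c \<odot>\<^bsub>right_part ?L\<^esub> t)"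
      by simp
  next
    fix t assume "t \<in> carrier (right_part ?L)"
    then have t: "t \<in> carrier (tens A N M)" by (simp add: tensor_bimodule_simps)
    have "\<one>\<^bsub>B\<^esub> \<in> carrier B" using R.R.one_closed by simp
    then have "rsmult ?L t \<one>\<^bsub>B\<^esub> = t"
      by (intro tens_ext[OF N Md(1) tensor_rsmult_additive additive_map_id _ t]) (simp_all add: tensor_rsmult_tp Md)
    then show "\<one>\<^bsub>opposite B\<^esub> \<odot>\<^bsub>right_part ?L\<^esub> t = t" by simp
  qed (auto simp: tensor_bimodule_simps LT.M.a_ac add R.ring_axioms intro: LT.M.add.l_inv_ex)
  have "rsmult ?L (c \<odot>\<^bsub>?L\<^esub> t) b = c \<odot>\<^bsub>?L\<^esub> rsmult ?L t b"
    if "c \<in> carrier C" "t \<in> carrier ?L" "b \<in> carrier B" for c t b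
  proof -
    have t: "t \<in> carrier (tens A N M)" using that by (simp add: tensor_bimodule_simps)
    show ?thesis unfolding tensor_bimodule_simps using t
    proof (induction rule: tens_induct[OF N Md(1), consumes 1])
      case (1 x y)
      then show ?case using that by (simp add: tens_smult_tp[OF N Md(1)] tensor_rsmult_tp Md(4) left_module.smult_closed[OF Nd(1)])
    next
      case (2 s t)
      then show ?case using that by (simp add: LT.smult_r_distr add)
    qed
  qed
  then show ?thesis using L R by (auto simp: bimod_def)
qed

text \<open>Both maps are built in two stages: for fixed y an additive map on N \<otimes> M, then a
  balanced map in both variables; in the other direction n is fixed. The families h and k are
  chosen, and their additivity in the parameter follows by comparison on pure tensors.\<close>

lemma tens_assoc:
  assumes Y: "left_module B Y"
  shows "mod_iso C (tens B (tensor_bimodule A N M) Y) (tens A N (tens B M Y))"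
proof -
  let ?L = "tensor_bimodule A N M" and ?TY = "tens B M Y"
  let ?X = "tens B ?L Y" and ?Z = "tens A N ?TY"
  note L = bimod_tensor and TY = left_module_tens[OF M Y]
  note X = left_module_tens[OF L Y] and Z = left_module_tens[OF N TY]
  interpret Y: left_module B Y by (rule Y)
  note N1 = Md(1)
  note cl = tp_closed[OF N N1] tp_closed[OF M Y] tp_closed[OF N TY] tp_closed[OF L Y, unfolded tensor_bimodule_simps]
    tp_add_left[OF N N1] tp_add_left[OF M Y] tp_add_left[OF N TY] tp_add_left[OF L Y, unfolded tensor_bimodule_simps]
    tp_add_right[OF N N1] tp_add_right[OF M Y] tp_add_right[OF N TY] tp_add_right[OF L Y, unfolded tensor_bimodule_simps]
    tens_smult_tp[OF N N1] tens_smult_tp[OF M Y] tens_smult_tp[OF N TY] tens_smult_tp[OF L Y, unfolded tensor_bimodule_simps]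
  have bal: "tp B M Y (rsmult M m b) y = tp B M Y m (b \<odot>\<^bsub>Y\<^esub> y)" if "m \<in> carrier M" "b \<in> carrier B" "y \<in> carrier Y" for m b y
    by (rule tp_balanced[OF M Y that])
  have balN: "tp A N ?TY (rsmult N n a) t = tp A N ?TY n (a \<odot>\<^bsub>?TY\<^esub> t)" if "n \<in> carrier N" "a \<in> carrier A" "t \<in> carrier ?TY" for n a t
    by (rule tp_balanced[OF N TY that])
  have balNM: "tp A N M (rsmult N n a) m = tp A N M n (a \<odot>\<^bsub>M\<^esub> m)" if "n \<in> carrier N" "a \<in> carrier A" "m \<in> carrier M" for n a m
    by (rule tp_balanced[OF N N1 that])
  have balL: "tp B ?L Y (rsmult ?L l b) y = tp B ?L Y l (b \<odot>\<^bsub>Y\<^esub> y)" if "l \<in> carrier (tens A N M)" "b \<in> carrier B" "y \<in> carrier Y" for l b y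
    by (rule tp_balanced[OF L Y]) (use that in \<open>simp_all add: tensor_bimodule_simps\<close>)
  have "\<exists>h. additive_map (tens A N M) ?Z h \<and> (\<forall>n\<in>carrier N. \<forall>m\<in>carrier M. h (tp A N M n m) = tp A N ?TY n (tp B M Y m y))"
    if y: "y \<in> carrier Y" for y
  proof -
    obtain h where "additive_map (tens A N M) ?Z h"
      "\<And>n m. n \<in> carrier N \<Longrightarrow> m \<in> carrier M \<Longrightarrow> h (tp A N M n m) = tp A N ?TY n (tp B M Y m y)"
    proof (rule tens_additive[OF N N1 left_module.axioms(2)[OF Z]])
      show "balanced A N M ?Z (\<lambda>n m. tp A N ?TY n (tp B M Y m y))"
        by (rule balancedI) (use y in \<open>simp_all add: cl balN\<close>)
    qed (rule that)
    then show ?thesis by blast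
  qed
  then obtain h where h: "\<And>y. y \<in> carrier Y \<Longrightarrow> additive_map (tens A N M) ?Z (h y)"
    "\<And>y n m. y \<in> carrier Y \<Longrightarrow> n \<in> carrier N \<Longrightarrow> m \<in> carrier M \<Longrightarrow> h y (tp A N M n m) = tp A N ?TY n (tp B M Y m y)"
    by metis
  obtain f where f: "f \<in> mod_hom C ?X ?Z"
    "\<And>l y. l \<in> carrier ?L \<Longrightarrow> y \<in> carrier Y \<Longrightarrow> f (tp B ?L Y l y) = h y l"
  proof (rule tens_hom[OF L Y Z])
    show "balanced B ?L Y ?Z (\<lambda>l y. h y l)"
    proof (rule balancedI; unfold tensor_bimodule_simps)
      show "h (y \<oplus>\<^bsub>Y\<^esub> y') l = h y l \<oplus>\<^bsub>?Z\<^esub> h y' l" if "l \<in> carrier (tens A N M)" "y \<in> carrier Y" "y' \<in> carrier Y" for l y y'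
        by (rule tens_ext[OF N N1 h(1) additive_map_plus[OF left_module.axioms(2)[OF Z] h(1) h(1)] _ that(1)])
           (use that in \<open>simp_all add: h(2) cl\<close>)
      show "h y (rsmult ?L l b) = h (b \<odot>\<^bsub>Y\<^esub> y) l" if "l \<in> carrier (tens A N M)" "b \<in> carrier B" "y \<in> carrier Y" for l b y
        by (rule tens_ext[OF N N1 additive_map_comp[OF tensor_rsmult_additive h(1)] h(1) _ that(1)])
           (use that in \<open>simp_all add: h(2) tensor_rsmult_tp Md(4) bal\<close>)
    qed (use additive_mapD[OF h(1)] in auto)
    show "h y (c \<odot>\<^bsub>?L\<^esub> l) = c \<odot>\<^bsub>?Z\<^esub> h y l" if "c \<in> carrier C" "l \<in> carrier ?L" "y \<in> carrier Y" for c l y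
    proof -
      interpret Z: left_module C ?Z by (rule Z)
      interpret NM: left_module C "tens A N M" by (rule left_module_tens[OF N N1])
      have l: "l \<in> carrier (tens A N M)" using that by (simp add: tensor_bimodule_simps)
      show ?thesis unfolding tensor_bimodule_simps using l
        by (induction rule: tens_induct[OF N N1, consumes 1])
           (use that in \<open>simp_all add: cl h(2) additive_mapD[OF h(1)] NM.smult_r_distr Z.smult_r_distr left_module.smult_closed[OF Nd(1)] left_module.smult_closed[OF N1]\<close>)
    qed
  qed (rule that)
  have "\<exists>k. additive_map ?TY ?X k \<and> (\<forall>m\<in>carrier M. \<forall>y\<in>carrier Y. k (tp B M Y m y) = tp B ?L Y (tp A N M n m) y)"
    if n: "n \<in> carrier N" for n
  proof -
    obtain k where "additive_map ?TY ?X k"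
      "\<And>m y. m \<in> carrier M \<Longrightarrow> y \<in> carrier Y \<Longrightarrow> k (tp B M Y m y) = tp B ?L Y (tp A N M n m) y"
    proof (rule tens_additive[OF M Y left_module.axioms(2)[OF X]])
      show "balanced B M Y ?X (\<lambda>m y. tp B ?L Y (tp A N M n m) y)"
        by (rule balancedI) (use n in \<open>simp_all add: cl balL Md(4) flip: tensor_rsmult_tp\<close>)
    qed (rule that)
    then show ?thesis by blast
  qed
  then obtain k where k: "\<And>n. n \<in> carrier N \<Longrightarrow> additive_map ?TY ?X (k n)"
    "\<And>n m y. n \<in> carrier N \<Longrightarrow> m \<in> carrier M \<Longrightarrow> y \<in> carrier Y \<Longrightarrow> k n (tp B M Y m y) = tp B ?L Y (tp A N M n m) y"
    by metis
  obtain g where g: "additive_map ?Z ?X g" "\<And>n t. n \<in> carrier N \<Longrightarrow> t \<in> carrier ?TY \<Longrightarrow> g (tp A N ?TY n t) = k n t"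
  proof (rule tens_additive[OF N TY left_module.axioms(2)[OF X]])
    show "balanced A N ?TY ?X k"
    proof (rule balancedI)
      show "k (n \<oplus>\<^bsub>N\<^esub> n') t = k n t \<oplus>\<^bsub>?X\<^esub> k n' t" if "n \<in> carrier N" "n' \<in> carrier N" "t \<in> carrier ?TY" for n n' t
        by (rule tens_ext[OF M Y k(1) additive_map_plus[OF left_module.axioms(2)[OF X] k(1) k(1)] _ that(3)])
           (use that left_module.axioms(2)[OF Nd(1)] in \<open>simp_all add: k(2) cl abelian_group_def abelian_monoid.a_closed\<close>)
      show "k (rsmult N n a) t = k n (a \<odot>\<^bsub>?TY\<^esub> t)" if "n \<in> carrier N" "a \<in> carrier A" "t \<in> carrier ?TY" for n a t
      proof -
        have a: "additive_map ?TY ?TY (\<lambda>t. a \<odot>\<^bsub>?TY\<^esub> t)"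
          using that left_module.smult_closed[OF TY] left_module.smult_r_distr[OF TY] by (auto simp: additive_map_def)
        show ?thesis
          by (rule tens_ext[OF M Y k(1) additive_map_comp[OF a k(1)] _ that(3)])
             (use that left_module.smult_closed[OF N1] in \<open>simp_all add: k(2) cl Nd(4) balNM\<close>)
      qed
    qed (use additive_mapD[OF k(1)] in auto)
  qed (rule that)
  have gf: "g (f t) = t" if t: "t \<in> carrier ?X" for t
  proof (rule tens_ext[OF L Y additive_map_comp[OF mod_hom_additive[OF f(1)] g(1)] additive_map_id _ t])
    fix l y assume l: "l \<in> carrier ?L" and y: "y \<in> carrier Y"
    have a: "additive_map (tens A N M) ?X (\<lambda>l. tp B ?L Y l y)" using y by (simp add: additive_map_def cl)
    have "g (h y l) = tp B ?L Y l y"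
      by (rule tens_ext[OF N N1 additive_map_comp[OF h(1)[OF y] g(1)] a])
         (use l y in \<open>simp_all add: h(2) g(2) k(2) cl tensor_bimodule_simps\<close>)
    then show "g (f (tp B ?L Y l y)) = tp B ?L Y l y" using l y by (simp add: f(2))
  qed
  have fg: "f (g t) = t" if t: "t \<in> carrier ?Z" for t
  proof (rule tens_ext[OF N TY additive_map_comp[OF g(1) mod_hom_additive[OF f(1)]] additive_map_id _ t])
    fix n t assume n: "n \<in> carrier N" and t: "t \<in> carrier ?TY"
    have a: "additive_map ?TY ?Z (tp A N ?TY n)" using n by (simp add: additive_map_def cl)
    have "f (k n t) = tp A N ?TY n t"
      by (rule tens_ext[OF M Y additive_map_comp[OF k(1)[OF n] mod_hom_additive[OF f(1)]] a _ t])
         (use n in \<open>simp_all add: h(2) k(2) f(2) cl tensor_bimodule_simps\<close>)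
    then show "f (g (tp A N ?TY n t)) = tp A N ?TY n t" using n t by (simp add: g(2))
  qed
  \<comment> \<open>Only f is known to be linear; the additive map g serves as the witness of its
    bijectivity.\<close>
  have "bij_betw f (carrier ?X) (carrier ?Z)"
    by (rule bij_betw_byWitness[where f' = g]) (use gf fg mod_hom_closed[OF f(1)] additive_mapD(1)[OF g(1)] in auto)
  then show ?thesis unfolding mod_iso_def using X Z f(1) by blast
qed

end

section \<open>Modules over the enveloping algebra\<close>

text \<open>Evaluating a formal sum termwise, as \<open>enveloping_module\<close> does, amounts to
  applying an additive map to its class; so the value does not depend on the representative.\<close>

lemma (in tensor_pair) finsum_representative:
  assumes L: "abelian_group L" and h: "additive_map (tens B M N) L h"
    and \<beta>: "\<And>x y. x \<in> carrier M \<Longrightarrow> y \<in> carrier N \<Longrightarrow> h (pure x y) = \<beta> (x, y)"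
    and p: "p \<in> carrier FG"
  shows "(\<Oplus>\<^bsub>L\<^esub>z\<in>Poly_Mapping.keys p. [Poly_Mapping.lookup p z] \<cdot>\<^bsub>L\<^esub> \<beta> z) = h (cl p)"
proof -
  interpret L: abelian_group L by (rule L)
  have hom: "(\<lambda>p. h (cl p)) \<in> hom FG (add_monoid L)"
  proof (rule homI)
    show "h (cl p) \<in> carrier (add_monoid L)" if "p \<in> carrier FG" for p
      using additive_mapD(1)[OF h] that by (auto simp: tens_simps carrier_TG)
    show "h (cl (p \<otimes>\<^bsub>FG\<^esub> q)) = h (cl p) \<otimes>\<^bsub>add_monoid L\<^esub> h (cl q)" if "p \<in> carrier FG" "q \<in> carrier FG" for p q
    proof -
      have "cl p \<in> carrier (tens B M N)" "cl q \<in> carrier (tens B M N)"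
        using that by (auto simp: tens_simps carrier_TG)
      from additive_mapD(2)[OF h this] show ?thesis using cl_add[OF that] by (simp add: tens_simps)
    qed
  qed
  have cmul: "h (cl (frag_cmul n (frag_of z))) = [n] \<cdot>\<^bsub>L\<^esub> \<beta> z" and bc: "\<beta> z \<in> carrier L"
    and cc: "frag_cmul n (frag_of z) \<in> carrier FG" if z: "z \<in> carrier M \<times> carrier N" for n :: int and z
  proof -
    have e: "h (cl (frag_of z)) = \<beta> z" using z \<beta> by (cases z) (auto simp: tp_def)
    show "h (cl (frag_cmul n (frag_of z))) = [n] \<cdot>\<^bsub>L\<^esub> \<beta> z"
      using hom_int_pow[OF hom _ group_free_Abelian_group L.a_group, of "frag_of z" n] z e by (simp add: add_pow_def)
    show "\<beta> z \<in> carrier L" using hom_in_carrier[OF hom, of "frag_of z"] z e by simp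
    show "frag_cmul n (frag_of z) \<in> carrier FG" using z keys_cmul[of n "frag_of z"] by auto
  qed
  \<comment> \<open>The claim is made for arbitrary finite S and coefficients c, so that the keys of
    p can be added one by one while the coefficients stay fixed.\<close>
  have sum: "finite S \<Longrightarrow> S \<subseteq> carrier M \<times> carrier N \<Longrightarrow> (\<Sum>z\<in>S. frag_cmul (c z) (frag_of z)) \<in> carrier FG \<and>
      h (cl (\<Sum>z\<in>S. frag_cmul (c z) (frag_of z))) = (\<Oplus>\<^bsub>L\<^esub>z\<in>S. [c z] \<cdot>\<^bsub>L\<^esub> \<beta> z)" for S and c :: "_ \<Rightarrow> int"
  proof (induction S rule: finite_induct)
    case empty
    have "h (cl 0) = \<zero>\<^bsub>L\<^esub>"
      using hom_one[OF hom group_free_Abelian_group L.a_group] by simp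
    then show ?case by simp
  next
    case (insert z S)
    let ?s = "\<Sum>z\<in>S. frag_cmul (c z) (frag_of z)"
    have z: "z \<in> carrier M \<times> carrier N" using insert by auto
    have s: "?s \<in> carrier FG" "h (cl ?s) = (\<Oplus>\<^bsub>L\<^esub>z\<in>S. [c z] \<cdot>\<^bsub>L\<^esub> \<beta> z)" using insert by auto
    have "h (cl (frag_cmul (c z) (frag_of z) + ?s)) = [c z] \<cdot>\<^bsub>L\<^esub> \<beta> z \<oplus>\<^bsub>L\<^esub> h (cl ?s)"
      using hom_mult[OF hom cc[OF z] s(1)] by (simp add: cmul[OF z])
    moreover have "(\<Oplus>\<^bsub>L\<^esub>z\<in>insert z S. [c z] \<cdot>\<^bsub>L\<^esub> \<beta> z) = [c z] \<cdot>\<^bsub>L\<^esub> \<beta> z \<oplus>\<^bsub>L\<^esub> (\<Oplus>\<^bsub>L\<^esub>z\<in>S. [c z] \<cdot>\<^bsub>L\<^esub> \<beta> z)"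
      by (rule L.finsum_insert) (use insert bc in \<open>auto intro!: L.add.int_pow_closed\<close>)
    ultimately show ?case using insert s frag_closed[OF cc[OF z] s(1)] by simp
  qed
  have "p = (\<Sum>z\<in>Poly_Mapping.keys p. frag_cmul (Poly_Mapping.lookup p z) (frag_of z))"
    using frag_expansion[of p] unfolding frag_extend_def .
  then show ?thesis
    using sum[OF finite_keys p[unfolded carrier_free_Abelian_group_iff], of "Poly_Mapping.lookup p"] by simp
qed

lemma scalar_bimodule_simps [simp]:
  "carrier (scalar_bimodule B) = carrier B" "add (scalar_bimodule B) = add B" "\<zero>\<^bsub>scalar_bimodule B\<^esub> = \<zero>\<^bsub>B\<^esub>"
  "smult (scalar_bimodule B) = smult B" "rsmult (scalar_bimodule B) a c = c \<odot>\<^bsub>B\<^esub> a"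
  by (auto simp: scalar_bimodule_def)

lemma regular_bimodule_simps [simp]:
  "carrier (regular_bimodule B) = carrier B" "add (regular_bimodule B) = add B" "\<zero>\<^bsub>regular_bimodule B\<^esub> = \<zero>\<^bsub>B\<^esub>"
  "smult (regular_bimodule B) = mult B" "rsmult (regular_bimodule B) = mult B"
  by (auto simp: regular_bimodule_def)

lemma smult_opposite [simp]: "c \<odot>\<^bsub>opposite B\<^esub> b = c \<odot>\<^bsub>B\<^esub> b" for B :: "('k, 'b, 'x) module_scheme"
  by (simp add: opposite_def)

text \<open>The element a \<otimes> b of the enveloping algebra.\<close>

definition pe where "pe K B a b = tp K (scalar_bimodule B) (opposite B) a b"

abbreviation env_tens where "env_tens K B \<equiv> tens K (scalar_bimodule B) (opposite B)"

lemma enveloping_simps: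
  "carrier (enveloping_algebra K B) = carrier (env_tens K B)" "add (enveloping_algebra K B) = add (env_tens K B)"
  "\<zero>\<^bsub>enveloping_algebra K B\<^esub> = \<zero>\<^bsub>env_tens K B\<^esub>" "\<one>\<^bsub>enveloping_algebra K B\<^esub> = pe K B \<one>\<^bsub>B\<^esub> \<one>\<^bsub>B\<^esub>"
  by (auto simp: enveloping_algebra_def tensor_algebra_def tens_simps Let_def pe_def tp_def)

text \<open>The way back from \<open>enveloping_module\<close>. Syzygies over the enveloping algebra
  arise as plain modules and have to be read as bimodules before they can be tensored with
  Y.\<close>

definition bim ::
  "('k, 'w) ring_scheme \<Rightarrow> ('k, 'b, 'x) module_scheme \<Rightarrow> (('b \<times> 'b \<Rightarrow>\<^sub>0 int) set, 'z, 'y) module_scheme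
    \<Rightarrow> ('b, 'b, 'z) bimodule" where
  "bim K B Z = \<lparr>carrier = carrier Z, mult = undefined, one = undefined, ring.zero = \<zero>\<^bsub>Z\<^esub>, add = add Z,
     smult = (\<lambda>b z. pe K B b \<one>\<^bsub>B\<^esub> \<odot>\<^bsub>Z\<^esub> z), rsmult = (\<lambda>z b. pe K B \<one>\<^bsub>B\<^esub> b \<odot>\<^bsub>Z\<^esub> z)\<rparr>"

lemma bim_simps [simp]:
  "carrier (bim K B Z) = carrier Z" "add (bim K B Z) = add Z" "\<zero>\<^bsub>bim K B Z\<^esub> = \<zero>\<^bsub>Z\<^esub>"
  "b \<odot>\<^bsub>bim K B Z\<^esub> z = pe K B b \<one>\<^bsub>B\<^esub> \<odot>\<^bsub>Z\<^esub> z" "rsmult (bim K B Z) z b = pe K B \<one>\<^bsub>B\<^esub> b \<odot>\<^bsub>Z\<^esub> z"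
  by (auto simp: bim_def)

context
  fixes K :: "('k, 'w) ring_scheme" and B :: "('k, 'b, 'x) module_scheme"
  assumes fd: "fd_algebra K B"
begin

interpretation K: ring K by (rule left_module.axioms(1)[OF fd_algebra.left_module_A[OF fd]])
interpretation B: ring B by (rule fd_algebra.ring_A[OF fd])
interpretation KB: left_module K B by (rule fd_algebra.left_module_A[OF fd])
interpretation fd: fd_algebra K B by (rule fd)

private abbreviation "E \<equiv> enveloping_algebra K B"
private abbreviation "S \<equiv> scalar_bimodule B"
private abbreviation "Op \<equiv> opposite B"

lemma K_comm: "c \<in> carrier K \<Longrightarrow> c' \<in> carrier K \<Longrightarrow> c \<otimes>\<^bsub>K\<^esub> c' = c' \<otimes>\<^bsub>K\<^esub> c"
  using field.axioms(1)[OF fd.field_K] by (simp add: domain_def cring_def comm_monoid.m_comm)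

lemma K_ring: "ring K"
  by (rule left_module.axioms(1)[OF fd.left_module_A])

lemma ring_opposite: "ring Op"
  by (rule ringI)
     (auto intro!: abelian_groupI monoidI simp: B.a_ac B.m_assoc B.l_distr B.r_distr intro: B.add.l_inv_ex)

lemma left_module_opposite: "left_module K Op"
  by (rule left_moduleI)
     (auto simp: B.a_ac KB.smult_l_distr KB.smult_r_distr KB.smult_assoc KB.smult_one K_ring intro: B.add.l_inv_ex)

lemma bimod_scalar: "bimod K K S"
proof -
  have oK: "ring (opposite K)"
    by (rule ringI)
       (auto intro!: abelian_groupI monoidI simp: K.a_ac K.m_assoc K.l_distr K.r_distr intro: K.add.l_inv_ex)
  have 1: "left_module K S"
    by (rule left_moduleI)
       (auto simp: B.a_ac KB.smult_l_distr KB.smult_r_distr KB.smult_assoc KB.smult_one K_ring intro: B.add.l_inv_ex)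
  have 2: "left_module (opposite K) (right_part S)"
    by (rule left_moduleI)
       (auto simp: B.a_ac KB.smult_l_distr KB.smult_r_distr KB.smult_one oK K_comm intro: B.add.l_inv_ex simp flip: KB.smult_assoc)
  have "c \<odot>\<^bsub>B\<^esub> (c' \<odot>\<^bsub>B\<^esub> b) = c' \<odot>\<^bsub>B\<^esub> (c \<odot>\<^bsub>B\<^esub> b)" if "c \<in> carrier K" "c' \<in> carrier K" "b \<in> carrier B" for c c' b
    using that by (simp add: K_comm flip: KB.smult_assoc)
  then show ?thesis using 1 2 by (simp add: bimod_def)
qed

interpretation T: tensor_pair K S Op by (rule tensor_pairI[OF bimod_scalar left_module_opposite])

lemma pe_closed: "a \<in> carrier B \<Longrightarrow> b \<in> carrier B \<Longrightarrow> pe K B a b \<in> carrier E"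
  and pe_add_left: "a \<in> carrier B \<Longrightarrow> a' \<in> carrier B \<Longrightarrow> b \<in> carrier B \<Longrightarrow>
    pe K B (a \<oplus>\<^bsub>B\<^esub> a') b = pe K B a b \<oplus>\<^bsub>E\<^esub> pe K B a' b"
  and pe_add_right: "a \<in> carrier B \<Longrightarrow> b \<in> carrier B \<Longrightarrow> b' \<in> carrier B \<Longrightarrow>
    pe K B a (b \<oplus>\<^bsub>B\<^esub> b') = pe K B a b \<oplus>\<^bsub>E\<^esub> pe K B a b'"
  and pe_balanced: "a \<in> carrier B \<Longrightarrow> b \<in> carrier B \<Longrightarrow> c \<in> carrier K \<Longrightarrow>
    pe K B (c \<odot>\<^bsub>B\<^esub> a) b = pe K B a (c \<odot>\<^bsub>B\<^esub> b)"
  using tp_closed[OF bimod_scalar left_module_opposite] tp_add_left[OF bimod_scalar left_module_opposite]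
    tp_add_right[OF bimod_scalar left_module_opposite] tp_balanced[OF bimod_scalar left_module_opposite]
  by (simp_all add: pe_def enveloping_simps)

lemma env_induct [consumes 1]:
  assumes "e \<in> carrier E"
    and "\<And>a b. a \<in> carrier B \<Longrightarrow> b \<in> carrier B \<Longrightarrow> P (pe K B a b)"
    and "\<And>e e'. e \<in> carrier E \<Longrightarrow> e' \<in> carrier E \<Longrightarrow> P e \<Longrightarrow> P e' \<Longrightarrow> P (e \<oplus>\<^bsub>E\<^esub> e')"
  shows "P e"
  using assms tens_induct[OF bimod_scalar left_module_opposite, of e P] by (simp add: enveloping_simps pe_def)

lemma env_ext:
  assumes "additive_map E H f" "additive_map E H g"
    and "\<And>a b. a \<in> carrier B \<Longrightarrow> b \<in> carrier B \<Longrightarrow> f (pe K B a b) = g (pe K B a b)"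
    and "e \<in> carrier E"
  shows "f e = g e"
  using assms(4)
  by (induction rule: env_induct) (use assms(1-3) in \<open>simp_all add: additive_mapD(2)[of _ H]\<close>)

lemma env_additive:
  assumes "abelian_group H" "balanced K S Op H \<beta>"
  obtains h where "additive_map E H h" "\<And>a b. a \<in> carrier B \<Longrightarrow> b \<in> carrier B \<Longrightarrow> h (pe K B a b) = \<beta> a b"
proof (rule tens_additive[OF bimod_scalar left_module_opposite assms])
  fix h assume "additive_map (env_tens K B) H h"
    and *: "\<And>x y. x \<in> carrier S \<Longrightarrow> y \<in> carrier Op \<Longrightarrow> h (tp K S Op x y) = \<beta> x y"
  then have "additive_map E H h" by (simp add: additive_map_def enveloping_simps)
  then show thesis by (rule that) (use * in \<open>simp add: pe_def\<close>)
qed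

text \<open>The product is a union over two representatives, so independence is needed in both:
  \<open>F1\<close> lets the second one vary for any formal sum p, and \<open>F2\<close> then lets
  the first one vary while the second stays pure.\<close>

lemma pe_mult:
  assumes "a \<in> carrier B" "b \<in> carrier B" "a' \<in> carrier B" "b' \<in> carrier B"
  shows "pe K B a b \<otimes>\<^bsub>E\<^esub> pe K B a' b' = pe K B (a \<otimes>\<^bsub>B\<^esub> a') (b' \<otimes>\<^bsub>B\<^esub> b)"
proof -
  let ?F = "\<lambda>p q. frag_extend (\<lambda>(a, b). frag_extend (\<lambda>(a', b'). frag_of (a \<otimes>\<^bsub>B\<^esub> a', b \<otimes>\<^bsub>Op\<^esub> b')) q) p"
  let ?p = "frag_of (a, b)" and ?q = "frag_of (a', b')"
  have F2: "?F k ?q \<in> T.TK" if "k \<in> T.TK" for k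
    using T.frag_map_TK[where f = "\<lambda>x. x \<otimes>\<^bsub>B\<^esub> a'" and g = "\<lambda>y. y \<otimes>\<^bsub>Op\<^esub> b'", OF _ _ _ _ _ _ T.tensor_pair_axioms that] assms
    by (simp add: B.l_distr B.r_distr fd.smult_mult_left fd.smult_mult_right case_prod_beta')
  have F1: "?F p k \<in> T.TK" if p: "p \<in> carrier T.FG" and k: "k \<in> T.TK" for p k
  proof (rule free_Abelian_group_induct[OF p[unfolded carrier_free_Abelian_group_iff], where P = "\<lambda>p. ?F p k \<in> T.TK"])
    fix x assume "x \<in> carrier S \<times> carrier Op"
    then have x: "fst x \<in> carrier B" "snd x \<in> carrier B" by auto
    show "?F (frag_of x) k \<in> T.TK"
      using T.frag_map_TK[where f = "\<lambda>y. fst x \<otimes>\<^bsub>B\<^esub> y" and g = "\<lambda>y. snd x \<otimes>\<^bsub>Op\<^esub> y", OF _ _ _ _ _ _ T.tensor_pair_axioms k] x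
      by (simp add: B.l_distr B.r_distr fd.smult_mult_left fd.smult_mult_right case_prod_beta')
  qed (use T.TK_closed in \<open>simp_all add: frag_extend_diff\<close>)
  \<comment> \<open>The formal sum q sits inside the function that is extended, so this is
    additivity of \<open>frag_extend\<close> in the function, shown by induction on p.\<close>
  have Fdiff: "?F p (q - r) = ?F p q - ?F p r" for p q r
  proof -
    have "frag_extend (\<lambda>x. f x - g x) p = frag_extend f p - frag_extend g p" for f g :: "_ \<Rightarrow> _ \<Rightarrow>\<^sub>0 int"
      by (rule free_Abelian_group_induct[OF subset_UNIV]) (simp_all add: frag_extend_diff)
    from this[of "\<lambda>(a, b). frag_extend (\<lambda>(a', b'). frag_of (a \<otimes>\<^bsub>B\<^esub> a', b \<otimes>\<^bsub>Op\<^esub> b')) q"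
        "\<lambda>(a, b). frag_extend (\<lambda>(a', b'). frag_of (a \<otimes>\<^bsub>B\<^esub> a', b \<otimes>\<^bsub>Op\<^esub> b')) r"]
    show ?thesis by (simp add: case_prod_beta' frag_extend_diff)
  qed
  have pc: "?p \<in> carrier T.FG" using assms by simp
  have "(\<Union>p\<in>T.cl ?p. \<Union>q\<in>T.cl ?q. T.cl (?F p q)) = T.cl (?F ?p ?q)"
  proof -
    have inner: "(\<Union>q\<in>T.cl ?q. T.cl (?F p q)) = T.cl (?F p ?q)" if "p \<in> carrier T.FG" for p
    proof (rule T.UN_cl)
      fix q assume "q \<in> T.cl ?q"
      then have "?F p (q - ?q) \<in> T.TK" unfolding T.cl_iff by (rule F1[OF that])
      then show "T.cl (?F p q) = T.cl (?F p ?q)" unfolding T.cl_eq_iff Fdiff .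
    qed
    have "(\<Union>p\<in>T.cl ?p. \<Union>q\<in>T.cl ?q. T.cl (?F p q)) = (\<Union>p\<in>T.cl ?p. T.cl (?F p ?q))"
    proof (rule SUP_cong[OF refl])
      fix p assume "p \<in> T.cl ?p"
      then have "p - ?p \<in> carrier T.FG" using T.cl_iff T.TK_closed(1) by blast
      then have "p \<in> carrier T.FG" using T.frag_closed[OF _ pc, of "p - ?p"] by simp
      then show "(\<Union>q\<in>T.cl ?q. T.cl (?F p q)) = T.cl (?F p ?q)" by (rule inner)
    qed
    also have "\<dots> = T.cl (?F ?p ?q)"
    proof (rule T.UN_cl)
      fix p assume "p \<in> T.cl ?p"
      then have "?F (p - ?p) ?q \<in> T.TK" unfolding T.cl_iff by (rule F2)
      then show "T.cl (?F p ?q) = T.cl (?F ?p ?q)" unfolding T.cl_eq_iff frag_extend_diff[of _ p] .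
    qed
    finally show ?thesis .
  qed
  then show ?thesis
    by (simp add: enveloping_algebra_def tensor_algebra_def Let_def pe_def tp_def)
qed

lemma pe_one_right: "b \<in> carrier B \<Longrightarrow> b' \<in> carrier B \<Longrightarrow> pe K B \<one>\<^bsub>B\<^esub> b' \<otimes>\<^bsub>E\<^esub> pe K B b \<one>\<^bsub>B\<^esub> = pe K B b b'"
  by (simp_all add: pe_mult)

lemma bimod_bim:
  assumes Z: "left_module E Z"
  shows "bimod B B (bim K B Z)"
proof -
  interpret Z: left_module E Z by (rule Z)
  have 1: "left_module B (bim K B Z)"
    by (rule left_moduleI)
       (auto simp: pe_closed Z.M.a_ac pe_add_left Z.smult_l_distr Z.smult_r_distr Z.smult_one pe_mult
          B.ring_axioms intro: Z.M.add.l_inv_ex simp flip: Z.smult_assoc enveloping_simps)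
  have 2: "left_module Op (right_part (bim K B Z))"
    by (rule left_moduleI)
       (auto simp: pe_closed Z.M.a_ac pe_add_right Z.smult_l_distr Z.smult_r_distr Z.smult_one pe_mult
          ring_opposite intro: Z.M.add.l_inv_ex simp flip: Z.smult_assoc enveloping_simps)
  show ?thesis using 1 2 by (auto simp: bimod_def pe_closed pe_mult simp flip: Z.smult_assoc)
qed

lemma mod_hom_bim:
  assumes "f \<in> mod_hom E Z Z'"
  shows "f \<in> mod_hom B (bim K B Z) (bim K B Z')" "f \<in> right_hom B (bim K B Z) (bim K B Z')"
  by (rule mod_homI; simp add: mod_hom_simps[OF assms] pe_closed)+

section \<open>Projective bimodules as right modules and under tensoring\<close>

lemma fac_right_bim:
  assumes "fac E U P P' h"
  shows "fac Op (right_part (bim K B U)) (right_part (bim K B P)) (right_part (bim K B P')) h"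
  using assms
proof induction
  case (fac_null h)
  then show ?case by (intro fac.fac_null) simp
next
  case (fac_step \<alpha> \<beta> h' h)
  show ?case
    by (rule fac.fac_step[OF mod_hom_bim(2)[OF fac_step(1)] mod_hom_bim(2)[OF fac_step(2)] fac_step(5)])
       (use fac_step(4) in simp)
qed

lemma fac_tens_bim:
  assumes U: "left_module E U" and P: "left_module E P" and P': "left_module E P'" and Y: "left_module B Y"
    and "fac E U P P' h"
  shows "\<exists>H. fac B (tens B (bim K B U) Y) (tens B (bim K B P) Y) (tens B (bim K B P') Y) H \<and>
    (\<forall>x\<in>carrier P. \<forall>y\<in>carrier Y. H (tp B (bim K B P) Y x y) = tp B (bim K B P') Y (h x) y)"
  using assms(5)
proof induction
  case (fac_null h)
  show ?case
    by (intro exI[of _ "\<lambda>t. \<zero>\<^bsub>tens B (bim K B P') Y\<^esub>"] conjI fac.fac_null)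
       (simp_all add: fac_null tp_zero_left[OF bimod_bim[OF P'] Y, simplified])
next
  case (fac_step \<alpha> \<beta> h' h)
  note bU = bimod_bim[OF U] and bP = bimod_bim[OF P] and bP' = bimod_bim[OF P']
  obtain a where a: "a \<in> mod_hom B (tens B (bim K B P) Y) (tens B (bim K B U) Y)"
    "\<And>x y. x \<in> carrier (bim K B P) \<Longrightarrow> y \<in> carrier Y \<Longrightarrow> a (tp B (bim K B P) Y x y) = tp B (bim K B U) Y (\<alpha> x) y"
    by (rule tens_map[OF bP Y bU Y mod_hom_bim[OF fac_step(1)] mod_hom_id]) (rule that)
  obtain b where b: "b \<in> mod_hom B (tens B (bim K B U) Y) (tens B (bim K B P') Y)"
    "\<And>x y. x \<in> carrier (bim K B U) \<Longrightarrow> y \<in> carrier Y \<Longrightarrow> b (tp B (bim K B U) Y x y) = tp B (bim K B P') Y (\<beta> x) y"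
    by (rule tens_map[OF bU Y bP' Y mod_hom_bim[OF fac_step(2)] mod_hom_id]) (rule that)
  from fac_step(5) obtain H where H: "fac B (tens B (bim K B U) Y) (tens B (bim K B P) Y) (tens B (bim K B P') Y) H"
    "\<forall>x\<in>carrier P. \<forall>y\<in>carrier Y. H (tp B (bim K B P) Y x y) = tp B (bim K B P') Y (h' x) y" by (elim exE conjE)
  have h': "h' \<in> mod_hom E P P'" by (rule fac_mod_hom[OF fac_step(3) P P'])
  show ?case
  proof (intro exI conjI ballI)
    show "fac B (tens B (bim K B U) Y) (tens B (bim K B P) Y) (tens B (bim K B P') Y)
        (\<lambda>t. b (a t) \<oplus>\<^bsub>tens B (bim K B P') Y\<^esub> H t)"
      by (rule fac.fac_step[OF a(1) b(1) H(1)]) simp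
    show "b (a (tp B (bim K B P) Y x y)) \<oplus>\<^bsub>tens B (bim K B P') Y\<^esub> H (tp B (bim K B P) Y x y) = tp B (bim K B P') Y (h x) y"
      if "x \<in> carrier P" "y \<in> carrier Y" for x y
      using that H(2) mod_hom_closed[OF fac_step(1)] mod_hom_closed[OF fac_step(2)] mod_hom_closed[OF h']
      by (simp add: a(2) b(2) fac_step(4) tp_add_left[OF bP' Y, simplified])
  qed
qed

text \<open>That the enveloping algebra is a ring is taken as a hypothesis here; it is later read
  off from a given module over it, since \<open>left_module\<close> includes this fact.\<close>

lemma left_module_env:
  assumes E: "ring E"
  shows "left_module E (regular_module E)" "bimod B B (bim K B (regular_module E))"
    "left_module Op (right_part (bim K B (regular_module E)))"
  using left_module_regular[OF E] bimod_bim[OF left_module_regular[OF E]] bimodD(2) by blast+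

lemma env_mult_additive:
  assumes E: "ring E" and "e \<in> carrier E"
  shows "additive_map E E (\<lambda>x. e \<otimes>\<^bsub>E\<^esub> x)"
proof -
  interpret E: ring E by (rule E)
  show ?thesis using assms(2) by (auto simp: additive_map_def E.r_distr)
qed

text \<open>A \<open>K\<close>-basis \<open>b\<^sub>i\<close> of \<open>B\<close> gives the basis \<open>b\<^sub>i \<otimes> 1\<close> of the enveloping algebra as a
  right \<open>B\<close>-module.\<close>

lemma dual_basis_env_right:
  assumes E: "ring E"
  shows "dual_basis Op (right_part (bim K B (regular_module E)))"
proof -
  let ?rE = "right_part (bim K B (regular_module E))"
  interpret E: ring E by (rule E)
  note L = left_module_env[OF E]
  interpret rE: left_module Op ?rE by (rule L(3))
  \<comment> \<open>\<Theta> is h \<otimes> id; for h the identity of B it is the identity of the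
    enveloping algebra.\<close>
  have "\<exists>\<Theta>. pfac Op ?rE ?rE \<Theta> \<and> (\<forall>b\<in>carrier B. \<forall>b'\<in>carrier B. \<Theta> (pe K B b b') = pe K B (h b) b')"
    if "pfac K B B h" for h
    using that
  proof induction
    case (fac_null h)
    have "pe K B \<zero>\<^bsub>B\<^esub> b' = \<zero>\<^bsub>E\<^esub>" if "b' \<in> carrier B" for b'
      using tp_zero_left[OF bimod_scalar left_module_opposite, of b'] that by (simp add: pe_def enveloping_simps)
    then show ?case
      by (intro exI[of _ "\<lambda>e. \<zero>\<^bsub>E\<^esub>"] conjI fac.fac_null) (simp_all add: fac_null)
  next
    case (fac_step \<alpha> \<beta> h' h)
    have \<alpha>: "\<And>b. b \<in> carrier B \<Longrightarrow> \<alpha> b \<in> carrier K"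
      "\<And>b b'. b \<in> carrier B \<Longrightarrow> b' \<in> carrier B \<Longrightarrow> \<alpha> (b \<oplus>\<^bsub>B\<^esub> b') = \<alpha> b \<oplus>\<^bsub>K\<^esub> \<alpha> b'"
      "\<And>c b. c \<in> carrier K \<Longrightarrow> b \<in> carrier B \<Longrightarrow> \<alpha> (c \<odot>\<^bsub>B\<^esub> b) = c \<otimes>\<^bsub>K\<^esub> \<alpha> b"
      using mod_hom_simps[OF fac_step(1)] by simp_all
    define b0 where "b0 = \<beta> \<one>\<^bsub>K\<^esub>"
    have b0: "b0 \<in> carrier B" unfolding b0_def by (rule mod_hom_closed[OF fac_step(2)]) simp
    have \<beta>: "\<beta> c = c \<odot>\<^bsub>B\<^esub> b0" if "c \<in> carrier K" for c
      unfolding b0_def using mod_hom_regular_eq[OF K_ring fac_step(2) that] .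
    from fac_step(5) obtain \<Theta> where \<Theta>: "pfac Op ?rE ?rE \<Theta>"
      "\<forall>b\<in>carrier B. \<forall>b'\<in>carrier B. \<Theta> (pe K B b b') = pe K B (h' b) b'" by (elim exE conjE)
    have h': "h' \<in> mod_hom K B B" by (rule fac_mod_hom[OF fac_step(3) fd.left_module_A fd.left_module_A])
    \<comment> \<open>The coordinate form \<alpha> \<otimes> id, with values in K \<otimes> B =
      B.\<close>
    obtain \<psi> where \<psi>: "additive_map E B \<psi>"
      "\<And>a b. a \<in> carrier B \<Longrightarrow> b \<in> carrier B \<Longrightarrow> \<psi> (pe K B a b) = \<alpha> a \<odot>\<^bsub>B\<^esub> b"
    proof (rule env_additive[OF B.abelian_group_axioms])
      show "balanced K S Op B (\<lambda>a b. \<alpha> a \<odot>\<^bsub>B\<^esub> b)"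
        by (rule balancedI)
           (simp_all add: \<alpha> KB.smult_l_distr KB.smult_r_distr K_comm flip: KB.smult_assoc)
    qed (rule that)
    have \<psi>r: "\<psi> (pe K B \<one>\<^bsub>B\<^esub> x \<otimes>\<^bsub>E\<^esub> e) = \<psi> e \<otimes>\<^bsub>B\<^esub> x" if x: "x \<in> carrier B" and e: "e \<in> carrier E" for x e
    proof (rule env_ext[OF additive_map_comp[OF env_mult_additive[OF E] \<psi>(1)] additive_map_comp[OF \<psi>(1)] _ e])
      show "additive_map B B (\<lambda>y. y \<otimes>\<^bsub>B\<^esub> x)" using x by (auto simp: additive_map_def B.l_distr)
    qed (use x in \<open>simp_all add: pe_closed pe_mult \<psi>(2) \<alpha> fd.smult_mult_left\<close>)
    have \<psi>h: "\<psi> \<in> mod_hom Op ?rE (regular_module Op)"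
      by (rule mod_homI) (simp_all add: additive_mapD[OF \<psi>(1)] \<psi>r)
    let ?z = "pe K B b0 \<one>\<^bsub>B\<^esub>"
    have z: "?z \<in> carrier ?rE" using b0 by (simp add: pe_closed)
    show ?case
    proof (intro exI conjI ballI)
      show "pfac Op ?rE ?rE (\<lambda>e. \<psi> e \<odot>\<^bsub>?rE\<^esub> ?z \<oplus>\<^bsub>?rE\<^esub> \<Theta> e)"
        by (rule fac.fac_step[OF \<psi>h mod_hom_regular[OF L(3) z] \<Theta>(1)]) simp
      show "\<psi> (pe K B b b') \<odot>\<^bsub>?rE\<^esub> ?z \<oplus>\<^bsub>?rE\<^esub> \<Theta> (pe K B b b') = pe K B (h b) b'"
        if "b \<in> carrier B" "b' \<in> carrier B" for b b'
        using that b0 \<Theta>(2) mod_hom_closed[OF h']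
        by (simp add: \<psi>(2) \<alpha> pe_one_right fac_step(4) \<beta> pe_add_left pe_balanced)
    qed
  qed
  from this[OF field_dual_basis[OF fd.field_K fd.left_module_A fd.finite_dimensional]]
  obtain \<Theta> where \<Theta>: "pfac Op ?rE ?rE \<Theta>" "\<forall>b\<in>carrier B. \<forall>b'\<in>carrier B. \<Theta> (pe K B b b') = pe K B b b'"
    by (elim exE conjE)
  have "additive_map E E \<Theta>"
    using mod_hom_additive[OF fac_mod_hom[OF \<Theta>(1) L(3,3)]] by (simp add: additive_map_def)
  then have "\<Theta> e = e" if "e \<in> carrier E" for e
    by (rule env_ext[OF _ additive_map_id _ that]) (use \<Theta>(2) in simp)
  then show ?thesis by (intro fac_cong[OF \<Theta>(1)]) simp
qed

text \<open>Likewise \<open>E \<otimes>\<^sub>B Y = B \<otimes>\<^sub>K Y\<close> is free over \<open>B\<close>, on a \<open>K\<close>-basis of \<open>Y\<close>.\<close>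

lemma dual_basis_tens_env:
  assumes E: "ring E" and Y: "left_module B Y" and fY: "finitely_generated B Y"
  shows "dual_basis B (tens B (bim K B (regular_module E)) Y)"
proof -
  let ?bE = "bim K B (regular_module E)" and ?YK = "scalar_module B Y"
  let ?T = "tens B ?bE Y"
  interpret E: ring E by (rule E)
  interpret Y: left_module B Y by (rule Y)
  note L = left_module_env[OF E]
  note T = left_module_tens[OF L(2) Y]
  interpret T: left_module B ?T by (rule T)
  note YK = fd.left_module_scalar[OF Y]
  note tpc = tp_closed[OF L(2) Y, simplified] and tpl = tp_add_left[OF L(2) Y, simplified]
    and tpr = tp_add_right[OF L(2) Y, simplified] and tpb = tp_balanced[OF L(2) Y, simplified]
    and tps = tens_smult_tp[OF L(2) Y, simplified]
  note reg = left_module_regular[OF B.ring_axioms]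
  let ?one = "pe K B \<one>\<^bsub>B\<^esub> \<one>\<^bsub>B\<^esub>"
  have one: "?one \<in> carrier E" by (simp add: pe_closed)
  \<comment> \<open>Under the identification of (b \<otimes> b') \<otimes> y with b \<otimes> b' y,
    the map \<Theta> is id \<otimes> h.\<close>
  have "\<exists>\<Theta>. pfac B ?T ?T \<Theta> \<and> (\<forall>b\<in>carrier B. \<forall>b'\<in>carrier B. \<forall>y\<in>carrier Y.
      \<Theta> (tp B ?bE Y (pe K B b b') y) = b \<odot>\<^bsub>?T\<^esub> tp B ?bE Y ?one (h (b' \<odot>\<^bsub>Y\<^esub> y)))"
    if "pfac K ?YK ?YK h" for h
    using that
  proof induction
    case (fac_null h)
    then show ?case
      by (intro exI[of _ "\<lambda>t. \<zero>\<^bsub>?T\<^esub>"] conjI fac.fac_null)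
         (simp_all add: tp_zero[OF L(2) Y, simplified] one)
  next
    case (fac_step \<alpha> \<beta> h' h)
    have \<alpha>: "\<And>y. y \<in> carrier Y \<Longrightarrow> \<alpha> y \<in> carrier K"
      "\<And>y y'. y \<in> carrier Y \<Longrightarrow> y' \<in> carrier Y \<Longrightarrow> \<alpha> (y \<oplus>\<^bsub>Y\<^esub> y') = \<alpha> y \<oplus>\<^bsub>K\<^esub> \<alpha> y'"
      "\<And>c y. c \<in> carrier K \<Longrightarrow> y \<in> carrier Y \<Longrightarrow> \<alpha> ((c \<odot>\<^bsub>B\<^esub> \<one>\<^bsub>B\<^esub>) \<odot>\<^bsub>Y\<^esub> y) = c \<otimes>\<^bsub>K\<^esub> \<alpha> y"
      using mod_hom_simps[OF fac_step(1)] by simp_all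
    have \<alpha>': "\<alpha> ((c \<odot>\<^bsub>B\<^esub> b) \<odot>\<^bsub>Y\<^esub> y) = c \<otimes>\<^bsub>K\<^esub> \<alpha> (b \<odot>\<^bsub>Y\<^esub> y)" if "c \<in> carrier K" "b \<in> carrier B" "y \<in> carrier Y" for c b y
      using \<alpha>(3)[of c "b \<odot>\<^bsub>Y\<^esub> y"] that by (simp add: fd.scalar_one flip: Y.smult_assoc)
    define y0 where "y0 = \<beta> \<one>\<^bsub>K\<^esub>"
    have y0: "y0 \<in> carrier Y" unfolding y0_def using mod_hom_closed[OF fac_step(2), of "\<one>\<^bsub>K\<^esub>"] by simp
    have \<beta>: "\<beta> c = (c \<odot>\<^bsub>B\<^esub> \<one>\<^bsub>B\<^esub>) \<odot>\<^bsub>Y\<^esub> y0" if "c \<in> carrier K" for c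
      unfolding y0_def using mod_hom_regular_eq[OF K_ring fac_step(2) that] by simp
    from fac_step(5) obtain \<Theta> where \<Theta>: "pfac B ?T ?T \<Theta>"
      "\<forall>b\<in>carrier B. \<forall>b'\<in>carrier B. \<forall>y\<in>carrier Y.
        \<Theta> (tp B ?bE Y (pe K B b b') y) = b \<odot>\<^bsub>?T\<^esub> tp B ?bE Y ?one (h' (b' \<odot>\<^bsub>Y\<^esub> y))" by (elim exE conjE)
    have h': "h' \<in> mod_hom K ?YK ?YK" by (rule fac_mod_hom[OF fac_step(3) YK YK])
    \<comment> \<open>The linear form \<Lambda> below sends (b \<otimes> b') \<otimes> y to \<alpha>
      (b' y) b. It is defined in two stages, at first on the enveloping algebra for fixed y.\<close>
    have "\<exists>l. additive_map E B l \<and> (\<forall>b\<in>carrier B. \<forall>b'\<in>carrier B. l (pe K B b b') = \<alpha> (b' \<odot>\<^bsub>Y\<^esub> y) \<odot>\<^bsub>B\<^esub> b)"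
      if y: "y \<in> carrier Y" for y
    proof -
      obtain l where "additive_map E B l"
        "\<And>b b'. b \<in> carrier B \<Longrightarrow> b' \<in> carrier B \<Longrightarrow> l (pe K B b b') = \<alpha> (b' \<odot>\<^bsub>Y\<^esub> y) \<odot>\<^bsub>B\<^esub> b"
      proof (rule env_additive[OF B.abelian_group_axioms])
        show "balanced K S Op B (\<lambda>b b'. \<alpha> (b' \<odot>\<^bsub>Y\<^esub> y) \<odot>\<^bsub>B\<^esub> b)"
          by (rule balancedI)
             (use y in \<open>simp_all add: \<alpha> \<alpha>' Y.smult_l_distr KB.smult_l_distr KB.smult_r_distr K_comm flip: KB.smult_assoc\<close>)
      qed (rule that)
      then show ?thesis by blast
    qed
    then obtain l where l: "\<And>y. y \<in> carrier Y \<Longrightarrow> additive_map E B (l y)"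
      "\<And>y b b'. y \<in> carrier Y \<Longrightarrow> b \<in> carrier B \<Longrightarrow> b' \<in> carrier B \<Longrightarrow> l y (pe K B b b') = \<alpha> (b' \<odot>\<^bsub>Y\<^esub> y) \<odot>\<^bsub>B\<^esub> b"
      by metis
    obtain \<Lambda> where \<Lambda>: "\<Lambda> \<in> mod_hom B ?T (regular_module B)"
      "\<And>e y. e \<in> carrier ?bE \<Longrightarrow> y \<in> carrier Y \<Longrightarrow> \<Lambda> (tp B ?bE Y e y) = l y e"
    proof (rule tens_hom[OF L(2) Y reg])
      show "balanced B ?bE Y (regular_module B) (\<lambda>e y. l y e)"
      proof (rule balancedI; simp)
        show "l y e \<in> carrier B" if "e \<in> carrier E" "y \<in> carrier Y" for e y using additive_mapD(1)[OF l(1)] that by blast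
        show "l y (e \<oplus>\<^bsub>E\<^esub> e') = l y e \<oplus>\<^bsub>B\<^esub> l y e'" if "e \<in> carrier E" "e' \<in> carrier E" "y \<in> carrier Y" for e e' y
          using additive_mapD(2)[OF l(1)] that by blast
        show "l (y \<oplus>\<^bsub>Y\<^esub> y') e = l y e \<oplus>\<^bsub>B\<^esub> l y' e" if "e \<in> carrier E" "y \<in> carrier Y" "y' \<in> carrier Y" for e y y'
          by (rule env_ext[OF l(1) additive_map_plus[OF B.abelian_group_axioms l(1) l(1)] _ that(1)])
             (use that in \<open>simp_all add: l(2) \<alpha> Y.smult_r_distr KB.smult_l_distr\<close>)
        show "l y (pe K B \<one>\<^bsub>B\<^esub> x \<otimes>\<^bsub>E\<^esub> e) = l (x \<odot>\<^bsub>Y\<^esub> y) e" if "e \<in> carrier E" "x \<in> carrier B" "y \<in> carrier Y" for e x y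
          by (rule env_ext[OF additive_map_comp[OF env_mult_additive[OF E] l(1)] l(1) _ that(1)])
             (use that in \<open>simp_all add: l(2) pe_closed pe_mult Y.smult_assoc\<close>)
      qed
      show "l y (x \<odot>\<^bsub>?bE\<^esub> e) = x \<odot>\<^bsub>regular_module B\<^esub> l y e" if "x \<in> carrier B" "e \<in> carrier ?bE" "y \<in> carrier Y" for x e y
      proof -
        have x: "additive_map B B (\<lambda>b. x \<otimes>\<^bsub>B\<^esub> b)" using that(1) by (auto simp: additive_map_def B.r_distr)
        have e: "e \<in> carrier E" using that by simp
        have "l y (pe K B x \<one>\<^bsub>B\<^esub> \<otimes>\<^bsub>E\<^esub> e) = x \<otimes>\<^bsub>B\<^esub> l y e"
          by (rule env_ext[OF additive_map_comp[OF env_mult_additive[OF E] l(1)] additive_map_comp[OF l(1) x] _ e])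
             (use that in \<open>simp_all add: l(2) pe_closed pe_mult \<alpha> fd.smult_mult_right\<close>)
        then show ?thesis by simp
      qed
    qed (rule that)
    let ?z = "tp B ?bE Y ?one y0"
    have z: "?z \<in> carrier ?T" using y0 one by (simp add: tpc)
    show ?case
    proof (intro exI conjI ballI)
      show "pfac B ?T ?T (\<lambda>t. \<Lambda> t \<odot>\<^bsub>?T\<^esub> ?z \<oplus>\<^bsub>?T\<^esub> \<Theta> t)"
        by (rule fac.fac_step[OF \<Lambda>(1) mod_hom_regular[OF T z] \<Theta>(1)]) simp
      fix b b' y assume b: "b \<in> carrier B" "b' \<in> carrier B" and y: "y \<in> carrier Y"
      define c where "c = \<alpha> (b' \<odot>\<^bsub>Y\<^esub> y)"
      have c: "c \<in> carrier K" using b y by (simp add: c_def \<alpha>)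
      have hc: "h' (b' \<odot>\<^bsub>Y\<^esub> y) \<in> carrier Y" using mod_hom_closed[OF h'] b y by simp
      have cy: "(c \<odot>\<^bsub>B\<^esub> \<one>\<^bsub>B\<^esub>) \<odot>\<^bsub>Y\<^esub> y0 \<in> carrier Y" using c y0 by simp
      have "(c \<odot>\<^bsub>B\<^esub> b) \<odot>\<^bsub>?T\<^esub> ?z = b \<odot>\<^bsub>?T\<^esub> ((c \<odot>\<^bsub>B\<^esub> \<one>\<^bsub>B\<^esub>) \<odot>\<^bsub>?T\<^esub> ?z)"
        using b c z by (simp add: fd.scalar_one' flip: T.smult_assoc)
      also have "(c \<odot>\<^bsub>B\<^esub> \<one>\<^bsub>B\<^esub>) \<odot>\<^bsub>?T\<^esub> ?z = tp B ?bE Y ?one ((c \<odot>\<^bsub>B\<^esub> \<one>\<^bsub>B\<^esub>) \<odot>\<^bsub>Y\<^esub> y0)"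
        using c y0 one by (simp add: tps pe_mult pe_balanced flip: tpb)
      finally have e: "(c \<odot>\<^bsub>B\<^esub> b) \<odot>\<^bsub>?T\<^esub> ?z = b \<odot>\<^bsub>?T\<^esub> tp B ?bE Y ?one ((c \<odot>\<^bsub>B\<^esub> \<one>\<^bsub>B\<^esub>) \<odot>\<^bsub>Y\<^esub> y0)" .
      have "h (b' \<odot>\<^bsub>Y\<^esub> y) = (c \<odot>\<^bsub>B\<^esub> \<one>\<^bsub>B\<^esub>) \<odot>\<^bsub>Y\<^esub> y0 \<oplus>\<^bsub>Y\<^esub> h' (b' \<odot>\<^bsub>Y\<^esub> y)"
        using fac_step(4)[of "b' \<odot>\<^bsub>Y\<^esub> y"] b y \<beta>[OF c] by (simp add: c_def)
      then show "\<Lambda> (tp B ?bE Y (pe K B b b') y) \<odot>\<^bsub>?T\<^esub> ?z \<oplus>\<^bsub>?T\<^esub> \<Theta> (tp B ?bE Y (pe K B b b') y) =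
          b \<odot>\<^bsub>?T\<^esub> tp B ?bE Y ?one (h (b' \<odot>\<^bsub>Y\<^esub> y))"
        using b y e \<Theta>(2) hc cy one
        by (simp add: \<Lambda>(2) pe_closed l(2) tpr T.smult_r_distr tpc flip: c_def)
    qed
  qed
  from this[OF field_dual_basis[OF fd.field_K YK fd.fg_scalar[OF Y fY]]]
  obtain \<Theta> where \<Theta>: "pfac B ?T ?T \<Theta>" "\<forall>b\<in>carrier B. \<forall>b'\<in>carrier B. \<forall>y\<in>carrier Y.
      \<Theta> (tp B ?bE Y (pe K B b b') y) = b \<odot>\<^bsub>?T\<^esub> tp B ?bE Y ?one (b' \<odot>\<^bsub>Y\<^esub> y)"
    by (elim exE conjE)
  note \<Theta>h = mod_hom_additive[OF fac_mod_hom[OF \<Theta>(1) T T]]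
  have "\<Theta> t = t" if t: "t \<in> carrier ?T" for t
  proof (rule tens_ext[OF L(2) Y \<Theta>h additive_map_id _ t])
    fix e y assume e: "e \<in> carrier ?bE" and y: "y \<in> carrier Y"
    have a: "additive_map E ?T (\<lambda>e. tp B ?bE Y e y)" using y by (simp add: additive_map_def tpc tpl)
    show "\<Theta> (tp B ?bE Y e y) = tp B ?bE Y e y"
    proof (rule env_ext[OF additive_map_comp[OF a \<Theta>h] a])
      show "\<Theta> (tp B ?bE Y (pe K B b b') y) = tp B ?bE Y (pe K B b b') y" if "b \<in> carrier B" "b' \<in> carrier B" for b b'
        using that y one \<Theta>(2) by (simp add: tps pe_mult pe_closed flip: tpb)
    qed (use e in simp)
  qed
  then show ?thesis by (intro fac_cong[OF \<Theta>(1)]) simp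
qed

text \<open>For the enveloping algebra itself both claims come from K-bases. They pass to P because
  the identity of P is a finite sum through that algebra, and both constructions carry such sums
  along.\<close>

lemma dual_basis_bim:
  assumes P: "left_module E P" and dP: "dual_basis E P"
  shows "dual_basis Op (right_part (bim K B P))"
    "left_module B Y \<Longrightarrow> finitely_generated B Y \<Longrightarrow> dual_basis B (tens B (bim K B P) Y)"
proof -
  have E: "ring E" by (rule left_module.axioms(1)[OF P])
  note L = left_module_env[OF E] and bP = bimod_bim[OF P]
  note rP = bimodD(2)[OF bP]
  show "dual_basis Op (right_part (bim K B P))"
    by (rule fac_trans[OF fac_right_bim[OF dP] dual_basis_env_right[OF E] rP rP L(3) left_module_regular[OF ring_opposite]])
  assume Y: "left_module B Y" and fY: "finitely_generated B Y"
  note T = left_module_tens[OF bP Y]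
  obtain H where H: "fac B (tens B (bim K B (regular_module E)) Y) (tens B (bim K B P) Y) (tens B (bim K B P) Y) H"
    "\<forall>x\<in>carrier P. \<forall>y\<in>carrier Y. H (tp B (bim K B P) Y x y) = tp B (bim K B P) Y x y"
    using fac_tens_bim[OF L(1) P P Y dP] by (elim exE conjE)
  have "H t = t" if t: "t \<in> carrier (tens B (bim K B P) Y)" for t
    by (rule tens_ext[OF bP Y mod_hom_additive[OF fac_mod_hom[OF H(1) T T]] additive_map_id _ t]) (use H(2) in simp)
  then have "fac B (tens B (bim K B (regular_module E)) Y) (tens B (bim K B P) Y) (tens B (bim K B P) Y) (\<lambda>t. t)"
    by (intro fac_cong[OF H(1)]) simp
  then show "dual_basis B (tens B (bim K B P) Y)"
    by (rule fac_trans[OF _ dual_basis_tens_env[OF E Y fY] T T left_module_tens[OF L(2) Y] left_module_regular[OF B.ring_axioms]])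
qed

text \<open>The action is defined through an arbitrary representative p of the class. Centrality of
  K makes a \<otimes> b \<mapsto> a x b well defined on the tensor product over K, so p may be
  traded for the pure representative.\<close>

lemma enveloping_module_pe:
  assumes M: "bimod B B M" and central: "\<And>c x. c \<in> carrier K \<Longrightarrow> x \<in> carrier M \<Longrightarrow>
      (c \<odot>\<^bsub>B\<^esub> \<one>\<^bsub>B\<^esub>) \<odot>\<^bsub>M\<^esub> x = rsmult M x (c \<odot>\<^bsub>B\<^esub> \<one>\<^bsub>B\<^esub>)"
    and a: "a \<in> carrier B" and b: "b \<in> carrier B" and x: "x \<in> carrier M"
  shows "pe K B a b \<odot>\<^bsub>enveloping_module M\<^esub> x = rsmult M (a \<odot>\<^bsub>M\<^esub> x) b"
proof -
  note Md = bimodD[OF M]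
  interpret M: left_module B M by (rule Md(1))
  have bal: "rsmult M ((c \<odot>\<^bsub>B\<^esub> a) \<odot>\<^bsub>M\<^esub> x) b = rsmult M (a \<odot>\<^bsub>M\<^esub> x) (c \<odot>\<^bsub>B\<^esub> b)"
    if "a \<in> carrier B" "c \<in> carrier K" "b \<in> carrier B" for a c b
  proof -
    have "(c \<odot>\<^bsub>B\<^esub> a) \<odot>\<^bsub>M\<^esub> x = (c \<odot>\<^bsub>B\<^esub> \<one>\<^bsub>B\<^esub>) \<odot>\<^bsub>M\<^esub> (a \<odot>\<^bsub>M\<^esub> x)"
      using that x by (simp add: fd.scalar_one flip: M.smult_assoc)
    also have "\<dots> = rsmult M (a \<odot>\<^bsub>M\<^esub> x) (c \<odot>\<^bsub>B\<^esub> \<one>\<^bsub>B\<^esub>)" using that x by (simp add: central)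
    finally show ?thesis using that x by (simp add: fd.scalar_one flip: Md(7))
  qed
  obtain h where h: "additive_map (env_tens K B) M h"
    "\<And>a b. a \<in> carrier S \<Longrightarrow> b \<in> carrier Op \<Longrightarrow> h (tp K S Op a b) = rsmult M (a \<odot>\<^bsub>M\<^esub> x) b"
  proof (rule tens_additive[OF bimod_scalar left_module_opposite Md(9)])
    show "balanced K S Op M (\<lambda>a b. rsmult M (a \<odot>\<^bsub>M\<^esub> x) b)"
      by (rule balancedI) (use x in \<open>simp_all add: Md(4-6) bal M.smult_l_distr\<close>)
  qed (rule that)
  let ?X = "T.cl (frag_of (a, b))"
  define p where "p = (SOME p. p \<in> ?X)"
  have "frag_of (a, b) \<in> ?X" by (simp add: T.cl_iff T.TK_closed(2))
  then have p: "p \<in> ?X" unfolding p_def by (rule someI)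
  then have pk: "p - frag_of (a, b) \<in> T.TK" by (simp add: T.cl_iff)
  then have "p - frag_of (a, b) \<in> carrier T.FG" using T.TK_closed(1) by blast
  moreover have "frag_of (a, b) \<in> carrier T.FG" using a b by simp
  ultimately have pc: "p \<in> carrier T.FG" using T.frag_closed[of "p - frag_of (a, b)" "frag_of (a, b)"] by simp
  have "pe K B a b \<odot>\<^bsub>enveloping_module M\<^esub> x =
      (\<Oplus>\<^bsub>M\<^esub>z\<in>Poly_Mapping.keys p. [Poly_Mapping.lookup p z] \<cdot>\<^bsub>M\<^esub> (rsmult M (fst z \<odot>\<^bsub>M\<^esub> x) (snd z)))"
    unfolding enveloping_module_def pe_def tp_def p_def by (simp add: Let_def)
  also have "\<dots> = h (T.cl p)"
    by (rule T.finsum_representative[OF Md(9) h(1) _ pc]) (simp add: h(2))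
  also have "T.cl p = ?X" using pk by (simp add: T.cl_eq_iff)
  also have "h ?X = rsmult M (a \<odot>\<^bsub>M\<^esub> x) b" using h(2)[of a b] a b by (simp add: tp_def)
  finally show ?thesis .
qed

end

section \<open>Singular equivalences\<close>

lemma syzygy_SucE:
  fixes R :: "('r, 'x) ring_scheme"
  assumes "syzygy R (Suc n) X Y"
  obtains Z i p and P :: "'r std_module" where "syzygy R n X Z" "short_exact R Y i P p Z" "dual_basis R P"
proof -
  obtain Z p and P :: "'r std_module" where Z: "syzygy R n X Z"
    and P: "projective_cover R P p Z" "mod_iso R (P\<lparr>carrier := a_kernel P Z p\<rparr>) Y"
    using assms unfolding syzygy.simps by (elim exE conjE)
  obtain i where "short_exact R Y i P p Z" "dual_basis R P"
    by (rule projective_cover_short_exact[OF P])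
  with Z show ?thesis by (rule that)
qed

lemma enveloping_module_simps [simp]:
  "carrier (enveloping_module M) = carrier M" "add (enveloping_module M) = add M"
  "\<zero>\<^bsub>enveloping_module M\<^esub> = \<zero>\<^bsub>M\<^esub>"
  by (auto simp: enveloping_module_def)

text \<open>\<open>stably_isomorphic\<close> presents a composite as v u + id, whereas
  \<open>stab\<close> wants composite plus defect to be id. After tensoring, the defect is therefore
  -H with H induced by v u, and it passes through the projective module P \<otimes> Y.\<close>

lemma pfac_tens_defect:
  assumes L: "bimod B B L" and P: "bimod B B P" and Y: "left_module B Y" and dP: "dual_basis B (tens B P Y)"
    and u: "u \<in> mod_hom B L P" "u \<in> right_hom B L P" and v: "v \<in> mod_hom B P L" "v \<in> right_hom B P L"
    and e: "\<And>x. x \<in> carrier L \<Longrightarrow> e x = v (u x) \<oplus>\<^bsub>L\<^esub> x"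
    and D: "additive_map (tens B L Y) (tens B L Y) D"
      "\<And>x y. x \<in> carrier L \<Longrightarrow> y \<in> carrier Y \<Longrightarrow> D (tp B L Y x y) = tp B L Y (e x) y"
  obtains H where "pfac B (tens B L Y) (tens B L Y) H"
    "\<And>t. t \<in> carrier (tens B L Y) \<Longrightarrow> D t \<oplus>\<^bsub>tens B L Y\<^esub> H t = t"
proof -
  have B: "ring B" by (rule left_module.axioms(1)[OF Y])
  note T = left_module_tens[OF L Y] and TP = left_module_tens[OF P Y]
  interpret T: left_module B "tens B L Y" by (rule T)
  obtain H where H: "fac B (tens B P Y) (tens B L Y) (tens B L Y) H"
    "\<forall>x\<in>carrier L. \<forall>y\<in>carrier Y. H (tp B L Y x y) = tp B L Y (v (u x)) y"
    using fac_tens_left[OF L L P Y u v] by (elim exE conjE)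
  have pH: "pfac B (tens B L Y) (tens B L Y) H"
    by (rule fac_trans[OF H(1) dP T T TP left_module_regular[OF B]])
  note Hh = fac_mod_hom[OF pH T T]
  have eq: "D t = H t \<oplus>\<^bsub>tens B L Y\<^esub> t" if t: "t \<in> carrier (tens B L Y)" for t
    by (rule tens_ext[OF L Y D(1) additive_map_plus[OF left_module.axioms(2)[OF T] mod_hom_additive[OF Hh] additive_map_id] _ t])
       (simp add: D(2) e H(2) mod_hom_closed[OF v(1)] mod_hom_closed[OF u(1)] tp_add_left[OF L Y])
  have "D t \<oplus>\<^bsub>tens B L Y\<^esub> \<ominus>\<^bsub>tens B L Y\<^esub> H t = t" if t: "t \<in> carrier (tens B L Y)" for t
    using t mod_hom_closed[OF Hh t]
    by (simp add: eq T.M.a_assoc abelian_group_add_cancel[OF T.M.abelian_group_axioms])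
  then show ?thesis by (rule that[OF fac_uminus[OF pH T T]])
qed

lemma is_bimodule_bimod: "is_bimodule K A B M \<Longrightarrow> bimod A B M"
  by (auto simp: is_bimodule_def bimod_def)

context
  fixes K :: "('k, 'w) ring_scheme" and B :: "('k, 'b, 'x) module_scheme"
  assumes fd: "fd_algebra K B"
begin

interpretation B: ring B by (rule fd_algebra.ring_A[OF fd])
interpretation fd: fd_algebra K B by (rule fd)

lemma bimod_regular: "bimod B B (regular_bimodule B)"
proof -
  have 1: "left_module B (regular_bimodule B)"
    by (rule left_moduleI)
       (auto simp: B.a_ac B.m_assoc B.l_distr B.r_distr B.ring_axioms intro: B.add.l_inv_ex)
  have 2: "left_module (opposite B) (right_part (regular_bimodule B))"
    by (rule left_moduleI)
       (auto simp: B.a_ac B.m_assoc B.l_distr B.r_distr ring_opposite[OF fd] intro: B.add.l_inv_ex)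
  show ?thesis using 1 2 by (simp add: bimod_def B.m_assoc)
qed

lemma enveloping_regular_pe:
  "a \<in> carrier B \<Longrightarrow> b \<in> carrier B \<Longrightarrow> x \<in> carrier B \<Longrightarrow>
    pe K B a b \<odot>\<^bsub>enveloping_module (regular_bimodule B)\<^esub> x = a \<otimes>\<^bsub>B\<^esub> x \<otimes>\<^bsub>B\<^esub> b"
  by (subst enveloping_module_pe[OF fd bimod_regular]) (simp_all add: fd.scalar_one fd.scalar_one')

text \<open>The case of level 0: W is a copy of the bimodule B, so it is the regular module on the
  right, and w \<otimes> y \<mapsto> g w y has the inverse y \<mapsto> f 1 \<otimes> y.\<close>

lemma tens_regular_bimodule_iso:
  assumes iso: "mod_iso (enveloping_algebra K B) (enveloping_module (regular_bimodule B)) W"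
  shows "dual_basis (opposite B) (right_part (bim K B W))"
    "left_module B Y \<Longrightarrow> mod_iso B (tens B (bim K B W) Y) Y"
proof -
  obtain f g where W: "left_module (enveloping_algebra K B) W"
    and f: "f \<in> mod_hom (enveloping_algebra K B) (enveloping_module (regular_bimodule B)) W"
    and g: "g \<in> mod_hom (enveloping_algebra K B) W (enveloping_module (regular_bimodule B))"
    and gf0: "\<And>x. x \<in> carrier (enveloping_module (regular_bimodule B)) \<Longrightarrow> g (f x) = x" and fg: "\<And>w. w \<in> carrier W \<Longrightarrow> f (g w) = w"
    by (rule mod_isoE[OF iso]) (rule that)
  have gf: "g (f x) = x" if "x \<in> carrier B" for x using gf0 that by simp
  note bW = bimod_bim[OF fd W]
  note pec = pe_closed[OF fd]
  have fs: "\<And>x. x \<in> carrier B \<Longrightarrow> f x \<in> carrier W"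
    "\<And>x y. x \<in> carrier B \<Longrightarrow> y \<in> carrier B \<Longrightarrow> f (x \<oplus>\<^bsub>B\<^esub> y) = f x \<oplus>\<^bsub>W\<^esub> f y"
    using mod_hom_simps(1,2)[OF f] by simp_all
  have fs': "f (a \<otimes>\<^bsub>B\<^esub> x) = pe K B a \<one>\<^bsub>B\<^esub> \<odot>\<^bsub>W\<^esub> f x" "f (x \<otimes>\<^bsub>B\<^esub> a) = pe K B \<one>\<^bsub>B\<^esub> a \<odot>\<^bsub>W\<^esub> f x"
    if "x \<in> carrier B" "a \<in> carrier B" for x a
    using that mod_hom_simps(3)[OF f, of "pe K B a \<one>\<^bsub>B\<^esub>" x] mod_hom_simps(3)[OF f, of "pe K B \<one>\<^bsub>B\<^esub> a" x]
    by (simp_all add: pec enveloping_regular_pe)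
  have gs: "\<And>x. x \<in> carrier W \<Longrightarrow> g x \<in> carrier B"
    "\<And>x y. x \<in> carrier W \<Longrightarrow> y \<in> carrier W \<Longrightarrow> g (x \<oplus>\<^bsub>W\<^esub> y) = g x \<oplus>\<^bsub>B\<^esub> g y"
    using mod_hom_simps(1,2)[OF g] by simp_all
  have gs': "g (pe K B a \<one>\<^bsub>B\<^esub> \<odot>\<^bsub>W\<^esub> x) = a \<otimes>\<^bsub>B\<^esub> g x" "g (pe K B \<one>\<^bsub>B\<^esub> a \<odot>\<^bsub>W\<^esub> x) = g x \<otimes>\<^bsub>B\<^esub> a"
    if "x \<in> carrier W" "a \<in> carrier B" for x a
    using that mod_hom_simps(3)[OF g _ that(1), of "pe K B a \<one>\<^bsub>B\<^esub>"] mod_hom_simps(3)[OF g _ that(1), of "pe K B \<one>\<^bsub>B\<^esub> a"]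
    by (simp_all add: pec enveloping_regular_pe gs)
  note oB = ring_opposite[OF fd]
  show "dual_basis (opposite B) (right_part (bim K B W))"
  proof (rule fac_retract[OF dual_basis_regular[OF oB] _ _ _ left_module_regular[OF oB] bimodD(2)[OF bW]])
    show "g \<in> mod_hom (opposite B) (right_part (bim K B W)) (regular_module (opposite B))"
      by (rule mod_homI) (simp_all add: gs gs')
    show "f \<in> mod_hom (opposite B) (regular_module (opposite B)) (right_part (bim K B W))"
      by (rule mod_homI) (simp_all add: fs fs'(2))
  qed (simp add: fg)
  assume Y: "left_module B Y"
  interpret Y: left_module B Y by (rule Y)
  note T = left_module_tens[OF bW Y]
  obtain h where h: "h \<in> mod_hom B (tens B (bim K B W) Y) Y"
    "\<And>w y. w \<in> carrier (bim K B W) \<Longrightarrow> y \<in> carrier Y \<Longrightarrow> h (tp B (bim K B W) Y w y) = g w \<odot>\<^bsub>Y\<^esub> y"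
  proof (rule tens_hom[OF bW Y Y])
    show "balanced B (bim K B W) Y Y (\<lambda>w y. g w \<odot>\<^bsub>Y\<^esub> y)"
      by (rule balancedI) (simp_all add: gs gs' Y.smult_l_distr Y.smult_r_distr Y.smult_assoc)
  qed (use that in \<open>auto simp: gs gs' Y.smult_assoc\<close>)
  let ?k = "\<lambda>y. tp B (bim K B W) Y (f \<one>\<^bsub>B\<^esub>) y"
  note cl = tp_closed[OF bW Y, simplified] tp_add_right[OF bW Y, simplified]
  have f1: "f b = pe K B b \<one>\<^bsub>B\<^esub> \<odot>\<^bsub>W\<^esub> f \<one>\<^bsub>B\<^esub>" "f b = pe K B \<one>\<^bsub>B\<^esub> b \<odot>\<^bsub>W\<^esub> f \<one>\<^bsub>B\<^esub>" if "b \<in> carrier B" for b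
    using fs'[of "\<one>\<^bsub>B\<^esub>" b] that by simp_all
  have k: "?k (b \<odot>\<^bsub>Y\<^esub> y) = tp B (bim K B W) Y (f b) y" if "b \<in> carrier B" "y \<in> carrier Y" for b y
    using tp_balanced[OF bW Y, of "f \<one>\<^bsub>B\<^esub>" b y] that fs(1)[of "\<one>\<^bsub>B\<^esub>"] by (simp add: f1(2)[OF that(1)])
  have kh: "?k \<in> mod_hom B Y (tens B (bim K B W) Y)"
  proof (rule mod_homI)
    show "?k (b \<odot>\<^bsub>Y\<^esub> y) = b \<odot>\<^bsub>tens B (bim K B W) Y\<^esub> ?k y" if "b \<in> carrier B" "y \<in> carrier Y" for b y
      using tens_smult_tp[OF bW Y, of b "f \<one>\<^bsub>B\<^esub>" y] that fs(1)[of "\<one>\<^bsub>B\<^esub>"] k[OF that] by (simp add: f1(1)[OF that(1)])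
  qed (use fs(1)[of "\<one>\<^bsub>B\<^esub>"] in \<open>simp_all add: cl\<close>)
  show "mod_iso B (tens B (bim K B W) Y) Y"
  proof (rule mod_isoI[OF T Y h(1) kh])
    show "?k (h t) = t" if t: "t \<in> carrier (tens B (bim K B W) Y)" for t
      by (rule tens_ext[OF bW Y additive_map_comp[OF mod_hom_additive[OF h(1)] mod_hom_additive[OF kh]] additive_map_id _ t])
         (simp add: h(2) k gs fg)
  qed (use fs(1)[of "\<one>\<^bsub>B\<^esub>"] in \<open>simp add: h(2) gf Y.smult_one\<close>)
qed

text \<open>All bimodule syzygies of \<open>B\<close> are projective as right modules, so that the defining sequences
  split on the right and stay exact under \<open>- \<otimes>\<^sub>B Y\<close>.\<close>

lemma syzygy_env:
  fixes Y :: "('b, 'y) module"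
  assumes Y: "left_module B Y" and fY: "finitely_generated B Y"
  shows "syzygy (enveloping_algebra K B) l (enveloping_module (regular_bimodule B)) W \<Longrightarrow>
    dual_basis (opposite B) (right_part (bim K B W)) \<and>
    (\<forall>Z. syzygy B l Y Z \<longrightarrow> stab B (tens B (bim K B W) Y) Z)"
proof (induction l arbitrary: W)
  case 0
  then have iso: "mod_iso (enveloping_algebra K B) (enveloping_module (regular_bimodule B)) W" by simp
  show ?case
    using tens_regular_bimodule_iso(1)[OF iso] stab_iso[OF mod_iso_trans[OF tens_regular_bimodule_iso(2)[OF iso Y]]]
    by (simp only: syzygy.simps) blast
next
  case (Suc l)
  let ?E = "enveloping_algebra K B"
  obtain Z0 i p and P :: "('b \<times> 'b \<Rightarrow>\<^sub>0 int) set std_module" where Z0: "syzygy ?E l (enveloping_module (regular_bimodule B)) Z0"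
    and ex: "short_exact ?E W i P p Z0" and dP: "dual_basis ?E P"
    by (rule syzygy_SucE[OF Suc.prems]) (rule that)
  note D = short_exactD[OF ex]
  have IH: "dual_basis (opposite B) (right_part (bim K B Z0))"
    "\<And>Z. syzygy B l Y Z \<Longrightarrow> stab B (tens B (bim K B Z0) Y) Z"
    using Suc.IH[OF Z0] by auto
  note bW = bimod_bim[OF fd D(1)] and bP = bimod_bim[OF fd D(2)] and bZ = bimod_bim[OF fd D(3)]
  note rW = bimodD(2)[OF bW] and rP = bimodD(2)[OF bP] and rZ = bimodD(2)[OF bZ]
  note i = mod_hom_bim[OF fd D(4)] and p = mod_hom_bim[OF fd D(5)]
  let ?rP = "right_part (bim K B P)"
  interpret rP: left_module "opposite B" ?rP by (rule rP)
  \<comment> \<open>By the induction hypothesis \<open>Z0\<close> is projective on the right, so p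
    has a right-linear section s.\<close>
  obtain s where s: "s \<in> right_hom B (bim K B Z0) (bim K B P)" "\<And>z. z \<in> carrier Z0 \<Longrightarrow> p (s z) = z"
    using dual_basis_lift[OF IH(1) mod_hom_id p(2) _ rZ rZ rP] D(7) by (metis right_part_simps(1) bim_simps(1))
  have kh: "(\<lambda>x. x \<ominus>\<^bsub>?rP\<^esub> s (p x)) \<in> mod_hom (opposite B) ?rP ?rP"
    by (rule mod_hom_sub[OF mod_hom_id mod_hom_comp[OF p(2) s(1)] rP])
  have sp: "s (p x) \<in> carrier P" "p x \<in> carrier Z0" if "x \<in> carrier P" for x
    using right_homD(1)[OF s(1), of "p x"] mod_hom_closed[OF D(5) that] by simp_all
  have im: "x \<ominus>\<^bsub>?rP\<^esub> s (p x) \<in> i ` carrier (right_part (bim K B W))" if "x \<in> carrier ?rP" for x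
  proof -
    have x: "x \<in> carrier P" using that by simp
    interpret rZ: left_module "opposite B" "right_part (bim K B Z0)" by (rule rZ)
    have "p (x \<ominus>\<^bsub>?rP\<^esub> s (p x)) = p x \<ominus>\<^bsub>right_part (bim K B Z0)\<^esub> p x"
      using mod_hom_diff[OF rP rZ p(2), of x "s (p x)"] x sp[OF x] s(2)[of "p x"] by simp
    also have "\<dots> = \<zero>\<^bsub>Z0\<^esub>" using sp[OF x] rZ.M.r_neg[of "p x"] by (simp add: a_minus_def)
    finally show ?thesis using mod_hom_closed[OF kh that] D(8) by simp
  qed
  \<comment> \<open>The right-linear retraction of i that belongs to the section s: id - s p, read
    inside W.\<close>
  obtain k where k: "k \<in> right_hom B (bim K B P) (bim K B W)"
    "\<And>x. x \<in> carrier ?rP \<Longrightarrow> i (k x) = x \<ominus>\<^bsub>?rP\<^esub> s (p x)"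
    by (rule mod_hom_lift_inj[OF i(2) _ kh im rW]) (use D(6) that in auto)
  have s0: "s \<zero>\<^bsub>Z0\<^esub> = \<zero>\<^bsub>P\<^esub>" using mod_hom_zero[OF rZ rP s(1)] by simp
  have ki: "k (i x) = x" if x: "x \<in> carrier W" for x
  proof (rule inj_onD[OF D(6)])
    have ix: "i x \<in> carrier P" by (rule mod_hom_closed[OF D(4) x])
    have "\<ominus>\<^bsub>?rP\<^esub> \<zero>\<^bsub>P\<^esub> = \<zero>\<^bsub>P\<^esub>" using rP.M.minus_equality[of "\<zero>\<^bsub>?rP\<^esub>" "\<zero>\<^bsub>?rP\<^esub>"] rP.M.r_zero[of "\<zero>\<^bsub>?rP\<^esub>"] rP.M.zero_closed by simp
    then show "i (k (i x)) = i x"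
      using k(2)[of "i x"] ix D(9)[OF x] s0 rP.M.r_zero[of "i x"] by (simp add: a_minus_def)
    show "k (i x) \<in> carrier W" using right_homD(1)[OF k(1), of "i x"] ix by simp
  qed (rule x)
  have iks: "i (k x) \<oplus>\<^bsub>bim K B P\<^esub> s (p x) = x" if x: "x \<in> carrier (bim K B P)" for x
  proof -
    have "(x \<ominus>\<^bsub>?rP\<^esub> s (p x)) \<oplus>\<^bsub>?rP\<^esub> s (p x) = x"
      using x sp[of x] rP.M.a_assoc[of x "\<ominus>\<^bsub>?rP\<^esub> s (p x)" "s (p x)"] rP.M.l_neg[of "s (p x)"] rP.M.r_zero[of x]
        rP.M.a_inv_closed[of "s (p x)"]
      unfolding a_minus_def by (simp del: right_part_simps(2,3) bim_simps(2,3))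
    then show ?thesis using k(2)[of x] x by simp
  qed
  \<comment> \<open>W is a right-linear retract of P, and P is projective on the right; this keeps
    the induction going.\<close>
  have "dual_basis (opposite B) (right_part (bim K B W))"
    by (rule fac_retract[OF dual_basis_bim(1)[OF fd D(2) dP] i(2) k(1) _ rP rW]) (simp add: ki)
  moreover have "stab B (tens B (bim K B W) Y) Z" if Z: "syzygy B (Suc l) Y Z" for Z
  proof -
    obtain Z1 i1 p1 and P1 :: "'b std_module" where Z1: "syzygy B l Y Z1" and ex1: "short_exact B Z i1 P1 p1 Z1" and dP1: "dual_basis B P1"
      by (rule syzygy_SucE[OF Z]) (rule that)
    obtain i' p' where ex': "short_exact B (tens B (bim K B W) Y) i' (tens B (bim K B P) Y) p' (tens B (bim K B Z0) Y)"
      by (rule tens_split_exact[OF bW bP bZ Y i p k(1) s(1)])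
         (use ki s(2) iks D(9) that in auto)
    \<comment> \<open>The tensored bimodule sequence and the syzygy sequence of Y both have
      projective middle terms, and their right ends are stably equivalent by induction.\<close>
    show ?thesis
      by (rule stab_syzygy[OF ex' ex1 dual_basis_bim(2)[OF fd D(2) dP Y fY] dP1 IH(2)[OF Z1]])
  qed
  ultimately show ?case by blast
qed

text \<open>A projective bimodule tensored with Y is projective over B, so bimodule maps through
  projectives become maps of B-modules through projectives.\<close>

lemma stab_tens_enveloping:
  fixes L :: "('b, 'b, 'm, 'u) bimodule_scheme"
  assumes L: "bimod B B L"
    and central: "\<And>c x. c \<in> carrier K \<Longrightarrow> x \<in> carrier L \<Longrightarrow>
      (c \<odot>\<^bsub>B\<^esub> \<one>\<^bsub>B\<^esub>) \<odot>\<^bsub>L\<^esub> x = rsmult L x (c \<odot>\<^bsub>B\<^esub> \<one>\<^bsub>B\<^esub>)"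
    and W: "left_module (enveloping_algebra K B) W"
    and st: "stably_isomorphic (enveloping_algebra K B) (enveloping_module L) W"
    and Y: "left_module B Y" and fY: "finitely_generated B Y"
  shows "stab B (tens B L Y) (tens B (bim K B W) Y)"
proof -
  let ?E = "enveloping_algebra K B" and ?L = "enveloping_module L"
  note Ld = bimodD[OF L]
  interpret L: left_module B L by (rule Ld(1))
  interpret W: left_module ?E W by (rule W)
  note bW = bimod_bim[OF fd W]
  have pel: "pe K B b \<one>\<^bsub>B\<^esub> \<odot>\<^bsub>?L\<^esub> x = b \<odot>\<^bsub>L\<^esub> x" and per: "pe K B \<one>\<^bsub>B\<^esub> b \<odot>\<^bsub>?L\<^esub> x = rsmult L x b"
    if "b \<in> carrier B" "x \<in> carrier L" for b x
    using enveloping_module_pe[OF fd L central, of b "\<one>\<^bsub>B\<^esub>" x] enveloping_module_pe[OF fd L central, of "\<one>\<^bsub>B\<^esub>" b x] that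
    by (simp_all add: Ld(8) L.smult_one)
  note pec = pe_closed[OF fd]
  \<comment> \<open>L comes with its own two actions, while the other modules are bimodules only via
    \<open>bim\<close>. On L the two descriptions agree by centrality, so homomorphisms can be read
    in either way.\<close>
  have to: "f \<in> mod_hom B L (bim K B Z)" "f \<in> right_hom B L (bim K B Z)"
    if f: "f \<in> mod_hom ?E ?L Z" for f and Z :: "(_, 'z, 'zz) module_scheme"
    using mod_hom_simps[OF f] by (auto intro!: mod_homI simp: pec simp flip: pel per)
  have fr: "f \<in> mod_hom B (bim K B Z) L" "f \<in> right_hom B (bim K B Z) L"
    if f: "f \<in> mod_hom ?E Z ?L" for f and Z :: "(_, 'z, 'zz) module_scheme"
    using mod_hom_simps[OF f] by (auto intro!: mod_homI simp: pec pel per)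
  obtain f g where f: "f \<in> mod_hom ?E ?L W" and g: "g \<in> mod_hom ?E W ?L"
    and facL: "factors_through_projective ?E ?L ?L (\<lambda>x. g (f x) \<ominus>\<^bsub>?L\<^esub> x)"
    and facW: "factors_through_projective ?E W W (\<lambda>y. f (g y) \<ominus>\<^bsub>W\<^esub> y)"
    using st unfolding stably_isomorphic_def by blast
  have fc: "f x \<in> carrier W" if "x \<in> carrier L" for x using mod_hom_closed[OF f] that by simp
  have gc: "g x \<in> carrier L" if "x \<in> carrier W" for x using mod_hom_closed[OF g] that by simp
  obtain P :: "('b \<times> 'b \<Rightarrow>\<^sub>0 int) set std_module" and u v where P: "fg_projective ?E P" and u: "u \<in> mod_hom ?E ?L P" and v: "v \<in> mod_hom ?E P ?L"
    and uv: "\<forall>x\<in>carrier ?L. g (f x) \<ominus>\<^bsub>?L\<^esub> x = v (u x)"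
    using facL unfolding factors_through_projective_def by (elim exE conjE)
  obtain P' :: "('b \<times> 'b \<Rightarrow>\<^sub>0 int) set std_module" and u' v' where P': "fg_projective ?E P'" and u': "u' \<in> mod_hom ?E W P'" and v': "v' \<in> mod_hom ?E P' W"
    and uv': "\<forall>x\<in>carrier W. f (g x) \<ominus>\<^bsub>W\<^esub> x = v' (u' x)"
    using facW unfolding factors_through_projective_def by (elim exE conjE)
  note PP = fg_projective_imp[OF P] and PP' = fg_projective_imp[OF P']
  have "abelian_group ?L"
    by (rule abelian_groupI) (auto simp: L.M.a_ac intro: L.M.add.l_inv_ex)
  then interpret eL: abelian_group ?L .
  have gf: "g (f x) = v (u x) \<oplus>\<^bsub>L\<^esub> x" if x: "x \<in> carrier L" for x
  proof -
    have "(g (f x) \<ominus>\<^bsub>?L\<^esub> x) \<oplus>\<^bsub>?L\<^esub> x = g (f x)"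
      using eL.a_assoc[of "g (f x)" "\<ominus>\<^bsub>?L\<^esub> x" x] eL.l_neg[of x] eL.r_zero[of "g (f x)"] eL.a_inv_closed[of x]
        x gc[OF fc[OF x]] unfolding a_minus_def by (simp del: enveloping_module_simps(2,3))
    then show ?thesis using uv x by simp
  qed
  have fg: "f (g y) = v' (u' y) \<oplus>\<^bsub>bim K B W\<^esub> y" if y: "y \<in> carrier (bim K B W)" for y
  proof -
    have y': "y \<in> carrier W" using y by simp
    have "(f (g y) \<ominus>\<^bsub>W\<^esub> y) \<oplus>\<^bsub>W\<^esub> y = f (g y)"
      using y' fc[OF gc[OF y']] by (simp add: a_minus_def W.M.a_assoc W.M.l_neg)
    then show ?thesis using uv' y' by simp
  qed
  obtain F where F: "F \<in> mod_hom B (tens B L Y) (tens B (bim K B W) Y)"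
    "\<And>x y. x \<in> carrier L \<Longrightarrow> y \<in> carrier Y \<Longrightarrow> F (tp B L Y x y) = tp B (bim K B W) Y (f x) y"
    by (rule tens_map[OF L Y bW Y to[OF f] mod_hom_id]) (rule that)
  obtain G where G: "G \<in> mod_hom B (tens B (bim K B W) Y) (tens B L Y)"
    "\<And>x y. x \<in> carrier (bim K B W) \<Longrightarrow> y \<in> carrier Y \<Longrightarrow> G (tp B (bim K B W) Y x y) = tp B L Y (g x) y"
    by (rule tens_map[OF bW Y L Y fr[OF g] mod_hom_id]) (rule that)
  obtain H where H: "pfac B (tens B L Y) (tens B L Y) H"
    "\<And>t. t \<in> carrier (tens B L Y) \<Longrightarrow> G (F t) \<oplus>\<^bsub>tens B L Y\<^esub> H t = t"
  proof (rule pfac_tens_defect[where L = L and P = "bim K B P" and Y = Y and u = u and v = v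
        and e = "\<lambda>x. g (f x)" and D = "\<lambda>t. G (F t)"])
    show "additive_map (tens B L Y) (tens B L Y) (\<lambda>t. G (F t))"
      by (rule additive_map_comp[OF mod_hom_additive[OF F(1)] mod_hom_additive[OF G(1)]])
  qed (use F(2) G(2) fc that in \<open>auto intro: L bimod_bim[OF fd PP(1)] Y dual_basis_bim(2)[OF fd PP Y fY] to[OF u] fr[OF v] gf\<close>)
  obtain H' where H': "pfac B (tens B (bim K B W) Y) (tens B (bim K B W) Y) H'"
    "\<And>t. t \<in> carrier (tens B (bim K B W) Y) \<Longrightarrow> F (G t) \<oplus>\<^bsub>tens B (bim K B W) Y\<^esub> H' t = t"
  proof (rule pfac_tens_defect[where L = "bim K B W" and P = "bim K B P'" and Y = Y and u = u' and v = v'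
        and e = "\<lambda>x. f (g x)" and D = "\<lambda>t. F (G t)"])
    show "additive_map (tens B (bim K B W) Y) (tens B (bim K B W) Y) (\<lambda>t. F (G t))"
      by (rule additive_map_comp[OF mod_hom_additive[OF G(1)] mod_hom_additive[OF F(1)]])
  qed (use F(2) G(2) gc that fg in \<open>auto intro: bW bimod_bim[OF fd PP'(1)] Y dual_basis_bim(2)[OF fd PP' Y fY]
        mod_hom_bim[OF fd u'] mod_hom_bim[OF fd v']\<close>)
  show ?thesis
    by (rule stabI[OF left_module_tens[OF L Y] left_module_tens[OF bW Y] F(1) G(1) H(1) H'(1) H(2) H'(2)])
qed

end

text \<open>On pure tensors, c n \<otimes> m = n c \<otimes> m = n \<otimes> c m = n \<otimes> m c
  by centrality on N, balancedness and centrality on M.\<close>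

lemma tensor_bimodule_central:
  assumes A: "fd_algebra K A" and B: "fd_algebra K B"
    and N: "is_bimodule K B A N" and M: "is_bimodule K A B M"
    and c: "c \<in> carrier K" and x: "x \<in> carrier (tensor_bimodule A N M)"
  shows "(c \<odot>\<^bsub>B\<^esub> \<one>\<^bsub>B\<^esub>) \<odot>\<^bsub>tensor_bimodule A N M\<^esub> x = rsmult (tensor_bimodule A N M) x (c \<odot>\<^bsub>B\<^esub> \<one>\<^bsub>B\<^esub>)"
proof -
  note bN = is_bimodule_bimod[OF N] and bM = is_bimodule_bimod[OF M]
  note L = bimod_tensor[OF bN bM]
  note MA = bimodD(1)[OF bM]
  have cN: "(c \<odot>\<^bsub>B\<^esub> \<one>\<^bsub>B\<^esub>) \<odot>\<^bsub>N\<^esub> n = rsmult N n (c \<odot>\<^bsub>A\<^esub> \<one>\<^bsub>A\<^esub>)" if "n \<in> carrier N" for n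
    using N c that by (simp add: is_bimodule_def)
  have cM: "(c \<odot>\<^bsub>A\<^esub> \<one>\<^bsub>A\<^esub>) \<odot>\<^bsub>M\<^esub> m = rsmult M m (c \<odot>\<^bsub>B\<^esub> \<one>\<^bsub>B\<^esub>)" if "m \<in> carrier M" for m
    using M c that by (simp add: is_bimodule_def)
  have cB: "c \<odot>\<^bsub>B\<^esub> \<one>\<^bsub>B\<^esub> \<in> carrier B" and cA: "c \<odot>\<^bsub>A\<^esub> \<one>\<^bsub>A\<^esub> \<in> carrier A"
    using fd_algebra.scalar_closed[OF B c] fd_algebra.scalar_closed[OF A c]
      monoid.one_closed[OF ring.is_monoid[OF fd_algebra.ring_A[OF B]]] monoid.one_closed[OF ring.is_monoid[OF fd_algebra.ring_A[OF A]]] by auto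
  have l: "additive_map (tens A N M) (tens A N M) (\<lambda>x. (c \<odot>\<^bsub>B\<^esub> \<one>\<^bsub>B\<^esub>) \<odot>\<^bsub>tens A N M\<^esub> x)"
    using left_module.smult_closed[OF left_module_tens[OF bN MA] cB] left_module.smult_r_distr[OF left_module_tens[OF bN MA] cB]
    by (auto simp: additive_map_def)
  show ?thesis unfolding tensor_bimodule_simps
    by (rule tens_ext[OF bN MA l tensor_rsmult_additive[OF bN bM cB]])
       (use x in \<open>simp_all add: tens_smult_tp[OF bN MA cB] tensor_rsmult_tp[OF bN bM cB] cN tp_balanced[OF bN MA _ cA] cM tensor_bimodule_simps\<close>)
qed

lemma stab_tens_tens:
  fixes Y :: "('b, 'y) module"
  assumes A: "fd_algebra K A" and B: "fd_algebra K B"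
    and N: "is_bimodule K B A N" and M: "is_bimodule K A B M"
    and W: "syzygy (enveloping_algebra K B) l (enveloping_module (regular_bimodule B)) W"
    and st: "stably_isomorphic (enveloping_algebra K B) (enveloping_module (tensor_bimodule A N M)) W"
    and Y: "left_module B Y" "finitely_generated B Y" and Z: "syzygy B l Y Z"
  shows "stab B (tens A N (tens B M Y)) Z"
proof -
  note bN = is_bimodule_bimod[OF N] and bM = is_bimodule_bimod[OF M]
  note L = bimod_tensor[OF bN bM]
  have 1: "stab B (tens A N (tens B M Y)) (tens B (tensor_bimodule A N M) Y)"
    by (rule stab_sym[OF stab_iso[OF tens_assoc[OF bN bM Y(1)]]])
  have 2: "stab B (tens B (tensor_bimodule A N M) Y) (tens B (bim K B W) Y)"
    by (rule stab_tens_enveloping[OF B L tensor_bimodule_central[OF A B N M] syzygy_left_module[OF W] st Y])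
  have 3: "stab B (tens B (bim K B W) Y) Z" using syzygy_env[OF B Y W] Z by blast
  show ?thesis by (rule stab_trans[OF stab_trans[OF 1 2] 3])
qed

text \<open>N is projective on both sides: on the right for exactness, on the left so that N
  \<otimes> P is projective. Tensored syzygy sequences over A can thus be compared, degree by
  degree, with those of X' over B.\<close>

lemma stab_tens_syzygy:
  fixes A :: "('a, 'u) ring_scheme" and B :: "('b, 'v) ring_scheme"
  assumes N: "bimod B A N" and dN: "dual_basis B N" and dN': "dual_basis (opposite A) (right_part N)"
    and st: "stab B (tens A N X) X'"
  shows "syzygy A n X Z \<Longrightarrow> syzygy B n X' Z' \<Longrightarrow> stab B (tens A N Z) Z'"
proof (induction n arbitrary: Z Z')
  case 0
  have 1: "stab B (tens A N Z) (tens A N X)"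
    by (rule stab_tens[OF N dN stab_iso[OF mod_iso_sym]]) (use 0 in simp)
  have 2: "stab B X' Z'" by (rule stab_iso) (use 0 in simp)
  show ?case by (rule stab_trans[OF stab_trans[OF 1 st] 2])
next
  case (Suc n)
  obtain Z0 i p and P :: "'a std_module" where Z0: "syzygy A n X Z0" and ex: "short_exact A Z i P p Z0" and dP: "dual_basis A P"
    by (rule syzygy_SucE[OF Suc.prems(1)]) (rule that)
  obtain Z1 i1 p1 and P1 :: "'b std_module" where Z1: "syzygy B n X' Z1" and ex1: "short_exact B Z' i1 P1 p1 Z1" and dP1: "dual_basis B P1"
    by (rule syzygy_SucE[OF Suc.prems(2)]) (rule that)
  obtain i' p' where ex': "short_exact B (tens A N Z) i' (tens A N P) p' (tens A N Z0)"
    by (rule tens_short_exact[OF N dN' ex]) (rule that)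
  show ?case
    by (rule stab_syzygy[OF ex' ex1 dual_basis_tens[OF N short_exactD(2)[OF ex] dN dP] dP1 Suc.IH[OF Z0 Z1]])
qed

section \<open>Invariance of the Igusa-Todorov distance\<close>

text \<open>The new generator has to be chosen before the module to be resolved: it is a copy V of N
  \<otimes> U \<oplus> B. The first summand carries the tensored terms, the second the free module
  that enters with the pullback.\<close>

lemma igusa_todorov_transfer:
  fixes K :: "'k ring" and A :: "('k, 'a) module" and B :: "('k, 'b) module"
    and M :: "('a, 'b, 'm, 'u) bimodule_scheme" and N :: "('b, 'a, 'n, 'v) bimodule_scheme"
  assumes A: "fd_algebra K A" and B: "fd_algebra K B"
    and pair: "singular_equivalence_pair K A B l M N" and IT: "igusa_todorov_algebra m n A"
  shows "igusa_todorov_algebra m (n + l) B"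
proof -
  have M: "is_bimodule K A B M" and N: "is_bimodule K B A N"
    and pM: "fg_projective A M" and pN: "fg_projective B N" and pN': "fg_projective (opposite A) (right_part N)"
    using pair by (auto simp: singular_equivalence_pair_def)
  obtain W where W: "syzygy (enveloping_algebra K B) l (enveloping_module (regular_bimodule B)) W"
    and st: "stably_isomorphic (enveloping_algebra K B) (enveloping_module (tensor_bimodule A N M)) W"
    using pair unfolding singular_equivalence_pair_def by blast
  note bM = is_bimodule_bimod[OF M] and bN = is_bimodule_bimod[OF N]
  note dM = fg_projective_imp(2)[OF pM] and dN = fg_projective_imp(2)[OF pN] and dN' = fg_projective_imp(2)[OF pN']
  note fM = fg_dual_basis[OF bimodD(1)[OF bM] dM] and fN = fg_dual_basis[OF bimodD(1)[OF bN] dN]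
  have rB: "ring B" by (rule fd_algebra.ring_A[OF B])
  note reg = left_module_regular[OF rB]
  obtain U :: "'a std_module" where U: "left_module A U" "finitely_generated A U"
    and res: "\<And>X :: 'a std_module. fg_module A X \<Longrightarrow> \<exists>C d. syzygy A n X (C 0) \<and> (\<forall>i\<le>m. in_add A U (C (Suc i))) \<and>
      exact_resolution A m C d"
    using IT unfolding igusa_todorov_algebra_def fg_module_def by blast
  note TU = left_module_tens[OF bN U(1)]
  let ?S = "direct_sum (tens A N U) (regular_module B)"
  note S = left_module_direct_sum[OF TU reg] and Sh = direct_sum_homs[OF TU reg]
  have fS: "finitely_generated B ?S"
    by (rule fg_direct_sum[OF TU reg tens_fg[OF bN U(1) fN U(2)] fg_dual_basis[OF reg dual_basis_regular[OF rB]]])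
  obtain V :: "'b std_module" where V: "mod_iso B ?S V" by (rule std_copy_fg[OF S fS])
  have LV: "left_module B V" using V by (simp add: mod_iso_def)
  have SU: "fac B ?S (tens A N U) (tens A N U) (\<lambda>x. x)"
    by (rule fac_cong[OF fac_single[OF Sh(3) Sh(1) TU]]) simp
  have SR: "fac B ?S (regular_module B) (regular_module B) (\<lambda>x. x)"
    by (rule fac_cong[OF fac_single[OF Sh(4) Sh(2) reg]]) simp
  have VU: "fac B V (tens A N U) (tens A N U) (\<lambda>x. x)" by (rule fac_change[OF V SU TU TU])
  have VR: "fac B V (regular_module B) (regular_module B) (\<lambda>x. x)" by (rule fac_change[OF V SR reg reg])
  have main: "\<exists>C d. syzygy B (n + l) Y (C 0) \<and> (\<forall>i\<le>m. in_add B V (C (Suc i))) \<and> exact_resolution B m C d"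
    if Y: "fg_module B Y" for Y :: "'b std_module"
  proof -
    have LY: "left_module B Y" "finitely_generated B Y" using Y by (auto simp: fg_module_def)
    note X0 = left_module_tens[OF bM LY(1)] and fX0 = tens_fg[OF bM LY(1) fM LY(2)]
    obtain X :: "'a std_module" where X: "mod_iso A (tens B M Y) X" by (rule std_copy_fg[OF X0 fX0])
    have "fg_module A X" using X fg_iso[OF X fX0] by (simp add: fg_module_def mod_iso_def)
    from res[OF this] obtain C :: "nat \<Rightarrow> 'a std_module" and d where C: "syzygy A n X (C 0)" "\<forall>i\<le>m. in_add A U (C (Suc i))" "exact_resolution A m C d"
      by (elim exE conjE)
    \<comment> \<open>The l syzygies come first, because N \<otimes> M \<otimes> Y is stably
      equivalent to \<open>Zl\<close>; the n syzygies taken over A are then matched by n further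
      ones.\<close>
    obtain Zl where Zl: "syzygy B l Y Zl" "fg_module B Zl"
      using syzygy_exists[OF fd_algebra.finite_rank_free[OF B] Y] by blast
    obtain Z where Z: "syzygy B n Zl Z"
      using syzygy_exists[OF fd_algebra.finite_rank_free[OF B] Zl(2)] by blast
    have "stab B (tens A N X) (tens A N (tens B M Y))"
      by (rule stab_tens[OF bN dN stab_sym[OF stab_iso[OF X]]])
    then have "stab B (tens A N X) Zl"
      by (rule stab_trans[OF _ stab_tens_tens[OF A B N M W st LY Zl(1)]])
    then have stZ: "stab B (tens A N (C 0)) Z"
      by (rule stab_tens_syzygy[OF bN dN dN' _ C(1) Z])
    have LC: "left_module A (C i)" if "i \<le> Suc m" for i
      using that C(2) syzygy_left_module[OF C(1)] by (cases i) (auto simp: in_add_def)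
    have facC: "fac B V (tens A N (C (Suc i))) (tens A N (C (Suc i))) (\<lambda>x. x)" if i: "i \<le> m" for i
    proof -
      have L: "left_module A (C (Suc i))" using LC i by simp
      have "fac A U (C (Suc i)) (C (Suc i)) (\<lambda>x. x)" using in_add_imp_fac(2)[OF _ U(1)] C(2) i by blast
      then show ?thesis
        by (intro fac_trans[OF fac_tens_id[OF bN L U(1)] VU left_module_tens[OF bN L] left_module_tens[OF bN L] TU LV])
    qed
    obtain d' where d': "exact_resolution B m (\<lambda>i. tens A N (C i)) d'"
      by (rule tens_exact_resolution[OF bN dN' C(3) LC]) (use that in auto)
    have "\<exists>D :: 'b std_module. mod_iso B (tens A N (C i)) D" if i: "i \<le> Suc m" for i
    proof -
      have suc: "\<exists>D :: 'b std_module. mod_iso B (tens A N (C (Suc j))) D" if "j \<le> m" for j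
      proof -
        have "left_module B (tens A N (C (Suc j)))" by (rule left_module_tens[OF bN LC]) (use that in simp)
        then show ?thesis using std_copy[OF _ LV facC[OF that]] by metis
      qed
      show ?thesis
      proof (cases i)
        \<comment> \<open>The term in degree 0 is not known to lie in add(V). Being the image of the
          term in degree 1 under \<open>d' 0\<close>, it embeds, by a choice of preimages, into the
          carrier of the copy of that term.\<close>
        case 0
        obtain D :: "'b std_module" where D: "mod_iso B (tens A N (C (Suc 0))) D" using suc[of 0] by auto
        obtain e where e: "bij_betw e (carrier (tens A N (C (Suc 0)))) (carrier D)" using D by (auto simp: mod_iso_def)
        have sur: "d' 0 ` carrier (tens A N (C (Suc 0))) = carrier (tens A N (C 0))"
          using d' by (simp add: exact_resolution_def)
        let ?s = "inv_into (carrier (tens A N (C (Suc 0)))) (d' 0)"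
        have "inj_on ?s (carrier (tens A N (C 0)))" using inj_on_inv_into[of "carrier (tens A N (C 0))" "d' 0"] sur by simp
        moreover have "?s ` carrier (tens A N (C 0)) \<subseteq> carrier (tens A N (C (Suc 0)))"
          using sur inv_into_into[of _ "d' 0" "carrier (tens A N (C (Suc 0)))"] by auto
        ultimately have "inj_on (e \<circ> ?s) (carrier (tens A N (C 0)))"
          using e by (intro comp_inj_on) (auto simp: bij_betw_def intro: inj_on_subset)
        then show ?thesis using mod_iso_transport[OF left_module_tens[OF bN LC[of 0]]] 0 by (metis zero_le)
      next
        case (Suc j)
        then show ?thesis using suc[of j] i by simp
      qed
    qed
    then obtain D :: "nat \<Rightarrow> 'b std_module" where D: "\<And>i. i \<le> Suc m \<Longrightarrow> mod_iso B (tens A N (C i)) (D i)" by metis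
    obtain \<delta> where \<delta>: "exact_resolution B m D \<delta>" by (rule exact_resolution_iso[OF d' D])
    have addD: "in_add B V (D (Suc i))" if i: "i \<le> m" for i
    proof -
      have iso: "mod_iso B (tens A N (C (Suc i))) (D (Suc i))" using D i by simp
      show ?thesis unfolding in_add_std_iff[OF LV] using fac_iso[OF iso facC[OF i]] iso by (simp add: mod_iso_def)
    qed
    \<comment> \<open>The copied resolution ends in \<open>D 0\<close>, which is only stably
      equivalent to the syzygy Z; the pullback then moves it to Z itself.\<close>
    have "stab B Z (D 0)" using stab_trans[OF stab_sym[OF stZ] stab_iso[OF D[of 0]]] by simp
    then obtain C' d'' where C': "C' 0 = Z" "\<And>i. i \<le> m \<Longrightarrow> in_add B V (C' (Suc i))" "exact_resolution B m C' d''"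
      using exact_resolution_stab[OF \<delta> LV VR addD] by metis
    have "syzygy B (n + l) Y (C' 0)" unfolding C'(1) by (rule syzygy_add[OF Zl(1) Z])
    then show ?thesis using C'(2,3) by blast
  qed
  have "fg_module B V" using LV fg_iso[OF V fS] by (simp add: fg_module_def)
  then show ?thesis unfolding igusa_todorov_algebra_def using main by blast
qed

lemma singular_equivalence_pair_sym:
  "singular_equivalence_pair K A B l M N \<Longrightarrow> singular_equivalence_pair K B A l N M"
  by (auto simp: singular_equivalence_pair_def)

theorem theorem1p4:
  fixes K :: "'k ring"
    and A :: "('k, 'a) module"
    and B :: "('k, 'b) module"
  assumes "fd_algebra K A"
    and "fd_algebra K B"
    and "singularly_equivalent_with_level K A B"
  shows "IT_dist A = IT_dist B"
proof -
  obtain l and M :: "('a, 'b, nat \<Rightarrow> 'a) bimodule" and N :: "('b, 'a, nat \<Rightarrow> 'b) bimodule"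
    where pair: "singular_equivalence_pair K A B l M N"
    using assms(3) by (auto simp: singularly_equivalent_with_level_def)
  \<comment> \<open>In either direction n is shifted by l while m is kept, so both infima run over
    the same set.\<close>
  have "(\<exists>n. igusa_todorov_algebra m n A) \<longleftrightarrow> (\<exists>n. igusa_todorov_algebra m n B)" for m
    using igusa_todorov_transfer[OF assms(1,2) pair]
      igusa_todorov_transfer[OF assms(2,1) singular_equivalence_pair_sym[OF pair]] by blast
  then show ?thesis by (simp add: IT_dist_def)
qed

end
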